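(* Let $(\Sigma_1,\omega_1,E_1)$ be a Pfaffian groupoid over $X_1$ and $(\Sigma_2,\omega_2,E_2)$ a Pfaffian groupoid over $X_2$, and assume they are Pfaffian Morita equivalent via a principal Pfaffian bibundle $X_1\xleftarrow{\mu_1}(P,\theta,\Phi)\xrightarrow{\mu_2}X_2$. Let $x\in X_1$, $y\in X_2$ be points whose orbits are related by $P$, let $p\in P$ satisfy $\mu_1(p)=x$ and $\mu_2(p)=y$, and let $$\varphi_p:(\Sigma_1)_x\to(\Sigma_2)_y,\qquad g_1\mapsto g_2 \text{ where } g_2\in(\Sigma_2)_y \text{ is the unique element with } g_1\cdot p=p\cdot g_2,$$ be the induced isomorphism of isotropy Lie groups. Then: 1. The isomorphism $\varphi_p$ (i.e. its differential at the unit) sends $\mathfrak g_x(\omega_1)=\ker_x(\omega_1)\cap\ker_x(ds)\subset T_x(\Sigma_1)_x$ to $\mathfrak g_y(\omega_2)=\ker_y(\omega_2)\cap\ker_y(ds)\subset T_y(\Sigma_2)_y$. 2. The representations of $(\Sigma_1)_x$ on $(E_1)_x$ and of $(\Sigma_2)_y$ on $(E_2)_y$ are isomorphic (along $\varphi_p$). 3. The isomorphism $\varphi_p$ is (together with such an isomorphism of representations) an isomorphism of Pfaffian groups from $((\Sigma_1)_x,\omega_1|_{(\Sigma_1)_x},(E_1)_x)$ to $((\Sigma_2)_y,\omega_2|_{(\Sigma_2)_y},(E_2)_y)$.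
   Context: **Lie groupoids.** A Lie groupoid $\Sigma\rightrightarrows X$ has smooth source and target $s,t:\Sigma\to X$ (surjective submersions with Hausdorff fibres), multiplication $m(g,h)=gh$ defined when $s(g)=t(h)$, and units identified with $X$. The base is a Hausdorff second countable manifold; the arrow manifold may be non-Hausdorff and non-second-countable. The isotropy group at $x$ is the Lie group $\Sigma_x=s^{-1}(x)\cap t^{-1}(x)$; the orbit of $x$ is $t(s^{-1}(x))$. A representation of $\Sigma$ is a vector bundle $E\to X$ with a smooth action by linear isomorphisms $g\cdot:E_{s(g)}\to E_{t(g)}$. **Pfaffian groupoid.** $(\Sigma,\omega,E)$ over $X$: a Lie groupoid $\Sigma\rightrightarrows X$, a representation $E\to X$ and a 1-form $\omega\in\Omega^1(\Sigma,t^*E)$ such that: (i) $\omega$ is multiplicative: $(m^*\omega)_{(g,h)}=(\mathrm{pr}_1^*\omega)_{(g,h)}+g\cdot(\mathrm{pr}_2^*\omega)_{(g,h)}$ for composable $(g,h)$; (ii) $\omega$ has constant rank; (iii) $T\Sigma=\ker(\omega)+\ker(ds)$; (iv) $\ker(\omega)\cap\ker(ds)$ is involutive; (v) $\ker(\omega)\cap\ker(dt)=\ker(\omega)\cap\ker(ds)$. A Pfaffian group is a Pfaffian groupoid over a point; for $x\in X$ the triple $(\Sigma_x,\omega|_{\Sigma_x},E_x)$ is a Pfaffian group. An isomorphism from $(\Sigma_1,\omega_1,E_1)$ to $(\Sigma_2,\omega_2,E_2)$ is a pair $(F,\Psi)$ with $F:\Sigma_1\to\Sigma_2$ a Lie groupoid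 isomorphism and $\Psi:E_1\to E_2$ a vector bundle isomorphism over the same base diffeomorphism, with $\Psi(g\cdot e)=F(g)\cdot\Psi(e)$ and $F^*\omega_2=\Psi\circ\omega_1$. **Principal bundles.** A left action of $\Sigma$ on $P$ along a moment map $\mu:P\to X$ assigns $g\cdot p$ to $(g,p)$ with $s(g)=\mu(p)$, with $\mu(g\cdot p)=t(g)$. A principal $\Sigma$-bundle over $M$ is such an action together with a $\Sigma$-invariant surjective submersion $\pi:P\to M$ such that the action is free, proper, and transitive on the $\pi$-fibres. Standing assumption: moment maps of principal bundles are surjective submersions. Right versions are analogous, with $p\cdot g$ defined when $t(g)=\mu(p)$ and $\mu(p\cdot g)=s(g)$. **Principal Pfaffian bundles.** A (left) principal $(\Sigma,\omega,E)$-bundle over $M$ is a principal $\Sigma$-bundle $\pi:P\to M$ with moment map $\mu$, together with $\theta\in\Omega^1(P,\mu^*E)$ such that, for the action map $m_P$, $(m_P^*\theta)_{(g,p)}=(\mathrm{pr}_1^*\omega)_{(g,p)}+g\cdot(\mathrm{pr}_2^*\theta)_{(g,p)}$, and $\ker(d\mu)\cap\ker(\theta)=\ker(d\pi)\cap\ker(\theta)$. For right principal Pfaffian bundles the first condition is replaced by $(m_P^*\theta)_{(p,g)}=g^{-1}\cdot(\mathrm{pr}_1^*\theta)_{(p,g)}+g^{-1}\cdot(\mathrm{pr}_2^*\omega)_{(p,g)}$. **Pfaffian Morita equivalence.** A principal Pfaffian bibundle between $(\Sigma_1,\omega_1,E_1)$ over $X_1$ and $(\Sigma_2,\omega_2,E_2)$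 over $X_2$ is a triple $(P,\theta,\Phi)$, with maps $\mu_i:P\to X_i$, such that: $(P,\theta)$ is a left principal $(\Sigma_1,\omega_1,E_1)$-bundle over $X_2$ with moment map $\mu_1$ and projection $\mu_2$; $\Phi:\mu_1^*E_1\to\mu_2^*E_2$ is an isomorphism of vector bundles over $P$; $(P,\Phi\circ\theta)$ is a right principal $(\Sigma_2,\omega_2,E_2)$-bundle over $X_1$ with moment map $\mu_2$ and projection $\mu_1$; the two actions commute; and, writing $\Phi_p:(E_1)_{\mu_1(p)}\to(E_2)_{\mu_2(p)}$, one has $\Phi_{g_1\cdot p}(g_1\cdot\alpha)=\Phi_p(\alpha)$ and $\Phi_{p\cdot g_2}(\alpha)=g_2^{-1}\cdot\Phi_p(\alpha)$ whenever defined. The two Pfaffian groupoids are Pfaffian Morita equivalent if such a bibundle exists. The orbits of $x\in X_1$ and $y\in X_2$ are related by $P$ if they correspond under the homeomorphism $X_1/\Sigma_1\cong X_2/\Sigma_2$ induced by $P$; equivalently there is $p\in P$ with $\mu_1(p)=x$, $\mu_2(p)=y$. *)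

theory Defs
  imports "HOL-Analysis.Analysis"
begin

section \<open>Smooth functions between subsets of Euclidean spaces\<close>

fun Ck_on :: "nat \<Rightarrow> ('a::euclidean_space \<Rightarrow> 'b::real_normed_vector) \<Rightarrow> 'a set \<Rightarrow> bool" where
  "Ck_on 0 f S \<longleftrightarrow> continuous_on S f"
| "Ck_on (Suc k) f S \<longleftrightarrow>
     (\<forall>x\<in>S. f differentiable (at x)) \<and> (\<forall>v. Ck_on k (\<lambda>x. frechet_derivative f (at x) v) S)"

text \<open>Smoothness on an arbitrary set means existence of local smooth extensions. The sets used below
  are relatively open in linear subspaces, where this is ordinary smoothness.\<close>

definition smooth_on :: "'a::euclidean_space set \<Rightarrow> ('a \<Rightarrow> 'b::real_normed_vector) \<Rightarrow> bool" where
  "smooth_on S f \<longleftrightarrow>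
     (\<forall>x\<in>S. \<exists>T F. open T \<and> x \<in> T \<and> (\<forall>k. Ck_on k F T) \<and> (\<forall>y\<in>S \<inter> T. F y = f y))"

definition linear_between ::
  "'a::real_vector set \<Rightarrow> 'b::real_vector set \<Rightarrow> ('a \<Rightarrow> 'b) \<Rightarrow> bool" where
  "linear_between V W f \<longleftrightarrow> f ` V \<subseteq> W \<and>
     (\<forall>u\<in>V. \<forall>v\<in>V. f (u + v) = f u + f v) \<and> (\<forall>c. \<forall>v\<in>V. f (c *\<^sub>R v) = c *\<^sub>R f v)"

definition linear_iso ::
  "'a::real_vector set \<Rightarrow> 'b::real_vector set \<Rightarrow> ('a \<Rightarrow> 'b) \<Rightarrow> bool" where
  "linear_iso V W f \<longleftrightarrow> linear_between V W f \<and> bij_betw f V W"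


section \<open>Smooth manifolds\<close>

text \<open>A chart is a pair of a domain and a map which sends the domain bijectively onto a relatively
  open subset of some linear subspace of a Euclidean space \<^typ>\<open>'e\<close>. Using subspaces instead of all of
  \<^typ>\<open>'e\<close> covers every dimension from 0 to that of \<^typ>\<open>'e\<close> with one type, so that manifolds and
  their submanifolds have charts of the same type.\<close>

type_synonym ('a, 'e) chart = "'a set \<times> ('a \<Rightarrow> 'e)"

definition chart_image :: "('a, 'e) chart \<Rightarrow> 'e set" where
  "chart_image c = snd c ` fst c"

definition chart_inv :: "('a, 'e) chart \<Rightarrow> 'e \<Rightarrow> 'a" where
  "chart_inv c = inv_into (fst c) (snd c)"

definition is_chart :: "('a, 'e::euclidean_space) chart \<Rightarrow> bool" where
  "is_chart c \<longleftrightarrow> inj_on (snd c) (fst c) \<and>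
     (\<exists>V. subspace V \<and> openin (top_of_set V) (chart_image c))"

definition compatible_charts ::
  "('a, 'e::euclidean_space) chart \<Rightarrow> ('a, 'e) chart \<Rightarrow> bool" where
  "compatible_charts c d \<longleftrightarrow>
     openin (top_of_set (chart_image c)) (snd c ` (fst c \<inter> fst d)) \<and>
     openin (top_of_set (chart_image d)) (snd d ` (fst c \<inter> fst d)) \<and>
     smooth_on (snd c ` (fst c \<inter> fst d)) (snd d \<circ> chart_inv c) \<and>
     smooth_on (snd d ` (fst c \<inter> fst d)) (snd c \<circ> chart_inv d)"

text \<open>The atlas need not be maximal; \<open>charts\<close> is the maximal atlas it generates. Neither the
  Hausdorff property nor second countability is part of \<open>smooth_manifold\<close>.\<close>

record ('a, 'e) manifold =
  points :: "'a set"
  atlas :: "('a, 'e) chart set"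

definition smooth_manifold :: "('a, 'e::euclidean_space) manifold \<Rightarrow> bool" where
  "smooth_manifold M \<longleftrightarrow>
     (\<forall>c\<in>atlas M. fst c \<subseteq> points M \<and> is_chart c) \<and>
     (\<forall>c\<in>atlas M. \<forall>d\<in>atlas M. compatible_charts c d) \<and>
     (\<Union>c\<in>atlas M. fst c) = points M"

definition charts :: "('a, 'e::euclidean_space) manifold \<Rightarrow> ('a, 'e) chart set" where
  "charts M = {c. fst c \<subseteq> points M \<and> is_chart c \<and> (\<forall>d\<in>atlas M. compatible_charts c d)}"

definition manifold_topology :: "('a, 'e::euclidean_space) manifold \<Rightarrow> 'a topology" where
  "manifold_topology M = topology (\<lambda>S. S \<subseteq> points M \<and>
     (\<forall>c\<in>atlas M. openin (top_of_set (chart_image c)) {z \<in> chart_image c. chart_inv c z \<in> S}))"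

lemma openin_manifold_topology:
  "openin (manifold_topology M) S \<longleftrightarrow> S \<subseteq> points M \<and>
     (\<forall>c\<in>atlas M. openin (top_of_set (chart_image c)) {z \<in> chart_image c. chart_inv c z \<in> S})"
proof -
  let ?P = "\<lambda>S. S \<subseteq> points M \<and>
     (\<forall>c\<in>atlas M. openin (top_of_set (chart_image c)) {z \<in> chart_image c. chart_inv c z \<in> S})"
  have "istopology ?P"
    unfolding istopology_def
  proof (intro conjI allI impI)
    fix S T assume S: "?P S" and T: "?P T"
    show "S \<inter> T \<subseteq> points M" using S by blast
    show "\<forall>c\<in>atlas M. openin (top_of_set (chart_image c)) {z \<in> chart_image c. chart_inv c z \<in> S \<inter> T}"
    proof
      fix c assume "c \<in> atlas M"
      then have "openin (top_of_set (chart_image c))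
          ({z \<in> chart_image c. chart_inv c z \<in> S} \<inter> {z \<in> chart_image c. chart_inv c z \<in> T})"
        using S T by (intro openin_Int) auto
      then show "openin (top_of_set (chart_image c)) {z \<in> chart_image c. chart_inv c z \<in> S \<inter> T}"
        by (rule back_subst) auto
    qed
  next
    fix K assume K: "\<forall>S\<in>K. ?P S"
    show "\<Union>K \<subseteq> points M" using K by blast
    show "\<forall>c\<in>atlas M. openin (top_of_set (chart_image c)) {z \<in> chart_image c. chart_inv c z \<in> \<Union>K}"
    proof
      fix c assume c: "c \<in> atlas M"
      have "openin (top_of_set (chart_image c))
          (\<Union>S\<in>K. {z \<in> chart_image c. chart_inv c z \<in> S})"
        by (rule openin_Union) (use K c in blast)
      then show "openin (top_of_set (chart_image c)) {z \<in> chart_image c. chart_inv c z \<in> \<Union>K}"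
        by (rule back_subst) auto
    qed
  qed
  then show ?thesis
    unfolding manifold_topology_def by (simp add: topology_inverse')
qed

definition smooth_map ::
  "('a, 'e::euclidean_space) manifold \<Rightarrow> ('b, 'f::euclidean_space) manifold \<Rightarrow> ('a \<Rightarrow> 'b) \<Rightarrow> bool" where
  "smooth_map M N f \<longleftrightarrow> f ` points M \<subseteq> points N \<and>
     (\<forall>p\<in>points M. \<exists>c\<in>charts M. \<exists>d\<in>charts N. p \<in> fst c \<and> f ` fst c \<subseteq> fst d \<and>
        smooth_on (chart_image c) (snd d \<circ> f \<circ> chart_inv c))"

definition diffeomorphism ::
  "('a, 'e::euclidean_space) manifold \<Rightarrow> ('b, 'f::euclidean_space) manifold \<Rightarrow> ('a \<Rightarrow> 'b) \<Rightarrow> bool" where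
  "diffeomorphism M N f \<longleftrightarrow> bij_betw f (points M) (points N) \<and>
     smooth_map M N f \<and> smooth_map N M (inv_into (points M) f)"

definition smooth_fun ::
  "('a, 'e::euclidean_space) manifold \<Rightarrow> 'a set \<Rightarrow> ('a \<Rightarrow> 'b::real_normed_vector) \<Rightarrow> bool" where
  "smooth_fun M S f \<longleftrightarrow> (\<forall>c\<in>charts M. smooth_on (snd c ` (fst c \<inter> S)) (f \<circ> chart_inv c))"

definition prod_manifold ::
  "('a, 'e::euclidean_space) manifold \<Rightarrow> ('b, 'f::euclidean_space) manifold
     \<Rightarrow> ('a \<times> 'b, 'e \<times> 'f) manifold" where
  "prod_manifold M N = \<lparr> points = points M \<times> points N,
     atlas = {(fst c \<times> fst d, map_prod (snd c) (snd d)) | c d. c \<in> atlas M \<and> d \<in> atlas N} \<rparr>"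

text \<open>The embedded submanifold structure on \<open>A\<close>: its charts are the restrictions of slice charts of
  the maximal atlas. They cover \<open>A\<close> precisely if \<open>A\<close> is an embedded submanifold.\<close>

definition submanifold ::
  "('a, 'e::euclidean_space) manifold \<Rightarrow> 'a set \<Rightarrow> ('a, 'e) manifold" where
  "submanifold M A = \<lparr> points = A,
     atlas = {(fst c \<inter> A, snd c) | c. c \<in> charts M \<and>
                (\<exists>W. subspace W \<and> snd c ` (fst c \<inter> A) = chart_image c \<inter> W)} \<rparr>"

definition fibre_product ::
  "('a, 'e::euclidean_space) manifold \<Rightarrow> ('b, 'f::euclidean_space) manifold \<Rightarrow>
     ('a \<Rightarrow> 'x) \<Rightarrow> ('b \<Rightarrow> 'x) \<Rightarrow> ('a \<times> 'b, 'e \<times> 'f) manifold" where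
  "fibre_product M N f g = submanifold (prod_manifold M N)
     {(a, b). a \<in> points M \<and> b \<in> points N \<and> f a = g b}"


section \<open>Tangent spaces, differentials and Lie brackets\<close>

text \<open>Tangent vectors at \<open>p\<close> are represented by their coordinates in a chosen chart around \<open>p\<close>, so
  the tangent space is the linear subspace on which this chart is modelled. Coordinates in any other
  chart are obtained by \<open>coord_deriv\<close> of the identity.\<close>

definition chart_at :: "('a, 'e::euclidean_space) manifold \<Rightarrow> 'a \<Rightarrow> ('a, 'e) chart" where
  "chart_at M p = (SOME c. c \<in> atlas M \<and> p \<in> fst c)"

definition tangent :: "('a, 'e::euclidean_space) manifold \<Rightarrow> 'a \<Rightarrow> 'e set" where
  "tangent M p = span (chart_image (chart_at M p))"

definition coord_deriv ::
  "('a, 'e::euclidean_space) chart \<Rightarrow> ('b, 'f::euclidean_space) chart \<Rightarrow> ('a \<Rightarrow> 'b) \<Rightarrow> 'a \<Rightarrow> 'e \<Rightarrow> 'f" where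
  "coord_deriv c d f p v =
     vector_derivative (\<lambda>r::real. snd d (f (chart_inv c (snd c p + r *\<^sub>R v)))) (at 0)"

definition differential ::
  "('a, 'e::euclidean_space) manifold \<Rightarrow> ('b, 'f::euclidean_space) manifold \<Rightarrow> ('a \<Rightarrow> 'b)
     \<Rightarrow> 'a \<Rightarrow> 'e \<Rightarrow> 'f" where
  "differential M N f p = coord_deriv (chart_at M p) (chart_at N (f p)) f p"

definition ker_differential ::
  "('a, 'e::euclidean_space) manifold \<Rightarrow> ('b, 'f::euclidean_space) manifold \<Rightarrow> ('a \<Rightarrow> 'b)
     \<Rightarrow> 'a \<Rightarrow> 'e set" where
  "ker_differential M N f p = {v \<in> tangent M p. differential M N f p v = 0}"

definition surjective_submersion ::
  "('a, 'e::euclidean_space) manifold \<Rightarrow> ('b, 'f::euclidean_space) manifold \<Rightarrow> ('a \<Rightarrow> 'b) \<Rightarrow> bool" where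
  "surjective_submersion M N f \<longleftrightarrow> smooth_map M N f \<and> f ` points M = points N \<and>
     (\<forall>p\<in>points M. differential M N f p ` tangent M p = tangent N (f p))"

definition smooth_vector_field ::
  "('a, 'e::euclidean_space) manifold \<Rightarrow> 'a set \<Rightarrow> ('a \<Rightarrow> 'e) \<Rightarrow> bool" where
  "smooth_vector_field M S X \<longleftrightarrow> (\<forall>q\<in>S. X q \<in> tangent M q) \<and>
     (\<forall>c\<in>charts M. smooth_on (snd c ` (fst c \<inter> S))
        (\<lambda>z. let q = chart_inv c z in coord_deriv (chart_at M q) c (\<lambda>a. a) q (X q)))"

text \<open>The bracket \<open>[X, Y]\<close> at \<open>p\<close>, as the derivative of \<open>Y\<close> along \<open>X\<close> minus that of \<open>X\<close> along \<open>Y\<close>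
  in the coordinates chosen at \<open>p\<close>.\<close>

definition lie_bracket ::
  "('a, 'e::euclidean_space) manifold \<Rightarrow> ('a \<Rightarrow> 'e) \<Rightarrow> ('a \<Rightarrow> 'e) \<Rightarrow> 'a \<Rightarrow> 'e" where
  "lie_bracket M X Y p =
     (let c = chart_at M p;
          local = (\<lambda>Z z. let q = chart_inv c z in coord_deriv (chart_at M q) c (\<lambda>a. a) q (Z q))
      in vector_derivative (\<lambda>r::real. local Y (snd c p + r *\<^sub>R X p)) (at 0)
         - vector_derivative (\<lambda>r::real. local X (snd c p + r *\<^sub>R Y p)) (at 0))"

definition involutive :: "('a, 'e::euclidean_space) manifold \<Rightarrow> ('a \<Rightarrow> 'e set) \<Rightarrow> bool" where
  "involutive M D \<longleftrightarrow> (\<forall>S X Y. openin (manifold_topology M) S \<and>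
     smooth_vector_field M S X \<and> smooth_vector_field M S Y \<and> (\<forall>q\<in>S. X q \<in> D q \<and> Y q \<in> D q)
     \<longrightarrow> (\<forall>q\<in>S. lie_bracket M X Y q \<in> D q))"


section \<open>Vector bundles and vector-bundle-valued forms\<close>

text \<open>The fibres of a bundle are subspaces of one ambient real vector space \<^typ>\<open>'v\<close>, which carries
  no topology and may be infinite dimensional, so nothing is restricted: any family of vector spaces
  lives in its direct sum. Fibres over different points may overlap, a point of the total space being
  a pair of a base point and a fibre element. The smooth structure comes from the local
  trivialisations \<open>(D, W, \<tau>)\<close>, consisting of linear isomorphisms \<open>\<tau> x\<close> from the fibre over \<open>x \<in> D\<close>
  to the model fibre \<open>W\<close>.\<close>

record ('x, 'v, 'f) vbundle =
  fibre :: "'x \<Rightarrow> 'v set"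
  trivs :: "('x set \<times> 'f set \<times> ('x \<Rightarrow> 'v \<Rightarrow> 'f)) set"

text \<open>Smooth vector bundle morphism over \<open>M\<close> from the pullback of \<open>E\<close> along \<open>a\<close> to the pullback
  of \<open>F\<close> along \<open>b\<close>.\<close>

definition smooth_bundle_map ::
  "('a, 'e::euclidean_space) manifold \<Rightarrow> ('x, 'v::real_vector, 'f::euclidean_space) vbundle \<Rightarrow> ('a \<Rightarrow> 'x)
   \<Rightarrow> ('y, 'w::real_vector, 'g::euclidean_space) vbundle \<Rightarrow> ('a \<Rightarrow> 'y) \<Rightarrow> ('a \<Rightarrow> 'v \<Rightarrow> 'w) \<Rightarrow> bool" where
  "smooth_bundle_map M E a F b L \<longleftrightarrow>
     (\<forall>m\<in>points M. linear_between (fibre E (a m)) (fibre F (b m)) (L m)) \<and>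
     (\<forall>(D, W, \<tau>)\<in>trivs E. \<forall>(D', W', \<tau>')\<in>trivs F. \<forall>w\<in>W.
        smooth_fun M {m \<in> points M. a m \<in> D \<and> b m \<in> D'}
          (\<lambda>m. \<tau>' (b m) (L m (inv_into (fibre E (a m)) (\<tau> (a m)) w))))"

definition smooth_bundle_iso ::
  "('a, 'e::euclidean_space) manifold \<Rightarrow> ('x, 'v::real_vector, 'f::euclidean_space) vbundle \<Rightarrow> ('a \<Rightarrow> 'x)
   \<Rightarrow> ('y, 'w::real_vector, 'g::euclidean_space) vbundle \<Rightarrow> ('a \<Rightarrow> 'y) \<Rightarrow> ('a \<Rightarrow> 'v \<Rightarrow> 'w) \<Rightarrow> bool" where
  "smooth_bundle_iso M E a F b L \<longleftrightarrow> smooth_bundle_map M E a F b L \<and>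
     (\<forall>m\<in>points M. linear_iso (fibre E (a m)) (fibre F (b m)) (L m))"

text \<open>The last condition says that the transition functions are smooth.\<close>

definition vector_bundle ::
  "('x, 'd::euclidean_space) manifold \<Rightarrow> ('x, 'v::real_vector, 'f::euclidean_space) vbundle \<Rightarrow> bool" where
  "vector_bundle X E \<longleftrightarrow>
     (\<forall>x\<in>points X. subspace (fibre E x)) \<and>
     (\<forall>(D, W, \<tau>)\<in>trivs E. openin (manifold_topology X) D \<and> subspace W \<and>
        (\<forall>x\<in>D. linear_iso (fibre E x) W (\<tau> x))) \<and>
     (\<Union>(D, W, \<tau>)\<in>trivs E. D) = points X \<and>
     smooth_bundle_map X E (\<lambda>x. x) E (\<lambda>x. x) (\<lambda>_ e. e)"

text \<open>\<open>\<theta>\<close> is a smooth 1-form on \<open>M\<close> with values in the pullback of \<open>E\<close> along \<open>f\<close>; smoothness is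
  tested on coordinate vector fields.\<close>

definition one_form ::
  "('a, 'e::euclidean_space) manifold \<Rightarrow> ('x, 'v::real_vector, 'f::euclidean_space) vbundle \<Rightarrow> ('a \<Rightarrow> 'x)
   \<Rightarrow> ('a \<Rightarrow> 'e \<Rightarrow> 'v) \<Rightarrow> bool" where
  "one_form M E f \<theta> \<longleftrightarrow>
     (\<forall>p\<in>points M. linear_between (tangent M p) (fibre E (f p)) (\<theta> p)) \<and>
     (\<forall>c\<in>charts M. \<forall>(D, W, \<tau>)\<in>trivs E. \<forall>v\<in>span (chart_image c).
        smooth_on (snd c ` {q \<in> fst c. f q \<in> D})
          (\<lambda>z. let q = chart_inv c z
               in \<tau> (f q) (\<theta> q (coord_deriv c (chart_at M q) (\<lambda>a. a) q v))))"

definition ker_form ::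
  "('a, 'e::euclidean_space) manifold \<Rightarrow> ('a \<Rightarrow> 'e \<Rightarrow> 'v::real_vector) \<Rightarrow> 'a \<Rightarrow> 'e set" where
  "ker_form M \<theta> p = {v \<in> tangent M p. \<theta> p v = 0}"

definition restrict_bundle ::
  "('x, 'v, 'f) vbundle \<Rightarrow> 'x set \<Rightarrow> ('x, 'v, 'f) vbundle" where
  "restrict_bundle E A = \<lparr> fibre = fibre E, trivs = {(D \<inter> A, W, \<tau>) | D W \<tau>. (D, W, \<tau>) \<in> trivs E} \<rparr>"


section \<open>Lie groupoids and Pfaffian groupoids\<close>

text \<open>All structure maps are total functions, constrained only where they are meaningful:
  \<open>mult G g h\<close> matters only if \<open>src G g = tgt G h\<close>.\<close>

record ('a, 'e, 'x, 'd) lie_groupoid =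
  arrows :: "('a, 'e) manifold"
  base :: "('x, 'd) manifold"
  src :: "'a \<Rightarrow> 'x"
  tgt :: "'a \<Rightarrow> 'x"
  mult :: "'a \<Rightarrow> 'a \<Rightarrow> 'a"
  unit_of :: "'x \<Rightarrow> 'a"
  ginv :: "'a \<Rightarrow> 'a"

definition composable ::
  "('a, 'e::euclidean_space, 'x, 'd::euclidean_space, 'z) lie_groupoid_scheme
     \<Rightarrow> ('a \<times> 'a, 'e \<times> 'e) manifold" where
  "composable G = fibre_product (arrows G) (arrows G) (src G) (tgt G)"

definition lie_groupoid ::
  "('a, 'e::euclidean_space, 'x, 'd::euclidean_space, 'z) lie_groupoid_scheme \<Rightarrow> bool" where
  "lie_groupoid G \<longleftrightarrow>
     (let \<Sigma> = arrows G; X = base G; s = src G; t = tgt G in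
       smooth_manifold \<Sigma> \<and> smooth_manifold X \<and>
       Hausdorff_space (manifold_topology X) \<and> second_countable (manifold_topology X) \<and>
       surjective_submersion \<Sigma> X s \<and> surjective_submersion \<Sigma> X t \<and>
       (\<forall>x\<in>points X.
          Hausdorff_space (subtopology (manifold_topology \<Sigma>) {g \<in> points \<Sigma>. s g = x}) \<and>
          Hausdorff_space (subtopology (manifold_topology \<Sigma>) {g \<in> points \<Sigma>. t g = x})) \<and>
       smooth_map (composable G) \<Sigma> (\<lambda>(g, h). mult G g h) \<and>
       smooth_map X \<Sigma> (unit_of G) \<and> smooth_map \<Sigma> \<Sigma> (ginv G) \<and>
       (\<forall>x\<in>points X. s (unit_of G x) = x \<and> t (unit_of G x) = x) \<and>
       (\<forall>g\<in>points \<Sigma>. \<forall>h\<in>points \<Sigma>. s g = t h \<longrightarrow>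
          s (mult G g h) = s h \<and> t (mult G g h) = t g) \<and>
       (\<forall>g\<in>points \<Sigma>. \<forall>h\<in>points \<Sigma>. \<forall>k\<in>points \<Sigma>. s g = t h \<and> s h = t k \<longrightarrow>
          mult G (mult G g h) k = mult G g (mult G h k)) \<and>
       (\<forall>g\<in>points \<Sigma>. mult G (unit_of G (t g)) g = g \<and> mult G g (unit_of G (s g)) = g) \<and>
       (\<forall>g\<in>points \<Sigma>. s (ginv G g) = t g \<and> t (ginv G g) = s g \<and>
          mult G g (ginv G g) = unit_of G (t g) \<and> mult G (ginv G g) g = unit_of G (s g)))"

definition representation ::
  "('a, 'e::euclidean_space, 'x, 'd::euclidean_space, 'z) lie_groupoid_scheme
     \<Rightarrow> ('x, 'v::real_vector, 'f::euclidean_space) vbundle \<Rightarrow> ('a \<Rightarrow> 'v \<Rightarrow> 'v) \<Rightarrow> bool" where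
  "representation G E \<rho> \<longleftrightarrow> vector_bundle (base G) E \<and>
     smooth_bundle_iso (arrows G) E (src G) E (tgt G) \<rho> \<and>
     (\<forall>x\<in>points (base G). \<forall>e\<in>fibre E x. \<rho> (unit_of G x) e = e) \<and>
     (\<forall>g\<in>points (arrows G). \<forall>h\<in>points (arrows G). src G g = tgt G h \<longrightarrow>
        (\<forall>e\<in>fibre E (src G h). \<rho> (mult G g h) e = \<rho> g (\<rho> h e)))"

record ('a, 'e, 'x, 'd, 'v, 'f) pfaffian_groupoid = "('a, 'e, 'x, 'd) lie_groupoid" +
  coeff :: "('x, 'v, 'f) vbundle"
  rep :: "'a \<Rightarrow> 'v \<Rightarrow> 'v"
  form :: "'a \<Rightarrow> 'e \<Rightarrow> 'v"

definition pfaffian_groupoid ::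
  "('a, 'e::euclidean_space, 'x, 'd::euclidean_space, 'v::real_vector, 'f::euclidean_space)
     pfaffian_groupoid \<Rightarrow> bool" where
  "pfaffian_groupoid G \<longleftrightarrow>
     (let \<Sigma> = arrows G; X = base G; \<omega> = form G; C = composable G in
       lie_groupoid G \<and> representation G (coeff G) (rep G) \<and>
       one_form \<Sigma> (coeff G) (tgt G) \<omega> \<and>
       (\<forall>(g, h)\<in>points C. \<forall>\<xi>\<in>tangent C (g, h).
          \<omega> (mult G g h) (differential C \<Sigma> (\<lambda>(a, b). mult G a b) (g, h) \<xi>) =
          \<omega> g (differential C \<Sigma> fst (g, h) \<xi>) +
          rep G g (\<omega> h (differential C \<Sigma> snd (g, h) \<xi>))) \<and>
       (\<exists>r. \<forall>g\<in>points \<Sigma>. dim (\<omega> g ` tangent \<Sigma> g) = r) \<and>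
       (\<forall>g\<in>points \<Sigma>. tangent \<Sigma> g =
          {u + v | u v. u \<in> ker_form \<Sigma> \<omega> g \<and> v \<in> ker_differential \<Sigma> X (src G) g}) \<and>
       involutive \<Sigma> (\<lambda>g. ker_form \<Sigma> \<omega> g \<inter> ker_differential \<Sigma> X (src G) g) \<and>
       (\<forall>g\<in>points \<Sigma>. ker_form \<Sigma> \<omega> g \<inter> ker_differential \<Sigma> X (tgt G) g =
          ker_form \<Sigma> \<omega> g \<inter> ker_differential \<Sigma> X (src G) g))"

definition lie_groupoid_iso ::
  "('a, 'e::euclidean_space, 'x, 'd::euclidean_space, 'z) lie_groupoid_scheme \<Rightarrow>
   ('b, 'e2::euclidean_space, 'y, 'd2::euclidean_space, 'z2) lie_groupoid_scheme \<Rightarrow>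
   ('a \<Rightarrow> 'b) \<Rightarrow> ('x \<Rightarrow> 'y) \<Rightarrow> bool" where
  "lie_groupoid_iso G H F f \<longleftrightarrow>
     diffeomorphism (arrows G) (arrows H) F \<and> diffeomorphism (base G) (base H) f \<and>
     (\<forall>g\<in>points (arrows G). src H (F g) = f (src G g) \<and> tgt H (F g) = f (tgt G g)) \<and>
     (\<forall>x\<in>points (base G). F (unit_of G x) = unit_of H (f x)) \<and>
     (\<forall>g\<in>points (arrows G). \<forall>h\<in>points (arrows G). src G g = tgt G h \<longrightarrow>
        F (mult G g h) = mult H (F g) (F h))"

text \<open>An isomorphism \<open>(F, \<Psi>)\<close> of Pfaffian groupoids covering the base diffeomorphism \<open>f\<close>.\<close>

definition pfaffian_iso ::
  "('a, 'e::euclidean_space, 'x, 'd::euclidean_space, 'v::real_vector, 'f::euclidean_space)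
     pfaffian_groupoid \<Rightarrow>
   ('b, 'e2::euclidean_space, 'y, 'd2::euclidean_space, 'w::real_vector, 'f2::euclidean_space)
     pfaffian_groupoid \<Rightarrow>
   ('a \<Rightarrow> 'b) \<Rightarrow> ('x \<Rightarrow> 'y) \<Rightarrow> ('x \<Rightarrow> 'v \<Rightarrow> 'w) \<Rightarrow> bool" where
  "pfaffian_iso G H F f \<Psi> \<longleftrightarrow>
     lie_groupoid_iso G H F f \<and>
     smooth_bundle_iso (base G) (coeff G) (\<lambda>x. x) (coeff H) f \<Psi> \<and>
     (\<forall>g\<in>points (arrows G). \<forall>e\<in>fibre (coeff G) (src G g).
        \<Psi> (tgt G g) (rep G g e) = rep H (F g) (\<Psi> (src G g) e)) \<and>
     (\<forall>g\<in>points (arrows G). \<forall>v\<in>tangent (arrows G) g.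
        form H (F g) (differential (arrows G) (arrows H) F g v) = \<Psi> (tgt G g) (form G g v))"


section \<open>Isotropy groups\<close>

definition isotropy :: "('a, 'e, 'x, 'd, 'z) lie_groupoid_scheme \<Rightarrow> 'x \<Rightarrow> 'a set" where
  "isotropy G x = {g \<in> points (arrows G). src G g = x \<and> tgt G g = x}"

definition isotropy_manifold ::
  "('a, 'e::euclidean_space, 'x, 'd, 'z) lie_groupoid_scheme \<Rightarrow> 'x \<Rightarrow> ('a, 'e) manifold" where
  "isotropy_manifold G x = submanifold (arrows G) (isotropy G x)"

definition isotropy_incl ::
  "('a, 'e::euclidean_space, 'x, 'd, 'z) lie_groupoid_scheme \<Rightarrow> 'x \<Rightarrow> 'a \<Rightarrow> 'e \<Rightarrow> 'e" where
  "isotropy_incl G x = differential (isotropy_manifold G x) (arrows G) (\<lambda>g. g)"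

text \<open>The Pfaffian group at \<open>x\<close>, as a Pfaffian groupoid over the one-point manifold; the form is the
  pullback along the inclusion of the isotropy group.\<close>

definition isotropy_pfaffian ::
  "('a, 'e::euclidean_space, 'x, 'd::euclidean_space, 'v::real_vector, 'f::euclidean_space)
     pfaffian_groupoid \<Rightarrow> 'x \<Rightarrow> ('a, 'e, 'x, 'd, 'v, 'f) pfaffian_groupoid" where
  "isotropy_pfaffian G x = G \<lparr> arrows := isotropy_manifold G x,
     base := submanifold (base G) {x},
     coeff := restrict_bundle (coeff G) {x},
     form := (\<lambda>g v. form G g (isotropy_incl G x g v)) \<rparr>"

definition symbol_space ::
  "('a, 'e::euclidean_space, 'x, 'd::euclidean_space, 'v::real_vector, 'f::euclidean_space)
     pfaffian_groupoid \<Rightarrow> 'x \<Rightarrow> 'e set" where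
  "symbol_space G x = ker_form (arrows G) (form G) (unit_of G x) \<inter>
     ker_differential (arrows G) (base G) (src G) (unit_of G x)"

text \<open>\<open>symbol_space\<close> seen inside the tangent space of the isotropy group at the unit.\<close>

definition isotropy_symbol ::
  "('a, 'e::euclidean_space, 'x, 'd::euclidean_space, 'v::real_vector, 'f::euclidean_space)
     pfaffian_groupoid \<Rightarrow> 'x \<Rightarrow> 'e set" where
  "isotropy_symbol G x = {v \<in> tangent (isotropy_manifold G x) (unit_of G x).
     isotropy_incl G x (unit_of G x) v \<in> symbol_space G x}"

definition isotropy_rep_iso ::
  "('a, 'e::euclidean_space, 'x, 'd::euclidean_space, 'v::real_vector, 'f::euclidean_space)
     pfaffian_groupoid \<Rightarrow> 'x \<Rightarrow>
   ('b, 'e2::euclidean_space, 'y, 'd2::euclidean_space, 'w::real_vector, 'f2::euclidean_space)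
     pfaffian_groupoid \<Rightarrow> 'y \<Rightarrow> ('a \<Rightarrow> 'b) \<Rightarrow> ('v \<Rightarrow> 'w) \<Rightarrow> bool" where
  "isotropy_rep_iso G x H y \<phi> \<psi> \<longleftrightarrow>
     linear_iso (fibre (coeff G) x) (fibre (coeff H) y) \<psi> \<and>
     (\<forall>g\<in>isotropy G x. \<forall>e\<in>fibre (coeff G) x. \<psi> (rep G g e) = rep H (\<phi> g) (\<psi> e))"


section \<open>Principal bundles and principal Pfaffian bibundles\<close>

text \<open>The total space is not required to be Hausdorff: the unit bibundle of a groupoid has the arrow
  manifold as total space. Accordingly, properness of an action is \<^const>\<open>proper_map\<close> (closed with
  compact fibres), which for locally compact Hausdorff targets amounts to compactness of preimages of
  compact sets.\<close>

definition left_principal_bundle ::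
  "('a, 'e::euclidean_space, 'x, 'd::euclidean_space, 'z) lie_groupoid_scheme \<Rightarrow>
   ('p, 'q::euclidean_space) manifold \<Rightarrow> ('m, 'n::euclidean_space) manifold \<Rightarrow>
   ('a \<Rightarrow> 'p \<Rightarrow> 'p) \<Rightarrow> ('p \<Rightarrow> 'x) \<Rightarrow> ('p \<Rightarrow> 'm) \<Rightarrow> bool" where
  "left_principal_bundle G P M act \<mu> \<pi> \<longleftrightarrow>
     (let \<Sigma> = arrows G; s = src G; t = tgt G; S = {(g, p). g \<in> points \<Sigma> \<and> p \<in> points P \<and> s g = \<mu> p} in
       smooth_manifold P \<and> smooth_manifold M \<and>
       surjective_submersion P (base G) \<mu> \<and> surjective_submersion P M \<pi> \<and>
       smooth_map (fibre_product \<Sigma> P s \<mu>) P (\<lambda>(g, p). act g p) \<and>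
       (\<forall>(g, p)\<in>S. \<mu> (act g p) = t g) \<and>
       (\<forall>p\<in>points P. act (unit_of G (\<mu> p)) p = p) \<and>
       (\<forall>(h, p)\<in>S. \<forall>g\<in>points \<Sigma>. s g = t h \<longrightarrow> act (mult G g h) p = act g (act h p)) \<and>
       (\<forall>(g, p)\<in>S. \<pi> (act g p) = \<pi> p) \<and>
       (\<forall>(g, p)\<in>S. act g p = p \<longrightarrow> g = unit_of G (\<mu> p)) \<and>
       proper_map (subtopology (prod_topology (manifold_topology \<Sigma>) (manifold_topology P)) S)
         (prod_topology (manifold_topology P) (manifold_topology P)) (\<lambda>(g, p). (act g p, p)) \<and>
       (\<forall>p\<in>points P. \<forall>q\<in>points P. \<pi> p = \<pi> q \<longrightarrow>
          (\<exists>g\<in>points \<Sigma>. s g = \<mu> p \<and> act g p = q)))"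

definition right_principal_bundle ::
  "('a, 'e::euclidean_space, 'x, 'd::euclidean_space, 'z) lie_groupoid_scheme \<Rightarrow>
   ('p, 'q::euclidean_space) manifold \<Rightarrow> ('m, 'n::euclidean_space) manifold \<Rightarrow>
   ('p \<Rightarrow> 'a \<Rightarrow> 'p) \<Rightarrow> ('p \<Rightarrow> 'x) \<Rightarrow> ('p \<Rightarrow> 'm) \<Rightarrow> bool" where
  "right_principal_bundle G P M act \<mu> \<pi> \<longleftrightarrow>
     (let \<Sigma> = arrows G; s = src G; t = tgt G; S = {(p, g). p \<in> points P \<and> g \<in> points \<Sigma> \<and> \<mu> p = t g} in
       smooth_manifold P \<and> smooth_manifold M \<and>
       surjective_submersion P (base G) \<mu> \<and> surjective_submersion P M \<pi> \<and>
       smooth_map (fibre_product P \<Sigma> \<mu> t) P (\<lambda>(p, g). act p g) \<and>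
       (\<forall>(p, g)\<in>S. \<mu> (act p g) = s g) \<and>
       (\<forall>p\<in>points P. act p (unit_of G (\<mu> p)) = p) \<and>
       (\<forall>(p, g)\<in>S. \<forall>h\<in>points \<Sigma>. s g = t h \<longrightarrow> act p (mult G g h) = act (act p g) h) \<and>
       (\<forall>(p, g)\<in>S. \<pi> (act p g) = \<pi> p) \<and>
       (\<forall>(p, g)\<in>S. act p g = p \<longrightarrow> g = unit_of G (\<mu> p)) \<and>
       proper_map (subtopology (prod_topology (manifold_topology P) (manifold_topology \<Sigma>)) S)
         (prod_topology (manifold_topology P) (manifold_topology P)) (\<lambda>(p, g). (p, act p g)) \<and>
       (\<forall>p\<in>points P. \<forall>q\<in>points P. \<pi> p = \<pi> q \<longrightarrow>
          (\<exists>g\<in>points \<Sigma>. \<mu> p = t g \<and> act p g = q)))"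

definition left_principal_pfaffian_bundle ::
  "('a, 'e::euclidean_space, 'x, 'd::euclidean_space, 'v::real_vector, 'f::euclidean_space)
     pfaffian_groupoid \<Rightarrow>
   ('p, 'q::euclidean_space) manifold \<Rightarrow> ('m, 'n::euclidean_space) manifold \<Rightarrow>
   ('a \<Rightarrow> 'p \<Rightarrow> 'p) \<Rightarrow> ('p \<Rightarrow> 'x) \<Rightarrow> ('p \<Rightarrow> 'm) \<Rightarrow> ('p \<Rightarrow> 'q \<Rightarrow> 'v) \<Rightarrow> bool" where
  "left_principal_pfaffian_bundle G P M act \<mu> \<pi> \<theta> \<longleftrightarrow>
     (let \<Sigma> = arrows G; C = fibre_product \<Sigma> P (src G) \<mu> in
       left_principal_bundle G P M act \<mu> \<pi> \<and>
       one_form P (coeff G) \<mu> \<theta> \<and>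
       (\<forall>(g, p)\<in>points C. \<forall>\<xi>\<in>tangent C (g, p).
          \<theta> (act g p) (differential C P (\<lambda>(a, b). act a b) (g, p) \<xi>) =
          form G g (differential C \<Sigma> fst (g, p) \<xi>) +
          rep G g (\<theta> p (differential C P snd (g, p) \<xi>))) \<and>
       (\<forall>p\<in>points P. ker_differential P (base G) \<mu> p \<inter> ker_form P \<theta> p =
          ker_differential P M \<pi> p \<inter> ker_form P \<theta> p))"

definition right_principal_pfaffian_bundle ::
  "('a, 'e::euclidean_space, 'x, 'd::euclidean_space, 'v::real_vector, 'f::euclidean_space)
     pfaffian_groupoid \<Rightarrow>
   ('p, 'q::euclidean_space) manifold \<Rightarrow> ('m, 'n::euclidean_space) manifold \<Rightarrow>
   ('p \<Rightarrow> 'a \<Rightarrow> 'p) \<Rightarrow> ('p \<Rightarrow> 'x) \<Rightarrow> ('p \<Rightarrow> 'm) \<Rightarrow> ('p \<Rightarrow> 'q \<Rightarrow> 'v) \<Rightarrow> bool" where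
  "right_principal_pfaffian_bundle G P M act \<mu> \<pi> \<theta> \<longleftrightarrow>
     (let \<Sigma> = arrows G; C = fibre_product P \<Sigma> \<mu> (tgt G) in
       right_principal_bundle G P M act \<mu> \<pi> \<and>
       one_form P (coeff G) \<mu> \<theta> \<and>
       (\<forall>(p, g)\<in>points C. \<forall>\<xi>\<in>tangent C (p, g).
          \<theta> (act p g) (differential C P (\<lambda>(a, b). act a b) (p, g) \<xi>) =
          rep G (ginv G g) (\<theta> p (differential C P fst (p, g) \<xi>)) +
          rep G (ginv G g) (form G g (differential C \<Sigma> snd (p, g) \<xi>))) \<and>
       (\<forall>p\<in>points P. ker_differential P (base G) \<mu> p \<inter> ker_form P \<theta> p =
          ker_differential P M \<pi> p \<inter> ker_form P \<theta> p))"

text \<open>Both groupoids being Pfaffian is not part of this definition.\<close>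

definition principal_pfaffian_bibundle ::
  "('a, 'e::euclidean_space, 'x, 'd::euclidean_space, 'v::real_vector, 'f::euclidean_space)
     pfaffian_groupoid \<Rightarrow>
   ('b, 'e2::euclidean_space, 'y, 'd2::euclidean_space, 'w::real_vector, 'f2::euclidean_space)
     pfaffian_groupoid \<Rightarrow>
   ('p, 'q::euclidean_space) manifold \<Rightarrow> ('p \<Rightarrow> 'x) \<Rightarrow> ('p \<Rightarrow> 'y) \<Rightarrow>
   ('a \<Rightarrow> 'p \<Rightarrow> 'p) \<Rightarrow> ('p \<Rightarrow> 'b \<Rightarrow> 'p) \<Rightarrow>
   ('p \<Rightarrow> 'q \<Rightarrow> 'v) \<Rightarrow> ('p \<Rightarrow> 'v \<Rightarrow> 'w) \<Rightarrow> bool" where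
  "principal_pfaffian_bibundle G1 G2 P \<mu>1 \<mu>2 lact ract \<theta> \<Phi> \<longleftrightarrow>
     left_principal_pfaffian_bundle G1 P (base G2) lact \<mu>1 \<mu>2 \<theta> \<and>
     smooth_bundle_iso P (coeff G1) \<mu>1 (coeff G2) \<mu>2 \<Phi> \<and>
     right_principal_pfaffian_bundle G2 P (base G1) ract \<mu>2 \<mu>1 (\<lambda>p v. \<Phi> p (\<theta> p v)) \<and>
     (\<forall>g\<in>points (arrows G1). \<forall>p\<in>points P. \<forall>h\<in>points (arrows G2).
        src G1 g = \<mu>1 p \<and> \<mu>2 p = tgt G2 h \<longrightarrow> ract (lact g p) h = lact g (ract p h)) \<and>
     (\<forall>g\<in>points (arrows G1). \<forall>p\<in>points P. src G1 g = \<mu>1 p \<longrightarrow>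
        (\<forall>\<alpha>\<in>fibre (coeff G1) (\<mu>1 p). \<Phi> (lact g p) (rep G1 g \<alpha>) = \<Phi> p \<alpha>)) \<and>
     (\<forall>p\<in>points P. \<forall>h\<in>points (arrows G2). \<mu>2 p = tgt G2 h \<longrightarrow>
        (\<forall>\<alpha>\<in>fibre (coeff G1) (\<mu>1 p). \<Phi> (ract p h) \<alpha> = rep G2 (ginv G2 h) (\<Phi> p \<alpha>)))"

definition induced_isotropy_map ::
  "('b, 'e2, 'y, 'd2, 'z) lie_groupoid_scheme \<Rightarrow> 'y \<Rightarrow>
   ('a \<Rightarrow> 'p \<Rightarrow> 'p) \<Rightarrow> ('p \<Rightarrow> 'b \<Rightarrow> 'p) \<Rightarrow> 'p \<Rightarrow> 'a \<Rightarrow> 'b" where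
  "induced_isotropy_map G2 y lact ract p g1 = (THE g2. g2 \<in> isotropy G2 y \<and> lact g1 p = ract p g2)"

end

theory Submission
  imports Defs
begin

text \<open>The isotropy group \<open>\<Sigma>\<^sub>x\<close> is a fibre of \<open>(s, t)\<close>. Left translation shows that the dimension of
  \<open>ker ds \<inter> ker dt\<close> at \<open>g\<close> only depends on the source of \<open>g\<close>, so \<open>(s, t)\<close> has constant rank along the fibres of \<open>s\<close>
  and \<open>\<Sigma>\<^sub>x\<close> is an embedded submanifold with tangent spaces \<open>ker ds \<inter> ker dt\<close>.

  The orbit map \<open>g \<mapsto> g \<cdot> p\<close> on an isotropy group is injective and has constant rank by homogeneity, hence
  it is an immersion and has local smooth left inverses; properness of the action makes its inverse
  continuous. As \<open>g \<cdot> p = p \<cdot> \<phi> g\<close>, the map \<open>\<phi>\<close> and its inverse are smooth.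

  The isomorphism of representations is \<open>\<Phi>\<^sub>p\<close>. Equivariance of \<open>\<Phi>\<close> under both actions gives
  \<open>\<Phi>\<^sub>p (g e) = \<phi> g (\<Phi>\<^sub>p e)\<close>, and evaluating \<open>\<theta>\<close> on the velocity of \<open>g \<cdot> p = p \<cdot> \<phi> g\<close> by the left and by the right
  multiplicativity gives \<open>\<Phi>\<^sub>p \<circ> \<omega>\<^sub>1 = \<phi>\<^sup>* \<omega>\<^sub>2\<close>, which also identifies the symbol spaces. Differentials are
  computed throughout on velocities of curves.\<close>

section \<open>Calculus of \<open>C\<^sup>k\<close> maps\<close>

text \<open>The isotropy group is a fibre of (s, t), whose rank may change from orbit to orbit, so
  it is not covered by the submersion case. Left translation compares only arrows with a common
  source. For this reason \<open>constant_rank\<close> asks for its kernel estimate only where R f =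
  R (f z0); in \<open>fibre_embedded_constant_rank\<close> the map R keeps the source coordinate, so
  that all points to be compared lie on one source fibre. A bijective smooth homomorphism of Lie
  groups need not be a diffeomorphism without second countability: take the identity from the
  discrete reals to the reals. Smoothness of the inverse therefore has to come from the bibundle,
  where each of \<open>\<phi>\<close> and its inverse is one orbit map followed by the inverse of
  the other. \<open>differential\<close> refers to charts picked by choice, so composites would drag
  transition maps along. Velocities of curves avoid this: an identity between maps passes to
  velocities by substitution. They also deal with translations, which live on fibres and not on open
  sets.\<close>

lemma Ck_on_cong:
  assumes "open S" and "\<And>x. x \<in> S \<Longrightarrow> f x = g x" and "Ck_on k f S"
  shows "Ck_on k g S"
  using assms(2,3)
proof (induction k arbitrary: f g)
  case 0
  then show ?case using continuous_on_cong[of S S f g] by simp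
next
  case (Suc k)
  have der: "(g has_derivative frechet_derivative f (at x)) (at x)" if "x \<in> S" for x
  proof (rule has_derivative_transform_within_open[OF _ assms(1) that])
    show "(f has_derivative frechet_derivative f (at x)) (at x)"
      using Suc.prems(2) that frechet_derivative_works by auto
  qed (use Suc.prems(1) in auto)
  have eq: "frechet_derivative f (at x) = frechet_derivative g (at x)" if "x \<in> S" for x
    using frechet_derivative_at[OF der[OF that]] .
  show ?case
    unfolding Ck_on.simps
  proof (intro conjI ballI allI)
    fix x assume "x \<in> S" then show "g differentiable at x" using der differentiable_def by blast
  next
    fix v show "Ck_on k (\<lambda>x. frechet_derivative g (at x) v) S"
      by (rule Suc.IH[of "\<lambda>x. frechet_derivative f (at x) v"]) (use eq Suc.prems in auto)
  qed
qed

lemma Ck_on_mono: "Ck_on k f T \<Longrightarrow> S \<subseteq> T \<Longrightarrow> Ck_on k f S"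
  by (induction k arbitrary: f) (auto intro: continuous_on_subset)

lemma Ck_on_Suc_imp: "Ck_on (Suc k) f S \<Longrightarrow> Ck_on k f S"
proof (induction k arbitrary: f)
  case 0
  then show ?case
    by (auto intro!: continuous_at_imp_continuous_on differentiable_imp_continuous_within)
next
  case (Suc k)
  then show ?case
    unfolding Ck_on.simps(2)[of k f S] Ck_on.simps(2)[of "Suc k" f S] by blast
qed

lemma Ck_on_has_derivative:
  "Ck_on (Suc k) f S \<Longrightarrow> x \<in> S \<Longrightarrow> (f has_derivative frechet_derivative f (at x)) (at x)"
  using frechet_derivative_works by auto

text \<open>Allows the derivative to be given by a formula; the definition of \<open>Ck_on\<close>
  speaks only of the chosen \<open>frechet_derivative\<close>.\<close>

lemma Ck_on_SucI:
  assumes "open S" and der: "\<And>x. x \<in> S \<Longrightarrow> (f has_derivative f' x) (at x)"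
    and "\<And>v. Ck_on k (\<lambda>x. f' x v) S"
  shows "Ck_on (Suc k) f S"
  unfolding Ck_on.simps
proof (intro conjI ballI allI)
  fix x assume "x \<in> S" then show "f differentiable at x" using der differentiable_def by blast
next
  fix v show "Ck_on k (\<lambda>x. frechet_derivative f (at x) v) S"
    by (rule Ck_on_cong[OF assms(1) _ assms(3)[of v]]) (use frechet_derivative_at[OF der] in auto)
qed

lemma Ck_on_const: "Ck_on k (\<lambda>x. c) S"
  by (induction k arbitrary: c) auto

lemma Ck_on_bounded_linear_compose:
  assumes "open S" and L: "bounded_linear L" and "Ck_on k f S"
  shows "Ck_on k (\<lambda>x. L (f x)) S"
  using assms(3)
proof (induction k arbitrary: f)
  case 0
  then show ?case by (auto intro: bounded_linear.continuous_on[OF L])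
next
  case (Suc k)
  show ?case
  proof (rule Ck_on_SucI[OF assms(1)])
    fix x assume "x \<in> S"
    then show "((\<lambda>x. L (f x)) has_derivative (\<lambda>v. L (frechet_derivative f (at x) v))) (at x)"
      by (intro bounded_linear.has_derivative[OF L] Ck_on_has_derivative[OF Suc.prems])
  next
    fix v show "Ck_on k (\<lambda>x. L (frechet_derivative f (at x) v)) S"
      using Suc.IH Suc.prems by auto
  qed
qed

lemma Ck_on_bounded_linear:
  assumes "open S" and L: "bounded_linear L"
  shows "Ck_on k L S"
proof (cases k)
  case 0
  then show ?thesis by (simp add: bounded_linear.continuous_on[OF L continuous_on_id])
next
  case (Suc j)
  show ?thesis
    unfolding Suc by (rule Ck_on_SucI[OF assms(1) bounded_linear_imp_has_derivative[OF L] Ck_on_const])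
qed

lemma Ck_on_add:
  assumes "open S" "Ck_on k f S" "Ck_on k g S"
  shows "Ck_on k (\<lambda>x. f x + g x) S"
  using assms(2,3)
proof (induction k arbitrary: f g)
  case 0
  then show ?case by (auto intro: continuous_intros)
next
  case (Suc k)
  show ?case
  proof (rule Ck_on_SucI[OF assms(1)])
    fix x assume "x \<in> S"
    then show "((\<lambda>x. f x + g x) has_derivative
        (\<lambda>v. frechet_derivative f (at x) v + frechet_derivative g (at x) v)) (at x)"
      by (intro has_derivative_add Ck_on_has_derivative[OF Suc.prems(1)]
          Ck_on_has_derivative[OF Suc.prems(2)])
  next
    fix v
    show "Ck_on k (\<lambda>x. frechet_derivative f (at x) v + frechet_derivative g (at x) v) S"
      using Suc.IH Suc.prems by auto
  qed
qed

lemma Ck_on_sum: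
  assumes "open S" "\<And>i. i \<in> I \<Longrightarrow> Ck_on k (f i) S"
  shows "Ck_on k (\<lambda>x. \<Sum>i\<in>I. f i x) S"
  using assms(2) by (induction I rule: infinite_finite_induct) (auto intro!: Ck_on_const Ck_on_add assms(1))

lemma Ck_on_scaleR:
  assumes "open S" "Ck_on k a S" "Ck_on k f S"
  shows "Ck_on k (\<lambda>x. a x *\<^sub>R f x) S"
  using assms(2,3)
proof (induction k arbitrary: a f)
  case 0
  then show ?case by (auto intro: continuous_intros)
next
  case (Suc k)
  show ?case
  proof (rule Ck_on_SucI[OF assms(1)])
    fix x assume "x \<in> S"
    then show "((\<lambda>x. a x *\<^sub>R f x) has_derivative
        (\<lambda>v. a x *\<^sub>R frechet_derivative f (at x) v + frechet_derivative a (at x) v *\<^sub>R f x)) (at x)"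
      by (intro has_derivative_scaleR Ck_on_has_derivative[OF Suc.prems(1)]
          Ck_on_has_derivative[OF Suc.prems(2)])
  next
    fix v
    show "Ck_on k (\<lambda>x. a x *\<^sub>R frechet_derivative f (at x) v + frechet_derivative a (at x) v *\<^sub>R f x) S"
      using Suc.prems Ck_on_Suc_imp[OF Suc.prems(1)] Ck_on_Suc_imp[OF Suc.prems(2)]
      by (intro Ck_on_add[OF assms(1)] Suc.IH) auto
  qed
qed

lemma Ck_on_inner:
  assumes "open S" "Ck_on k f S"
  shows "Ck_on k (\<lambda>x. f x \<bullet> w) S"
  by (rule Ck_on_bounded_linear_compose[OF assms(1) bounded_linear_inner_left assms(2)])

lemma linear_sum_Basis:
  assumes "linear f"
  shows "f v = (\<Sum>i\<in>Basis. (v \<bullet> i) *\<^sub>R f i)"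
proof -
  have "f v = f (\<Sum>i\<in>Basis. (v \<bullet> i) *\<^sub>R i)" by (simp add: euclidean_representation)
  then show ?thesis by (simp add: linear_sum[OF assms] linear_scale[OF assms])
qed

lemma Ck_on_compose:
  fixes f :: "'a::euclidean_space \<Rightarrow> 'b::euclidean_space" and g :: "'b \<Rightarrow> 'c::real_normed_vector"
  assumes "open S" "open T" "f ` S \<subseteq> T" "Ck_on k f S" "Ck_on k g T"
  shows "Ck_on k (\<lambda>x. g (f x)) S"
  using assms(4,5)
proof (induction k arbitrary: g)
  case 0
  then show ?case using continuous_on_compose2[of T g S f] assms(3) by auto
next
  case (Suc k)
  have fT: "f x \<in> T" if "x \<in> S" for x using assms(3) that by auto
  have lin: "linear (frechet_derivative g (at (f x)))" if "x \<in> S" for x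
    using Ck_on_has_derivative[OF Suc.prems(2) fT[OF that]] has_derivative_linear by blast
  show ?case
  proof (rule Ck_on_SucI[OF assms(1)])
    fix x assume x: "x \<in> S"
    have "((\<lambda>x. g (f x)) has_derivative
        (\<lambda>v. frechet_derivative g (at (f x)) (frechet_derivative f (at x) v))) (at x)"
      using has_derivative_compose[OF Ck_on_has_derivative[OF Suc.prems(1) x]
          Ck_on_has_derivative[OF Suc.prems(2) fT[OF x]]] .
    \<comment> \<open>The direction in which g is differentiated moves with x, whereas
      \<open>Ck_on\<close> controls derivatives in fixed directions. Expanding that direction in the
      basis leaves products of scalar functions with derivatives of g in fixed directions.\<close>
    then show "((\<lambda>x. g (f x)) has_derivative (\<lambda>v. \<Sum>i\<in>Basis.
        (frechet_derivative f (at x) v \<bullet> i) *\<^sub>R frechet_derivative g (at (f x)) i)) (at x)"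
      by (rule has_derivative_eq_rhs) (rule ext, rule linear_sum_Basis[OF lin[OF x]])
  next
    fix v
    have "Ck_on k (\<lambda>x. frechet_derivative g (at (f x)) i) S" for i
      using Suc.IH[of "\<lambda>y. frechet_derivative g (at y) i"] Suc.prems Ck_on_Suc_imp[OF Suc.prems(1)]
      by auto
    then show "Ck_on k (\<lambda>x. \<Sum>i\<in>Basis. (frechet_derivative f (at x) v \<bullet> i) *\<^sub>R
        frechet_derivative g (at (f x)) i) S"
      using Suc.prems by (intro Ck_on_sum Ck_on_scaleR Ck_on_inner assms(1)) auto
  qed
qed

section \<open>The smooth inverse function theorem\<close>

text \<open>Where \<open>a\<close> vanishes, the increment of \<open>b\<close> is multiplied by
  something of order |y - x|, so continuity of \<open>b\<close> is enough for the product rule. This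
  allows \<open>Ck_on_inverse_family\<close> to differentiate an expression containing the inverse
  family, which at that stage is only known to be continuous.\<close>

lemma has_derivative_scaleR_vanishing:
  fixes a :: "'a::real_normed_vector \<Rightarrow> real" and b :: "'a \<Rightarrow> 'b::real_normed_vector"
  assumes a: "(a has_derivative a') (at x)" and "a x = 0" and b: "isCont b x"
  shows "((\<lambda>y. a y *\<^sub>R b y) has_derivative (\<lambda>u. a' u *\<^sub>R b x)) (at x)"
proof -
  have bl: "bounded_linear a'" using a by (rule has_derivative_bounded_linear)
  obtain K where K: "\<And>u. norm (a' u) \<le> norm u * K" using bounded_linear.bounded[OF bl] by blast
  have 1: "((\<lambda>y. ((1 / norm (y - x)) *\<^sub>R (a y - a' (y - x))) *\<^sub>R b y) \<longlongrightarrow> 0 *\<^sub>R b x) (at x)"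
    using a b \<open>a x = 0\<close>
    by (intro tendsto_scaleR) (auto simp: has_derivative_within isCont_def)
  have 2: "((\<lambda>y. ((1 / norm (y - x)) * a' (y - x)) *\<^sub>R (b y - b x)) \<longlongrightarrow> 0) (at x)"
  proof (rule Lim_null_comparison)
    have "norm (((1 / norm (y - x)) * a' (y - x)) *\<^sub>R (b y - b x)) \<le> K * norm (b y - b x)"
      if "y \<noteq> x" for y
    proof -
      have "\<bar>a' (y - x)\<bar> * norm (b y - b x) \<le> norm (y - x) * K * norm (b y - b x)"
        using K[of "y - x"] by (intro mult_right_mono) auto
      then show ?thesis using that by (simp add: divide_simps mult_ac)
    qed
    then show "\<forall>\<^sub>F y in at x. norm (((1 / norm (y - x)) * a' (y - x)) *\<^sub>R (b y - b x))
        \<le> K * norm (b y - b x)"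
      by (auto simp: eventually_at_filter)
    have "((\<lambda>y. K * norm (b y - b x)) \<longlongrightarrow> K * norm (b x - b x)) (at x)"
      using b by (intro tendsto_intros) (auto simp: isCont_def)
    then show "((\<lambda>y. K * norm (b y - b x)) \<longlongrightarrow> 0) (at x)" by simp
  qed
  have "((\<lambda>y. (1 / norm (y - x)) *\<^sub>R (a y *\<^sub>R b y - (a x *\<^sub>R b x + a' (y - x) *\<^sub>R b x))) \<longlongrightarrow> 0) (at x)"
    using tendsto_add[OF 1 2] \<open>a x = 0\<close> by (simp add: algebra_simps)
  moreover have "bounded_linear (\<lambda>u. a' u *\<^sub>R b x)"
    using bounded_linear_compose[OF bounded_linear_scaleR_left bl, of "b x"] by simp
  ultimately show ?thesis by (simp add: has_derivative_within)
qed

text \<open>With w = B y0 v one has the exact identity B y v = w - B y (A y w - A y0 w). Its bracket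
  vanishes at y0, so the right-hand side is differentiable although \<open>B\<close> is merely
  continuous, with derivative - B (A' u) B v. This formula involves \<open>B\<close> and the first
  derivative of \<open>A\<close> only, so regularity climbs by induction on k.\<close>

lemma Ck_on_inverse_family:
  fixes A B :: "'a::euclidean_space \<Rightarrow> 'b::euclidean_space \<Rightarrow> 'b"
  assumes "open S" and lin: "\<And>y. y \<in> S \<Longrightarrow> linear (A y)" "\<And>y. y \<in> S \<Longrightarrow> linear (B y)"
    and inv: "\<And>y w. y \<in> S \<Longrightarrow> B y (A y w) = w" "\<And>y w. y \<in> S \<Longrightarrow> A y (B y w) = w"
    and A: "\<And>w. Ck_on k (\<lambda>y. A y w) S" and B: "\<And>v. continuous_on S (\<lambda>y. B y v)"
  shows "Ck_on k (\<lambda>y. B y v) S"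
  using A
proof (induction k arbitrary: v)
  case 0
  then show ?case using B by simp
next
  case (Suc k)
  define A' where "A' y j u = frechet_derivative (\<lambda>y. A y j) (at y) u" for y j u
  have A': "((\<lambda>y. A y j) has_derivative A' y j) (at y)" if "y \<in> S" for y j
    using Ck_on_has_derivative[OF Suc.prems that] unfolding A'_def by simp
  have IH: "Ck_on k (\<lambda>y. B y v) S" for v
    using Suc.IH Ck_on_Suc_imp[OF Suc.prems] by blast
  show ?case
  proof (rule Ck_on_SucI[OF assms(1)])
    fix y0 assume y0: "y0 \<in> S"
    define w where "w = B y0 v"
    \<comment> \<open>The i-th coordinate of A y w - A y0 w, written with the basis vectors j so
      that only the maps y -> A y j are differentiated. It is zero at y0.\<close>
    define a where "a i y = (\<Sum>j\<in>Basis. (w \<bullet> j) *\<^sub>R (A y j - A y0 j)) \<bullet> i" for i y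
    have aw: "(A y w - A y0 w) \<bullet> i = a i y" if "y \<in> S" for i y
      unfolding a_def linear_sum_Basis[OF lin(1)[OF that], of w]
        linear_sum_Basis[OF lin(1)[OF y0], of w]
      by (simp add: sum_subtractf scaleR_diff_right)
    have da: "(a i has_derivative (\<lambda>u. (\<Sum>j\<in>Basis. (w \<bullet> j) *\<^sub>R A' y0 j u) \<bullet> i)) (at y0)" for i
      unfolding a_def by (auto intro!: derivative_eq_intros A' y0)
    have eq: "w - (\<Sum>i\<in>Basis. a i y *\<^sub>R B y i) = B y v" if "y \<in> S" for y
    proof -
      have "(\<Sum>i\<in>Basis. a i y *\<^sub>R B y i) = B y (A y w - A y0 w)"
        unfolding linear_sum_Basis[OF lin(2)[OF that], of "A y w - A y0 w"]
        using aw[OF that] by simp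
      also have "\<dots> = w - B y v"
        using inv y0 that by (simp add: linear_diff[OF lin(2)[OF that]] w_def)
      finally show ?thesis by simp
    qed
    have "((\<lambda>y. w - (\<Sum>i\<in>Basis. a i y *\<^sub>R B y i)) has_derivative
        (\<lambda>u. 0 - (\<Sum>i\<in>Basis. ((\<Sum>j\<in>Basis. (w \<bullet> j) *\<^sub>R A' y0 j u) \<bullet> i) *\<^sub>R B y0 i))) (at y0)"
      using B y0 \<open>open S\<close>
      by (intro has_derivative_diff has_derivative_const has_derivative_sum
          has_derivative_scaleR_vanishing da)
         (auto simp: a_def continuous_on_eq_continuous_at)
    then show "((\<lambda>y. B y v) has_derivative (\<lambda>u. 0 - (\<Sum>i\<in>Basis.
        ((\<Sum>j\<in>Basis. (B y0 v \<bullet> j) *\<^sub>R A' y0 j u) \<bullet> i) *\<^sub>R B y0 i))) (at y0)"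
      using has_derivative_transform_within_open[OF _ \<open>open S\<close> y0, where g = "\<lambda>y. B y v"] eq
      unfolding w_def by blast
  next
    fix u
    have "Ck_on k (\<lambda>y. - (\<Sum>i\<in>Basis.
        ((\<Sum>j\<in>Basis. (B y v \<bullet> j) *\<^sub>R A' y j u) \<bullet> i) *\<^sub>R B y i)) S"
      using Suc.prems IH unfolding A'_def
      by (intro Ck_on_bounded_linear_compose[OF assms(1), where L = uminus] bounded_linear_minus
          bounded_linear_ident Ck_on_sum Ck_on_scaleR Ck_on_inner assms(1)) auto
    then show "Ck_on k (\<lambda>y. 0 - (\<Sum>i\<in>Basis.
        ((\<Sum>j\<in>Basis. (B y v \<bullet> j) *\<^sub>R A' y j u) \<bullet> i) *\<^sub>R B y i)) S" by simp
  qed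
qed

text \<open>The inverses are uniformly bounded near y0, because a small perturbation of
  \<open>A y0\<close> can be absorbed. The identity B y - B y0 = - B y (A y - A y0) B y0 then turns
  continuity of \<open>A\<close> in operator norm into pointwise continuity of
  \<open>B\<close>.\<close>

lemma continuous_on_inverse_family:
  fixes A :: "'a::metric_space \<Rightarrow> 'b::euclidean_space \<Rightarrow>\<^sub>L 'b"
  assumes A: "continuous_on S A" and B: "\<And>y. y \<in> S \<Longrightarrow> linear (B y)"
    and inv: "\<And>y w. y \<in> S \<Longrightarrow> B y (A y w) = w" "\<And>y w. y \<in> S \<Longrightarrow> A y (B y w) = w"
  shows "continuous_on S (\<lambda>y. B y v)"
  unfolding continuous_on_def
proof
  fix y0 assume y0: "y0 \<in> S"
  have "bounded_linear (B y0)" using B[OF y0] by (rule linear_conv_bounded_linear[THEN iffD1])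
  then obtain m where m: "m > 0" "\<And>z. norm (B y0 z) \<le> norm z * m"
    using bounded_linear.pos_bounded by blast
  have lim: "((\<lambda>y. norm (A y - A y0)) \<longlongrightarrow> 0) (at y0 within S)"
    using A y0 by (intro tendsto_norm_zero LIM_zero) (auto simp: continuous_on_def)
  \<comment> \<open>The radius 1/(2m) makes the error term at most half the norm of
    \<open>B y z\<close>. Moving it to the other side produces the constant 2m in
    \<open>bound\<close>.\<close>
  have ev: "\<forall>\<^sub>F y in at y0 within S. norm (A y - A y0) < 1 / (2 * m)"
    using order_tendstoD(2)[OF lim] m by simp
  have bound: "norm (B y z) \<le> 2 * m * norm z" if y: "y \<in> S" and n: "norm (A y - A y0) < 1 / (2 * m)" for y z
  proof -
    let ?x = "B y z"
    have "norm ?x = norm (B y0 (A y0 ?x))" using inv y0 by simp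
    also have "\<dots> \<le> norm (A y0 ?x) * m" by (rule m)
    also have "A y0 ?x = z - (A y - A y0) ?x" using inv y by (simp add: blinfun.diff_left)
    also have "norm \<dots> \<le> norm z + norm (A y - A y0) * norm ?x"
      by (rule order_trans[OF norm_triangle_ineq4]) (simp add: norm_blinfun)
    also have "\<dots> \<le> norm z + 1 / (2 * m) * norm ?x"
      by (intro add_left_mono mult_right_mono less_imp_le[OF n] norm_ge_zero)
    finally have "norm ?x \<le> (norm z + 1 / (2 * m) * norm ?x) * m" using m by simp
    then show ?thesis using m by (simp add: field_simps)
  qed
  have eventually_in_S: "\<forall>\<^sub>F y in at y0 within S. y \<in> S"
    unfolding eventually_at_topological by blast
  have "((\<lambda>y. B y v - B y0 v) \<longlongrightarrow> 0) (at y0 within S)"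
  proof (rule Lim_null_comparison)
    show "\<forall>\<^sub>F y in at y0 within S. norm (B y v - B y0 v) \<le> 2 * m * (norm (A y - A y0) * norm (B y0 v))"
      using ev eventually_in_S
    proof eventually_elim
      case (elim y)
      have "B y v - B y0 v = - B y ((A y - A y0) (B y0 v))"
        using inv elim y0 by (simp add: blinfun.diff_left linear_diff[OF B])
      then show ?case
        using bound[of y "(A y - A y0) (B y0 v)"] elim norm_blinfun[of "A y - A y0" "B y0 v"] m
        by (smt (verit) mult_left_mono norm_minus_cancel)
    qed
    have "((\<lambda>y. 2 * m * (norm (A y - A y0) * norm (B y0 v))) \<longlongrightarrow> 2 * m * (0 * norm (B y0 v))) (at y0 within S)"
      by (intro tendsto_intros lim)
    then show "((\<lambda>y. 2 * m * (norm (A y - A y0) * norm (B y0 v))) \<longlongrightarrow> 0) (at y0 within S)" by simp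
  qed
  then show "((\<lambda>y. B y v) \<longlongrightarrow> B y0 v) (at y0 within S)" by (simp add: LIM_zero_iff)
qed

definition smooth_open :: "'a::euclidean_space set \<Rightarrow> ('a \<Rightarrow> 'b::real_normed_vector) \<Rightarrow> bool" where
  "smooth_open T F \<longleftrightarrow> open T \<and> (\<forall>k. Ck_on k F T)"

lemma smooth_open_has_derivative:
  "smooth_open T F \<Longrightarrow> x \<in> T \<Longrightarrow> (F has_derivative frechet_derivative F (at x)) (at x)"
  unfolding smooth_open_def using Ck_on_has_derivative by blast

text \<open>\<open>inverse_function_theorem\<close> provides an inverse g whose derivative at y is
  the inverse of Df (g y). If g is of class k, then so is y -> Df (g y), hence also its pointwise
  inverse by \<open>Ck_on_inverse_family\<close>, so that g is of class k + 1. The last conclusion,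
  invertibility of the derivative on all of U', is what the dimension count of
  \<open>constant_rank\<close> uses.\<close>

theorem smooth_inverse_function:
  fixes f :: "'a::euclidean_space \<Rightarrow> 'a"
  assumes f: "smooth_open U f" and x0: "x0 \<in> U" and f0: "inj (frechet_derivative f (at x0))"
  obtains U' V g where "smooth_open U' f" "U' \<subseteq> U" "x0 \<in> U'" "homeomorphism U' V f g" "smooth_open V g"
    "\<And>z. z \<in> U' \<Longrightarrow> bij (frechet_derivative f (at z))"
proof -
  let ?D = "\<lambda>x. frechet_derivative f (at x)"
  define f' where "f' x = Blinfun (?D x)" for x
  have U: "open U" using f by (simp add: smooth_open_def)
  have der: "(f has_derivative ?D x) (at x)" if "x \<in> U" for x
    using smooth_open_has_derivative[OF f that] .
  have f'_apply: "blinfun_apply (f' x) = ?D x" if "x \<in> U" for x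
    unfolding f'_def by (rule bounded_linear_Blinfun_apply) (rule has_derivative_bounded_linear[OF der[OF that]])
  have der': "(f has_derivative blinfun_apply (f' x)) (at x)" if "x \<in> U" for x
    using der[OF that] f'_apply[OF that] by simp
  have Dk: "Ck_on k (\<lambda>x. ?D x v) U" for k v
    using f Ck_on.simps(2)[of k f U] unfolding smooth_open_def by blast
  have contf': "continuous_on U f'"
  proof (rule continuous_on_blinfun_componentwise)
    fix i :: 'a
    show "continuous_on U (\<lambda>x. f' x i)"
      using Dk[of 0 i] continuous_on_cong[of U U "\<lambda>x. f' x i" "\<lambda>x. ?D x i"] f'_apply by auto
  qed
  have "linear (?D x0)" using der[OF x0] has_derivative_linear by blast
  then obtain h where h: "linear h" "h \<circ> ?D x0 = id"
    using linear_injective_left_inverse f0 by blast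
  have invf: "Blinfun h o\<^sub>L f' x0 = id_blinfun"
    using h f'_apply[OF x0]
    by (intro blinfun_eqI) (simp add: bounded_linear_Blinfun_apply linear_conv_bounded_linear pointfree_idE)
  have "\<exists>U' V g g'. open U' \<and> U' \<subseteq> U \<and> x0 \<in> U' \<and> open V \<and> homeomorphism U' V f g \<and>
     (\<forall>y\<in>V. (g has_derivative g' y) (at y) \<and> g' y = inv (blinfun_apply (f'(g y))) \<and>
        bij (blinfun_apply (f'(g y))))" (is "\<exists>U' V g g'. ?Q U' V g g'")
  proof (rule inverse_function_theorem[OF U _ contf' x0 invf])
    show "(f has_derivative blinfun_apply (f' x)) (at x)" if "x \<in> U" for x by (rule der'[OF that])
  next
    fix U' V g g'
    assume "open U'" "U' \<subseteq> U" "x0 \<in> U'" "open V" "homeomorphism U' V f g"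
      "\<And>y. y \<in> V \<Longrightarrow> (g has_derivative g' y) (at y)"
      "\<And>y. y \<in> V \<Longrightarrow> g' y = inv (blinfun_apply (f'(g y)))"
      "\<And>y. y \<in> V \<Longrightarrow> bij (blinfun_apply (f'(g y)))"
    then have "?Q U' V g g'" by blast
    then show ?thesis by blast
  qed
  then obtain U' V g g' where *: "open U'" "U' \<subseteq> U" "x0 \<in> U'" "open V" "homeomorphism U' V f g"
    "\<And>y. y \<in> V \<Longrightarrow> (g has_derivative (g' y)) (at y)"
    "\<And>y. y \<in> V \<Longrightarrow> g' y = inv (blinfun_apply (f'(g y)))"
    "\<And>y. y \<in> V \<Longrightarrow> bij (blinfun_apply (f'(g y)))"
    by metis
  have gU': "g y \<in> U'" if "y \<in> V" for y using *(5) that by (auto simp: homeomorphism_def)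
  have gU: "g y \<in> U" if "y \<in> V" for y using gU'[OF that] *(2) by auto
  have Dg: "g' y = inv (?D (g y))" "bij (?D (g y))" if "y \<in> V" for y
    using *(7,8)[OF that] f'_apply[OF gU[OF that]] by auto
  have contg: "continuous_on V g" using *(5) by (simp add: homeomorphism_def)
  have Dlin: "linear (?D (g y))" if "y \<in> V" for y
    using has_derivative_linear[OF der[OF gU[OF that]]] .
  have inv: "g' y (?D (g y) w) = w" "?D (g y) (g' y w) = w" if "y \<in> V" for y w
    using Dg[OF that] by (simp_all add: bij_is_inj bij_is_surj surj_f_inv_f)
  have g'lin: "linear (g' y)" if "y \<in> V" for y using *(6)[OF that] has_derivative_linear by blast
  have contB: "continuous_on V (\<lambda>y. g' y v)" for v
  proof (rule continuous_on_inverse_family[where A = "\<lambda>y. f' (g y)"])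
    show "continuous_on V (\<lambda>y. f' (g y))"
      using continuous_on_compose2[OF contf' contg] gU by auto
  qed (use g'lin inv f'_apply gU in auto)
  have g: "Ck_on k g V" for k
  proof (induction k)
    case 0
    then show ?case using contg by simp
  next
    case (Suc k)
    show ?case
    proof (rule Ck_on_SucI[OF *(4) *(6)])
      fix v
      show "Ck_on k (\<lambda>y. g' y v) V"
      proof (rule Ck_on_inverse_family[OF *(4), where A = "\<lambda>y. ?D (g y)"])
        fix w show "Ck_on k (\<lambda>y. ?D (g y) w) V"
          by (rule Ck_on_compose[OF *(4) U _ Suc.IH Dk]) (use gU in auto)
      qed (use Dlin g'lin inv contB in auto)
    qed auto
  qed
  show thesis
  proof (rule that[OF _ *(2,3,5)])
    show "smooth_open U' f" using f *(1,2) Ck_on_mono unfolding smooth_open_def by blast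
    show "smooth_open V g" using g *(4) by (simp add: smooth_open_def)
    fix z assume "z \<in> U'"
    then have "f z \<in> V" "g (f z) = z" using *(5) by (auto simp: homeomorphism_def)
    then show "bij (?D z)" using Dg(2)[of "f z"] by simp
  qed
qed

section \<open>Smooth maps on subsets of Euclidean spaces\<close>

lemma smooth_open_subset: "smooth_open T F \<Longrightarrow> open S \<Longrightarrow> S \<subseteq> T \<Longrightarrow> smooth_open S F"
  using Ck_on_mono unfolding smooth_open_def by blast

lemma smooth_open_compose:
  fixes f :: "'a::euclidean_space \<Rightarrow> 'b::euclidean_space" and g :: "'b \<Rightarrow> 'c::real_normed_vector"
  shows "smooth_open S f \<Longrightarrow> smooth_open T g \<Longrightarrow> f ` S \<subseteq> T \<Longrightarrow> smooth_open S (\<lambda>x. g (f x))"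
  using Ck_on_compose unfolding smooth_open_def by blast

lemma smooth_open_continuous_on: "smooth_open T F \<Longrightarrow> continuous_on T F"
  unfolding smooth_open_def by (metis Ck_on.simps(1))

lemma smooth_open_vimage: "smooth_open T F \<Longrightarrow> open B \<Longrightarrow> open {x \<in> T. F x \<in> B}"
  using continuous_open_preimage[OF smooth_open_continuous_on, of T F B]
  by (simp add: smooth_open_def Int_def vimage_def)

lemma smooth_open_add: "smooth_open S f \<Longrightarrow> smooth_open S g \<Longrightarrow> smooth_open S (\<lambda>x. f x + g x)"
  unfolding smooth_open_def by (auto intro: Ck_on_add)

lemma smooth_open_linear_compose:
  fixes L :: "'b::euclidean_space \<Rightarrow> 'c::euclidean_space"
  shows "linear L \<Longrightarrow> smooth_open S f \<Longrightarrow> smooth_open S (\<lambda>x. L (f x))"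
  unfolding smooth_open_def by (auto intro: Ck_on_bounded_linear_compose simp: linear_conv_bounded_linear)

lemma smooth_open_linear:
  fixes L :: "'b::euclidean_space \<Rightarrow> 'c::euclidean_space"
  shows "linear L \<Longrightarrow> open S \<Longrightarrow> smooth_open S L"
  unfolding smooth_open_def by (auto intro: Ck_on_bounded_linear simp: linear_conv_bounded_linear)

lemma smooth_open_const: "open S \<Longrightarrow> smooth_open S (\<lambda>x. c)"
  by (simp add: smooth_open_def Ck_on_const)

lemma smooth_open_Pair:
  fixes f :: "'a::euclidean_space \<Rightarrow> 'b::euclidean_space" and g :: "'a \<Rightarrow> 'c::euclidean_space"
  assumes "smooth_open S f" "smooth_open S g"
  shows "smooth_open S (\<lambda>x. (f x, g x))"
proof -
  have 1: "linear (\<lambda>x::'b. (x, 0::'c))" and 2: "linear (\<lambda>x::'c. (0::'b, x))"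
    by (auto simp: linear_iff)
  show ?thesis
    using smooth_open_add[OF smooth_open_linear_compose[OF 1 assms(1)] smooth_open_linear_compose[OF 2 assms(2)]]
    by simp
qed

lemma smooth_onI:
  assumes "\<And>x. x \<in> S \<Longrightarrow> \<exists>T F. smooth_open T F \<and> x \<in> T \<and> (\<forall>y\<in>S \<inter> T. F y = f y)"
  shows "smooth_on S f"
  unfolding smooth_on_def
proof
  fix x assume "x \<in> S"
  then obtain T F where "smooth_open T F" "x \<in> T" "\<forall>y\<in>S \<inter> T. F y = f y" using assms by blast
  then show "\<exists>T F. open T \<and> x \<in> T \<and> (\<forall>k. Ck_on k F T) \<and> (\<forall>y\<in>S \<inter> T. F y = f y)"
    by (intro exI[of _ T] exI[of _ F]) (simp add: smooth_open_def)
qed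

lemma smooth_onE:
  assumes "smooth_on S f" "x \<in> S"
  obtains T F where "smooth_open T F" "x \<in> T" "\<And>y. y \<in> S \<Longrightarrow> y \<in> T \<Longrightarrow> F y = f y"
proof -
  have "\<exists>T F. open T \<and> x \<in> T \<and> (\<forall>k. Ck_on k F T) \<and> (\<forall>y\<in>S \<inter> T. F y = f y)"
    using assms unfolding smooth_on_def by (rule bspec)
  then obtain T F where *: "open T" "x \<in> T" "\<forall>k. Ck_on k F T" "\<forall>y\<in>S \<inter> T. F y = f y"
    by (elim exE conjE)
  show thesis
  proof (rule that)
    show "smooth_open T F" using *(1,3) by (simp add: smooth_open_def)
    show "F y = f y" if "y \<in> S" "y \<in> T" for y using *(4) that by blast
  qed fact
qed

lemma smooth_on_subset_cong:
  assumes "smooth_on S f" "T \<subseteq> S" "\<And>x. x \<in> T \<Longrightarrow> f x = g x"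
  shows "smooth_on T g"
proof (rule smooth_onI)
  fix x assume "x \<in> T"
  then have "x \<in> S" using assms(2) by auto
  obtain U F where "smooth_open U F" "x \<in> U" "\<And>y. y \<in> S \<Longrightarrow> y \<in> U \<Longrightarrow> F y = f y"
    by (rule smooth_onE[OF assms(1) \<open>x \<in> S\<close>]) blast
  then show "\<exists>U F. smooth_open U F \<and> x \<in> U \<and> (\<forall>y\<in>T \<inter> U. F y = g y)"
    using assms(2,3) by (intro exI[of _ U] exI[of _ F]) auto
qed

lemma smooth_on_subset: "smooth_on S f \<Longrightarrow> T \<subseteq> S \<Longrightarrow> smooth_on T f"
  by (rule smooth_on_subset_cong[OF _ _ refl])

lemma smooth_on_cong: "smooth_on S f \<Longrightarrow> (\<And>x. x \<in> S \<Longrightarrow> f x = g x) \<Longrightarrow> smooth_on S g"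
  by (rule smooth_on_subset_cong[OF _ order_refl])

lemma smooth_on_local:
  assumes "\<And>x. x \<in> S \<Longrightarrow> \<exists>T. open T \<and> x \<in> T \<and> smooth_on (S \<inter> T) f"
  shows "smooth_on S f"
proof (rule smooth_onI)
  fix x assume "x \<in> S"
  then obtain T where T: "open T" "x \<in> T" "smooth_on (S \<inter> T) f" using assms[of x] by auto
  have "x \<in> S \<inter> T" using \<open>x \<in> S\<close> T(2) by simp
  then obtain T' F where F: "smooth_open T' F" "x \<in> T'" "\<And>y. y \<in> S \<inter> T \<Longrightarrow> y \<in> T' \<Longrightarrow> F y = f y"
    by (rule smooth_onE[OF T(3)]) blast
  have "smooth_open (T \<inter> T') F"
    using F(1) T(1) by (intro smooth_open_subset[OF F(1)]) (auto simp: smooth_open_def)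
  then show "\<exists>T F. smooth_open T F \<and> x \<in> T \<and> (\<forall>y\<in>S \<inter> T. F y = f y)"
    using T F by (intro exI[of _ "T \<inter> T'"] exI[of _ F]) auto
qed

lemma smooth_open_smooth_on: "smooth_open T F \<Longrightarrow> S \<subseteq> T \<Longrightarrow> smooth_on S F"
  by (rule smooth_onI) (intro exI[of _ T] exI[of _ F], auto)

lemma smooth_on_const: "smooth_on S (\<lambda>x. c)"
  by (rule smooth_open_smooth_on[OF smooth_open_const[OF open_UNIV]]) auto

lemma smooth_on_singleton: "smooth_on S f" if "S \<subseteq> {a}"
  by (rule smooth_on_cong[OF smooth_on_const[of S "f a"]]) (use that in auto)

section \<open>Straightening submersions and the constant rank theorem\<close>

text \<open>Charts take values in subspaces, while smoothness and derivatives are handled on open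
  sets of the ambient space. Precomposing with such a projection extends data from the
  subspace.\<close>

lemma subspace_projection:
  fixes W :: "'a::euclidean_space set"
  assumes "subspace W"
  obtains P where "linear P" "range P \<subseteq> W" "\<And>w. w \<in> W \<Longrightarrow> P w = w"
  using linear_exists_right_inverse_on[OF linear_ident assms] that by auto

lemma has_vector_derivative_eventually:
  assumes f: "(f has_vector_derivative v) (at t)" and ev: "\<forall>\<^sub>F r in nhds t. f r = g r"
  shows "(g has_vector_derivative v) (at t)"
proof -
  have "\<forall>\<^sub>F r in nhds t. r \<in> UNIV \<longrightarrow> f r = g r" using ev by simp
  from has_vector_derivative_cong_ev[OF this eventually_nhds_x_imp_x[OF ev]] f show ?thesis by simp
qed

text \<open>A projection onto \<open>W\<close> fixes the curve near t, hence it fixes the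
  derivative.\<close>

lemma has_vector_derivative_in_subspace:
  fixes \<gamma> :: "real \<Rightarrow> 'a::euclidean_space"
  assumes "subspace W" and \<gamma>: "(\<gamma> has_vector_derivative v) (at t)" and "\<forall>\<^sub>F r in nhds t. \<gamma> r \<in> W"
  shows "v \<in> W"
proof -
  obtain P where P: "linear P" "range P \<subseteq> W" "\<And>w. w \<in> W \<Longrightarrow> P w = w"
    by (rule subspace_projection[OF assms(1)]) blast
  have "((\<lambda>r. P (\<gamma> r)) has_vector_derivative P v) (at t)"
    using bounded_linear.has_vector_derivative[OF _ \<gamma>] P(1) by (simp add: linear_conv_bounded_linear)
  moreover have "\<forall>\<^sub>F r in nhds t. P (\<gamma> r) = \<gamma> r"
    using assms(3) by eventually_elim (rule P(3))
  ultimately have "(\<gamma> has_vector_derivative P v) (at t)"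
    by (rule has_vector_derivative_eventually)
  then have "v = P v" using \<gamma> vector_derivative_unique_at by blast
  then show ?thesis using P(2) by (metis rangeI subsetD)
qed

lemma has_vector_derivative_along_line:
  assumes "(F has_derivative F') (at z)"
  shows "((\<lambda>r::real. F (z + r *\<^sub>R u)) has_vector_derivative F' u) (at 0)"
proof -
  have "((\<lambda>r::real. z + r *\<^sub>R u) has_derivative (\<lambda>r. r *\<^sub>R u)) (at 0)"
    by (auto intro!: derivative_eq_intros)
  from has_derivative_compose[OF this, of F F'] assms
  have "((\<lambda>r::real. F (z + r *\<^sub>R u)) has_derivative (\<lambda>r. F' (r *\<^sub>R u))) (at 0)" by simp
  then show ?thesis
    using has_derivative_linear[OF assms] by (simp add: has_vector_derivative_def linear_scale)
qed

lemma eventually_line_mem: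
  fixes z u :: "'a::real_normed_vector"
  assumes "open T" "z \<in> T" shows "\<forall>\<^sub>F r::real in nhds 0. z + r *\<^sub>R u \<in> T"
proof -
  have "((\<lambda>r::real. z + r *\<^sub>R u) \<longlongrightarrow> z + 0 *\<^sub>R u) (nhds 0)"
    by (intro tendsto_intros filterlim_ident)
  then show ?thesis using topological_tendstoD[OF _ assms(1)] assms(2) by simp
qed

lemma has_derivative_in_subspace:
  fixes F :: "'a::real_normed_vector \<Rightarrow> 'b::euclidean_space"
  assumes F: "(F has_derivative F') (at z)" and "subspace V" "z \<in> V" "u \<in> V" and "subspace W"
    and "open T" "z \<in> T" and "\<And>y. y \<in> V \<Longrightarrow> y \<in> T \<Longrightarrow> F y \<in> W"
  shows "F' u \<in> W"
proof (rule has_vector_derivative_in_subspace[OF assms(5) has_vector_derivative_along_line[OF F]])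
  show "\<forall>\<^sub>F r::real in nhds 0. F (z + r *\<^sub>R u) \<in> W"
    using eventually_line_mem[OF assms(6,7)]
    by eventually_elim (use assms in \<open>auto intro: subspace_add subspace_mul\<close>)
qed

lemma straighten:
  fixes H :: "'e::euclidean_space \<Rightarrow> 'z::euclidean_space"
  assumes V: "subspace V" and H: "smooth_open T H" and z0: "z0 \<in> T" "z0 \<in> V"
    and HZ: "\<And>z. z \<in> V \<Longrightarrow> z \<in> T \<Longrightarrow> H z \<in> L ` V"
    and D: "(H has_derivative L) (at z0)" and H0: "H z0 = 0"
  obtains T1 O1 \<psi> \<psi>i where "smooth_open T1 \<psi>" "z0 \<in> T1" "T1 \<subseteq> T" "smooth_open O1 \<psi>i"
    "homeomorphism T1 O1 \<psi> \<psi>i" "\<psi> z0 = 0"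
    "\<And>z. z \<in> T1 \<Longrightarrow> \<psi> z \<in> V \<longleftrightarrow> z \<in> V" "\<And>z. z \<in> T1 \<Longrightarrow> z \<in> V \<Longrightarrow> L (\<psi> z) = H z"
    "(\<psi> has_derivative (\<lambda>v. v)) (at z0)" "\<And>z. z \<in> T1 \<Longrightarrow> bij (frechet_derivative \<psi> (at z))"
proof -
  have linL: "linear L" using D has_derivative_linear by blast
  obtain P where P: "linear P" "range P \<subseteq> V" "\<And>w. w \<in> V \<Longrightarrow> P w = w"
    by (rule subspace_projection[OF V]) blast
  obtain R where R: "range R \<subseteq> V" "linear R" "\<And>w. w \<in> L ` V \<Longrightarrow> L (R w) = w"
    using linear_exists_right_inverse_on[OF linL V] by auto
  define T' where "T' = {z \<in> T. P z \<in> T}"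
  \<comment> \<open>\<open>R\<close> is a right inverse of \<open>L\<close> on \<open>L\<close>
    V\<open>with values in\<close>V\<open>. For z in\<close>V\<open>the remainder H z - L (z - z0) lies in\<close>L
    \<open>V\<close>, so applying \<open>L\<close> to this formula returns H z. The projection
    \<open>P\<close> makes the formula read \<open>H\<close> on \<open>V\<close> only, where its
    values are controlled.\<close>
  define \<psi> where "\<psi> z = (z - z0) + R (H (P z) - L (P z - z0))" for z
  have T: "open T" using H by (simp add: smooth_open_def)
  have "smooth_open T P" by (rule smooth_open_linear[OF P(1) T])
  then have "open T'" unfolding T'_def by (rule smooth_open_vimage[OF _ T])
  have sP: "smooth_open T' P" by (rule smooth_open_linear[OF P(1) \<open>open T'\<close>])
  have sHP: "smooth_open T' (\<lambda>z. H (P z))"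
    by (rule smooth_open_compose[OF sP H]) (auto simp: T'_def)
  have s\<psi>: "smooth_open T' \<psi>"
    unfolding \<psi>_def
    using smooth_open_add[OF sP smooth_open_const[OF \<open>open T'\<close>, of "- z0"]]
      smooth_open_add[OF smooth_open_linear[OF linear_ident \<open>open T'\<close>] smooth_open_const[OF \<open>open T'\<close>, of "- z0"]]
    by (intro smooth_open_add smooth_open_linear_compose[OF R(2)])
       (use smooth_open_add[OF sHP smooth_open_linear_compose[OF linear_uminus smooth_open_linear_compose[OF linL]]] in auto)
  have "(\<psi> has_derivative (\<lambda>v. v + R (L (P v) - L (P v)))) (at z0)"
  proof -
    have dP: "(P has_derivative P) (at z0)" "(R has_derivative R) (at w)" "(L has_derivative L) (at w')" for w w'
      using P(1) R(2) linL by (auto intro!: bounded_linear_imp_has_derivative simp: linear_conv_bounded_linear)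
    have "((\<lambda>z. H (P z)) has_derivative (\<lambda>v. L (P v))) (at z0)"
      using has_derivative_compose[OF dP(1), of H L] D P(3)[OF z0(2)] by simp
    moreover have "((\<lambda>z. L (P z - z0)) has_derivative (\<lambda>v. L (P v))) (at z0)"
      using has_derivative_compose[OF has_derivative_diff[OF dP(1) has_derivative_const] dP(3), of z0] by simp
    ultimately have "((\<lambda>z. R (H (P z) - L (P z - z0))) has_derivative (\<lambda>v. R (L (P v) - L (P v)))) (at z0)"
      using has_derivative_compose[OF has_derivative_diff dP(2)] by blast
    then show ?thesis unfolding \<psi>_def
      by (intro has_derivative_add) (auto intro!: derivative_eq_intros)
  qed
  then have d\<psi>: "(\<psi> has_derivative (\<lambda>v. v)) (at z0)" using linear_0[OF R(2)] by simp
  have "z0 \<in> T'" using z0 P(3) by (simp add: T'_def)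
  moreover have "inj (frechet_derivative \<psi> (at z0))"
    using frechet_derivative_at[OF d\<psi>] by (metis inj_on_id2)
  ultimately obtain T1 O1 \<psi>i where *: "smooth_open T1 \<psi>" "T1 \<subseteq> T'" "z0 \<in> T1" "homeomorphism T1 O1 \<psi> \<psi>i"
    "smooth_open O1 \<psi>i" "\<And>z. z \<in> T1 \<Longrightarrow> bij (frechet_derivative \<psi> (at z))"
    using smooth_inverse_function[OF s\<psi>] by metis
  show thesis
  proof (rule that[OF *(1) *(3) _ *(5,4) _ _ _ d\<psi> *(6)])
    show "T1 \<subseteq> T" using *(2) by (auto simp: T'_def)
    show "\<psi> z0 = 0" using P(3)[OF z0(2)] H0 linear_0[OF R(2)] linear_0[OF linL] by (simp add: \<psi>_def)
    fix z assume z: "z \<in> T1"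
    have RV: "R w \<in> V" for w using R(1) by auto
    show "\<psi> z \<in> V \<longleftrightarrow> z \<in> V"
    proof
      assume "\<psi> z \<in> V"
      then have "\<psi> z - R (H (P z) - L (P z - z0)) + z0 \<in> V"
        using V RV z0 by (intro subspace_add subspace_diff) auto
      then show "z \<in> V" by (simp add: \<psi>_def)
    next
      assume "z \<in> V"
      then show "\<psi> z \<in> V" unfolding \<psi>_def using V RV z0 by (intro subspace_add subspace_diff) auto
    qed
    assume zV: "z \<in> V"
    have "z \<in> T" using z *(2) by (auto simp: T'_def)
    have "subspace (L ` V)" using linL V by (rule linear_subspace_image)
    then have "H z - L (z - z0) \<in> L ` V"
      using HZ[OF zV \<open>z \<in> T\<close>] V zV z0 by (auto intro!: subspace_diff imageI)
    then show "L (\<psi> z) = H z"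
      using R(3) P(3)[OF zV] by (simp add: \<psi>_def linear_add[OF linL])
  qed
qed

text \<open>In straightened coordinates the zero set of \<open>H\<close> is the kernel of
  \<open>L\<close>, so the line r v lies in it. Its preimage has velocity v, since the derivative of
  the coordinate change at z0 is the identity.\<close>

lemma kernel_curve:
  fixes H :: "'e::euclidean_space \<Rightarrow> 'z::euclidean_space"
  assumes V: "subspace V" and H: "smooth_open T H" and z0: "z0 \<in> T" "z0 \<in> V"
    and HZ: "\<And>z. z \<in> V \<Longrightarrow> z \<in> T \<Longrightarrow> H z \<in> L ` V"
    and D: "(H has_derivative L) (at z0)" and H0: "H z0 = 0" and v: "v \<in> V" "L v = 0"
  obtains \<gamma> :: "real \<Rightarrow> 'e" where "\<gamma> 0 = z0" "(\<gamma> has_vector_derivative v) (at 0)"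
    "\<forall>\<^sub>F r in nhds 0. \<gamma> r \<in> V \<and> \<gamma> r \<in> T \<and> H (\<gamma> r) = 0"
proof -
  have linL: "linear L" using D has_derivative_linear by blast
  obtain T1 O1 \<psi> \<psi>i where *: "smooth_open T1 \<psi>" "z0 \<in> T1" "T1 \<subseteq> T" "smooth_open O1 \<psi>i"
    "homeomorphism T1 O1 \<psi> \<psi>i" "\<psi> z0 = 0"
    "\<And>z. z \<in> T1 \<Longrightarrow> \<psi> z \<in> V \<longleftrightarrow> z \<in> V" "\<And>z. z \<in> T1 \<Longrightarrow> z \<in> V \<Longrightarrow> L (\<psi> z) = H z"
    "(\<psi> has_derivative (\<lambda>v. v)) (at z0)"
    using straighten[OF V H z0 HZ D H0] by metis
  have inv: "\<psi>i (\<psi> z) = z" "\<psi> z \<in> O1" if "z \<in> T1" for z using *(5) that by (auto simp: homeomorphism_def)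
  have inv': "\<psi> (\<psi>i w) = w" "\<psi>i w \<in> T1" if "w \<in> O1" for w using *(5) that by (auto simp: homeomorphism_def)
  have O1: "open O1" "0 \<in> O1" using *(4) inv[OF *(2)] *(6) by (auto simp: smooth_open_def)
  let ?D = "frechet_derivative \<psi>i (at 0)"
  have d\<psi>i: "(\<psi>i has_derivative ?D) (at 0)" using smooth_open_has_derivative[OF *(4) O1(2)] .
  have "((\<lambda>z. \<psi>i (\<psi> z)) has_derivative ?D) (at z0)"
    using has_derivative_compose[OF *(9), of \<psi>i ?D] d\<psi>i *(6) by simp
  moreover have "((\<lambda>z. \<psi>i (\<psi> z)) has_derivative (\<lambda>v. v)) (at z0)"
    by (rule has_derivative_transform_within_open[of "\<lambda>v. v" _ _ _ T1])
       (use *(1,2) inv in \<open>auto simp: smooth_open_def\<close>)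
  ultimately have D: "?D = (\<lambda>v. v)" by (rule has_derivative_unique)
  have "((\<lambda>r. \<psi>i (0 + r *\<^sub>R v)) has_vector_derivative v) (at 0)"
    using has_vector_derivative_along_line[OF d\<psi>i, of v] by (simp add: D)
  then have 1: "((\<lambda>r. \<psi>i (r *\<^sub>R v)) has_vector_derivative v) (at 0)" by simp
  have 2: "\<forall>\<^sub>F r::real in nhds 0. r *\<^sub>R v \<in> O1" using eventually_line_mem[OF O1, of v] by simp
  have "\<forall>\<^sub>F r in nhds 0. \<psi>i (r *\<^sub>R v) \<in> V \<and> \<psi>i (r *\<^sub>R v) \<in> T \<and> H (\<psi>i (r *\<^sub>R v)) = 0"
    using 2
  proof eventually_elim
    case (elim r)
    have "\<psi>i (r *\<^sub>R v) \<in> V" using *(7)[OF inv'(2)[OF elim]] inv'(1)[OF elim] V v by (simp add: subspace_mul)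
    then show ?case
      using *(8)[OF inv'(2)[OF elim]] inv'[OF elim] *(3) v linear_scale[OF linL] by auto
  qed
  moreover have "\<psi>i (0 *\<^sub>R v) = z0" using inv[OF *(2)] *(6) by simp
  ultimately show thesis using that[OF _ 1] by simp
qed

text \<open>In coordinates straightening R (f - f z0), the level set of R f through z0 is the flat
  piece W = V \<inter> ker L. At each of its points, ker (R Df) on \<open>V\<close> embeds into
  \<open>W\<close> by the derivative of the coordinates, and dim W is bounded by dim (ker Df) by the
  hypothesis \<open>rank\<close>. As ker Df is contained in ker (R Df), the two kernels agree. So f
  has zero derivative along \<open>W\<close> and is locally constant on the level set.\<close>

theorem constant_rank:
  fixes f :: "'e::euclidean_space \<Rightarrow> 'y::euclidean_space" and R :: "'y \<Rightarrow> 'z::euclidean_space"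
  assumes V: "subspace V" and f: "smooth_open T f" and z0: "z0 \<in> T" "z0 \<in> V" and R: "linear R"
    and RZ: "\<And>z. z \<in> V \<Longrightarrow> z \<in> T \<Longrightarrow> R (f z - f z0) \<in> (\<lambda>v. R (f0 v)) ` V"
    and f0: "(f has_derivative f0) (at z0)"
    and rank: "\<And>z. z \<in> V \<Longrightarrow> z \<in> T \<Longrightarrow> R (f z) = R (f z0) \<Longrightarrow>
      dim {v \<in> V. R (f0 v) = 0} \<le> dim {v \<in> V. frechet_derivative f (at z) v = 0}"
  obtains T2 where "open T2" "z0 \<in> T2" "T2 \<subseteq> T"
    "\<And>z. z \<in> V \<Longrightarrow> z \<in> T2 \<Longrightarrow> R (f z) = R (f z0) \<Longrightarrow> f z = f z0"
proof -
  define H where "H z = R (f z - f z0)" for z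
  define L where "L v = R (f0 v)" for v
  have T: "open T" using f by (simp add: smooth_open_def)
  have bR: "bounded_linear R" using R by (simp add: linear_conv_bounded_linear)
  have sH: "smooth_open T H"
    unfolding H_def using smooth_open_linear_compose[OF R smooth_open_add[OF f smooth_open_const[OF T, of "- f z0"]]]
    by simp
  have dH: "(H has_derivative (\<lambda>v. R (f' v))) (at z)" if "(f has_derivative f') (at z)" for f' z
    unfolding H_def using bounded_linear.has_derivative[OF bR has_derivative_diff[OF that has_derivative_const]]
    by simp
  have linL: "linear L" unfolding L_def using dH[OF f0] has_derivative_linear by blast
  have H0: "H z0 = 0" by (simp add: H_def linear_0[OF R])
  obtain T1 O1 \<psi> \<psi>i where *: "smooth_open T1 \<psi>" "z0 \<in> T1" "T1 \<subseteq> T" "smooth_open O1 \<psi>i"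
    "homeomorphism T1 O1 \<psi> \<psi>i" "\<psi> z0 = 0"
    "\<And>z. z \<in> T1 \<Longrightarrow> \<psi> z \<in> V \<longleftrightarrow> z \<in> V" "\<And>z. z \<in> T1 \<Longrightarrow> z \<in> V \<Longrightarrow> L (\<psi> z) = H z"
    "(\<psi> has_derivative (\<lambda>v. v)) (at z0)" "\<And>z. z \<in> T1 \<Longrightarrow> bij (frechet_derivative \<psi> (at z))"
  proof (rule straighten[OF V sH z0 _ _ H0])
    show "H z \<in> L ` V" if "z \<in> V" "z \<in> T" for z using RZ[OF that] by (simp add: H_def L_def)
    show "(H has_derivative L) (at z0)" unfolding L_def by (rule dH[OF f0])
  qed blast
  have inv: "\<psi>i (\<psi> z) = z" "\<psi> z \<in> O1" if "z \<in> T1" for z using *(5) that by (auto simp: homeomorphism_def)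
  have inv': "\<psi> (\<psi>i w) = w" "\<psi>i w \<in> T1" if "w \<in> O1" for w using *(5) that by (auto simp: homeomorphism_def)
  have O1: "open O1" "0 \<in> O1" using *(4) inv[OF *(2)] *(6) by (auto simp: smooth_open_def)
  have T1: "open T1" using *(1) by (simp add: smooth_open_def)
  define W where "W = {v \<in> V. L v = 0}"
  have W: "subspace W"
    unfolding W_def using V linL
    by (auto simp: subspace_def linear_0 linear_add linear_scale)
  define g where "g w = f (\<psi>i w)" for w
  let ?D\<psi> = "\<lambda>z. frechet_derivative \<psi> (at z)" and ?D\<psi>i = "\<lambda>w. frechet_derivative \<psi>i (at w)"
    and ?Df = "\<lambda>z. frechet_derivative f (at z)"
  \<comment> \<open>The core of the argument: \<open>N\<close> is the kernel of R Df and
    \<open>M\<close> the kernel of Df on \<open>V\<close> at the point z with coordinates w. The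
    chain dim N <= dim W <= dim M forces M = N, and the inverse coordinate change carries
    \<open>W\<close> into \<open>N\<close>.\<close>
  have dg: "\<exists>g'. (g has_derivative g') (at w) \<and> (\<forall>u\<in>W. g' u = 0)" if w: "w \<in> W" "w \<in> O1" for w
  proof -
    define z where "z = \<psi>i w"
    have z: "z \<in> T1" "z \<in> T" "\<psi> z = w" using inv'[OF w(2)] *(3) by (auto simp: z_def)
    have zV: "z \<in> V" using *(7)[OF z(1)] w(1) z(3) by (simp add: W_def)
    have dz: "(\<psi> has_derivative ?D\<psi> z) (at z)" "(f has_derivative ?Df z) (at z)"
      using smooth_open_has_derivative[OF *(1) z(1)] smooth_open_has_derivative[OF f z(2)] by auto
    have dw: "(\<psi>i has_derivative ?D\<psi>i w) (at w)" using smooth_open_has_derivative[OF *(4) w(2)] .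
    have lin: "linear (?D\<psi> z)" "linear (?Df z)" "linear (?D\<psi>i w)" using dz dw has_derivative_linear by blast+
    have "((\<lambda>w. \<psi> (\<psi>i w)) has_derivative (\<lambda>u. ?D\<psi> z (?D\<psi>i w u))) (at w)"
      using has_derivative_compose[OF dw, of \<psi> "?D\<psi> z"] dz(1) by (simp add: z_def)
    moreover have "((\<lambda>w. \<psi> (\<psi>i w)) has_derivative (\<lambda>u. u)) (at w)"
      by (rule has_derivative_transform_within_open[of "\<lambda>v. v" _ _ _ O1]) (use O1 w inv' in auto)
    ultimately have comp: "?D\<psi> z (?D\<psi>i w u) = u" for u by (metis has_derivative_unique)
    have \<psi>iV: "?D\<psi>i w u \<in> V" if "u \<in> V" for u
      using w by (intro has_derivative_in_subspace[OF dw V _ that V O1(1) w(2)])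
        (use *(7)[OF inv'(2)] inv'(1) in \<open>auto simp: W_def\<close>)
    have \<psi>V: "?D\<psi> z u \<in> V" if "u \<in> V" for u
      using *(7) by (intro has_derivative_in_subspace[OF dz(1) V zV that V T1 z(1)]) auto
    have L: "L (?D\<psi> z u) = R (?Df z u)" if "u \<in> V" for u
    proof -
      have 1: "((\<lambda>r::real. L (\<psi> (z + r *\<^sub>R u))) has_vector_derivative L (?D\<psi> z u)) (at 0)"
        using bounded_linear.has_vector_derivative[OF _ has_vector_derivative_along_line[OF dz(1)]] linL
        by (simp add: linear_conv_bounded_linear)
      have 2: "((\<lambda>r::real. H (z + r *\<^sub>R u)) has_vector_derivative R (?Df z u)) (at 0)"
        by (rule has_vector_derivative_along_line[OF dH[OF dz(2)]])
      have ev: "\<forall>\<^sub>F r::real in nhds 0. L (\<psi> (z + r *\<^sub>R u)) = H (z + r *\<^sub>R u)"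
        using eventually_line_mem[OF T1 z(1)]
        by eventually_elim (use *(8) zV that V in \<open>auto intro: subspace_add subspace_mul\<close>)
      have "((\<lambda>r::real. H (z + r *\<^sub>R u)) has_vector_derivative L (?D\<psi> z u)) (at 0)"
        using 1 ev by (rule has_vector_derivative_eventually)
      then show ?thesis using 2 vector_derivative_unique_at by blast
    qed
    define N where "N = {v \<in> V. R (?Df z v) = 0}"
    define M where "M = {v \<in> V. ?Df z v = 0}"
    have "subspace N" "subspace M"
      unfolding N_def M_def using V lin(2) R
      by (auto simp: subspace_def linear_0 linear_add linear_scale)
    have "M \<subseteq> N" by (auto simp: M_def N_def linear_0[OF R])
    have injD: "inj (?D\<psi> z)" using *(10)[OF z(1)] bij_is_inj by blast
    have "dim N = dim (?D\<psi> z ` N)"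
      using dim_image_eq[OF lin(1), of N] injD inj_on_subset by (metis subset_UNIV)
    also have "\<dots> \<le> dim W"
      by (rule dim_subset) (use L \<psi>V in \<open>auto simp: N_def W_def\<close>)
    also have "\<dots> \<le> dim M"
    proof -
      have "R (f z - f z0) = 0" using *(8)[OF z(1) zV] z(3) w(1) by (simp add: H_def W_def)
      then have "R (f z) = R (f z0)" by (simp add: linear_diff[OF R])
      then show ?thesis using rank[OF zV z(2)] by (simp add: W_def L_def M_def)
    qed
    finally have "dim N \<le> dim M" .
    then have "M = N" using \<open>M \<subseteq> N\<close> subspace_dim_equal[OF \<open>subspace M\<close> \<open>subspace N\<close>] by blast
    have "?Df z (?D\<psi>i w u) = 0" if u: "u \<in> W" for u
    proof -
      have "?D\<psi>i w u \<in> V" using \<psi>iV u by (simp add: W_def)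
      moreover have "R (?Df z (?D\<psi>i w u)) = 0" using L[OF calculation] comp u by (simp add: W_def)
      ultimately have "?D\<psi>i w u \<in> M" unfolding \<open>M = N\<close> N_def by simp
      then show ?thesis by (simp add: M_def)
    qed
    moreover have "(g has_derivative (\<lambda>u. ?Df z (?D\<psi>i w u))) (at w)"
      unfolding g_def using has_derivative_compose[OF dw, of f "?Df z"] dz(2) by (simp add: z_def)
    ultimately show ?thesis by blast
  qed
  \<comment> \<open>A ball is star-shaped, so the segment from 0 to w stays in the domain and g can
    be integrated along it.\<close>
  obtain \<epsilon> where \<epsilon>: "\<epsilon> > 0" "ball 0 \<epsilon> \<subseteq> O1" using O1 open_contains_ball by blast
  have const: "g w = g 0" if w: "w \<in> W" "w \<in> ball 0 \<epsilon>" for w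
  proof -
    have mem: "r *\<^sub>R w \<in> W" "r *\<^sub>R w \<in> O1" if "r \<in> {0..1}" for r
    proof -
      show "r *\<^sub>R w \<in> W" using W w(1) by (rule subspace_mul)
      have "norm (r *\<^sub>R w) \<le> norm w" using that by (simp add: mult_left_le_one_le)
      then show "r *\<^sub>R w \<in> O1" using w(2) \<epsilon>(2) by auto
    qed
    have "((\<lambda>r. g (r *\<^sub>R w)) has_derivative (\<lambda>r. 0)) (at r within {0..1})" if r: "r \<in> {0..1}" for r
    proof -
      obtain g' where g': "(g has_derivative g') (at (r *\<^sub>R w))" "\<forall>u\<in>W. g' u = 0" using dg[OF mem[OF r]] by blast
      have "((\<lambda>r. r *\<^sub>R w) has_derivative (\<lambda>r. r *\<^sub>R w)) (at r)" by (auto intro!: derivative_eq_intros)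
      from has_derivative_compose[OF this g'(1)]
      have "((\<lambda>r. g (r *\<^sub>R w)) has_derivative (\<lambda>r. g' (r *\<^sub>R w))) (at r)" .
      then show ?thesis using g'(2) W w(1) by (simp add: subspace_mul has_derivative_at_withinI)
    qed
    then have "\<exists>c. \<forall>r\<in>{0..1}. g (r *\<^sub>R w) = c"
      using has_derivative_zero_constant[of "{0..1::real}" "\<lambda>r. g (r *\<^sub>R w)"] by simp
    then obtain c where c: "\<And>r. r \<in> {0..1} \<Longrightarrow> g (r *\<^sub>R w) = c" by blast
    show ?thesis using c[of 0] c[of 1] by simp
  qed
  define T2 where "T2 = {z \<in> T1. \<psi> z \<in> ball 0 \<epsilon>}"
  show thesis
  proof
    show "open T2" unfolding T2_def by (rule smooth_open_vimage[OF *(1)]) simp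
    show "z0 \<in> T2" using *(2,6) \<epsilon>(1) by (simp add: T2_def)
    show "T2 \<subseteq> T" using *(3) by (auto simp: T2_def)
    fix z assume z: "z \<in> V" "z \<in> T2" "R (f z) = R (f z0)"
    have "z \<in> T1" "\<psi> z \<in> ball 0 \<epsilon>" using z(2) by (auto simp: T2_def)
    moreover have "\<psi> z \<in> W"
      using *(7,8)[OF \<open>z \<in> T1\<close>] z by (simp add: W_def H_def linear_diff[OF R])
    ultimately have "g (\<psi> z) = g 0" using const by blast
    then show "f z = f z0" using inv \<open>z \<in> T1\<close> *(2,6) by (metis g_def)
  qed
qed

section \<open>Charts and smooth maps\<close>

lemma chart_inv_snd: "is_chart c \<Longrightarrow> q \<in> fst c \<Longrightarrow> chart_inv c (snd c q) = q"
  by (simp add: is_chart_def chart_inv_def)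

lemma snd_chart_inv: "z \<in> chart_image c \<Longrightarrow> snd c (chart_inv c z) = z"
  by (simp add: chart_image_def chart_inv_def f_inv_into_f)

lemma chart_inv_mem: "z \<in> chart_image c \<Longrightarrow> chart_inv c z \<in> fst c"
  by (simp add: chart_image_def chart_inv_def inv_into_into)

lemma chart_image_mem: "q \<in> fst c \<Longrightarrow> snd c q \<in> chart_image c"
  by (simp add: chart_image_def)

text \<open>A relatively open set contains a small shift of one of its points along any direction of
  the subspace. Hence the model subspace of a chart is recovered as the span of its image, which is
  what makes \<open>tangent\<close> the right space.\<close>

lemma openin_subspace_span:
  fixes V :: "'a::euclidean_space set"
  assumes "subspace V" "openin (top_of_set V) S" "S \<noteq> {}"
  shows "span S = V"
proof
  have "S \<subseteq> V" using assms(2) openin_imp_subset by blast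
  then show "span S \<subseteq> V" using assms(1) span_minimal by blast
  obtain T where T: "open T" "S = V \<inter> T" using assms(2) by (auto simp: openin_open)
  obtain z where z: "z \<in> S" using assms(3) by blast
  show "V \<subseteq> span S"
  proof
    fix v assume v: "v \<in> V"
    have "\<forall>\<^sub>F r::real in nhds 0. z + r *\<^sub>R v \<in> T" using eventually_line_mem[OF T(1)] z T(2) by blast
    then obtain e where e: "e > 0" "\<And>r. dist r 0 < e \<Longrightarrow> z + r *\<^sub>R v \<in> T"
      unfolding eventually_nhds_metric by blast
    define r where "r = e / 2"
    have r: "r \<noteq> 0" "z + r *\<^sub>R v \<in> T" using e by (auto simp: r_def)
    have "z + r *\<^sub>R v \<in> S" using r z v assms(1) T(2) by (auto intro: subspace_add subspace_mul)
    then have "(1 / r) *\<^sub>R ((z + r *\<^sub>R v) - z) \<in> span S"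
      using z by (intro span_mul span_diff span_base)
    then show "v \<in> span S" using r by simp
  qed
qed

lemma chart_image_open:
  assumes "is_chart c" "p \<in> fst c"
  obtains T where "open T" "chart_image c = span (chart_image c) \<inter> T"
proof -
  obtain V where V: "subspace V" "openin (top_of_set V) (chart_image c)"
    using assms(1) by (auto simp: is_chart_def)
  have "span (chart_image c) = V"
    using openin_subspace_span[OF V] chart_image_mem[OF assms(2)] by blast
  then show thesis using V that by (auto simp: openin_open)
qed

text \<open>Neighbourhoods are open sets of coordinates, so that composing maps or changing charts
  never requires a chart to be replaced by a smaller one.\<close>

definition smooth_at ::
  "('a, 'e::euclidean_space) chart \<Rightarrow> ('b, 'f::euclidean_space) chart \<Rightarrow> ('a \<Rightarrow> 'b) \<Rightarrow> 'a \<Rightarrow> bool" where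
  "smooth_at c d f p \<longleftrightarrow> p \<in> fst c \<and> f p \<in> fst d \<and>
     (\<exists>T. open T \<and> snd c p \<in> T \<and> (\<forall>q\<in>fst c. snd c q \<in> T \<longrightarrow> f q \<in> fst d) \<and>
        smooth_on (chart_image c \<inter> T) (\<lambda>z. snd d (f (chart_inv c z))))"

lemma smooth_atI:
  assumes "p \<in> fst c" "open T" "snd c p \<in> T" "\<And>q. q \<in> fst c \<Longrightarrow> snd c q \<in> T \<Longrightarrow> f q \<in> fst d"
    "smooth_on (chart_image c \<inter> T) (\<lambda>z. snd d (f (chart_inv c z)))"
  shows "smooth_at c d f p"
  unfolding smooth_at_def using assms by (intro conjI exI[of _ T]) auto

lemma smooth_atE:
  assumes "smooth_at c d f p"
  obtains T where "open T" "snd c p \<in> T" "\<And>q. q \<in> fst c \<Longrightarrow> snd c q \<in> T \<Longrightarrow> f q \<in> fst d"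
    "smooth_on (chart_image c \<inter> T) (\<lambda>z. snd d (f (chart_inv c z)))"
  using assms unfolding smooth_at_def by (elim conjE exE) blast

lemma smooth_at_mem: "smooth_at c d f p \<Longrightarrow> p \<in> fst c" "smooth_at c d f p \<Longrightarrow> f p \<in> fst d"
  by (simp_all add: smooth_at_def)

text \<open>Calculus is done on the coordinate expression F, which extends to an open set of the
  ambient space and therefore has Frechet derivatives. The set T serves two purposes at once: there
  F represents f, and f maps into the target chart.\<close>

lemma smooth_atE_ext:
  assumes "is_chart c" "smooth_at c d f p"
  obtains T F where "smooth_open T F" "snd c p \<in> T" "\<And>q. q \<in> fst c \<Longrightarrow> snd c q \<in> T \<Longrightarrow> f q \<in> fst d"
    "\<And>q. q \<in> fst c \<Longrightarrow> snd c q \<in> T \<Longrightarrow> F (snd c q) = snd d (f q)"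
proof -
  obtain T where T: "open T" "snd c p \<in> T" "\<And>q. q \<in> fst c \<Longrightarrow> snd c q \<in> T \<Longrightarrow> f q \<in> fst d"
    "smooth_on (chart_image c \<inter> T) (\<lambda>z. snd d (f (chart_inv c z)))"
    by (rule smooth_atE[OF assms(2)]) blast
  have "snd c p \<in> chart_image c \<inter> T" using T(2) chart_image_mem[OF smooth_at_mem(1)[OF assms(2)]] by simp
  then obtain U F where F: "smooth_open U F" "snd c p \<in> U"
    "\<And>z. z \<in> chart_image c \<inter> T \<Longrightarrow> z \<in> U \<Longrightarrow> F z = snd d (f (chart_inv c z))"
    by (rule smooth_onE[OF T(4)]) blast
  show thesis
  proof (rule that[of "U \<inter> T" F])
    show "smooth_open (U \<inter> T) F"
      using F(1) T(1) by (intro smooth_open_subset[OF F(1)]) (auto simp: smooth_open_def)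
    show "F (snd c q) = snd d (f q)" if "q \<in> fst c" "snd c q \<in> U \<inter> T" for q
      using F(3)[of "snd c q"] that chart_image_mem[OF that(1)] chart_inv_snd[OF assms(1) that(1)] by simp
  qed (use T F in auto)
qed

lemma smooth_atI_ext:
  assumes "is_chart c" "p \<in> fst c" "smooth_open T F" "snd c p \<in> T"
    "\<And>q. q \<in> fst c \<Longrightarrow> snd c q \<in> T \<Longrightarrow> f q \<in> fst d"
    "\<And>q. q \<in> fst c \<Longrightarrow> snd c q \<in> T \<Longrightarrow> F (snd c q) = snd d (f q)"
  shows "smooth_at c d f p"
proof (rule smooth_atI[OF assms(2) _ assms(4,5)])
  show "open T" using assms(3) by (simp add: smooth_open_def)
  show "smooth_on (chart_image c \<inter> T) (\<lambda>z. snd d (f (chart_inv c z)))"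
    by (rule smooth_on_cong[OF smooth_open_smooth_on[OF assms(3)]])
      (use assms(6)[OF chart_inv_mem] snd_chart_inv in fastforce)+
qed

lemma smooth_at_compose:
  assumes "is_chart c" "is_chart d" and f: "smooth_at c d f p" and g: "smooth_at d e g (f p)"
  shows "smooth_at c e (\<lambda>x. g (f x)) p"
proof -
  obtain T F where F: "smooth_open T F" "snd c p \<in> T" "\<And>q. q \<in> fst c \<Longrightarrow> snd c q \<in> T \<Longrightarrow> f q \<in> fst d"
    "\<And>q. q \<in> fst c \<Longrightarrow> snd c q \<in> T \<Longrightarrow> F (snd c q) = snd d (f q)"
    by (rule smooth_atE_ext[OF assms(1) f]) blast
  obtain U G where G: "smooth_open U G" "snd d (f p) \<in> U" "\<And>q. q \<in> fst d \<Longrightarrow> snd d q \<in> U \<Longrightarrow> g q \<in> fst e"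
    "\<And>q. q \<in> fst d \<Longrightarrow> snd d q \<in> U \<Longrightarrow> G (snd d q) = snd e (g q)"
    by (rule smooth_atE_ext[OF assms(2) g]) blast
  define T' where "T' = {z \<in> T. F z \<in> U}"
  have "open T'" unfolding T'_def using F(1) G(1) by (intro smooth_open_vimage) (auto simp: smooth_open_def)
  then have "smooth_open T' F" by (rule smooth_open_subset[OF F(1)]) (auto simp: T'_def)
  then have GF: "smooth_open T' (\<lambda>z. G (F z))" using G(1) by (rule smooth_open_compose) (auto simp: T'_def)
  have p: "p \<in> fst c" using f by (rule smooth_at_mem)
  show ?thesis
    by (rule smooth_atI_ext[OF assms(1) p GF]) (use F G p in \<open>auto simp: T'_def\<close>)
qed

lemma smooth_at_cong:
  assumes "is_chart c" "smooth_at c d f p" "open U" "snd c p \<in> U"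
    "\<And>q. q \<in> fst c \<Longrightarrow> snd c q \<in> U \<Longrightarrow> f q = g q"
  shows "smooth_at c d g p"
proof -
  obtain T F where F: "smooth_open T F" "snd c p \<in> T" "\<And>q. q \<in> fst c \<Longrightarrow> snd c q \<in> T \<Longrightarrow> f q \<in> fst d"
    "\<And>q. q \<in> fst c \<Longrightarrow> snd c q \<in> T \<Longrightarrow> F (snd c q) = snd d (f q)"
    by (rule smooth_atE_ext[OF assms(1,2)]) blast
  have p: "p \<in> fst c" using assms(2) by (rule smooth_at_mem)
  have "smooth_open (T \<inter> U) F"
    using F(1) assms(3) by (intro smooth_open_subset[OF F(1)]) (auto simp: smooth_open_def)
  then show ?thesis
    by (rule smooth_atI_ext[OF assms(1) p]) (use F assms(4) assms(5)[symmetric] in auto)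
qed

lemma smooth_at_id: "is_chart c \<Longrightarrow> p \<in> fst c \<Longrightarrow> smooth_at c c (\<lambda>x. x) p"
  by (rule smooth_atI_ext[OF _ _ smooth_open_linear[OF linear_ident open_UNIV]]) auto

text \<open>In this pointwise form, compatibility can be composed by
  \<open>smooth_at_compose\<close>; the openness of overlaps and the smoothness of transition maps
  are absorbed into \<open>smooth_at\<close>.\<close>

lemma compatible_charts_iff:
  assumes c: "is_chart c" and d: "is_chart d"
  shows "compatible_charts c d \<longleftrightarrow>
    (\<forall>q\<in>fst c \<inter> fst d. smooth_at c d (\<lambda>x. x) q \<and> smooth_at d c (\<lambda>x. x) q)"
proof -
  have 1: "openin (top_of_set (chart_image c)) (snd c ` (fst c \<inter> fst d)) \<and>
      smooth_on (snd c ` (fst c \<inter> fst d)) (snd d \<circ> chart_inv c) \<longleftrightarrow>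
      (\<forall>q\<in>fst c \<inter> fst d. smooth_at c d (\<lambda>x. x) q)" (is "?L \<longleftrightarrow> ?R")
    if c: "is_chart c" and d: "is_chart d" for c d :: "('a, 'b) chart"
  proof
    assume L: ?L
    then obtain T where T: "open T" "snd c ` (fst c \<inter> fst d) = chart_image c \<inter> T"
      by (auto simp: openin_open)
    show ?R
    proof
      fix q assume q: "q \<in> fst c \<inter> fst d"
      show "smooth_at c d (\<lambda>x. x) q"
      proof (rule smooth_atI[of _ _ T])
        show "smooth_on (chart_image c \<inter> T) (\<lambda>z. snd d (chart_inv c z))"
          using L by (simp add: T(2)[symmetric] o_def)
        show "q' \<in> fst d" if "q' \<in> fst c" "snd c q' \<in> T" for q'
        proof -
          have "snd c q' \<in> snd c ` (fst c \<inter> fst d)"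
            using that chart_image_mem[OF that(1)] by (simp add: T(2))
          then show ?thesis using c that(1) by (auto simp: is_chart_def inj_on_def)
        qed
      qed (use q T in auto)
    qed
  next
    assume R: ?R
    have ex: "\<exists>T. open T \<and> z \<in> T \<and> chart_image c \<inter> T \<subseteq> snd c ` (fst c \<inter> fst d) \<and>
        smooth_on (chart_image c \<inter> T) (\<lambda>z. snd d (chart_inv c z))"
      if "z \<in> snd c ` (fst c \<inter> fst d)" for z
    proof -
      obtain q where q: "q \<in> fst c \<inter> fst d" "z = snd c q"
        using \<open>z \<in> snd c ` (fst c \<inter> fst d)\<close> by blast
      have "smooth_at c d (\<lambda>x. x) q" using R q(1) by blast
      then obtain T where T: "open T" "snd c q \<in> T" "\<And>q. q \<in> fst c \<Longrightarrow> snd c q \<in> T \<Longrightarrow> q \<in> fst d"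
        "smooth_on (chart_image c \<inter> T) (\<lambda>z. snd d (chart_inv c z))" by (rule smooth_atE) blast
      have "chart_image c \<inter> T \<subseteq> snd c ` (fst c \<inter> fst d)" using T(3) by (auto simp: chart_image_def)
      then show ?thesis using T q by (intro exI[of _ T]) simp
    qed
    show ?L
    proof
      show "openin (top_of_set (chart_image c)) (snd c ` (fst c \<inter> fst d))"
      proof (subst openin_subopen, intro ballI)
        fix z assume z: "z \<in> snd c ` (fst c \<inter> fst d)"
        then obtain T where "open T" "z \<in> T" "chart_image c \<inter> T \<subseteq> snd c ` (fst c \<inter> fst d)"
          using ex by auto
        then show "\<exists>T. openin (top_of_set (chart_image c)) T \<and> z \<in> T \<and> T \<subseteq> snd c ` (fst c \<inter> fst d)"
          using z by (intro exI[of _ "chart_image c \<inter> T"]) (auto simp: chart_image_def)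
      qed
      show "smooth_on (snd c ` (fst c \<inter> fst d)) (snd d \<circ> chart_inv c)"
      proof (rule smooth_on_local)
        fix z assume "z \<in> snd c ` (fst c \<inter> fst d)"
        then obtain T where T: "open T" "z \<in> T" "smooth_on (chart_image c \<inter> T) (\<lambda>z. snd d (chart_inv c z))"
          using ex by auto
        then show "\<exists>T. open T \<and> z \<in> T \<and> smooth_on (snd c ` (fst c \<inter> fst d) \<inter> T) (snd d \<circ> chart_inv c)"
          by (intro exI[of _ T]) (auto simp: o_def chart_image_def intro: smooth_on_subset[OF T(3)])
      qed
    qed
  qed
  show ?thesis
    unfolding compatible_charts_def using 1[OF c d] 1[OF d c] by (auto simp: Int_commute)
qed

section \<open>Charts of the maximal atlas\<close>

lemma smooth_manifoldD:
  assumes "smooth_manifold M"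
  shows "c \<in> atlas M \<Longrightarrow> is_chart c" "c \<in> atlas M \<Longrightarrow> fst c \<subseteq> points M"
    "c \<in> atlas M \<Longrightarrow> c \<in> charts M" "c \<in> charts M \<Longrightarrow> is_chart c" "c \<in> charts M \<Longrightarrow> fst c \<subseteq> points M"
  using assms by (auto simp: smooth_manifold_def charts_def)

lemma chart_at:
  assumes "smooth_manifold M" "p \<in> points M"
  shows "chart_at M p \<in> atlas M" "p \<in> fst (chart_at M p)" "is_chart (chart_at M p)" "chart_at M p \<in> charts M"
proof -
  have "p \<in> (\<Union>c\<in>atlas M. fst c)" using assms by (simp add: smooth_manifold_def)
  then have "\<exists>c. c \<in> atlas M \<and> p \<in> fst c" by blast
  from someI_ex[OF this] show *: "chart_at M p \<in> atlas M" "p \<in> fst (chart_at M p)"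
    by (auto simp: chart_at_def)
  show "is_chart (chart_at M p)" "chart_at M p \<in> charts M" using smooth_manifoldD[OF assms(1)] * by auto
qed

text \<open>Members of \<open>charts M\<close> are by definition compared with the atlas only.
  Around each point an atlas chart mediates between two of them.\<close>

lemma chart_change:
  assumes M: "smooth_manifold M" and "c \<in> charts M" "d \<in> charts M" "q \<in> fst c" "q \<in> fst d"
  shows "smooth_at c d (\<lambda>x. x) q"
proof -
  have q: "q \<in> points M" using smooth_manifoldD(5)[OF M] assms by blast
  let ?e = "chart_at M q"
  have e: "?e \<in> atlas M" "q \<in> fst ?e" "is_chart ?e" using chart_at[OF M q] by auto
  have cd: "is_chart c" "is_chart d" using smooth_manifoldD[OF M] assms by auto
  have "compatible_charts c ?e" "compatible_charts d ?e" using assms(2,3) e(1) by (auto simp: charts_def)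
  then have "smooth_at c ?e (\<lambda>x. x) q" "smooth_at ?e d (\<lambda>x. x) q"
    using compatible_charts_iff[OF cd(1) e(3)] compatible_charts_iff[OF cd(2) e(3)] e(2) assms(4,5) by blast+
  then show ?thesis using smooth_at_compose[OF cd(1) e(3), of "\<lambda>x. x" q d "\<lambda>x. x"] by simp
qed

lemma chartsI:
  assumes M: "smooth_manifold M" and c': "is_chart c'" "fst c' \<subseteq> points M"
    and *: "\<And>q. q \<in> fst c' \<Longrightarrow> \<exists>c\<in>charts M. smooth_at c' c (\<lambda>x. x) q \<and> smooth_at c c' (\<lambda>x. x) q"
  shows "c' \<in> charts M"
proof -
  have "compatible_charts c' d" if d: "d \<in> atlas M" for d
  proof -
    have dc: "is_chart d" "d \<in> charts M" using smooth_manifoldD[OF M] d by auto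
    show ?thesis
      unfolding compatible_charts_iff[OF c'(1) dc(1)]
    proof
      fix q assume q: "q \<in> fst c' \<inter> fst d"
      then obtain c where c: "c \<in> charts M" "smooth_at c' c (\<lambda>x. x) q" "smooth_at c c' (\<lambda>x. x) q"
        using *[of q] by blast
      have "is_chart c" "q \<in> fst c" using smooth_manifoldD(4)[OF M c(1)] smooth_at_mem(1)[OF c(3)] .
      then show "smooth_at c' d (\<lambda>x. x) q \<and> smooth_at d c' (\<lambda>x. x) q"
        using smooth_at_compose[OF c'(1) _ c(2) chart_change[OF M c(1) dc(2)]]
          smooth_at_compose[OF dc(1) _ chart_change[OF M dc(2) c(1)] c(3)] q by auto
    qed
  qed
  then show ?thesis using c' by (auto simp: charts_def)
qed

text \<open>Shrinking a chart to an open set is the case W = UNIV, passing to a slice is the case T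
  = UNIV.\<close>

lemma is_chart_subset:
  assumes "is_chart c" "subspace W" "open T" "S \<subseteq> fst c" "snd c ` S = chart_image c \<inter> T \<inter> W"
  shows "is_chart (S, snd c)"
proof -
  obtain V U where V: "subspace V" "open U" "chart_image c = V \<inter> U"
    using assms(1) by (auto simp: is_chart_def openin_open)
  have "chart_image (S, snd c) = (V \<inter> W) \<inter> (U \<inter> T)"
    using assms(5) V(3) by (auto simp: chart_image_def)
  then have "openin (top_of_set (V \<inter> W)) (chart_image (S, snd c))"
    using V(2) assms(3) by (auto simp: openin_open intro!: exI[of _ "U \<inter> T"])
  moreover have "subspace (V \<inter> W)" using V(1) assms(2) by (rule subspace_inter)
  ultimately show ?thesis
    using assms(1,4) by (auto simp: is_chart_def intro: inj_on_subset)
qed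

lemma smooth_at_restrict_source:
  assumes "is_chart c" "is_chart (S, snd c)" "S \<subseteq> fst c" "smooth_at c d f p" "p \<in> S"
  shows "smooth_at (S, snd c) d f p"
proof -
  obtain T F where F: "smooth_open T F" "snd c p \<in> T" "\<And>q. q \<in> fst c \<Longrightarrow> snd c q \<in> T \<Longrightarrow> f q \<in> fst d"
    "\<And>q. q \<in> fst c \<Longrightarrow> snd c q \<in> T \<Longrightarrow> F (snd c q) = snd d (f q)"
    by (rule smooth_atE_ext[OF assms(1,4)]) blast
  show ?thesis by (rule smooth_atI_ext[OF assms(2) _ F(1)]) (use F assms in auto)
qed

lemma smooth_at_restrict_target:
  assumes "is_chart c" "smooth_at c d f p" "open U" "snd c p \<in> U" "\<And>q. q \<in> fst c \<Longrightarrow> snd c q \<in> U \<Longrightarrow> f q \<in> S"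
  shows "smooth_at c (fst d \<inter> S, snd d) f p"
proof -
  obtain T F where F: "smooth_open T F" "snd c p \<in> T" "\<And>q. q \<in> fst c \<Longrightarrow> snd c q \<in> T \<Longrightarrow> f q \<in> fst d"
    "\<And>q. q \<in> fst c \<Longrightarrow> snd c q \<in> T \<Longrightarrow> F (snd c q) = snd d (f q)"
    by (rule smooth_atE_ext[OF assms(1,2)]) blast
  have "smooth_open (T \<inter> U) F"
    using F(1) assms(3) by (intro smooth_open_subset[OF F(1)]) (auto simp: smooth_open_def)
  then show ?thesis
    by (rule smooth_atI_ext[OF assms(1) smooth_at_mem(1)[OF assms(2)]]) (use F assms in auto)
qed

lemma smooth_at_vimage:
  assumes "is_chart c" "smooth_at c d f p" "open U" "snd d (f p) \<in> U"
  obtains T where "open T" "snd c p \<in> T" "\<And>q. q \<in> fst c \<Longrightarrow> snd c q \<in> T \<Longrightarrow> f q \<in> fst d \<and> snd d (f q) \<in> U"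
proof -
  obtain T F where F: "smooth_open T F" "snd c p \<in> T" "\<And>q. q \<in> fst c \<Longrightarrow> snd c q \<in> T \<Longrightarrow> f q \<in> fst d"
    "\<And>q. q \<in> fst c \<Longrightarrow> snd c q \<in> T \<Longrightarrow> F (snd c q) = snd d (f q)"
    by (rule smooth_atE_ext[OF assms(1,2)]) blast
  have "open {z \<in> T. F z \<in> U}" by (rule smooth_open_vimage[OF F(1) assms(3)])
  then show thesis
    by (rule that) (use F assms(4) smooth_at_mem(1)[OF assms(2)] in auto)
qed

lemma chart_shrink:
  assumes M: "smooth_manifold M" and c: "c \<in> charts M" and T: "open T"
  shows "({q \<in> fst c. snd c q \<in> T}, snd c) \<in> charts M"
proof (rule chartsI[OF M])
  let ?S = "{q \<in> fst c. snd c q \<in> T}"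
  have ic: "is_chart c" using smooth_manifoldD[OF M] c by auto
  show ic': "is_chart (?S, snd c)"
    by (rule is_chart_subset[OF ic subspace_UNIV T]) (auto simp: chart_image_def)
  show "fst (?S, snd c) \<subseteq> points M" using smooth_manifoldD(5)[OF M c] by auto
  fix q assume q: "q \<in> fst (?S, snd c)"
  then have q': "q \<in> fst c" "snd c q \<in> T" by auto
  have id: "smooth_at c c (\<lambda>x. x) q" using smooth_at_id[OF ic] q' by simp
  have "fst c \<inter> ?S = ?S" by auto
  then have "smooth_at (?S, snd c) c (\<lambda>x. x) q" "smooth_at c (?S, snd c) (\<lambda>x. x) q"
    using smooth_at_restrict_source[OF ic ic' _ id] smooth_at_restrict_target[OF ic id T, of ?S] q' by auto
  then show "\<exists>c'\<in>charts M. smooth_at (?S, snd c) c' (\<lambda>x. x) q \<and> smooth_at c' (?S, snd c) (\<lambda>x. x) q"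
    using c by blast
qed

section \<open>Smoothness at a point, independently of charts\<close>

definition smooth_in ::
  "('a, 'e::euclidean_space) manifold \<Rightarrow> ('b, 'f::euclidean_space) manifold \<Rightarrow> ('a \<Rightarrow> 'b) \<Rightarrow> 'a \<Rightarrow> bool" where
  "smooth_in M N f p \<longleftrightarrow> (\<exists>c\<in>charts M. \<exists>d\<in>charts N. smooth_at c d f p)"

lemma smooth_inI: "c \<in> charts M \<Longrightarrow> d \<in> charts N \<Longrightarrow> smooth_at c d f p \<Longrightarrow> smooth_in M N f p"
  unfolding smooth_in_def by blast

lemma smooth_inE:
  assumes "smooth_in M N f p"
  obtains c d where "c \<in> charts M" "d \<in> charts N" "smooth_at c d f p"
  using assms unfolding smooth_in_def by (elim bexE)

lemma smooth_in_mem: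
  assumes "smooth_manifold M" "smooth_manifold N" "smooth_in M N f p"
  shows "p \<in> points M" "f p \<in> points N"
proof -
  obtain c d where *: "c \<in> charts M" "d \<in> charts N" "smooth_at c d f p"
    by (rule smooth_inE[OF assms(3)])
  show "p \<in> points M" "f p \<in> points N"
    using smooth_at_mem[OF *(3)] smooth_manifoldD(5)[OF assms(1) *(1)] smooth_manifoldD(5)[OF assms(2) *(2)]
    by auto
qed

lemma smooth_in_charts:
  assumes M: "smooth_manifold M" and N: "smooth_manifold N" and f: "smooth_in M N f p"
    and "c \<in> charts M" "p \<in> fst c" "d \<in> charts N" "f p \<in> fst d"
  shows "smooth_at c d f p"
proof -
  obtain c' d' where *: "c' \<in> charts M" "d' \<in> charts N" "smooth_at c' d' f p"
    by (rule smooth_inE[OF f])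
  have ch: "is_chart c" "is_chart c'" "is_chart d'"
    using smooth_manifoldD(4)[OF M assms(4)] smooth_manifoldD(4)[OF M *(1)] smooth_manifoldD(4)[OF N *(2)] .
  have "smooth_at c c' (\<lambda>x. x) p" "smooth_at d' d (\<lambda>x. x) (f p)"
    using chart_change[OF M assms(4) *(1)] chart_change[OF N *(2) assms(6)] smooth_at_mem[OF *(3)] assms by auto
  from smooth_at_compose[OF ch(1,2) this(1), of d f] smooth_at_compose[OF ch(2,3) *(3) this(2)]
  show ?thesis by simp
qed

lemma smooth_map_iff:
  assumes M: "smooth_manifold M" and N: "smooth_manifold N"
  shows "smooth_map M N f \<longleftrightarrow> (\<forall>p\<in>points M. smooth_in M N f p)"
proof
  assume f: "smooth_map M N f"
  show "\<forall>p\<in>points M. smooth_in M N f p"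
  proof
    fix p assume "p \<in> points M"
    then obtain c d where cd: "c \<in> charts M" "d \<in> charts N" "p \<in> fst c" "f ` fst c \<subseteq> fst d"
      "smooth_on (chart_image c) (snd d \<circ> f \<circ> chart_inv c)"
      using f by (auto simp: smooth_map_def)
    have "smooth_at c d f p"
      by (rule smooth_atI[of _ _ UNIV]) (use cd in \<open>auto simp: o_def\<close>)
    then show "smooth_in M N f p" using cd by (intro smooth_inI)
  qed
next
  assume f: "\<forall>p\<in>points M. smooth_in M N f p"
  show "smooth_map M N f"
    unfolding smooth_map_def
  proof (intro conjI ballI)
    show "f ` points M \<subseteq> points N" using f smooth_in_mem[OF M N] by blast
    fix p assume "p \<in> points M"
    then have "smooth_in M N f p" using f by simp
    then obtain c d where cd: "c \<in> charts M" "d \<in> charts N" "smooth_at c d f p"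
      by (rule smooth_inE)
    obtain T where T: "open T" "snd c p \<in> T" "\<And>q. q \<in> fst c \<Longrightarrow> snd c q \<in> T \<Longrightarrow> f q \<in> fst d"
      "smooth_on (chart_image c \<inter> T) (\<lambda>z. snd d (f (chart_inv c z)))"
      by (rule smooth_atE[OF cd(3)]) blast
    \<comment> \<open>\<open>smooth_map\<close> wants the whole chart domain to be mapped into the
      target chart, while \<open>smooth_at\<close> guarantees this only for coordinates in
      T.\<close>
    define c' where "c' = ({q \<in> fst c. snd c q \<in> T}, snd c)"
    have c': "c' \<in> charts M" unfolding c'_def by (rule chart_shrink[OF M cd(1) T(1)])
    have ic: "is_chart c" "is_chart c'" using smooth_manifoldD(4)[OF M] cd c' by auto
    have im: "chart_image c' = chart_image c \<inter> T" by (auto simp: c'_def chart_image_def)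
    have inv: "chart_inv c' z = chart_inv c z" if "z \<in> chart_image c'" for z
    proof -
      obtain q where q: "q \<in> fst c'" "z = snd c' q" using \<open>z \<in> chart_image c'\<close> by (auto simp: chart_image_def)
      then show ?thesis using chart_inv_snd[OF ic(1), of q] chart_inv_snd[OF ic(2), of q] by (simp add: c'_def)
    qed
    have "smooth_on (chart_image c') (snd d \<circ> f \<circ> chart_inv c')"
      by (rule smooth_on_cong[of _ "\<lambda>z. snd d (f (chart_inv c z))"]) (use T(4) inv im in auto)
    then show "\<exists>c\<in>charts M. \<exists>d\<in>charts N. p \<in> fst c \<and> f ` fst c \<subseteq> fst d \<and>
        smooth_on (chart_image c) (snd d \<circ> f \<circ> chart_inv c)"
      using c' cd T smooth_at_mem(1)[OF cd(3)]
      by (intro bexI[of _ c'] bexI[of _ d] conjI) (auto simp: c'_def)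
  qed
qed

lemma smooth_in_compose:
  assumes M: "smooth_manifold M" and N: "smooth_manifold N" and K: "smooth_manifold K"
    and f: "smooth_in M N f p" and g: "smooth_in N K g (f p)"
  shows "smooth_in M K (\<lambda>x. g (f x)) p"
proof -
  let ?c = "chart_at M p" and ?d = "chart_at N (f p)" and ?e = "chart_at K (g (f p))"
  have mem: "p \<in> points M" "f p \<in> points N" "g (f p) \<in> points K"
    using smooth_in_mem[OF M N f] smooth_in_mem[OF N K g] by auto
  note c = chart_at[OF M mem(1)] and d = chart_at[OF N mem(2)] and e = chart_at[OF K mem(3)]
  show ?thesis
    by (rule smooth_inI[OF c(4) e(4) smooth_at_compose[OF c(3) d(3)
          smooth_in_charts[OF M N f c(4,2) d(4,2)] smooth_in_charts[OF N K g d(4,2) e(4,2)]]])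
qed

lemma smooth_in_const:
  assumes "smooth_manifold M" "smooth_manifold N" "p \<in> points M" "b \<in> points N"
  shows "smooth_in M N (\<lambda>x. b) p"
proof (rule smooth_inI[OF chart_at(4)[OF assms(1,3)] chart_at(4)[OF assms(2,4)]])
  show "smooth_at (chart_at M p) (chart_at N b) (\<lambda>x. b) p"
    by (rule smooth_atI_ext[OF chart_at(3,2)[OF assms(1,3)] smooth_open_const[OF open_UNIV]])
      (simp_all add: chart_at(2)[OF assms(2,4)])
qed

text \<open>A notion of neighbourhood in terms of chart domains. The topology itself enters only
  through \<open>openin_nbhd\<close>, when properness of the action is used.\<close>

definition nbhd :: "('a, 'e::euclidean_space) manifold \<Rightarrow> 'a \<Rightarrow> 'a set \<Rightarrow> bool" where
  "nbhd M p S \<longleftrightarrow> (\<exists>c\<in>charts M. p \<in> fst c \<and> fst c \<subseteq> S)"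

lemma nbhd_chart:
  assumes M: "smooth_manifold M" and "nbhd M p S" "c \<in> charts M" "p \<in> fst c"
  obtains T where "open T" "snd c p \<in> T" "\<And>q. q \<in> fst c \<Longrightarrow> snd c q \<in> T \<Longrightarrow> q \<in> S"
proof -
  obtain d where d: "d \<in> charts M" "p \<in> fst d" "fst d \<subseteq> S" using assms(2) by (auto simp: nbhd_def)
  have "is_chart c" by (rule smooth_manifoldD(4)[OF M assms(3)])
  from this chart_change[OF M assms(3) d(1) assms(4) d(2)]
  obtain T where "open T" "snd c p \<in> T" "\<And>q. q \<in> fst c \<Longrightarrow> snd c q \<in> T \<Longrightarrow> q \<in> fst d \<and> snd d q \<in> UNIV"
    by (rule smooth_at_vimage[OF _ _ open_UNIV UNIV_I]) blast
  then show thesis using that[of T] d(3) by blast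
qed

lemma nbhd_shrinkI:
  assumes M: "smooth_manifold M" and c: "c \<in> charts M" "p \<in> fst c" and T: "open T" "snd c p \<in> T"
    and S: "\<And>q. q \<in> fst c \<Longrightarrow> snd c q \<in> T \<Longrightarrow> q \<in> S"
  shows "nbhd M p S"
  unfolding nbhd_def
  by (rule bexI[OF _ chart_shrink[OF M c(1) T(1)]]) (use assms in auto)

lemma nbhd_vimage:
  assumes M: "smooth_manifold M" and N: "smooth_manifold N" and f: "smooth_in M N f p" and S: "nbhd N (f p) S"
  shows "nbhd M p {q \<in> points M. f q \<in> S}"
proof -
  let ?c = "chart_at M p"
  have p: "p \<in> points M" by (rule smooth_in_mem[OF M N f])
  obtain d where d: "d \<in> charts N" "f p \<in> fst d" "fst d \<subseteq> S" using S by (auto simp: nbhd_def)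
  have "smooth_at ?c d f p" using chart_at[OF M p] d by (intro smooth_in_charts[OF M N f])
  with chart_at(3)[OF M p]
  obtain T where T: "open T" "snd ?c p \<in> T" "\<And>q. q \<in> fst ?c \<Longrightarrow> snd ?c q \<in> T \<Longrightarrow> f q \<in> fst d \<and> snd d (f q) \<in> UNIV"
    by (rule smooth_at_vimage[OF _ _ open_UNIV UNIV_I]) blast
  show ?thesis
  proof (rule nbhd_shrinkI[OF M chart_at(4,2)[OF M p] T(1,2)])
    fix q assume q: "q \<in> fst ?c" "snd ?c q \<in> T"
    then show "q \<in> {q \<in> points M. f q \<in> S}"
      using T(3)[OF q] d(3) smooth_manifoldD(5)[OF M chart_at(4)[OF M p]] by blast
  qed
qed

lemma nbhd_mono: "nbhd M p S \<Longrightarrow> S \<subseteq> T \<Longrightarrow> nbhd M p T"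
  unfolding nbhd_def by blast

lemma nbhd_mem: "nbhd M p S \<Longrightarrow> p \<in> S"
  by (auto simp: nbhd_def)

lemma openin_nbhd:
  assumes M: "smooth_manifold M" and S: "openin (manifold_topology M) S" "p \<in> S"
  shows "nbhd M p S"
proof -
  let ?c = "chart_at M p"
  have p: "p \<in> points M" using S by (auto simp: openin_manifold_topology)
  have "openin (top_of_set (chart_image ?c)) {z \<in> chart_image ?c. chart_inv ?c z \<in> S}"
    using S(1) chart_at(1)[OF M p] by (simp add: openin_manifold_topology)
  then obtain T where T: "open T" "{z \<in> chart_image ?c. chart_inv ?c z \<in> S} = chart_image ?c \<inter> T"
    by (auto simp: openin_open)
  have *: "q \<in> S \<longleftrightarrow> snd ?c q \<in> T" if "q \<in> fst ?c" for q
  proof -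
    have "snd ?c q \<in> {z \<in> chart_image ?c. chart_inv ?c z \<in> S} \<longleftrightarrow> snd ?c q \<in> chart_image ?c \<inter> T"
      by (simp only: T(2))
    then show ?thesis
      using chart_image_mem[OF that] chart_inv_snd[OF chart_at(3)[OF M p] that] by simp
  qed
  show ?thesis
    by (rule nbhd_shrinkI[OF M chart_at(4,2)[OF M p] T(1)]) (use * chart_at(2)[OF M p] S(2) in auto)
qed

lemma smooth_in_cong:
  assumes M: "smooth_manifold M" and N: "smooth_manifold N" and f: "smooth_in M N f p"
    and S: "nbhd M p S" "\<And>q. q \<in> S \<Longrightarrow> f q = g q"
  shows "smooth_in M N g p"
proof -
  obtain c d where cd: "c \<in> charts M" "d \<in> charts N" "smooth_at c d f p"
    by (rule smooth_inE[OF f])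
  have ic: "is_chart c" by (rule smooth_manifoldD(4)[OF M cd(1)])
  obtain T where T: "open T" "snd c p \<in> T" "\<And>q. q \<in> fst c \<Longrightarrow> snd c q \<in> T \<Longrightarrow> q \<in> S"
    by (rule nbhd_chart[OF M S(1) cd(1) smooth_at_mem(1)[OF cd(3)]]) blast
  have "smooth_at c d g p" by (rule smooth_at_cong[OF ic cd(3) T(1,2)]) (use T(3) S(2) in auto)
  then show ?thesis using cd by (intro smooth_inI)
qed

section \<open>Velocities of curves\<close>

text \<open>The filter \<open>nhds 0\<close> includes the parameter 0 itself, so the base point is
  forced to lie in the chart.\<close>

definition chart_velocity :: "('a, 'e::euclidean_space) chart \<Rightarrow> (real \<Rightarrow> 'a) \<Rightarrow> 'e \<Rightarrow> bool" where
  "chart_velocity c \<gamma> v \<longleftrightarrow> (\<forall>\<^sub>F r in nhds 0. \<gamma> r \<in> fst c) \<and>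
     ((\<lambda>r. snd c (\<gamma> r)) has_vector_derivative v) (at 0)"

definition velocity :: "('a, 'e::euclidean_space) manifold \<Rightarrow> (real \<Rightarrow> 'a) \<Rightarrow> 'e \<Rightarrow> bool" where
  "velocity M \<gamma> v \<longleftrightarrow> chart_velocity (chart_at M (\<gamma> 0)) \<gamma> v"

lemma chart_velocityI:
  assumes "\<forall>\<^sub>F r in nhds 0. \<gamma> r \<in> fst c" "(g has_vector_derivative v) (at 0)"
    "\<forall>\<^sub>F r in nhds 0. g r = snd c (\<gamma> r)"
  shows "chart_velocity c \<gamma> v"
  unfolding chart_velocity_def using assms(1) has_vector_derivative_eventually[OF assms(2,3)] ..

lemma chart_velocity_unique: "chart_velocity c \<gamma> v \<Longrightarrow> chart_velocity c \<gamma> w \<Longrightarrow> v = w"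
  unfolding chart_velocity_def using vector_derivative_unique_at by blast

lemma velocity_unique: "velocity M \<gamma> v \<Longrightarrow> velocity M \<gamma> w \<Longrightarrow> v = w"
  unfolding velocity_def by (rule chart_velocity_unique)

lemma chart_velocity_mem: "chart_velocity c \<gamma> v \<Longrightarrow> \<gamma> 0 \<in> fst c"
  unfolding chart_velocity_def by (blast dest: eventually_nhds_x_imp_x)

lemma chart_velocity_cong:
  assumes "chart_velocity c \<gamma> v" "\<forall>\<^sub>F r in nhds 0. \<gamma> r = \<gamma>' r"
  shows "chart_velocity c \<gamma>' v"
proof -
  have "\<forall>\<^sub>F r in nhds 0. \<gamma> r \<in> fst c" "((\<lambda>r. snd c (\<gamma> r)) has_vector_derivative v) (at 0)"
    using assms(1) by (auto simp: chart_velocity_def)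
  moreover have "\<forall>\<^sub>F r in nhds 0. \<gamma>' r \<in> fst c"
    using calculation(1) assms(2) by eventually_elim simp
  moreover have "\<forall>\<^sub>F r in nhds 0. snd c (\<gamma> r) = snd c (\<gamma>' r)"
    using assms(2) by eventually_elim simp
  ultimately show ?thesis by (intro chart_velocityI[where g = "\<lambda>r. snd c (\<gamma> r)"])
qed

lemma velocity_cong:
  assumes "velocity M \<gamma> v" "\<forall>\<^sub>F r in nhds 0. \<gamma> r = \<gamma>' r"
  shows "velocity M \<gamma>' v"
  using chart_velocity_cong[OF assms(1)[unfolded velocity_def] assms(2)] eventually_nhds_x_imp_x[OF assms(2)]
  by (simp add: velocity_def)

lemma chart_velocity_in_span:
  assumes "chart_velocity c \<gamma> v" shows "v \<in> span (chart_image c)"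
proof (rule has_vector_derivative_in_subspace[OF subspace_span])
  show "((\<lambda>r. snd c (\<gamma> r)) has_vector_derivative v) (at 0)" using assms by (simp add: chart_velocity_def)
  have "\<forall>\<^sub>F r in nhds 0. \<gamma> r \<in> fst c" using assms by (simp add: chart_velocity_def)
  then show "\<forall>\<^sub>F r in nhds 0. snd c (\<gamma> r) \<in> span (chart_image c)"
    by eventually_elim (auto intro: span_base chart_image_mem)
qed

lemma chart_velocity_of_coords:
  assumes c: "is_chart c" "p \<in> fst c" and \<gamma>: "(\<gamma> has_vector_derivative v) (at 0)" "\<gamma> 0 = snd c p"
    and ev: "\<forall>\<^sub>F r in nhds 0. \<gamma> r \<in> chart_image c"
  shows "chart_velocity c (\<lambda>r. chart_inv c (\<gamma> r)) v" "chart_inv c (\<gamma> 0) = p"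
proof -
  have "\<forall>\<^sub>F r in nhds 0. chart_inv c (\<gamma> r) \<in> fst c"
    using ev by eventually_elim (rule chart_inv_mem)
  moreover have "\<forall>\<^sub>F r in nhds 0. \<gamma> r = snd c (chart_inv c (\<gamma> r))"
    using ev by eventually_elim (simp add: snd_chart_inv)
  ultimately show "chart_velocity c (\<lambda>r. chart_inv c (\<gamma> r)) v"
    by (intro chart_velocityI[OF _ \<gamma>(1)])
  show "chart_inv c (\<gamma> 0) = p" using chart_inv_snd[OF c] \<gamma>(2) by simp
qed

lemma chart_velocity_line:
  assumes c: "is_chart c" "p \<in> fst c" and v: "v \<in> span (chart_image c)"
  shows "chart_velocity c (\<lambda>r. chart_inv c (snd c p + r *\<^sub>R v)) v"
proof (rule chart_velocity_of_coords[OF c])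
  show "((\<lambda>r. snd c p + r *\<^sub>R v) has_vector_derivative v) (at 0)"
    using has_vector_derivative_along_line[of "\<lambda>x. x" "\<lambda>x. x" "snd c p" v] by simp
  obtain T where T: "open T" "chart_image c = span (chart_image c) \<inter> T"
    by (rule chart_image_open[OF c])
  have p: "snd c p \<in> span (chart_image c)" "snd c p \<in> T"
    using chart_image_mem[OF c(2)] T(2) by (auto intro: span_base)
  have "\<forall>\<^sub>F r::real in nhds 0. snd c p + r *\<^sub>R v \<in> T" by (rule eventually_line_mem[OF T(1) p(2)])
  then show "\<forall>\<^sub>F r::real in nhds 0. snd c p + r *\<^sub>R v \<in> chart_image c"
  proof eventually_elim
    case (elim r)
    have "snd c p + r *\<^sub>R v \<in> span (chart_image c)" using p(1) v by (intro span_add span_mul)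
    then show ?case using elim T(2) by blast
  qed
qed simp

lemma chart_velocity_smooth_open:
  assumes F: "(F has_derivative F') (at (snd c (\<gamma> 0)))" and "chart_velocity c \<gamma> v"
  shows "((\<lambda>r. F (snd c (\<gamma> r))) has_vector_derivative F' v) (at 0)"
proof -
  have "((\<lambda>r. snd c (\<gamma> r)) has_derivative (\<lambda>r. r *\<^sub>R v)) (at 0)"
    using assms(2) by (simp add: chart_velocity_def has_vector_derivative_def)
  from has_derivative_compose[OF this F] show ?thesis
    using has_derivative_linear[OF F] by (simp add: has_vector_derivative_def linear_scale)
qed

lemma chart_velocity_eventually:
  assumes "chart_velocity c \<gamma> v" "open T" "snd c (\<gamma> 0) \<in> T"
  shows "\<forall>\<^sub>F r in nhds 0. \<gamma> r \<in> fst c \<and> snd c (\<gamma> r) \<in> T"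
proof -
  have "isCont (\<lambda>r. snd c (\<gamma> r)) 0"
    using assms(1) has_vector_derivative_continuous by (auto simp: chart_velocity_def)
  then have "((\<lambda>r. snd c (\<gamma> r)) \<longlongrightarrow> snd c (\<gamma> 0)) (nhds 0)"
    unfolding isCont_def tendsto_at_iff_tendsto_nhds[of "\<lambda>r. snd c (\<gamma> r)"] .
  then have "\<forall>\<^sub>F r in nhds 0. snd c (\<gamma> r) \<in> T" using assms(2,3) topological_tendstoD by blast
  moreover have "\<forall>\<^sub>F r in nhds 0. \<gamma> r \<in> fst c" using assms(1) by (simp add: chart_velocity_def)
  ultimately show ?thesis by eventually_elim simp
qed

text \<open>\<open>coord_deriv\<close> differentiates along a coordinate line, and this line is
  itself a curve of velocity v. The second claim is therefore the first one applied to it.\<close>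

lemma coordinate_expression_derivative:
  assumes c: "is_chart c" "p \<in> fst c" and F: "smooth_open T F" "snd c p \<in> T"
    "\<And>q. q \<in> fst c \<Longrightarrow> snd c q \<in> T \<Longrightarrow> f q \<in> fst d"
    "\<And>q. q \<in> fst c \<Longrightarrow> snd c q \<in> T \<Longrightarrow> F (snd c q) = snd d (f q)"
    and dF: "(F has_derivative F') (at (snd c p))"
  shows "\<gamma> 0 = p \<Longrightarrow> chart_velocity c \<gamma> v \<Longrightarrow> chart_velocity d (\<lambda>r. f (\<gamma> r)) (F' v)"
    and "v \<in> span (chart_image c) \<Longrightarrow> coord_deriv c d f p v = F' v"
proof -
  have T: "open T" using F(1) by (simp add: smooth_open_def)
  have *: "chart_velocity d (\<lambda>r. f (\<gamma> r)) (F' v)" if \<gamma>: "\<gamma> 0 = p" "chart_velocity c \<gamma> v" for \<gamma> v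
  proof -
    have ev: "\<forall>\<^sub>F r in nhds 0. \<gamma> r \<in> fst c \<and> snd c (\<gamma> r) \<in> T"
      using chart_velocity_eventually[OF \<gamma>(2) T] F(2) \<gamma>(1) by simp
    have "((\<lambda>r. F (snd c (\<gamma> r))) has_vector_derivative F' v) (at 0)"
      using chart_velocity_smooth_open[OF _ \<gamma>(2), of F F'] dF \<gamma>(1) by simp
    moreover have "\<forall>\<^sub>F r in nhds 0. F (snd c (\<gamma> r)) = snd d (f (\<gamma> r))"
      using ev by eventually_elim (use F in auto)
    moreover have "\<forall>\<^sub>F r in nhds 0. f (\<gamma> r) \<in> fst d"
      using ev by eventually_elim (use F in auto)
    ultimately show ?thesis by (intro chart_velocityI[where g = "\<lambda>r. F (snd c (\<gamma> r))"])
  qed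
  then show "\<gamma> 0 = p \<Longrightarrow> chart_velocity c \<gamma> v \<Longrightarrow> chart_velocity d (\<lambda>r. f (\<gamma> r)) (F' v)" .
  assume v: "v \<in> span (chart_image c)"
  have "chart_velocity d (\<lambda>r. f (chart_inv c (snd c p + r *\<^sub>R v))) (F' v)"
    by (rule *[OF _ chart_velocity_line[OF c v]]) (simp add: chart_inv_snd[OF c])
  then show "coord_deriv c d f p v = F' v"
    unfolding coord_deriv_def chart_velocity_def by (blast intro: vector_derivative_at)
qed

lemma smooth_at_derivative:
  assumes c: "is_chart c" and f: "smooth_at c d f p"
  obtains F' where "linear F'" "\<And>v. v \<in> span (chart_image c) \<Longrightarrow> coord_deriv c d f p v = F' v"
    "\<And>\<gamma> v. \<gamma> 0 = p \<Longrightarrow> chart_velocity c \<gamma> v \<Longrightarrow> chart_velocity d (\<lambda>r. f (\<gamma> r)) (F' v)"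
proof -
  obtain T F where F: "smooth_open T F" "snd c p \<in> T" "\<And>q. q \<in> fst c \<Longrightarrow> snd c q \<in> T \<Longrightarrow> f q \<in> fst d"
    "\<And>q. q \<in> fst c \<Longrightarrow> snd c q \<in> T \<Longrightarrow> F (snd c q) = snd d (f q)"
    by (rule smooth_atE_ext[OF c f]) blast
  have dF: "(F has_derivative frechet_derivative F (at (snd c p))) (at (snd c p))"
    by (rule smooth_open_has_derivative[OF F(1,2)])
  note * = coordinate_expression_derivative[OF c smooth_at_mem(1)[OF f] F dF]
  show thesis by (rule that[OF has_derivative_linear[OF dF] *(2) *(1)])
qed

lemma tangent_subspace: "subspace (tangent M p)"
  by (simp add: tangent_def)

lemma velocity_tangent: "velocity M \<gamma> v \<Longrightarrow> v \<in> tangent M (\<gamma> 0)"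
  unfolding velocity_def tangent_def by (rule chart_velocity_in_span)

lemma tangent_velocity:
  assumes "smooth_manifold M" "p \<in> points M" "v \<in> tangent M p"
  obtains \<gamma> where "\<gamma> 0 = p" "velocity M \<gamma> v"
proof -
  let ?c = "chart_at M p"
  let ?\<gamma> = "\<lambda>r. chart_inv ?c (snd ?c p + r *\<^sub>R v)"
  have "?\<gamma> 0 = p" using chart_inv_snd[OF chart_at(3,2)[OF assms(1,2)]] by simp
  moreover have "chart_velocity ?c ?\<gamma> v"
    using chart_velocity_line[OF chart_at(3,2)[OF assms(1,2)]] assms(3) by (simp add: tangent_def)
  ultimately show thesis using that[of ?\<gamma>] by (simp add: velocity_def)
qed

lemma velocity_const:
  assumes "smooth_manifold M" "p \<in> points M" shows "velocity M (\<lambda>r. p) 0"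
  using chart_at[OF assms] by (simp add: velocity_def chart_velocity_def)

lemma velocity_eventually:
  assumes M: "smooth_manifold M" and "velocity M \<gamma> v" "nbhd M (\<gamma> 0) S"
  shows "\<forall>\<^sub>F r in nhds 0. \<gamma> r \<in> S"
proof -
  let ?c = "chart_at M (\<gamma> 0)"
  have "\<gamma> 0 \<in> points M" using assms(3) smooth_manifoldD(5)[OF M] by (auto simp: nbhd_def)
  from chart_at(4,2)[OF M this] obtain T where T: "open T" "snd ?c (\<gamma> 0) \<in> T"
    "\<And>q. q \<in> fst ?c \<Longrightarrow> snd ?c q \<in> T \<Longrightarrow> q \<in> S"
    by (rule nbhd_chart[OF M assms(3)]) blast
  have "\<forall>\<^sub>F r in nhds 0. \<gamma> r \<in> fst ?c \<and> snd ?c (\<gamma> r) \<in> T"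
    by (rule chart_velocity_eventually[OF assms(2)[unfolded velocity_def] T(1,2)])
  then show ?thesis by eventually_elim (use T(3) in blast)
qed

lemma velocity_points:
  assumes "smooth_manifold M" "velocity M \<gamma> v" "\<gamma> 0 \<in> points M"
  shows "\<forall>\<^sub>F r in nhds 0. \<gamma> r \<in> points M"
  by (rule velocity_eventually[OF assms(1,2)])
    (use chart_at[OF assms(1,3)] smooth_manifoldD(5)[OF assms(1)] in \<open>auto simp: nbhd_def\<close>)

text \<open>\<open>differential\<close> is meaningful on the tangent space only. Replacing it by a
  linear map of the whole ambient space makes the library facts on linear maps and dimensions
  applicable.\<close>

lemma smooth_in_differential:
  assumes M: "smooth_manifold M" and N: "smooth_manifold N" and f: "smooth_in M N f p"
  obtains F' where "linear F'" "\<And>v. v \<in> tangent M p \<Longrightarrow> differential M N f p v = F' v"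
    "\<And>\<gamma> v. \<gamma> 0 = p \<Longrightarrow> velocity M \<gamma> v \<Longrightarrow> velocity N (\<lambda>r. f (\<gamma> r)) (F' v)"
proof -
  have mem: "p \<in> points M" "f p \<in> points N" using smooth_in_mem[OF M N f] by auto
  have "smooth_at (chart_at M p) (chart_at N (f p)) f p"
    using chart_at[OF M mem(1)] chart_at[OF N mem(2)] by (intro smooth_in_charts[OF M N f])
  then obtain F' where "linear F'"
    "\<And>v. v \<in> span (chart_image (chart_at M p)) \<Longrightarrow> coord_deriv (chart_at M p) (chart_at N (f p)) f p v = F' v"
    "\<And>\<gamma> v. \<gamma> 0 = p \<Longrightarrow> chart_velocity (chart_at M p) \<gamma> v \<Longrightarrow> chart_velocity (chart_at N (f p)) (\<lambda>r. f (\<gamma> r)) (F' v)"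
    by (rule smooth_at_derivative[OF chart_at(3)[OF M mem(1)]]) blast
  then show thesis using that[of F'] by (simp add: differential_def tangent_def velocity_def)
qed

lemma velocity_differential:
  assumes M: "smooth_manifold M" and N: "smooth_manifold N" and f: "smooth_in M N f p"
    and \<gamma>: "velocity M \<gamma> v" "\<gamma> 0 = p"
  shows "velocity N (\<lambda>r. f (\<gamma> r)) (differential M N f p v)"
proof -
  have "v \<in> tangent M p" using velocity_tangent[OF \<gamma>(1)] \<gamma>(2) by simp
  obtain F' where "\<And>v. v \<in> tangent M p \<Longrightarrow> differential M N f p v = F' v"
    "\<And>\<gamma> v. \<gamma> 0 = p \<Longrightarrow> velocity M \<gamma> v \<Longrightarrow> velocity N (\<lambda>r. f (\<gamma> r)) (F' v)"
    by (rule smooth_in_differential[OF M N f]) blast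
  then show ?thesis using \<gamma> \<open>v \<in> tangent M p\<close> by simp
qed

text \<open>The way in which all differentials are computed below: any convenient curve with
  velocity v may be used.\<close>

lemma differential_eqI:
  assumes "smooth_manifold M" "smooth_manifold N" "smooth_in M N f p"
    and "velocity M \<gamma> v" "\<gamma> 0 = p" "velocity N (\<lambda>r. f (\<gamma> r)) w"
  shows "differential M N f p v = w"
  using velocity_unique[OF velocity_differential[OF assms(1-5)] assms(6)] .

lemma linear_between_differential:
  assumes "smooth_manifold M" "smooth_manifold N" "smooth_in M N f p"
  shows "linear_between (tangent M p) (tangent N (f p)) (differential M N f p)"
proof -
  obtain F' where F': "linear F'" "\<And>v. v \<in> tangent M p \<Longrightarrow> differential M N f p v = F' v"
    by (rule smooth_in_differential[OF assms]) blast
  have "differential M N f p v \<in> tangent N (f p)" if v: "v \<in> tangent M p" for v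
  proof -
    obtain \<gamma> where "\<gamma> 0 = p" "velocity M \<gamma> v"
      by (rule tangent_velocity[OF assms(1) smooth_in_mem(1)[OF assms] v])
    then show ?thesis using velocity_tangent[OF velocity_differential[OF assms]] by fastforce
  qed
  then show ?thesis
    using F' subspace_add[OF tangent_subspace[of M p]] subspace_mul[OF tangent_subspace[of M p]]
    unfolding linear_between_def by (intro conjI image_subsetI ballI allI) (simp_all add: linear_add linear_scale)
qed

text \<open>Injectivity on the model subspace comes from the reverse change of charts, which undoes
  F' on the velocity of a coordinate line.\<close>

lemma chart_velocity_change:
  assumes M: "smooth_manifold M" and c: "c \<in> charts M" "d \<in> charts M" "p \<in> fst c" "p \<in> fst d"
  obtains F' where "linear F'" "\<And>\<gamma> v. \<gamma> 0 = p \<Longrightarrow> chart_velocity c \<gamma> v \<Longrightarrow> chart_velocity d \<gamma> (F' v)"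
    "\<And>v. v \<in> span (chart_image c) \<Longrightarrow> F' v = 0 \<Longrightarrow> v = 0"
proof -
  have ic: "is_chart c" "is_chart d" using smooth_manifoldD[OF M] c by auto
  obtain F' where F': "linear F'" "\<And>\<gamma> v. \<gamma> 0 = p \<Longrightarrow> chart_velocity c \<gamma> v \<Longrightarrow> chart_velocity d (\<lambda>r. \<gamma> r) (F' v)"
    by (rule smooth_at_derivative[OF ic(1) chart_change[OF M c(1,2,3,4)]]) blast
  obtain G' where G': "linear G'" "\<And>\<gamma> v. \<gamma> 0 = p \<Longrightarrow> chart_velocity d \<gamma> v \<Longrightarrow> chart_velocity c (\<lambda>r. \<gamma> r) (G' v)"
    by (rule smooth_at_derivative[OF ic(2) chart_change[OF M c(2,1,4,3)]]) blast
  have "v = 0" if v: "v \<in> span (chart_image c)" "F' v = 0" for v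
  proof -
    let ?\<gamma> = "\<lambda>r. chart_inv c (snd c p + r *\<^sub>R v)"
    have 0: "?\<gamma> 0 = p" using chart_inv_snd[OF ic(1) c(3)] by simp
    have *: "chart_velocity c ?\<gamma> v" by (rule chart_velocity_line[OF ic(1) c(3) v(1)])
    have "chart_velocity c ?\<gamma> (G' (F' v))" using G'(2)[OF 0 F'(2)[OF 0 *]] .
    then show ?thesis using chart_velocity_unique[OF *] v(2) linear_0[OF G'(1)] by simp
  qed
  then show thesis using that F' by simp
qed

text \<open>The coordinates of the velocity in the chosen chart are not explicit. Only whether it
  vanishes is recorded; the vector itself is later reached through differentials of inclusions and
  projections.\<close>

lemma chart_velocity_imp_velocity:
  assumes M: "smooth_manifold M" and "c \<in> charts M" "chart_velocity c \<gamma> v"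
  obtains w where "velocity M \<gamma> w" "w = 0 \<longleftrightarrow> v = 0"
proof -
  have mem: "\<gamma> 0 \<in> fst c" by (rule chart_velocity_mem[OF assms(3)])
  then have "\<gamma> 0 \<in> points M" using smooth_manifoldD(5)[OF M assms(2)] by blast
  from mem chart_at(2)[OF M this]
  obtain F' where "linear F'" "\<And>\<gamma>' v. \<gamma>' 0 = \<gamma> 0 \<Longrightarrow> chart_velocity c \<gamma>' v \<Longrightarrow> chart_velocity (chart_at M (\<gamma> 0)) \<gamma>' (F' v)"
    "\<And>v. v \<in> span (chart_image c) \<Longrightarrow> F' v = 0 \<Longrightarrow> v = 0"
    by (rule chart_velocity_change[OF M assms(2) chart_at(4)[OF M \<open>\<gamma> 0 \<in> points M\<close>]]) blast
  then show thesis
    using that[of "F' v"] chart_velocity_in_span[OF assms(3)] assms(3) linear_0[of F'] by (auto simp: velocity_def)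
qed

section \<open>Embedded submanifolds\<close>

definition embedded :: "('a, 'e::euclidean_space) manifold \<Rightarrow> 'a set \<Rightarrow> bool" where
  "embedded M A \<longleftrightarrow> A \<subseteq> points M \<and> (\<forall>a\<in>A. \<exists>c\<in>charts M. a \<in> fst c \<and>
     (\<exists>W. subspace W \<and> snd c ` (fst c \<inter> A) = chart_image c \<inter> W))"

lemma points_submanifold [simp]: "points (submanifold M A) = A"
  by (simp add: submanifold_def)

lemma slice_is_chart:
  assumes "is_chart c" "subspace W" "snd c ` (fst c \<inter> A) = chart_image c \<inter> W"
  shows "is_chart (fst c \<inter> A, snd c)"
  by (rule is_chart_subset[OF assms(1,2) open_UNIV]) (use assms(3) in auto)

lemma atlas_submanifoldE:
  assumes "k \<in> atlas (submanifold M A)"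
  obtains c W where "k = (fst c \<inter> A, snd c)" "c \<in> charts M" "subspace W"
    "snd c ` (fst c \<inter> A) = chart_image c \<inter> W"
proof -
  have "\<exists>c. k = (fst c \<inter> A, snd c) \<and> c \<in> charts M \<and>
      (\<exists>W. subspace W \<and> snd c ` (fst c \<inter> A) = chart_image c \<inter> W)"
    using assms unfolding submanifold_def manifold.simps mem_Collect_eq .
  then show thesis using that by (elim exE conjE)
qed

lemma slice_atlas:
  assumes "c \<in> charts M" "subspace W" "snd c ` (fst c \<inter> A) = chart_image c \<inter> W"
  shows "(fst c \<inter> A, snd c) \<in> atlas (submanifold M A)"
  unfolding submanifold_def manifold.simps mem_Collect_eq using assms
  by (intro exI[of _ c] conjI exI[of _ W]) simp_all

lemma smooth_at_slices:
  assumes "smooth_manifold M" "c \<in> charts M" "d \<in> charts M" "is_chart (fst c \<inter> A, snd c)" "q \<in> fst c" "q \<in> fst d" "q \<in> A"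
  shows "smooth_at (fst c \<inter> A, snd c) (fst d \<inter> A, snd d) (\<lambda>x. x) q"
proof -
  have "smooth_at (fst c \<inter> A, snd c) d (\<lambda>x. x) q"
    by (rule smooth_at_restrict_source[OF smooth_manifoldD(4)[OF assms(1,2)] assms(4) _
        chart_change[OF assms(1,2,3,5,6)]]) (use assms in auto)
  then show ?thesis
    by (rule smooth_at_restrict_target[OF assms(4) _ open_UNIV]) auto
qed

lemma smooth_manifold_submanifold:
  assumes M: "smooth_manifold M" and A: "embedded M A"
  shows "smooth_manifold (submanifold M A)"
  unfolding smooth_manifold_def
proof (intro conjI ballI)
  fix k assume k: "k \<in> atlas (submanifold M A)"
  obtain c W where c: "k = (fst c \<inter> A, snd c)" "c \<in> charts M" "subspace W"
    "snd c ` (fst c \<inter> A) = chart_image c \<inter> W" by (rule atlas_submanifoldE[OF k])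
  show "fst k \<subseteq> points (submanifold M A)" by (simp add: c(1))
  show ick: "is_chart k"
    unfolding c(1) by (rule slice_is_chart[OF smooth_manifoldD(4)[OF M c(2)] c(3,4)])
  fix k' assume k': "k' \<in> atlas (submanifold M A)"
  obtain d W' where d: "k' = (fst d \<inter> A, snd d)" "d \<in> charts M" "subspace W'"
    "snd d ` (fst d \<inter> A) = chart_image d \<inter> W'" by (rule atlas_submanifoldE[OF k'])
  have ick': "is_chart k'"
    unfolding d(1) by (rule slice_is_chart[OF smooth_manifoldD(4)[OF M d(2)] d(3,4)])
  show "compatible_charts k k'"
    unfolding compatible_charts_iff[OF ick ick']
  proof
    fix q assume "q \<in> fst k \<inter> fst k'"
    then have q: "q \<in> fst c" "q \<in> fst d" "q \<in> A" by (simp_all add: c(1) d(1))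
    show "smooth_at k k' (\<lambda>x. x) q \<and> smooth_at k' k (\<lambda>x. x) q"
      using smooth_at_slices[OF M c(2) d(2) ick[unfolded c(1)] q]
        smooth_at_slices[OF M d(2) c(2) ick'[unfolded d(1)] q(2,1,3)]
      unfolding c(1) d(1) ..
  qed
next
  show "(\<Union>c\<in>atlas (submanifold M A). fst c) = points (submanifold M A)"
  proof
    show "(\<Union>c\<in>atlas (submanifold M A). fst c) \<subseteq> points (submanifold M A)"
      by (auto simp: submanifold_def)
    show "points (submanifold M A) \<subseteq> (\<Union>c\<in>atlas (submanifold M A). fst c)"
    proof
      fix a assume "a \<in> points (submanifold M A)"
      then have a: "a \<in> A" by simp
      then have "\<exists>c\<in>charts M. a \<in> fst c \<and> (\<exists>W. subspace W \<and> snd c ` (fst c \<inter> A) = chart_image c \<inter> W)"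
        using A unfolding embedded_def by simp
      then obtain c W where c: "c \<in> charts M" "a \<in> fst c" "subspace W" "snd c ` (fst c \<inter> A) = chart_image c \<inter> W"
        by (elim bexE conjE exE)
      have "(fst c \<inter> A, snd c) \<in> atlas (submanifold M A)" by (rule slice_atlas[OF c(1,3,4)])
      moreover have "a \<in> fst (fst c \<inter> A, snd c)" using a c(2) by simp
      ultimately show "a \<in> (\<Union>c\<in>atlas (submanifold M A). fst c)" by blast
    qed
  qed
qed

lemma embedded_slice:
  assumes M: "smooth_manifold M" and A: "embedded M A" and a: "a \<in> A"
  obtains c where "c \<in> charts M" "a \<in> fst c" "is_chart c" "is_chart (fst c \<inter> A, snd c)"
    "(fst c \<inter> A, snd c) \<in> charts (submanifold M A)"
proof -
  have "\<exists>c\<in>charts M. a \<in> fst c \<and> (\<exists>W. subspace W \<and> snd c ` (fst c \<inter> A) = chart_image c \<inter> W)"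
    using A a unfolding embedded_def by simp
  then obtain c W where c: "c \<in> charts M" "a \<in> fst c" "subspace W" "snd c ` (fst c \<inter> A) = chart_image c \<inter> W"
    by (elim bexE conjE exE)
  have "(fst c \<inter> A, snd c) \<in> atlas (submanifold M A)" by (rule slice_atlas[OF c(1,3,4)])
  then have sub: "(fst c \<inter> A, snd c) \<in> charts (submanifold M A)"
    by (rule smooth_manifoldD(3)[OF smooth_manifold_submanifold[OF M A]])
  have ic: "is_chart c" by (rule smooth_manifoldD(4)[OF M c(1)])
  show thesis by (rule that[OF c(1,2) ic slice_is_chart[OF ic c(3,4)] sub])
qed

lemma smooth_in_inclusion:
  assumes M: "smooth_manifold M" and A: "embedded M A" and a: "a \<in> A"
  shows "smooth_in (submanifold M A) M (\<lambda>x. x) a"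
proof -
  obtain c where c: "c \<in> charts M" "a \<in> fst c" "is_chart c" "is_chart (fst c \<inter> A, snd c)"
    "(fst c \<inter> A, snd c) \<in> charts (submanifold M A)" by (rule embedded_slice[OF assms])
  have "smooth_at (fst c \<inter> A, snd c) c (\<lambda>x. x) a"
    by (rule smooth_at_restrict_source[OF c(3,4) _ smooth_at_id[OF c(3,2)]]) (use a c(2) in auto)
  then show ?thesis by (rule smooth_inI[OF c(5,1)])
qed

lemma smooth_in_submanifold:
  assumes M: "smooth_manifold M" and A: "embedded M A" and K: "smooth_manifold K"
    and f: "smooth_in K M f p" and S: "nbhd K p S" "\<And>q. q \<in> S \<Longrightarrow> f q \<in> A"
  shows "smooth_in K (submanifold M A) f p"
proof -
  have "f p \<in> A" by (rule S(2)[OF nbhd_mem[OF S(1)]])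
  from embedded_slice[OF M A this]
  obtain c where c: "c \<in> charts M" "f p \<in> fst c" "is_chart c" "is_chart (fst c \<inter> A, snd c)"
    "(fst c \<inter> A, snd c) \<in> charts (submanifold M A)" .
  have p: "p \<in> points K" by (rule smooth_in_mem[OF K M f])
  note k = chart_at[OF K p]
  have f': "smooth_at (chart_at K p) c f p" by (rule smooth_in_charts[OF K M f k(4,2) c(1,2)])
  obtain T where T: "open T" "snd (chart_at K p) p \<in> T"
    "\<And>q. q \<in> fst (chart_at K p) \<Longrightarrow> snd (chart_at K p) q \<in> T \<Longrightarrow> q \<in> S"
    by (rule nbhd_chart[OF K S(1) k(4,2)]) blast
  have "smooth_at (chart_at K p) (fst c \<inter> A, snd c) f p"
    by (rule smooth_at_restrict_target[OF k(3) f' T(1,2)]) (rule S(2)[OF T(3)])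
  then show ?thesis by (rule smooth_inI[OF k(4) c(5)])
qed

text \<open>A slice chart of the submanifold has the same coordinate map as the chart it comes from,
  so a curve inside \<open>A\<close> has the same coordinate velocity in both.\<close>

lemma velocity_submanifold:
  assumes M: "smooth_manifold M" and A: "embedded M A" and \<gamma>: "velocity M \<gamma> v" "\<forall>\<^sub>F r in nhds 0. \<gamma> r \<in> A"
  obtains w where "velocity (submanifold M A) \<gamma> w" "differential (submanifold M A) M (\<lambda>x. x) (\<gamma> 0) w = v"
    "w = 0 \<longleftrightarrow> v = 0"
proof -
  note N = smooth_manifold_submanifold[OF M A]
  have a: "\<gamma> 0 \<in> A" using \<gamma>(2) by (rule eventually_nhds_x_imp_x)
  obtain c where c: "c \<in> charts M" "\<gamma> 0 \<in> fst c" "is_chart c" "is_chart (fst c \<inter> A, snd c)"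
    "(fst c \<inter> A, snd c) \<in> charts (submanifold M A)" by (rule embedded_slice[OF M A a])
  have p: "\<gamma> 0 \<in> points M" using a A by (auto simp: embedded_def)
  note k = chart_at[OF M p]
  obtain F' where F': "linear F'"
    "\<And>\<gamma>' v. \<gamma>' 0 = \<gamma> 0 \<Longrightarrow> chart_velocity (chart_at M (\<gamma> 0)) \<gamma>' v \<Longrightarrow> chart_velocity c \<gamma>' (F' v)"
    "\<And>v. v \<in> span (chart_image (chart_at M (\<gamma> 0))) \<Longrightarrow> F' v = 0 \<Longrightarrow> v = 0"
    by (rule chart_velocity_change[OF M k(4) c(1) k(2) c(2)]) blast
  have v: "v \<in> span (chart_image (chart_at M (\<gamma> 0)))"
    using velocity_tangent[OF \<gamma>(1)] by (simp add: tangent_def)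
  have 1: "chart_velocity c \<gamma> (F' v)" using F'(2)[of \<gamma> v] \<gamma>(1) by (simp add: velocity_def)
  have "\<forall>\<^sub>F r in nhds 0. \<gamma> r \<in> fst c" using 1 by (simp add: chart_velocity_def)
  then have "\<forall>\<^sub>F r in nhds 0. \<gamma> r \<in> fst (fst c \<inter> A, snd c)" using \<gamma>(2) by eventually_elim simp
  then have "chart_velocity (fst c \<inter> A, snd c) \<gamma> (F' v)" using 1 by (simp add: chart_velocity_def)
  then obtain w where w: "velocity (submanifold M A) \<gamma> w" "w = 0 \<longleftrightarrow> F' v = 0"
    by (rule chart_velocity_imp_velocity[OF N c(5)])
  have "differential (submanifold M A) M (\<lambda>x. x) (\<gamma> 0) w = v"
    by (rule differential_eqI[OF N M smooth_in_inclusion[OF M A a] w(1) refl \<gamma>(1)])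
  moreover have "w = 0 \<longleftrightarrow> v = 0" using w(2) F'(3)[OF v] linear_0[OF F'(1)] by blast
  ultimately show thesis using that w(1) by blast
qed

lemma velocity_submanifoldD:
  assumes M: "smooth_manifold M" and A: "embedded M A" and \<gamma>: "velocity (submanifold M A) \<gamma> w" "\<gamma> 0 \<in> A"
  shows "velocity M \<gamma> (differential (submanifold M A) M (\<lambda>x. x) (\<gamma> 0) w)" "\<forall>\<^sub>F r in nhds 0. \<gamma> r \<in> A"
  using velocity_differential[OF smooth_manifold_submanifold[OF M A] M smooth_in_inclusion[OF M A \<gamma>(2)] \<gamma>(1) refl]
    velocity_points[OF smooth_manifold_submanifold[OF M A] \<gamma>(1)] \<gamma>(2) by simp_all

section \<open>Products\<close>

definition prod_chart ::
  "('a, 'e) chart \<Rightarrow> ('b, 'f) chart \<Rightarrow> ('a \<times> 'b, 'e \<times> 'f) chart" where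
  "prod_chart c d = (fst c \<times> fst d, map_prod (snd c) (snd d))"

lemma fst_prod_chart: "fst (prod_chart c d) = fst c \<times> fst d"
  by (simp add: prod_chart_def)

lemma snd_prod_chart: "snd (prod_chart c d) pq = (snd c (fst pq), snd d (snd pq))"
  by (cases pq) (simp add: prod_chart_def)

lemma chart_image_prod_chart: "chart_image (prod_chart c d) = chart_image c \<times> chart_image d"
  by (simp add: chart_image_def prod_chart_def map_prod_surj_on)

lemma is_chart_prod_chart:
  assumes "is_chart c" "is_chart d" shows "is_chart (prod_chart c d)"
proof -
  obtain V W where V: "subspace V" "openin (top_of_set V) (chart_image c)"
    and W: "subspace W" "openin (top_of_set W) (chart_image d)"
    using assms by (auto simp: is_chart_def)
  have "openin (top_of_set (V \<times> W)) (chart_image (prod_chart c d))"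
    unfolding chart_image_prod_chart using V(2) W(2) by (rule openin_Times)
  moreover have "subspace (V \<times> W)" using V(1) W(1) by (rule subspace_Times)
  moreover have "inj_on (snd (prod_chart c d)) (fst (prod_chart c d))"
    using assms by (auto simp: is_chart_def inj_on_def prod_chart_def)
  ultimately show ?thesis unfolding is_chart_def by blast
qed

lemma smooth_at_fst:
  assumes "is_chart c" "is_chart d" "p \<in> fst c" "q \<in> fst d"
  shows "smooth_at (prod_chart c d) c fst (p, q)"
  by (rule smooth_atI_ext[OF is_chart_prod_chart[OF assms(1,2)] _ smooth_open_linear[OF linear_fst open_UNIV]])
    (use assms in \<open>auto simp: fst_prod_chart snd_prod_chart\<close>)

lemma smooth_at_snd:
  assumes "is_chart c" "is_chart d" "p \<in> fst c" "q \<in> fst d"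
  shows "smooth_at (prod_chart c d) d snd (p, q)"
  by (rule smooth_atI_ext[OF is_chart_prod_chart[OF assms(1,2)] _ smooth_open_linear[OF linear_snd open_UNIV]])
    (use assms in \<open>auto simp: fst_prod_chart snd_prod_chart\<close>)

lemma smooth_at_Pair:
  assumes e: "is_chart e" and f: "smooth_at e c f p" and g: "smooth_at e d g p"
  shows "smooth_at e (prod_chart c d) (\<lambda>x. (f x, g x)) p"
proof -
  obtain T F where F: "smooth_open T F" "snd e p \<in> T" "\<And>q. q \<in> fst e \<Longrightarrow> snd e q \<in> T \<Longrightarrow> f q \<in> fst c"
    "\<And>q. q \<in> fst e \<Longrightarrow> snd e q \<in> T \<Longrightarrow> F (snd e q) = snd c (f q)"
    by (rule smooth_atE_ext[OF e f]) blast
  obtain U G where G: "smooth_open U G" "snd e p \<in> U" "\<And>q. q \<in> fst e \<Longrightarrow> snd e q \<in> U \<Longrightarrow> g q \<in> fst d"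
    "\<And>q. q \<in> fst e \<Longrightarrow> snd e q \<in> U \<Longrightarrow> G (snd e q) = snd d (g q)"
    by (rule smooth_atE_ext[OF e g]) blast
  have TU: "open (T \<inter> U)" using F(1) G(1) by (auto simp: smooth_open_def)
  have "smooth_open (T \<inter> U) (\<lambda>z. (F z, G z))"
    by (intro smooth_open_Pair smooth_open_subset[OF F(1) TU] smooth_open_subset[OF G(1) TU]) auto
  then show ?thesis
    by (rule smooth_atI_ext[OF e smooth_at_mem(1)[OF f]])
      (use F G in \<open>auto simp: fst_prod_chart snd_prod_chart\<close>)
qed

lemma points_prod_manifold [simp]: "points (prod_manifold M N) = points M \<times> points N"
  by (simp add: prod_manifold_def)

lemma atlas_prod_manifoldE:
  assumes "k \<in> atlas (prod_manifold M N)"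
  obtains c d where "k = prod_chart c d" "c \<in> atlas M" "d \<in> atlas N"
proof -
  have "\<exists>c d. k = prod_chart c d \<and> c \<in> atlas M \<and> d \<in> atlas N"
    using assms unfolding prod_manifold_def prod_chart_def manifold.simps mem_Collect_eq .
  then show thesis using that by (elim exE conjE)
qed

lemma prod_chart_atlas: "c \<in> atlas M \<Longrightarrow> d \<in> atlas N \<Longrightarrow> prod_chart c d \<in> atlas (prod_manifold M N)"
  unfolding prod_manifold_def prod_chart_def manifold.simps mem_Collect_eq by (intro exI conjI) simp_all

lemma smooth_manifold_prod:
  assumes M: "smooth_manifold M" and N: "smooth_manifold N"
  shows "smooth_manifold (prod_manifold M N)"
  unfolding smooth_manifold_def
proof (intro conjI ballI)
  fix k assume k: "k \<in> atlas (prod_manifold M N)"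
  obtain c d where c: "k = prod_chart c d" "c \<in> atlas M" "d \<in> atlas N" by (rule atlas_prod_manifoldE[OF k])
  note cd = smooth_manifoldD(1,2,3)[OF M c(2)] smooth_manifoldD(1,2,3)[OF N c(3)]
  show "fst k \<subseteq> points (prod_manifold M N)" using cd by (auto simp: c(1) fst_prod_chart)
  show ick: "is_chart k" unfolding c(1) using cd by (intro is_chart_prod_chart)
  fix k' assume k': "k' \<in> atlas (prod_manifold M N)"
  obtain c' d' where c': "k' = prod_chart c' d'" "c' \<in> atlas M" "d' \<in> atlas N" by (rule atlas_prod_manifoldE[OF k'])
  note cd' = smooth_manifoldD(1,2,3)[OF M c'(2)] smooth_manifoldD(1,2,3)[OF N c'(3)]
  have ick': "is_chart k'" unfolding c'(1) using cd' by (intro is_chart_prod_chart)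
  have *: "smooth_at (prod_chart c d) (prod_chart c' d') (\<lambda>x. x) (p, q)"
    if "c \<in> charts M" "d \<in> charts N" "c' \<in> charts M" "d' \<in> charts N" "p \<in> fst c" "p \<in> fst c'" "q \<in> fst d" "q \<in> fst d'"
    for c c' :: "('a, 'b) chart" and d d' :: "('c, 'd) chart" and p q
  proof -
    have ic: "is_chart c" "is_chart d" "is_chart c'" "is_chart d'"
      using smooth_manifoldD(4)[OF M] smooth_manifoldD(4)[OF N] that(1-4) by blast+
    have 1: "smooth_at (prod_chart c d) c' (\<lambda>x. fst x) (p, q)"
      using smooth_at_compose[OF is_chart_prod_chart[OF ic(1,2)] ic(1) smooth_at_fst[OF ic(1,2) that(5,7)], of c' "\<lambda>x. x"]
        chart_change[OF M that(1,3,5,6)] by simp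
    have 2: "smooth_at (prod_chart c d) d' (\<lambda>x. snd x) (p, q)"
      using smooth_at_compose[OF is_chart_prod_chart[OF ic(1,2)] ic(2) smooth_at_snd[OF ic(1,2) that(5,7)], of d' "\<lambda>x. x"]
        chart_change[OF N that(2,4,7,8)] by simp
    show ?thesis using smooth_at_Pair[OF is_chart_prod_chart[OF ic(1,2)] 1 2] by simp
  qed
  show "compatible_charts k k'"
    unfolding compatible_charts_iff[OF ick ick']
  proof
    fix pq assume "pq \<in> fst k \<inter> fst k'"
    then obtain p q where pq: "pq = (p, q)" "p \<in> fst c" "p \<in> fst c'" "q \<in> fst d" "q \<in> fst d'"
      by (cases pq) (simp add: c(1) c'(1) fst_prod_chart)
    show "smooth_at k k' (\<lambda>x. x) pq \<and> smooth_at k' k (\<lambda>x. x) pq"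
      unfolding c(1) c'(1) pq(1) using * cd cd' pq by blast
  qed
next
  show "(\<Union>c\<in>atlas (prod_manifold M N). fst c) = points (prod_manifold M N)"
  proof
    show "(\<Union>c\<in>atlas (prod_manifold M N). fst c) \<subseteq> points (prod_manifold M N)"
    proof
      fix x assume "x \<in> (\<Union>c\<in>atlas (prod_manifold M N). fst c)"
      then obtain k where k: "k \<in> atlas (prod_manifold M N)" "x \<in> fst k" by blast
      obtain c d where "k = prod_chart c d" "c \<in> atlas M" "d \<in> atlas N" by (rule atlas_prod_manifoldE[OF k(1)])
      then show "x \<in> points (prod_manifold M N)"
        using k(2) smooth_manifoldD(2)[OF M, of c] smooth_manifoldD(2)[OF N, of d]
        by (cases x) (auto simp: fst_prod_chart)
    qed
    show "points (prod_manifold M N) \<subseteq> (\<Union>c\<in>atlas (prod_manifold M N). fst c)"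
    proof
      fix x assume "x \<in> points (prod_manifold M N)"
      then have "x \<in> fst (prod_chart (chart_at M (fst x)) (chart_at N (snd x)))"
        "prod_chart (chart_at M (fst x)) (chart_at N (snd x)) \<in> atlas (prod_manifold M N)"
        using chart_at(1,2)[OF M, of "fst x"] chart_at(1,2)[OF N, of "snd x"]
        by (cases x; simp add: fst_prod_chart prod_chart_atlas)+
      then show "x \<in> (\<Union>c\<in>atlas (prod_manifold M N). fst c)" by blast
    qed
  qed
qed

lemma prod_chart_charts:
  assumes "smooth_manifold M" "smooth_manifold N" "c \<in> atlas M" "d \<in> atlas N"
  shows "prod_chart c d \<in> charts (prod_manifold M N)"
  by (rule smooth_manifoldD(3)[OF smooth_manifold_prod[OF assms(1,2)] prod_chart_atlas[OF assms(3,4)]])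

lemma smooth_in_fst:
  assumes "smooth_manifold M" "smooth_manifold N" "p \<in> points M" "q \<in> points N"
  shows "smooth_in (prod_manifold M N) M fst (p, q)"
  using chart_at[OF assms(1,3)] chart_at[OF assms(2,4)]
  by (intro smooth_inI[OF prod_chart_charts[OF assms(1,2)] _ smooth_at_fst])

lemma smooth_in_snd:
  assumes "smooth_manifold M" "smooth_manifold N" "p \<in> points M" "q \<in> points N"
  shows "smooth_in (prod_manifold M N) N snd (p, q)"
  using chart_at[OF assms(1,3)] chart_at[OF assms(2,4)]
  by (intro smooth_inI[OF prod_chart_charts[OF assms(1,2)] _ smooth_at_snd])

lemma smooth_in_Pair:
  assumes K: "smooth_manifold K" and M: "smooth_manifold M" and N: "smooth_manifold N"
    and f: "smooth_in K M f p" and g: "smooth_in K N g p"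
  shows "smooth_in K (prod_manifold M N) (\<lambda>x. (f x, g x)) p"
proof -
  have mem: "p \<in> points K" "f p \<in> points M" "g p \<in> points N"
    using smooth_in_mem[OF K M f] smooth_in_mem[OF K N g] by auto
  note k = chart_at[OF K mem(1)] and c = chart_at[OF M mem(2)] and d = chart_at[OF N mem(3)]
  show ?thesis
    by (rule smooth_inI[OF k(4) prod_chart_charts[OF M N c(1) d(1)]
        smooth_at_Pair[OF k(3) smooth_in_charts[OF K M f k(4,2) c(4,2)] smooth_in_charts[OF K N g k(4,2) d(4,2)]]])
qed

lemma chart_velocity_Pair:
  assumes "chart_velocity c \<gamma> v" "chart_velocity d \<delta> w"
  shows "chart_velocity (prod_chart c d) (\<lambda>r. (\<gamma> r, \<delta> r)) (v, w)"
proof -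
  have "\<forall>\<^sub>F r in nhds 0. \<gamma> r \<in> fst c" "\<forall>\<^sub>F r in nhds 0. \<delta> r \<in> fst d"
    using assms by (auto simp: chart_velocity_def)
  then have "\<forall>\<^sub>F r in nhds 0. (\<gamma> r, \<delta> r) \<in> fst (prod_chart c d)"
    by eventually_elim (simp add: fst_prod_chart)
  moreover have "((\<lambda>r. (snd c (\<gamma> r), snd d (\<delta> r))) has_vector_derivative (v, w)) (at 0)"
    using assms by (auto simp: chart_velocity_def intro: has_vector_derivative_Pair)
  ultimately show ?thesis by (simp add: chart_velocity_def snd_prod_chart)
qed

lemma velocity_Pair:
  assumes M: "smooth_manifold M" and N: "smooth_manifold N"
    and \<gamma>: "velocity M \<gamma> v" "\<gamma> 0 \<in> points M" and \<delta>: "velocity N \<delta> w" "\<delta> 0 \<in> points N"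
  obtains \<xi> where "velocity (prod_manifold M N) (\<lambda>r. (\<gamma> r, \<delta> r)) \<xi>" "\<xi> = 0 \<longleftrightarrow> v = 0 \<and> w = 0"
proof -
  have "chart_velocity (prod_chart (chart_at M (\<gamma> 0)) (chart_at N (\<delta> 0))) (\<lambda>r. (\<gamma> r, \<delta> r)) (v, w)"
    by (rule chart_velocity_Pair[OF \<gamma>(1)[unfolded velocity_def] \<delta>(1)[unfolded velocity_def]])
  then obtain \<xi> where "velocity (prod_manifold M N) (\<lambda>r. (\<gamma> r, \<delta> r)) \<xi>" "\<xi> = 0 \<longleftrightarrow> (v, w) = 0"
    by (rule chart_velocity_imp_velocity[OF smooth_manifold_prod[OF M N]
        prod_chart_charts[OF M N chart_at(1)[OF M \<gamma>(2)] chart_at(1)[OF N \<delta>(2)]]])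
  then show thesis using that by (simp add: zero_prod_def)
qed

section \<open>Level sets and fibre products\<close>

text \<open>\<open>H\<close> is a local equation for \<open>A\<close> whose values on the chart stay
  in the image of its linearisation. Composing the chart with the straightening of \<open>H\<close>
  turns \<open>A\<close> into the kernel of \<open>L\<close>, which gives a slice chart. The second
  conclusion says that every vector of this kernel is the velocity of a curve in
  \<open>A\<close>.\<close>

lemma level_set:
  fixes H :: "'e::euclidean_space \<Rightarrow> 'z::euclidean_space"
  assumes M: "smooth_manifold M" and c: "c \<in> charts M" and a: "a \<in> fst c" "a \<in> A"
    and H: "smooth_open T H" "snd c a \<in> T" "(H has_derivative L) (at (snd c a))"
    and HZ: "\<And>q. q \<in> fst c \<Longrightarrow> snd c q \<in> T \<Longrightarrow> H (snd c q) \<in> L ` span (chart_image c)"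
    and A: "\<And>q. q \<in> fst c \<Longrightarrow> snd c q \<in> T \<Longrightarrow> q \<in> A \<longleftrightarrow> H (snd c q) = 0"
  shows "\<exists>c\<in>charts M. a \<in> fst c \<and> (\<exists>W. subspace W \<and> snd c ` (fst c \<inter> A) = chart_image c \<inter> W)"
    and "v \<in> span (chart_image c) \<Longrightarrow> L v = 0 \<Longrightarrow>
      \<exists>\<gamma>. \<gamma> 0 = a \<and> chart_velocity c \<gamma> v \<and> (\<forall>\<^sub>F r in nhds 0. \<gamma> r \<in> A)"
proof -
  let ?V = "span (chart_image c)"
  have ic: "is_chart c" by (rule smooth_manifoldD(4)[OF M c])
  obtain U where U: "open U" "chart_image c = ?V \<inter> U" by (rule chart_image_open[OF ic a(1)])
  have aV: "snd c a \<in> ?V" "snd c a \<in> U" using chart_image_mem[OF a(1)] U(2) by (auto intro: span_base)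
  \<comment> \<open>Intersecting with U makes every vector of the model subspace in the domain the
    coordinate of an actual point, so the hypotheses on points become hypotheses on
    coordinates.\<close>
  have TU: "smooth_open (T \<inter> U) H"
    using H(1) U(1) by (intro smooth_open_subset[OF H(1)]) (auto simp: smooth_open_def)
  have aTU: "snd c a \<in> T \<inter> U" using H(2) aV(2) by simp
  have coord: "\<exists>q\<in>fst c. z = snd c q" if "z \<in> ?V" "z \<in> T \<inter> U" for z
  proof -
    have "z \<in> chart_image c" using that U(2) by blast
    then show ?thesis by (auto simp: chart_image_def)
  qed
  have HZ': "H z \<in> L ` ?V" if "z \<in> ?V" "z \<in> T \<inter> U" for z using coord[OF that] HZ that by blast
  have H0: "H (snd c a) = 0" using A[OF a(1) H(2)] a(2) by blast
  show "\<exists>\<gamma>. \<gamma> 0 = a \<and> chart_velocity c \<gamma> v \<and> (\<forall>\<^sub>F r in nhds 0. \<gamma> r \<in> A)"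
    if v: "v \<in> ?V" "L v = 0"
  proof -
    obtain \<gamma> :: "real \<Rightarrow> 'e" where \<gamma>: "\<gamma> 0 = snd c a" "(\<gamma> has_vector_derivative v) (at 0)"
      "\<forall>\<^sub>F r in nhds 0. \<gamma> r \<in> ?V \<and> \<gamma> r \<in> T \<inter> U \<and> H (\<gamma> r) = 0"
      by (rule kernel_curve[OF subspace_span TU aTU aV(1) HZ' H(3) H0 v])
    have ev: "\<forall>\<^sub>F r in nhds 0. \<gamma> r \<in> chart_image c \<and> chart_inv c (\<gamma> r) \<in> A"
      using \<gamma>(3)
    proof eventually_elim
      case (elim r)
      then have im: "\<gamma> r \<in> chart_image c" using U(2) by blast
      then show ?case
        using A[OF chart_inv_mem[OF im]] elim by (simp add: snd_chart_inv[OF im])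
    qed
    then have ev': "\<forall>\<^sub>F r in nhds 0. \<gamma> r \<in> chart_image c" "\<forall>\<^sub>F r in nhds 0. chart_inv c (\<gamma> r) \<in> A"
      by (auto elim: eventually_mono)
    note chart_velocity_of_coords[OF ic a(1) \<gamma>(2,1) ev'(1)]
    then show ?thesis using ev'(2) by (intro exI[of _ "\<lambda>r. chart_inv c (\<gamma> r)"]) simp
  qed
  obtain T1 O1 \<psi> \<psi>i where *: "smooth_open T1 \<psi>" "snd c a \<in> T1" "T1 \<subseteq> T \<inter> U" "smooth_open O1 \<psi>i"
    "homeomorphism T1 O1 \<psi> \<psi>i" "\<psi> (snd c a) = 0"
    "\<And>z. z \<in> T1 \<Longrightarrow> \<psi> z \<in> ?V \<longleftrightarrow> z \<in> ?V" "\<And>z. z \<in> T1 \<Longrightarrow> z \<in> ?V \<Longrightarrow> L (\<psi> z) = H z"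
    by (rule straighten[OF subspace_span TU aTU aV(1) HZ' H(3) H0]) blast+
  have inv: "\<psi>i (\<psi> z) = z" "\<psi> z \<in> O1" if "z \<in> T1" for z using *(5) that by (auto simp: homeomorphism_def)
  have inv': "\<psi> (\<psi>i w) = w" "\<psi>i w \<in> T1" if "w \<in> O1" for w using *(5) that by (auto simp: homeomorphism_def)
  define S where "S = {q \<in> fst c. snd c q \<in> T1}"
  \<comment> \<open>The slice chart: in these coordinates the equation H = 0 reads L = 0, which is
    linear.\<close>
  define c' where "c' = (S, \<lambda>q. \<psi> (snd c q))"
  have c'_simps: "fst c' = S" "\<And>q. snd c' q = \<psi> (snd c q)" by (simp_all add: c'_def)
  have S: "q \<in> S \<longleftrightarrow> q \<in> fst c \<and> snd c q \<in> T1" for q by (simp add: S_def)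
  have qV: "snd c q \<in> ?V" if "q \<in> S" for q using that by (auto simp: S intro: span_base chart_image_mem)
  have im: "chart_image c' = ?V \<inter> O1"
  proof
    show "chart_image c' \<subseteq> ?V \<inter> O1"
    proof
      fix w assume "w \<in> chart_image c'"
      then obtain q where q: "q \<in> S" "w = \<psi> (snd c q)" unfolding chart_image_def[of c'] c'_simps by blast
      then show "w \<in> ?V \<inter> O1" using inv(2)[of "snd c q"] *(7)[of "snd c q"] qV[OF q(1)] by (simp add: S)
    qed
    show "?V \<inter> O1 \<subseteq> chart_image c'"
    proof
      fix w assume w: "w \<in> ?V \<inter> O1"
      then have "\<psi>i w \<in> ?V" "\<psi>i w \<in> T1" using *(7)[of "\<psi>i w"] inv'[of w] by auto
      moreover obtain q where "q \<in> fst c" "\<psi>i w = snd c q" using coord[of "\<psi>i w"] calculation *(3) by blast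
      ultimately have "q \<in> S" "\<psi> (snd c q) = w" using inv'[of w] w by (auto simp: S)
      then show "w \<in> chart_image c'" unfolding chart_image_def[of c'] c'_simps by blast
    qed
  qed
  have "inj_on (snd c') (fst c')"
  proof (rule inj_onI)
    fix q q' assume "q \<in> fst c'" "q' \<in> fst c'" and eq: "snd c' q = snd c' q'"
    then have q: "q \<in> fst c" "q' \<in> fst c" "snd c q \<in> T1" "snd c q' \<in> T1" by (simp_all add: c'_simps S)
    have "\<psi>i (\<psi> (snd c q)) = \<psi>i (\<psi> (snd c q'))" using eq unfolding c'_simps by (rule arg_cong)
    then have "snd c q = snd c q'" unfolding inv(1)[OF q(3)] inv(1)[OF q(4)] .
    moreover have "inj_on (snd c) (fst c)" using ic by (simp add: is_chart_def)
    ultimately show "q = q'" using q(1,2) by (simp only: inj_on_eq_iff)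
  qed
  moreover have "openin (top_of_set ?V) (chart_image c')"
    unfolding im using *(4) by (intro openin_open_Int) (simp add: smooth_open_def)
  ultimately have ic': "is_chart c'" unfolding is_chart_def using subspace_span by blast
  have c': "c' \<in> charts M"
  proof (rule chartsI[OF M ic'])
    show "fst c' \<subseteq> points M" using smooth_manifoldD(5)[OF M c] by (auto simp: c'_simps S)
    fix q assume "q \<in> fst c'"
    then have q: "q \<in> fst c" "snd c q \<in> T1" by (simp_all add: c'_simps S)
    have "smooth_at c' c (\<lambda>x. x) q"
      by (rule smooth_atI_ext[OF ic' _ *(4)]) (use q inv in \<open>auto simp: c'_simps S\<close>)
    moreover have "smooth_at c c' (\<lambda>x. x) q"
      by (rule smooth_atI_ext[OF ic _ *(1)]) (use q in \<open>auto simp: c'_simps S\<close>)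
    ultimately show "\<exists>c\<in>charts M. smooth_at c' c (\<lambda>x. x) q \<and> smooth_at c c' (\<lambda>x. x) q" using c by blast
  qed
  define W where "W = {w. L w = 0}"
  have "linear L" using H(3) has_derivative_linear by blast
  then have W: "subspace W" by (auto simp: W_def subspace_def linear_0 linear_add linear_scale)
  have mem: "q \<in> A \<longleftrightarrow> snd c' q \<in> W" if "q \<in> S" for q
    using that A[of q] *(8)[OF _ qV[OF that]] *(3) by (auto simp: S W_def c'_simps)
  have "snd c' ` (fst c' \<inter> A) = chart_image c' \<inter> W"
    unfolding chart_image_def[of c'] c'_simps(1) using mem by blast
  moreover have "a \<in> fst c'" using a(1) *(2) by (simp add: c'_simps S)
  ultimately show "\<exists>c\<in>charts M. a \<in> fst c \<and> (\<exists>W. subspace W \<and> snd c ` (fst c \<inter> A) = chart_image c \<inter> W)"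
    using c' W by blast
qed

lemma span_prod_chart:
  assumes "is_chart c" "p \<in> fst c" "is_chart d" "q \<in> fst d"
  shows "span (chart_image (prod_chart c d)) = span (chart_image c) \<times> span (chart_image d)"
proof (rule openin_subspace_span)
  obtain T where T: "open T" "chart_image c = span (chart_image c) \<inter> T"
    by (rule chart_image_open[OF assms(1,2)])
  obtain U where U: "open U" "chart_image d = span (chart_image d) \<inter> U"
    by (rule chart_image_open[OF assms(3,4)])
  have "openin (top_of_set (span (chart_image c))) (chart_image c)"
    by (subst T(2)) (rule openin_open_Int[OF T(1)])
  moreover have "openin (top_of_set (span (chart_image d))) (chart_image d)"
    by (subst U(2)) (rule openin_open_Int[OF U(1)])
  ultimately show "openin (top_of_set (span (chart_image c) \<times> span (chart_image d))) (chart_image (prod_chart c d))"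
    unfolding chart_image_prod_chart by (rule openin_Times)
  show "chart_image (prod_chart c d) \<noteq> {}"
    using chart_image_mem[OF assms(2)] chart_image_mem[OF assms(4)] by (auto simp: chart_image_prod_chart)
qed (intro subspace_Times subspace_span)

lemma chart_velocity_fst:
  assumes "chart_velocity (prod_chart c d) \<gamma> (v, w)" shows "chart_velocity c (\<lambda>r. fst (\<gamma> r)) v"
proof -
  have "((\<lambda>r. fst (snd (prod_chart c d) (\<gamma> r))) has_vector_derivative fst (v, w)) (at 0)"
    using assms by (intro bounded_linear.has_vector_derivative[OF bounded_linear_fst]) (simp add: chart_velocity_def)
  moreover have "\<forall>\<^sub>F r in nhds 0. \<gamma> r \<in> fst (prod_chart c d)" using assms by (simp add: chart_velocity_def)
  then have "\<forall>\<^sub>F r in nhds 0. fst (\<gamma> r) \<in> fst c" by eventually_elim (auto simp: fst_prod_chart)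
  ultimately show ?thesis by (simp add: chart_velocity_def snd_prod_chart)
qed

lemma chart_velocity_snd:
  assumes "chart_velocity (prod_chart c d) \<gamma> (v, w)" shows "chart_velocity d (\<lambda>r. snd (\<gamma> r)) w"
proof -
  have "((\<lambda>r. snd (snd (prod_chart c d) (\<gamma> r))) has_vector_derivative snd (v, w)) (at 0)"
    using assms by (intro bounded_linear.has_vector_derivative[OF bounded_linear_snd]) (simp add: chart_velocity_def)
  moreover have "\<forall>\<^sub>F r in nhds 0. \<gamma> r \<in> fst (prod_chart c d)" using assms by (simp add: chart_velocity_def)
  then have "\<forall>\<^sub>F r in nhds 0. snd (\<gamma> r) \<in> fst d" by eventually_elim (auto simp: fst_prod_chart)
  ultimately show ?thesis by (simp add: chart_velocity_def snd_prod_chart)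
qed

lemma submersionD:
  assumes "smooth_manifold M" "smooth_manifold X" "surjective_submersion M X f"
  shows "p \<in> points M \<Longrightarrow> smooth_in M X f p" "p \<in> points M \<Longrightarrow> f p \<in> points X"
    "p \<in> points M \<Longrightarrow> differential M X f p ` tangent M p = tangent X (f p)"
    "smooth_map M X f"
proof -
  show f: "smooth_map M X f" using assms(3) by (simp add: surjective_submersion_def)
  then show "p \<in> points M \<Longrightarrow> smooth_in M X f p" using smooth_map_iff[OF assms(1,2)] by blast
  show "p \<in> points M \<Longrightarrow> f p \<in> points X" using assms(3) by (auto simp: surjective_submersion_def)
  show "p \<in> points M \<Longrightarrow> differential M X f p ` tangent M p = tangent X (f p)"
    using assms(3) by (simp add: surjective_submersion_def)
qed

lemma chart_injD: "is_chart c \<Longrightarrow> q \<in> fst c \<Longrightarrow> q' \<in> fst c \<Longrightarrow> snd c q = snd c q' \<longleftrightarrow> q = q'"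
  unfolding is_chart_def by (elim conjE) (rule inj_on_eq_iff)

text \<open>In product coordinates the fibre product is the zero set of F - G, where F and G express
  f and g. Since f is a submersion, the first term of the linearisation alone reaches every tangent
  vector of \<open>X\<close>, so \<open>level_set\<close> applies. Its curve part gives the second
  conclusion: two vectors with the same image in \<open>X\<close> are velocities of a curve of
  pairs.\<close>

lemma fibre_product_local:
  fixes M :: "('a, 'e::euclidean_space) manifold" and N :: "('b, 'f::euclidean_space) manifold"
    and X :: "('x, 'd::euclidean_space) manifold"
  assumes M: "smooth_manifold M" and N: "smooth_manifold N" and X: "smooth_manifold X"
    and f: "surjective_submersion M X f" and g: "smooth_map N X g"
    and ab: "a \<in> points M" "b \<in> points N" "f a = g b"
  defines "S \<equiv> {(a, b). a \<in> points M \<and> b \<in> points N \<and> f a = g b}"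
  shows "\<exists>c\<in>charts (prod_manifold M N). (a, b) \<in> fst c \<and>
      (\<exists>W. subspace W \<and> snd c ` (fst c \<inter> S) = chart_image c \<inter> W)"
    and "v \<in> tangent M a \<Longrightarrow> w \<in> tangent N b \<Longrightarrow> differential M X f a v = differential N X g b w \<Longrightarrow>
      \<exists>\<gamma> \<delta>. \<gamma> 0 = a \<and> \<delta> 0 = b \<and> velocity M \<gamma> v \<and> velocity N \<delta> w \<and> (\<forall>\<^sub>F r in nhds 0. (\<gamma> r, \<delta> r) \<in> S)"
proof -
  define c d e where "c = chart_at M a" and "d = chart_at N b" and "e = chart_at X (f a)"
  have fa: "f a \<in> points X" by (rule submersionD(2)[OF M X f ab(1)])
  have c: "c \<in> atlas M" "a \<in> fst c" "is_chart c" "c \<in> charts M" unfolding c_def using chart_at[OF M ab(1)] .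
  have d: "d \<in> atlas N" "b \<in> fst d" "is_chart d" "d \<in> charts N" unfolding d_def using chart_at[OF N ab(2)] .
  have e: "e \<in> atlas X" "f a \<in> fst e" "is_chart e" "e \<in> charts X" unfolding e_def using chart_at[OF X fa] .
  have sf: "smooth_at c e f a" by (rule smooth_in_charts[OF M X submersionD(1)[OF M X f ab(1)] c(4,2) e(4,2)])
  have gb: "smooth_in N X g b" using g ab(2) smooth_map_iff[OF N X] by simp
  have sg: "smooth_at d e g b"
    by (rule smooth_in_charts[OF N X gb d(4,2) e(4)]) (use e(2) ab(3) in simp)
  obtain T1 F where F: "smooth_open T1 F" "snd c a \<in> T1" "\<And>q. q \<in> fst c \<Longrightarrow> snd c q \<in> T1 \<Longrightarrow> f q \<in> fst e"
    "\<And>q. q \<in> fst c \<Longrightarrow> snd c q \<in> T1 \<Longrightarrow> F (snd c q) = snd e (f q)"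
    by (rule smooth_atE_ext[OF c(3) sf]) blast
  obtain T2 G where G: "smooth_open T2 G" "snd d b \<in> T2" "\<And>q. q \<in> fst d \<Longrightarrow> snd d q \<in> T2 \<Longrightarrow> g q \<in> fst e"
    "\<And>q. q \<in> fst d \<Longrightarrow> snd d q \<in> T2 \<Longrightarrow> G (snd d q) = snd e (g q)"
    by (rule smooth_atE_ext[OF d(3) sg]) blast
  define F' G' where "F' = frechet_derivative F (at (snd c a))" and "G' = frechet_derivative G (at (snd d b))"
  have dF: "(F has_derivative F') (at (snd c a))" and dG: "(G has_derivative G') (at (snd d b))"
    unfolding F'_def G'_def using smooth_open_has_derivative[OF F(1,2)] smooth_open_has_derivative[OF G(1,2)] .
  have difF: "differential M X f a u = F' u" if "u \<in> tangent M a" for u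
    using coordinate_expression_derivative(2)[OF c(3,2) F dF, of u] that
    by (simp add: differential_def tangent_def c_def e_def)
  have difG: "differential N X g b u = G' u" if "u \<in> tangent N b" for u
    using coordinate_expression_derivative(2)[OF d(3,2) G dG, of u] that
    by (simp add: differential_def tangent_def d_def e_def ab(3))
  define k where "k = prod_chart c d"
  have kc: "k \<in> charts (prod_manifold M N)" unfolding k_def by (rule prod_chart_charts[OF M N c(1) d(1)])
  have V: "span (chart_image k) = tangent M a \<times> tangent N b"
    unfolding k_def span_prod_chart[OF c(3,2) d(3,2)] by (simp add: tangent_def c_def d_def)
  define T where "T = T1 \<times> T2"
  define H where "H z = F (fst z) - G (snd z)" for z
  define L where "L z = F' (fst z) - G' (snd z)" for z
  have oT: "open T" using F(1) G(1) by (simp add: T_def smooth_open_def open_Times)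
  have kab: "(a, b) \<in> fst k" "snd k (a, b) = (snd c a, snd d b)" using c(2) d(2)
    by (simp_all add: k_def fst_prod_chart snd_prod_chart)
  have sH: "smooth_open T H"
  proof -
    have "smooth_open T (\<lambda>z. F (fst z))" "smooth_open T (\<lambda>z. G (snd z))"
      by (rule smooth_open_compose[OF smooth_open_linear[OF linear_fst oT] F(1)];
          force simp: T_def) (rule smooth_open_compose[OF smooth_open_linear[OF linear_snd oT] G(1)]; force simp: T_def)
    then have "smooth_open T (\<lambda>z. F (fst z) + - G (snd z))"
      by (intro smooth_open_add smooth_open_linear_compose[OF linear_uminus])
    then show ?thesis by (simp add: H_def[abs_def])
  qed
  have kT: "snd k (a, b) \<in> T" using F(2) G(2) by (simp add: kab T_def)
  have dH: "(H has_derivative L) (at (snd k (a, b)))"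
  proof -
    have 1: "((\<lambda>z. F (fst z)) has_derivative (\<lambda>z. F' (fst z))) (at (snd k (a, b)))"
      by (rule has_derivative_compose[OF bounded_linear_imp_has_derivative[OF bounded_linear_fst]]) (simp add: kab dF)
    have 2: "((\<lambda>z. G (snd z)) has_derivative (\<lambda>z. G' (snd z))) (at (snd k (a, b)))"
      by (rule has_derivative_compose[OF bounded_linear_imp_has_derivative[OF bounded_linear_snd]]) (simp add: kab dG)
    show ?thesis unfolding H_def[abs_def] L_def[abs_def] by (rule has_derivative_diff[OF 1 2])
  qed
  have HZ: "H (snd k q) \<in> L ` span (chart_image k)" if q: "q \<in> fst k" "snd k q \<in> T" for q
  proof -
    obtain q1 q2 where qq: "q = (q1, q2)" by (cases q)
    have q12: "q1 \<in> fst c" "q2 \<in> fst d" "snd c q1 \<in> T1" "snd d q2 \<in> T2"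
      using q by (simp_all add: qq k_def fst_prod_chart snd_prod_chart T_def)
    have "H (snd k q) = snd e (f q1) - snd e (g q2)"
      using F(4)[OF q12(1,3)] G(4)[OF q12(2,4)] by (simp add: H_def qq k_def snd_prod_chart)
    moreover have "\<dots> \<in> span (chart_image e)"
      using chart_image_mem[OF F(3)[OF q12(1,3)]] chart_image_mem[OF G(3)[OF q12(2,4)]]
      by (intro span_diff span_base)
    ultimately have "H (snd k q) \<in> differential M X f a ` tangent M a"
      using submersionD(3)[OF M X f ab(1)] by (simp add: tangent_def e_def)
    then obtain u where u: "u \<in> tangent M a" "H (snd k q) = F' u" using difF by auto
    \<comment> \<open>The preimage under \<open>L\<close> can be taken with second component 0, by
      surjectivity of the differential of f.\<close>
    have "H (snd k q) = L (u, 0)" using u(2) linear_0[OF has_derivative_linear[OF dG]] by (simp add: L_def)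
    moreover have "(u, 0) \<in> span (chart_image k)" using u(1) subspace_0[OF tangent_subspace] by (simp add: V)
    ultimately show ?thesis by (rule image_eqI)
  qed
  have A: "q \<in> S \<longleftrightarrow> H (snd k q) = 0" if q: "q \<in> fst k" "snd k q \<in> T" for q
  proof -
    obtain q1 q2 where qq: "q = (q1, q2)" by (cases q)
    have q12: "q1 \<in> fst c" "q2 \<in> fst d" "snd c q1 \<in> T1" "snd d q2 \<in> T2"
      using q by (simp_all add: qq k_def fst_prod_chart snd_prod_chart T_def)
    have "q1 \<in> points M" "q2 \<in> points N"
      using q12 smooth_manifoldD(5)[OF M c(4)] smooth_manifoldD(5)[OF N d(4)] by blast+
    then have "q \<in> S \<longleftrightarrow> f q1 = g q2" by (simp add: S_def qq)
    also have "\<dots> \<longleftrightarrow> snd e (f q1) = snd e (g q2)"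
      using chart_injD[OF e(3) F(3)[OF q12(1,3)] G(3)[OF q12(2,4)]] by simp
    also have "\<dots> \<longleftrightarrow> H (snd k q) = 0"
      using F(4)[OF q12(1,3)] G(4)[OF q12(2,4)] by (simp add: H_def qq k_def snd_prod_chart)
    finally show ?thesis .
  qed
  have abS: "(a, b) \<in> S" using ab by (simp add: S_def)
  note level = level_set[OF smooth_manifold_prod[OF M N] kc kab(1) abS sH kT dH HZ A]
  show "\<exists>c\<in>charts (prod_manifold M N). (a, b) \<in> fst c \<and>
      (\<exists>W. subspace W \<and> snd c ` (fst c \<inter> S) = chart_image c \<inter> W)"
    by (rule level(1))
  assume v: "v \<in> tangent M a" and w: "w \<in> tangent N b" and eq: "differential M X f a v = differential N X g b w"
  have "(v, w) \<in> span (chart_image k)" using v w by (simp add: V)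
  moreover have "L (v, w) = 0" using eq difF[OF v] difG[OF w] by (simp add: L_def)
  ultimately have "\<exists>\<gamma>. \<gamma> 0 = (a, b) \<and> chart_velocity k \<gamma> (v, w) \<and> (\<forall>\<^sub>F r in nhds 0. \<gamma> r \<in> S)"
    by - (rule level(2); assumption)
  then obtain \<gamma> where \<gamma>: "\<gamma> 0 = (a, b)" "chart_velocity k \<gamma> (v, w)" "\<forall>\<^sub>F r in nhds 0. \<gamma> r \<in> S"
    by (elim exE conjE)
  show "\<exists>\<gamma> \<delta>. \<gamma> 0 = a \<and> \<delta> 0 = b \<and> velocity M \<gamma> v \<and> velocity N \<delta> w \<and> (\<forall>\<^sub>F r in nhds 0. (\<gamma> r, \<delta> r) \<in> S)"
    using chart_velocity_fst[OF \<gamma>(2)[unfolded k_def]] chart_velocity_snd[OF \<gamma>(2)[unfolded k_def]] \<gamma>(1,3)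
    by (intro exI[of _ "\<lambda>r. fst (\<gamma> r)"] exI[of _ "\<lambda>r. snd (\<gamma> r)"]) (simp add: velocity_def c_def d_def)
qed

text \<open>One interface for the three fibre products in play: the composable arrows and the
  domains of a left and of a right action.\<close>

locale fibred_pair =
  fixes M :: "('a, 'e::euclidean_space) manifold" and N :: "('b, 'f::euclidean_space) manifold"
    and X :: "('x, 'd::euclidean_space) manifold" and f :: "'a \<Rightarrow> 'x" and g :: "'b \<Rightarrow> 'x"
  assumes M: "smooth_manifold M" and N: "smooth_manifold N" and X: "smooth_manifold X"
    and f: "surjective_submersion M X f" and g: "smooth_map N X g"
begin

abbreviation "S \<equiv> {(a, b). a \<in> points M \<and> b \<in> points N \<and> f a = g b}"
abbreviation "C \<equiv> fibre_product M N f g"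

lemma manifold_prod: "smooth_manifold (prod_manifold M N)"
  by (rule smooth_manifold_prod[OF M N])

lemma embedded_S: "embedded (prod_manifold M N) S"
  unfolding embedded_def
proof (intro conjI ballI)
  show "S \<subseteq> points (prod_manifold M N)" by auto
  fix ab assume ab: "ab \<in> S"
  obtain a b where *: "ab = (a, b)" by (cases ab)
  show "\<exists>c\<in>charts (prod_manifold M N). ab \<in> fst c \<and> (\<exists>W. subspace W \<and> snd c ` (fst c \<inter> S) = chart_image c \<inter> W)"
    unfolding * by (rule fibre_product_local(1)[OF M N X f g]) (use ab * in auto)
qed

lemma C_def: "C = submanifold (prod_manifold M N) S"
  by (simp add: fibre_product_def)

lemma manifold_C: "smooth_manifold C"
  unfolding C_def by (rule smooth_manifold_submanifold[OF manifold_prod embedded_S])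

lemma points_C: "points C = S"
  by (simp add: C_def)

lemma smooth_fst:
  assumes "(a, b) \<in> points C" shows "smooth_in C M fst (a, b)"
proof -
  have ab: "(a, b) \<in> S" using assms by (simp only: points_C)
  then have m: "a \<in> points M" "b \<in> points N" by auto
  show ?thesis
    using smooth_in_compose[OF manifold_C manifold_prod M smooth_in_inclusion[OF manifold_prod embedded_S ab, folded C_def] smooth_in_fst[OF M N m]]
    by simp
qed

lemma smooth_snd:
  assumes "(a, b) \<in> points C" shows "smooth_in C N snd (a, b)"
proof -
  have ab: "(a, b) \<in> S" using assms by (simp only: points_C)
  then have m: "a \<in> points M" "b \<in> points N" by auto
  show ?thesis
    using smooth_in_compose[OF manifold_C manifold_prod N smooth_in_inclusion[OF manifold_prod embedded_S ab, folded C_def] smooth_in_snd[OF M N m]]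
    by simp
qed

lemma smooth_into:
  assumes K: "smooth_manifold K" and h: "smooth_in K M h1 p" "smooth_in K N h2 p"
    and eq: "\<And>q. q \<in> points K \<Longrightarrow> (h1 q, h2 q) \<in> points C"
  shows "smooth_in K C (\<lambda>q. (h1 q, h2 q)) p"
  unfolding C_def
proof (rule smooth_in_submanifold[OF manifold_prod embedded_S K smooth_in_Pair[OF K M N h]])
  have p: "p \<in> points K" by (rule smooth_in_mem[OF K M h(1)])
  show "nbhd K p (points K)"
    unfolding nbhd_def using chart_at(4,2)[OF K p] smooth_manifoldD(5)[OF K chart_at(4)[OF K p]] by blast
  show "(h1 q, h2 q) \<in> S" if "q \<in> points K" for q using eq[OF that] by (simp only: points_C)
qed

text \<open>A tangent vector of \<open>C\<close> is given in an unknown slice chart and can be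
  handled only through its two projections. The last clause replaces a formula for its
  coordinates.\<close>

lemma velocity_C:
  assumes \<gamma>: "velocity M \<gamma> v" and \<delta>: "velocity N \<delta> w" and ev: "\<forall>\<^sub>F r in nhds 0. (\<gamma> r, \<delta> r) \<in> points C"
  obtains \<xi> where "velocity C (\<lambda>r. (\<gamma> r, \<delta> r)) \<xi>" "\<xi> \<in> tangent C (\<gamma> 0, \<delta> 0)"
    "differential C M fst (\<gamma> 0, \<delta> 0) \<xi> = v" "differential C N snd (\<gamma> 0, \<delta> 0) \<xi> = w"
    "v = 0 \<Longrightarrow> w = 0 \<Longrightarrow> \<xi> = 0"
proof -
  have mem: "(\<gamma> 0, \<delta> 0) \<in> points C" using ev by (rule eventually_nhds_x_imp_x)
  then have m: "\<gamma> 0 \<in> points M" "\<delta> 0 \<in> points N" by (auto simp: points_C)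
  obtain \<eta> where \<eta>: "velocity (prod_manifold M N) (\<lambda>r. (\<gamma> r, \<delta> r)) \<eta>" "\<eta> = 0 \<longleftrightarrow> v = 0 \<and> w = 0"
    by (rule velocity_Pair[OF M N \<gamma> m(1) \<delta> m(2)])
  obtain \<xi> where \<xi>: "velocity C (\<lambda>r. (\<gamma> r, \<delta> r)) \<xi>" "\<xi> = 0 \<longleftrightarrow> \<eta> = 0"
    using velocity_submanifold[OF manifold_prod embedded_S \<eta>(1) ev[unfolded points_C]] unfolding C_def by blast
  show thesis
  proof (rule that[OF \<xi>(1)])
    show "\<xi> \<in> tangent C (\<gamma> 0, \<delta> 0)" using velocity_tangent[OF \<xi>(1)] .
    show "differential C M fst (\<gamma> 0, \<delta> 0) \<xi> = v"
      by (rule differential_eqI[OF manifold_C M smooth_fst[OF mem] \<xi>(1) refl]) (simp add: \<gamma>)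
    show "differential C N snd (\<gamma> 0, \<delta> 0) \<xi> = w"
      by (rule differential_eqI[OF manifold_C N smooth_snd[OF mem] \<xi>(1) refl]) (simp add: \<delta>)
    show "\<xi> = 0" if "v = 0" "w = 0" using that \<xi>(2) \<eta>(2) by simp
  qed
qed

lemma velocity_CD:
  assumes "velocity C \<gamma> \<xi>" "\<gamma> 0 \<in> points C"
  shows "velocity M (\<lambda>r. fst (\<gamma> r)) (differential C M fst (\<gamma> 0) \<xi>)"
    "velocity N (\<lambda>r. snd (\<gamma> r)) (differential C N snd (\<gamma> 0) \<xi>)"
    "\<forall>\<^sub>F r in nhds 0. \<gamma> r \<in> points C"
  using velocity_differential[OF manifold_C M _ assms(1) refl] velocity_differential[OF manifold_C N _ assms(1) refl]
    smooth_fst[of "fst (\<gamma> 0)" "snd (\<gamma> 0)"] smooth_snd[of "fst (\<gamma> 0)" "snd (\<gamma> 0)"]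
    velocity_points[OF manifold_C assms] assms(2) by simp_all

text \<open>A curve in \<open>C\<close> representing the vector has two components of velocity 0,
  and \<open>velocity_C\<close> then gives velocity 0 to the pair.\<close>

lemma tangent_C_eq_0:
  assumes "ab \<in> points C" and \<xi>: "\<xi> \<in> tangent C ab"
    and "differential C M fst ab \<xi> = 0" "differential C N snd ab \<xi> = 0"
  shows "\<xi> = 0"
proof -
  obtain \<gamma> where \<gamma>: "\<gamma> 0 = ab" "velocity C \<gamma> \<xi>" by (rule tangent_velocity[OF manifold_C assms(1) \<xi>])
  have "velocity M (\<lambda>r. fst (\<gamma> r)) 0" "velocity N (\<lambda>r. snd (\<gamma> r)) 0"
    "\<forall>\<^sub>F r in nhds 0. (fst (\<gamma> r), snd (\<gamma> r)) \<in> points C"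
    using velocity_CD[OF \<gamma>(2)] \<gamma>(1) assms by simp_all
  then obtain \<xi>' where "velocity C (\<lambda>r. (fst (\<gamma> r), snd (\<gamma> r))) \<xi>'" "\<xi>' = 0"
    by (rule velocity_C) blast
  then show ?thesis using velocity_unique[OF \<gamma>(2)] by simp
qed

lemma tangent_C_exists:
  assumes "(a, b) \<in> points C" "v \<in> tangent M a" "w \<in> tangent N b"
    "differential M X f a v = differential N X g b w"
  obtains \<gamma> \<delta> where "\<gamma> 0 = a" "\<delta> 0 = b" "velocity M \<gamma> v" "velocity N \<delta> w" "\<forall>\<^sub>F r in nhds 0. (\<gamma> r, \<delta> r) \<in> points C"
proof -
  have ab: "a \<in> points M" "b \<in> points N" "f a = g b" using assms(1) by (auto simp: points_C)
  from fibre_product_local(2)[OF M N X f g ab assms(2-4)] show thesis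
    using that unfolding points_C by blast
qed

end

section \<open>Fibres of constant rank\<close>

text \<open>The pair (s, t) is not a submersion, but it becomes one after t is projected to the part
  Z of its values that its differential reaches on ker ds. \<open>constant_rank\<close> shows that
  near a the projection loses nothing: if the projected values agree with those at a, then so do s
  and t. The estimate \<open>rank\<close> is required on the whole source fibre and not only on
  \<open>A\<close>, because a point with the same projected values is a priori known to have the
  same s only.\<close>

lemma fibre_embedded_constant_rank:
  fixes M :: "('a, 'e::euclidean_space) manifold" and X :: "('x, 'd::euclidean_space) manifold"
    and Y :: "('y, 'd2::euclidean_space) manifold"
  assumes M: "smooth_manifold M" and X: "smooth_manifold X" and Y: "smooth_manifold Y"
    and s: "surjective_submersion M X s" and t: "smooth_map M Y t"
    and a: "a \<in> points M" "s a = x" "t a = y"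
  defines "A \<equiv> {q \<in> points M. s q = x \<and> t q = y}"
    and "K \<equiv> (\<lambda>q. {v \<in> tangent M q. differential M X s q v = 0 \<and> differential M Y t q v = 0})"
  assumes rank: "\<And>q. q \<in> points M \<Longrightarrow> s q = x \<Longrightarrow> dim (K a) \<le> dim (K q)"
  shows "\<exists>c\<in>charts M. a \<in> fst c \<and> (\<exists>W. subspace W \<and> snd c ` (fst c \<inter> A) = chart_image c \<inter> W)"
    and "v \<in> K a \<Longrightarrow> \<exists>\<gamma>. \<gamma> 0 = a \<and> velocity M \<gamma> v \<and> (\<forall>\<^sub>F r in nhds 0. \<gamma> r \<in> A)"
proof -
  define c e e' where "c = chart_at M a" and "e = chart_at X x" and "e' = chart_at Y y"
  define V where "V = span (chart_image c)"
  have V: "subspace V" by (simp add: V_def)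
  have xX: "x \<in> points X" using submersionD(2)[OF M X s a(1)] a(2) by simp
  have ta: "smooth_in M Y t q" if "q \<in> points M" for q using t that smooth_map_iff[OF M Y] by simp
  have yY: "y \<in> points Y" using smooth_in_mem(2)[OF M Y ta[OF a(1)]] a(3) by simp
  have c: "c \<in> atlas M" "a \<in> fst c" "is_chart c" "c \<in> charts M" unfolding c_def using chart_at[OF M a(1)] .
  have e: "e \<in> atlas X" "x \<in> fst e" "is_chart e" "e \<in> charts X" unfolding e_def using chart_at[OF X xX] .
  have e': "e' \<in> atlas Y" "y \<in> fst e'" "is_chart e'" "e' \<in> charts Y" unfolding e'_def using chart_at[OF Y yY] .
  have ss: "smooth_at c e s a"
    by (rule smooth_in_charts[OF M X submersionD(1)[OF M X s a(1)] c(4,2) e(4)]) (use e(2) a(2) in simp)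
  have st: "smooth_at c e' t a"
    by (rule smooth_in_charts[OF M Y ta[OF a(1)] c(4,2) e'(4)]) (use e'(2) a(3) in simp)
  obtain T1 F where F: "smooth_open T1 F" "snd c a \<in> T1" "\<And>q. q \<in> fst c \<Longrightarrow> snd c q \<in> T1 \<Longrightarrow> s q \<in> fst e"
    "\<And>q. q \<in> fst c \<Longrightarrow> snd c q \<in> T1 \<Longrightarrow> F (snd c q) = snd e (s q)"
    by (rule smooth_atE_ext[OF c(3) ss]) blast
  obtain T2 G where G: "smooth_open T2 G" "snd c a \<in> T2" "\<And>q. q \<in> fst c \<Longrightarrow> snd c q \<in> T2 \<Longrightarrow> t q \<in> fst e'"
    "\<And>q. q \<in> fst c \<Longrightarrow> snd c q \<in> T2 \<Longrightarrow> G (snd c q) = snd e' (t q)"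
    by (rule smooth_atE_ext[OF c(3) st]) blast
  obtain U where U: "open U" "chart_image c = V \<inter> U" unfolding V_def by (rule chart_image_open[OF c(3,2)])
  define T where "T = T1 \<inter> T2 \<inter> U"
  have oT: "open T" using F(1) G(1) U(1) by (simp add: T_def smooth_open_def open_Int)
  have z0: "snd c a \<in> T" "snd c a \<in> V" using F(2) G(2) chart_image_mem[OF c(2)] U(2) by (auto simp: T_def)
  define f where "f z = (F z, G z)" for z
  let ?F' = "\<lambda>z. frechet_derivative F (at z)" and ?G' = "\<lambda>z. frechet_derivative G (at z)"
  have dF: "(F has_derivative ?F' z) (at z)" and dG: "(G has_derivative ?G' z) (at z)" if "z \<in> T" for z
    using smooth_open_has_derivative[OF F(1)] smooth_open_has_derivative[OF G(1)] that by (simp_all add: T_def)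
  have df: "(f has_derivative (\<lambda>v. (?F' z v, ?G' z v))) (at z)" if "z \<in> T" for z
    unfolding f_def[abs_def] by (rule has_derivative_Pair[OF dF[OF that] dG[OF that]])
  have lin: "linear (?F' z)" "linear (?G' z)" if "z \<in> T" for z
    using has_derivative_linear[OF dF[OF that]] has_derivative_linear[OF dG[OF that]] .
  have sf: "smooth_open T f"
    unfolding f_def[abs_def]
    by (intro smooth_open_Pair smooth_open_subset[OF F(1) oT] smooth_open_subset[OF G(1) oT]) (auto simp: T_def)
  have coord: "\<exists>q\<in>fst c. z = snd c q" if "z \<in> V" "z \<in> T" for z
  proof -
    have "z \<in> chart_image c" using that U(2) by (simp add: T_def)
    then show ?thesis by (auto simp: chart_image_def)
  qed
  have qM: "q \<in> points M" if "q \<in> fst c" for q using smooth_manifoldD(5)[OF M c(4)] that by blast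
  define F' G' where "F' = ?F' (snd c a)" and "G' = ?G' (snd c a)"
  have FF: "F (snd c q) = snd e (s q)" "s q \<in> fst e" "G (snd c q) = snd e' (t q)" "t q \<in> fst e'"
    if "q \<in> fst c" "snd c q \<in> T" for q
    using F(3,4)[OF that(1)] G(3,4)[OF that(1)] that(2) by (simp_all add: T_def)
  have difF: "differential M X s a u = F' u" if "u \<in> tangent M a" for u
    using coordinate_expression_derivative(2)[OF c(3,2) F dF[OF z0(1)], of u] that
    by (simp add: differential_def tangent_def c_def e_def a(2) F'_def)
  have difG: "differential M Y t a u = G' u" if "u \<in> tangent M a" for u
    using coordinate_expression_derivative(2)[OF c(3,2) G dG[OF z0(1)], of u] that
    by (simp add: differential_def tangent_def c_def e'_def a(3) G'_def)
  have tanV: "tangent M a = V" by (simp add: tangent_def V_def c_def)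
  have Ka: "K a = {v \<in> V. F' v = 0 \<and> G' v = 0}"
    unfolding K_def tanV using difF difG tanV by auto
  \<comment> \<open>The values of dt on ker ds, in coordinates. Together with the image of ds they
    have the dimension of the image of (ds, dt).\<close>
  define Z where "Z = G' ` {v \<in> V. F' v = 0}"
  have lin': "linear F'" "linear G'" unfolding F'_def G'_def using lin[OF z0(1)] .
  have "subspace {v \<in> V. F' v = 0}"
    using V lin'(1) by (auto simp: subspace_def linear_0 linear_add linear_scale)
  then have Z: "subspace Z" unfolding Z_def by (rule linear_subspace_image[OF lin'(2)])
  obtain P where P: "linear P" "range P \<subseteq> Z" "\<And>w. w \<in> Z \<Longrightarrow> P w = w" by (rule subspace_projection[OF Z]) blast
  \<comment> \<open>The source coordinate is kept, the target coordinate is projected to Z. As dt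
    maps ker ds into Z, where \<open>P\<close> is the identity, the composite with (ds, dt) has the
    same kernel as (ds, dt) itself.\<close>
  define R where "R uw = (fst uw, P (snd uw))" for uw :: "'d \<times> 'd2"
  have R: "linear R"
    unfolding R_def[abs_def] by (auto simp: linear_iff linear_add[OF P(1)] linear_scale[OF P(1)])
  define L where "L v = R (F' v, G' v)" for v
  have FV: "F' ` V = span (chart_image e)"
    using submersionD(3)[OF M X s a(1)] difF by (simp add: tanV a(2) tangent_def[of X] e_def)
  \<comment> \<open>First match u by surjectivity of ds, then correct the second component by a
    vector of ker ds, which leaves u alone.\<close>
  have onto: "(u, w) \<in> L ` V" if u: "u \<in> span (chart_image e)" and w: "w \<in> Z" for u w
  proof -
    obtain v0 where v0: "v0 \<in> V" "F' v0 = u" using u unfolding FV[symmetric] by blast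
    have "P (G' v0) \<in> Z" using P(2) by blast
    then have "w - P (G' v0) \<in> Z" using w Z by (intro subspace_diff)
    then obtain v1 where v1: "v1 \<in> V" "F' v1 = 0" "G' v1 = w - P (G' v0)" unfolding Z_def by auto
    have "P (w - P (G' v0)) = w - P (G' v0)" by (rule P(3)) fact
    then have "L (v0 + v1) = (u, w)"
      using v0 v1 by (simp add: L_def R_def linear_add[OF lin'(1)] linear_add[OF lin'(2)] linear_add[OF P(1)])
    moreover have "v0 + v1 \<in> V" using V v0(1) v1(1) by (rule subspace_add)
    ultimately show ?thesis by (metis imageI)
  qed
  have RZ: "R (f z - f (snd c a)) \<in> (\<lambda>v. R ((\<lambda>v. (?F' (snd c a) v, ?G' (snd c a) v)) v)) ` V"
    if z: "z \<in> V" "z \<in> T" for z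
  proof -
    obtain q where q: "q \<in> fst c" "z = snd c q" using coord[OF z] by blast
    have "F z - F (snd c a) \<in> span (chart_image e)"
      using FF(1,2)[OF q(1)] FF(1,2)[OF c(2) z0(1)] z(2) q(2)
      by (auto intro!: span_diff intro: span_base chart_image_mem)
    moreover have "P (G z - G (snd c a)) \<in> Z" using P(2) by blast
    ultimately have "(F z - F (snd c a), P (G z - G (snd c a))) \<in> L ` V" by (rule onto)
    then show ?thesis by (simp add: R_def f_def L_def[abs_def] F'_def G'_def)
  qed
  have kerL: "{v \<in> V. R (F' v, G' v) = 0} = K a"
  proof -
    have "P (G' v) = 0 \<longleftrightarrow> G' v = 0" if "v \<in> V" "F' v = 0" for v
      using P(3)[of "G' v"] that linear_0[OF P(1)] by (auto simp: Z_def)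
    then show ?thesis unfolding Ka R_def by (auto simp: zero_prod_def)
  qed
  have rank': "dim {v \<in> V. R ((\<lambda>v. (?F' (snd c a) v, ?G' (snd c a) v)) v) = 0} \<le>
      dim {v \<in> V. frechet_derivative f (at z) v = 0}"
    if z: "z \<in> V" "z \<in> T" and eq: "R (f z) = R (f (snd c a))" for z
  proof -
    obtain q where q: "q \<in> fst c" "z = snd c q" using coord[OF z] by blast
    have qT: "snd c q \<in> T" using z(2) q(2) by simp
    have qp: "q \<in> points M" by (rule qM[OF q(1)])
    have "snd e (s q) = snd e (s a)"
      using eq FF(1)[OF q(1) qT] FF(1)[OF c(2) z0(1)] q(2) by (simp add: R_def f_def)
    \<comment> \<open>This is the gain from keeping the source coordinate in \<open>R\<close>: the
      point q is on the source fibre of a, so the hypothesis \<open>rank\<close> applies to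
      it.\<close>
    then have sq: "s q = x" using chart_injD[OF e(3) FF(2)[OF q(1) qT] FF(2)[OF c(2) z0(1)]] a(2) by simp
    note tq = smooth_in_mem(2)[OF M Y ta[OF qp]]
    \<comment> \<open>\<open>K q\<close> is expressed in the chart chosen at q, the derivative of f
      in the chart c at a. The injective transition \<open>E\<close> carries the first kernel into
      the second, which suffices for the dimension estimate.\<close>
    obtain E where E: "linear E"
      "\<And>\<gamma> v. \<gamma> 0 = q \<Longrightarrow> chart_velocity (chart_at M q) \<gamma> v \<Longrightarrow> chart_velocity c \<gamma> (E v)"
      "\<And>v. v \<in> span (chart_image (chart_at M q)) \<Longrightarrow> E v = 0 \<Longrightarrow> v = 0"
      by (rule chart_velocity_change[OF M chart_at(4)[OF M qp] c(4) chart_at(2)[OF M qp] q(1)]) blast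
    obtain E' where E': "linear E'"
      "\<And>\<gamma> v. \<gamma> 0 = t q \<Longrightarrow> chart_velocity (chart_at Y (t q)) \<gamma> v \<Longrightarrow> chart_velocity e' \<gamma> (E' v)"
      by (rule chart_velocity_change[OF Y chart_at(4)[OF Y tq] e'(4) chart_at(2)[OF Y tq] FF(4)[OF q(1) qT]]) blast
    have qT12: "snd c q \<in> T1" "snd c q \<in> T2" using qT by (simp_all add: T_def)
    have EK: "E v \<in> {v \<in> V. frechet_derivative f (at z) v = 0}" if v: "v \<in> K q" for v
    proof -
      have v': "v \<in> tangent M q" "differential M X s q v = 0" "differential M Y t q v = 0"
        using v by (simp_all add: K_def)
      obtain \<gamma> where \<gamma>: "\<gamma> 0 = q" "velocity M \<gamma> v" by (rule tangent_velocity[OF M qp v'(1)])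
      have cv: "chart_velocity c \<gamma> (E v)" using E(2)[of \<gamma> v] \<gamma> by (simp add: velocity_def)
      have 1: "velocity X (\<lambda>r. s (\<gamma> r)) 0" "velocity Y (\<lambda>r. t (\<gamma> r)) 0"
        using velocity_differential[OF M X submersionD(1)[OF M X s qp] \<gamma>(2,1)]
          velocity_differential[OF M Y ta[OF qp] \<gamma>(2,1)] v' by simp_all
      have 2: "chart_velocity e (\<lambda>r. s (\<gamma> r)) 0" using 1(1) sq \<gamma>(1) by (simp add: velocity_def e_def)
      have 3: "chart_velocity e' (\<lambda>r. t (\<gamma> r)) 0"
        using E'(2)[of "\<lambda>r. t (\<gamma> r)" 0] 1(2) \<gamma>(1) linear_0[OF E'(1)] by (simp add: velocity_def)
      have "?F' z (E v) = 0"
        using chart_velocity_unique[OF coordinate_expression_derivative(1)[OF c(3) q(1) F(1) qT12(1) F(3,4) dF[OF qT] \<gamma>(1) cv] 2]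
        by (simp add: q(2))
      moreover have "?G' z (E v) = 0"
        using chart_velocity_unique[OF coordinate_expression_derivative(1)[OF c(3) q(1) G(1) qT12(2) G(3,4) dG[OF qT] \<gamma>(1) cv] 3]
        by (simp add: q(2))
      moreover have "frechet_derivative f (at z) = (\<lambda>v. (?F' z v, ?G' z v))"
        using frechet_derivative_at[OF df[OF z(2)]] by simp
      ultimately show ?thesis
        using chart_velocity_in_span[OF cv] by (simp add: V_def zero_prod_def)
    qed
    have subK: "subspace (K q)"
    proof -
      obtain A1 where A1: "linear A1" "\<And>v. v \<in> tangent M q \<Longrightarrow> differential M X s q v = A1 v"
        by (rule smooth_in_differential[OF M X submersionD(1)[OF M X s qp]]) blast
      obtain A2 where A2: "linear A2" "\<And>v. v \<in> tangent M q \<Longrightarrow> differential M Y t q v = A2 v"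
        by (rule smooth_in_differential[OF M Y ta[OF qp]]) blast
      have "K q = {v \<in> tangent M q. A1 v = 0 \<and> A2 v = 0}" unfolding K_def using A1(2) A2(2) by auto
      then show ?thesis
        using tangent_subspace[of M q] A1(1) A2(1) by (auto simp: subspace_def linear_0 linear_add linear_scale)
    qed
    have "inj_on E (K q)"
    proof (rule inj_onI)
      fix u w assume uw: "u \<in> K q" "w \<in> K q" "E u = E w"
      have "u - w \<in> tangent M q" using uw(1,2) by (auto simp: K_def intro: subspace_diff[OF tangent_subspace])
      moreover have "E (u - w) = 0" using uw(3) by (simp add: linear_diff[OF E(1)])
      ultimately show "u = w" using E(3)[of "u - w"] by (simp add: tangent_def)
    qed
    then have "dim (K q) = dim (E ` K q)"
      using dim_image_eq[OF E(1), of "K q"] subK by (simp add: span_eq_iff[THEN iffD2])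
    also have "\<dots> \<le> dim {v \<in> V. frechet_derivative f (at z) v = 0}"
      by (rule dim_subset) (use EK in blast)
    finally have "dim (K q) \<le> dim {v \<in> V. frechet_derivative f (at z) v = 0}" .
    moreover have "dim (K a) \<le> dim (K q)" by (rule rank[OF qp sq])
    ultimately show ?thesis using kerL by (simp add: F'_def G'_def)
  qed
  obtain T3 where T3: "open T3" "snd c a \<in> T3" "T3 \<subseteq> T"
    "\<And>z. z \<in> V \<Longrightarrow> z \<in> T3 \<Longrightarrow> R (f z) = R (f (snd c a)) \<Longrightarrow> f z = f (snd c a)"
    by (rule constant_rank[OF V sf z0 R RZ df[OF z0(1)] rank']) blast+
  \<comment> \<open>On \<open>T3\<close> the equation H = 0 has the same solutions in
    \<open>V\<close> as f = f (snd c a). In contrast to f, the values of \<open>H\<close> are known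
    to stay in the image of its linearisation, as \<open>level_set\<close> demands.\<close>
  define H where "H z = R (f z - f (snd c a))" for z
  have sH: "smooth_open T3 H"
  proof -
    have "smooth_open T3 (\<lambda>z. R (f z + - f (snd c a)))"
      by (intro smooth_open_linear_compose[OF R] smooth_open_add smooth_open_const smooth_open_subset[OF sf] T3)
    then show ?thesis by (simp add: H_def[abs_def])
  qed
  have dH: "(H has_derivative L) (at (snd c a))"
    using bounded_linear.has_derivative[OF R[unfolded linear_conv_bounded_linear]
        has_derivative_diff[OF df[OF z0(1)] has_derivative_const]]
    by (simp add: H_def[abs_def] L_def[abs_def] F'_def G'_def)
  have cV: "snd c q \<in> V" if "q \<in> fst c" for q unfolding V_def by (rule span_base[OF chart_image_mem[OF that]])
  have HZ: "H (snd c q) \<in> L ` span (chart_image c)" if "q \<in> fst c" "snd c q \<in> T3" for q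
    using RZ[OF cV[OF that(1)]] that(2) T3(3) by (auto simp: H_def L_def[abs_def] F'_def G'_def V_def)
  have A: "q \<in> A \<longleftrightarrow> H (snd c q) = 0" if q: "q \<in> fst c" "snd c q \<in> T3" for q
  proof -
    have qT: "snd c q \<in> T" using q(2) T3(3) by blast
    have "q \<in> A \<longleftrightarrow> s q = s a \<and> t q = t a" using qM[OF q(1)] a by (simp add: A_def)
    also have "\<dots> \<longleftrightarrow> snd e (s q) = snd e (s a) \<and> snd e' (t q) = snd e' (t a)"
      using chart_injD[OF e(3) FF(2)[OF q(1) qT] FF(2)[OF c(2) z0(1)]]
        chart_injD[OF e'(3) FF(4)[OF q(1) qT] FF(4)[OF c(2) z0(1)]] by simp
    also have "\<dots> \<longleftrightarrow> f (snd c q) = f (snd c a)"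
      using FF(1,3)[OF q(1) qT] FF(1,3)[OF c(2) z0(1)] by (simp add: f_def)
    also have "\<dots> \<longleftrightarrow> R (f (snd c q)) = R (f (snd c a))" using T3(4)[OF cV[OF q(1)] q(2)] by auto
    also have "\<dots> \<longleftrightarrow> H (snd c q) = 0" by (simp add: H_def linear_diff[OF R])
    finally show ?thesis .
  qed
  have aA: "a \<in> A" using a by (simp add: A_def)
  note level = level_set[OF M c(4,2) aA sH T3(2) dH HZ A]
  show "\<exists>c\<in>charts M. a \<in> fst c \<and> (\<exists>W. subspace W \<and> snd c ` (fst c \<inter> A) = chart_image c \<inter> W)"
    by (rule level(1))
  assume v: "v \<in> K a"
  then have "v \<in> span (chart_image c)" "L v = 0" using kerL by (auto simp: L_def V_def)
  then have "\<exists>\<gamma>. \<gamma> 0 = a \<and> chart_velocity c \<gamma> v \<and> (\<forall>\<^sub>F r in nhds 0. \<gamma> r \<in> A)"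
    by - (rule level(2); assumption)
  then obtain \<gamma> where \<gamma>: "\<gamma> 0 = a" "chart_velocity c \<gamma> v" "\<forall>\<^sub>F r in nhds 0. \<gamma> r \<in> A" by (elim exE conjE)
  show "\<exists>\<gamma>. \<gamma> 0 = a \<and> velocity M \<gamma> v \<and> (\<forall>\<^sub>F r in nhds 0. \<gamma> r \<in> A)"
    using \<gamma> by (intro exI[of _ \<gamma>]) (simp add: velocity_def c_def)
qed

text \<open>The one-point base makes \<open>fibre_embedded_constant_rank\<close> applicable to a single map.\<close>

definition point_manifold :: "(unit, real) manifold" where
  "point_manifold = \<lparr> points = UNIV, atlas = {(UNIV, \<lambda>_. 0)} \<rparr>"

lemma smooth_manifold_point: "smooth_manifold point_manifold"
proof -
  have im: "chart_image (UNIV, \<lambda>_::unit. 0::real) = {0}" by (auto simp: chart_image_def)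
  have ch: "is_chart (UNIV, \<lambda>_::unit. 0::real)"
    unfolding is_chart_def im by (auto intro!: exI[of _ "{0}"] simp: inj_on_def)
  have "compatible_charts (UNIV, \<lambda>_::unit. 0::real) (UNIV, \<lambda>_. 0)"
    unfolding compatible_charts_iff[OF ch ch] using smooth_at_id[OF ch] by simp
  then show ?thesis using ch by (simp add: smooth_manifold_def point_manifold_def)
qed

lemma surjective_submersion_point:
  assumes M: "smooth_manifold M" and "points M \<noteq> {}"
  shows "surjective_submersion M point_manifold (\<lambda>_. ())"
proof -
  note pt = smooth_manifold_point
  have sm: "smooth_in M point_manifold (\<lambda>_. ()) p" if "p \<in> points M" for p
    by (rule smooth_in_const[OF M pt that]) (simp add: point_manifold_def)
  have tan: "tangent point_manifold u = {0}" for u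
  proof -
    have "chart_at point_manifold u = (UNIV, \<lambda>_. 0)"
      using chart_at(1)[OF pt, of u] by (simp add: point_manifold_def)
    then have "chart_image (chart_at point_manifold u) = {0}" by (auto simp: chart_image_def)
    then show ?thesis by (simp add: tangent_def)
  qed
  have "differential M point_manifold (\<lambda>_. ()) p ` tangent M p = tangent point_manifold ()" if "p \<in> points M" for p
  proof -
    have "differential M point_manifold (\<lambda>_. ()) p ` tangent M p \<subseteq> {0}"
      using linear_between_differential[OF M pt sm[OF that]] by (simp add: linear_between_def tan)
    moreover have "tangent M p \<noteq> {}" using subspace_0[OF tangent_subspace[of M p]] by blast
    ultimately show ?thesis by (auto simp: tan)
  qed
  then show ?thesis
    unfolding surjective_submersion_def using sm smooth_map_iff[OF M pt] assms(2) by (auto simp: point_manifold_def)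
qed

text \<open>By constant rank every kernel vector is the velocity of a curve in a fibre of t.
  Injectivity reduces that fibre to a point, so the curve is constant and the vector is 0.\<close>

lemma injective_constant_rank_immersion:
  assumes M: "smooth_manifold M" and Y: "smooth_manifold Y" and t: "smooth_map M Y t"
    and inj: "inj_on t (points M)" and a: "a \<in> points M"
    and rank: "\<And>q. q \<in> points M \<Longrightarrow> dim (ker_differential M Y t a) \<le> dim (ker_differential M Y t q)"
    and v: "v \<in> tangent M a" "differential M Y t a v = 0"
  shows "v = 0"
proof -
  note pt = smooth_manifold_point
  have sub: "surjective_submersion M point_manifold (\<lambda>_. ())"
    by (rule surjective_submersion_point[OF M]) (use a in blast)
  have zero: "differential M point_manifold (\<lambda>_. ()) q u = 0" if qu: "q \<in> points M" "u \<in> tangent M q" for q u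
  proof -
    obtain \<gamma> where \<gamma>: "\<gamma> 0 = q" "velocity M \<gamma> u" by (rule tangent_velocity[OF M qu])
    show ?thesis
      by (rule differential_eqI[OF M pt submersionD(1)[OF M pt sub qu(1)] \<gamma>(2,1) velocity_const[OF pt]])
        (simp add: point_manifold_def)
  qed
  have K: "{u \<in> tangent M q. differential M point_manifold (\<lambda>_. ()) q u = 0 \<and> differential M Y t q u = 0} =
      ker_differential M Y t q" if "q \<in> points M" for q
    unfolding ker_differential_def using zero[OF that] by auto
  have "\<exists>\<gamma>. \<gamma> 0 = a \<and> velocity M \<gamma> v \<and> (\<forall>\<^sub>F r in nhds 0. \<gamma> r \<in> {q \<in> points M. () = () \<and> t q = t a})"
    by (rule fibre_embedded_constant_rank(2)[OF M pt Y sub t a refl refl]) (use rank K a zero v in \<open>simp_all add: ker_differential_def\<close>)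
  then obtain \<gamma> where \<gamma>: "\<gamma> 0 = a" "velocity M \<gamma> v" "\<forall>\<^sub>F r in nhds 0. \<gamma> r \<in> {q \<in> points M. () = () \<and> t q = t a}"
    by (elim exE conjE)
  have "\<forall>\<^sub>F r in nhds 0. \<gamma> r = a"
    using \<gamma>(3) by eventually_elim (use inj a in \<open>auto dest: inj_onD\<close>)
  then have "velocity M (\<lambda>r. a) v" by (rule velocity_cong[OF \<gamma>(2)])
  then show ?thesis by (rule velocity_unique[OF _ velocity_const[OF M a]])
qed

text \<open>In coordinates an immersion has a smooth local left inverse, and h is this left inverse
  applied to f. The hypothesis \<open>cont\<close> keeps h within the region where the left inverse
  is valid.\<close>

lemma smooth_in_lift_immersion:
  fixes N :: "('b, 'f::euclidean_space) manifold" and P :: "('p, 'q::euclidean_space) manifold"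
    and K :: "('k, 'e::euclidean_space) manifold"
  assumes N: "smooth_manifold N" and P: "smooth_manifold P" and K: "smooth_manifold K"
    and j: "smooth_in N P j (h p)"
    and ker: "\<And>v. v \<in> tangent N (h p) \<Longrightarrow> differential N P j (h p) v = 0 \<Longrightarrow> v = 0"
    and f: "smooth_in K P f p" and eq: "\<And>q. q \<in> points K \<Longrightarrow> j (h q) = f q"
    and cont: "\<And>S. nbhd N (h p) S \<Longrightarrow> nbhd K p {q. h q \<in> S}"
  shows "smooth_in K N h p"
proof -
  have p: "p \<in> points K" by (rule smooth_in_mem[OF K P f])
  have hp: "h p \<in> points N" by (rule smooth_in_mem[OF N P j])
  have jp: "j (h p) \<in> points P" by (rule smooth_in_mem[OF N P j])
  define c d k where "c = chart_at N (h p)" and "d = chart_at P (j (h p))" and "k = chart_at K p"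
  have c: "h p \<in> fst c" "is_chart c" "c \<in> charts N" unfolding c_def using chart_at(2-4)[OF N hp] .
  have d: "j (h p) \<in> fst d" "is_chart d" "d \<in> charts P" unfolding d_def using chart_at(2-4)[OF P jp] .
  have k: "p \<in> fst k" "is_chart k" "k \<in> charts K" unfolding k_def using chart_at(2-4)[OF K p] .
  have sj: "smooth_at c d j (h p)" by (rule smooth_in_charts[OF N P j c(3,1) d(3,1)])
  have sf: "smooth_at k d f p"
    by (rule smooth_in_charts[OF K P f k(3,1) d(3)]) (use d(1) eq[OF p] in simp)
  obtain T F where F: "smooth_open T F" "snd c (h p) \<in> T" "\<And>q. q \<in> fst c \<Longrightarrow> snd c q \<in> T \<Longrightarrow> j q \<in> fst d"
    "\<And>q. q \<in> fst c \<Longrightarrow> snd c q \<in> T \<Longrightarrow> F (snd c q) = snd d (j q)"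
    by (rule smooth_atE_ext[OF c(2) sj]) blast
  obtain T' G where G: "smooth_open T' G" "snd k p \<in> T'" "\<And>q. q \<in> fst k \<Longrightarrow> snd k q \<in> T' \<Longrightarrow> f q \<in> fst d"
    "\<And>q. q \<in> fst k \<Longrightarrow> snd k q \<in> T' \<Longrightarrow> G (snd k q) = snd d (f q)"
    by (rule smooth_atE_ext[OF k(2) sf]) blast
  define V where "V = span (chart_image c)"
  have V: "subspace V" "snd c (h p) \<in> V" unfolding V_def using c(1) by (auto intro: span_base chart_image_mem)
  define F' where "F' = frechet_derivative F (at (snd c (h p)))"
  have dF: "(F has_derivative F') (at (snd c (h p)))" unfolding F'_def by (rule smooth_open_has_derivative[OF F(1,2)])
  have linF: "linear F'" using dF by (rule has_derivative_linear)
  have difF: "differential N P j (h p) u = F' u" if "u \<in> V" for u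
    using coordinate_expression_derivative(2)[OF c(2,1) F dF, of u] that
    by (simp add: differential_def V_def c_def d_def)
  have "inj_on F' V"
  proof (rule inj_onI)
    fix u w assume uw: "u \<in> V" "w \<in> V" "F' u = F' w"
    have "u - w \<in> V" using V(1) uw by (intro subspace_diff)
    moreover have "F' (u - w) = 0" using uw(3) by (simp add: linear_diff[OF linF])
    ultimately show "u = w" using ker[of "u - w"] difF[of "u - w"] by (simp add: V_def tangent_def c_def)
  qed
  then obtain g where g: "linear g" "\<And>v. v \<in> V \<Longrightarrow> g (F' v) = v"
    using linear_exists_left_inverse_on[OF linF V(1)] by blast
  obtain Q where Q: "linear Q" "range Q \<subseteq> V" "\<And>w. w \<in> V \<Longrightarrow> Q w = w" by (rule subspace_projection[OF V(1)]) blast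
  define B where "B = {z \<in> T. Q z \<in> T}"
  \<comment> \<open>\<open>g\<close> is a linear left inverse of the derivative of F on
    \<open>V\<close> and \<open>Q\<close> projects onto \<open>V\<close>. The summand z - Q z makes
    the derivative the identity on the whole ambient space, so the inverse function theorem applies;
    on \<open>V\<close> it vanishes and only g F remains.\<close>
  define \<psi> where "\<psi> z = g (F (Q z)) + (z - Q z)" for z
  have T: "open T" using F(1) by (simp add: smooth_open_def)
  have B: "open B" unfolding B_def by (rule smooth_open_vimage[OF smooth_open_linear[OF Q(1) T] T])
  have lin: "linear (\<lambda>z. z - Q z)" using Q(1) by (intro linear_compose_sub linear_ident)
  have s\<psi>: "smooth_open B \<psi>"
  proof -
    have "smooth_open B (\<lambda>z. F (Q z))"
      by (rule smooth_open_compose[OF smooth_open_linear[OF Q(1) B] F(1)]) (auto simp: B_def)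
    then show ?thesis
      unfolding \<psi>_def[abs_def] by (intro smooth_open_add smooth_open_linear_compose[OF g(1)] smooth_open_linear[OF lin B])
  qed
  have d\<psi>: "(\<psi> has_derivative (\<lambda>v. v)) (at (snd c (h p)))"
  proof -
    have bl: "bounded_linear Q" "bounded_linear g" "bounded_linear (\<lambda>z. z - Q z)"
      using Q(1) g(1) lin by (simp_all add: linear_conv_bounded_linear)
    have "((\<lambda>z. F (Q z)) has_derivative (\<lambda>v. F' (Q v))) (at (snd c (h p)))"
      by (rule has_derivative_compose[OF bounded_linear_imp_has_derivative[OF bl(1)]]) (simp add: Q(3)[OF V(2)] dF)
    from has_derivative_add[OF bounded_linear.has_derivative[OF bl(2) this] bounded_linear_imp_has_derivative[OF bl(3)]]
    have "(\<psi> has_derivative (\<lambda>v. g (F' (Q v)) + (v - Q v))) (at (snd c (h p)))" unfolding \<psi>_def[abs_def] .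
    moreover have "g (F' (Q v)) = Q v" for v using g(2) Q(2) by blast
    ultimately show ?thesis by simp
  qed
  have "snd c (h p) \<in> B" using F(2) Q(3)[OF V(2)] by (simp add: B_def)
  moreover have "inj (frechet_derivative \<psi> (at (snd c (h p))))"
    by (subst frechet_derivative_at[OF d\<psi>, symmetric]) (rule inj_on_id2)
  ultimately obtain U O1 \<psi>i where U: "smooth_open U \<psi>" "U \<subseteq> B" "snd c (h p) \<in> U" "homeomorphism U O1 \<psi> \<psi>i" "smooth_open O1 \<psi>i"
    by (rule smooth_inverse_function[OF s\<psi>]) blast
  have O1: "\<psi> z \<in> O1" "\<psi>i (\<psi> z) = z" if "z \<in> U" for z using U(4) that by (auto simp: homeomorphism_def)
  have \<psi>_eq: "\<psi> (snd c (h q)) = g (snd d (f q))" if "q \<in> points K" "h q \<in> fst c" "snd c (h q) \<in> U" for q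
  proof -
    have "snd c (h q) \<in> V" unfolding V_def by (rule span_base[OF chart_image_mem[OF that(2)]])
    moreover have "snd c (h q) \<in> T" using that(3) U(2) by (auto simp: B_def)
    ultimately show ?thesis using F(4)[OF that(2)] eq[OF that(1)] Q(3) by (simp add: \<psi>_def)
  qed
  have nb: "nbhd N (h p) {n \<in> fst c. snd c n \<in> U}"
    by (rule nbhd_shrinkI[OF N c(3,1) _ U(3)]) (use U(1) in \<open>simp_all add: smooth_open_def\<close>)
  \<comment> \<open>Continuity of h enters here: without it h q could lie far from h p while j (h q)
    is close to j (h p).\<close>
  obtain T2 where T2: "open T2" "snd k p \<in> T2" "\<And>q. q \<in> fst k \<Longrightarrow> snd k q \<in> T2 \<Longrightarrow> q \<in> {q. h q \<in> {n \<in> fst c. snd c n \<in> U}}"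
    by (rule nbhd_chart[OF K cont[OF nb] k(3,1)]) blast
  define W where "W = {z \<in> T'. g (G z) \<in> O1} \<inter> T2"
  have sgG: "smooth_open T' (\<lambda>z. g (G z))" by (rule smooth_open_linear_compose[OF g(1) G(1)])
  have "open {z \<in> T'. g (G z) \<in> O1}" using smooth_open_vimage[OF sgG] U(5) by (simp add: smooth_open_def)
  then have "open W" unfolding W_def using T2(1) by (rule open_Int)
  then have "smooth_open W (\<lambda>z. g (G z))" by (rule smooth_open_subset[OF sgG]) (auto simp: W_def)
  then have sW: "smooth_open W (\<lambda>z. \<psi>i (g (G z)))" by (rule smooth_open_compose[OF _ U(5)]) (auto simp: W_def)
  have kp: "q \<in> points K" if "q \<in> fst k" for q using smooth_manifoldD(5)[OF K k(3)] that by blast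
  have "smooth_at k c h p"
  proof (rule smooth_atI_ext[OF k(2,1) sW])
    have "g (G (snd k p)) = \<psi> (snd c (h p))" using \<psi>_eq[OF p c(1) U(3)] G(4)[OF k(1) G(2)] by simp
    then show "snd k p \<in> W" using G(2) T2(2) O1(1)[OF U(3)] by (simp add: W_def)
    fix q assume q: "q \<in> fst k" "snd k q \<in> W"
    then have hq: "h q \<in> fst c" "snd c (h q) \<in> U" using T2(3)[OF q(1)] by (simp_all add: W_def)
    then show "h q \<in> fst c" by simp
    have "g (G (snd k q)) = \<psi> (snd c (h q))" using \<psi>_eq[OF kp[OF q(1)] hq] G(4)[OF q(1)] q(2) by (simp add: W_def)
    then show "\<psi>i (g (G (snd k q))) = snd c (h q)" using O1(2)[OF hq(2)] by simp
  qed
  then show ?thesis by (rule smooth_inI[OF k(3) c(3)])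
qed

section \<open>Lie groupoids and their isotropy groups\<close>

locale lie_gpd =
  fixes G :: "('a, 'e::euclidean_space, 'x, 'd::euclidean_space, 'z) lie_groupoid_scheme"
  assumes lie: "lie_groupoid G"
begin

abbreviation "\<Sigma> \<equiv> arrows G"

lemma smooth_manifolds: "smooth_manifold \<Sigma>" "smooth_manifold (base G)"
  using lie by (simp_all add: lie_groupoid_def Let_def)

lemma submersions: "surjective_submersion \<Sigma> (base G) (src G)" "surjective_submersion \<Sigma> (base G) (tgt G)"
  using lie by (simp_all add: lie_groupoid_def Let_def)

lemma smooth_mult: "smooth_map (composable G) \<Sigma> (\<lambda>(g, h). mult G g h)"
  using lie by (simp add: lie_groupoid_def Let_def)

lemma smooth_ginv: "smooth_map \<Sigma> \<Sigma> (ginv G)"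
  using lie by (simp add: lie_groupoid_def Let_def)

lemma src_tgt_base: "g \<in> points \<Sigma> \<Longrightarrow> src G g \<in> points (base G)" "g \<in> points \<Sigma> \<Longrightarrow> tgt G g \<in> points (base G)"
  by (fact submersionD(2)[OF smooth_manifolds submersions(1)], fact submersionD(2)[OF smooth_manifolds submersions(2)])

lemma smooth_in_src: "g \<in> points \<Sigma> \<Longrightarrow> smooth_in \<Sigma> (base G) (src G) g"
  by (rule submersionD(1)[OF smooth_manifolds submersions(1)])

lemma smooth_in_tgt: "g \<in> points \<Sigma> \<Longrightarrow> smooth_in \<Sigma> (base G) (tgt G) g"
  by (rule submersionD(1)[OF smooth_manifolds submersions(2)])

lemma smooth_in_ginv: "g \<in> points \<Sigma> \<Longrightarrow> smooth_in \<Sigma> \<Sigma> (ginv G) g"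
  using smooth_ginv smooth_map_iff[OF smooth_manifolds(1) smooth_manifolds(1)] by blast

lemma src_mult: "g \<in> points \<Sigma> \<Longrightarrow> h \<in> points \<Sigma> \<Longrightarrow> src G g = tgt G h \<Longrightarrow> src G (mult G g h) = src G h"
  using lie by (simp add: lie_groupoid_def Let_def)

lemma tgt_mult: "g \<in> points \<Sigma> \<Longrightarrow> h \<in> points \<Sigma> \<Longrightarrow> src G g = tgt G h \<Longrightarrow> tgt G (mult G g h) = tgt G g"
  using lie by (simp add: lie_groupoid_def Let_def)

lemma mult_assoc: "g \<in> points \<Sigma> \<Longrightarrow> h \<in> points \<Sigma> \<Longrightarrow> k \<in> points \<Sigma> \<Longrightarrow> src G g = tgt G h \<Longrightarrow> src G h = tgt G k \<Longrightarrow>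
    mult G (mult G g h) k = mult G g (mult G h k)"
  using lie by (simp add: lie_groupoid_def Let_def)

lemma mult_unit: "g \<in> points \<Sigma> \<Longrightarrow> mult G (unit_of G (tgt G g)) g = g"
    "g \<in> points \<Sigma> \<Longrightarrow> mult G g (unit_of G (src G g)) = g"
  using lie by (simp_all add: lie_groupoid_def Let_def)

lemma src_tgt_ginv: "g \<in> points \<Sigma> \<Longrightarrow> src G (ginv G g) = tgt G g" "g \<in> points \<Sigma> \<Longrightarrow> tgt G (ginv G g) = src G g"
  using lie by (simp_all add: lie_groupoid_def Let_def)

lemma mult_ginv: "g \<in> points \<Sigma> \<Longrightarrow> mult G g (ginv G g) = unit_of G (tgt G g)"
    "g \<in> points \<Sigma> \<Longrightarrow> mult G (ginv G g) g = unit_of G (src G g)"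
  using lie by (simp_all add: lie_groupoid_def Let_def)

lemma ginv_points: "g \<in> points \<Sigma> \<Longrightarrow> ginv G g \<in> points \<Sigma>"
  using smooth_ginv by (auto simp: smooth_map_def)

lemma unit_points: "u \<in> points (base G) \<Longrightarrow> unit_of G u \<in> points \<Sigma>"
  using lie by (auto simp: lie_groupoid_def Let_def smooth_map_def)

lemma src_tgt_unit: "u \<in> points (base G) \<Longrightarrow> src G (unit_of G u) = u" "u \<in> points (base G) \<Longrightarrow> tgt G (unit_of G u) = u"
  using lie by (simp_all add: lie_groupoid_def Let_def)

sublocale comp: fibred_pair \<Sigma> \<Sigma> "base G" "src G" "tgt G"
  using smooth_manifolds submersions by unfold_locales (simp_all add: surjective_submersion_def)

lemma composable_eq: "composable G = fibre_product \<Sigma> \<Sigma> (src G) (tgt G)"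
  by (simp add: composable_def)

lemma composable_iff: "(g, h) \<in> points (composable G) \<longleftrightarrow> g \<in> points \<Sigma> \<and> h \<in> points \<Sigma> \<and> src G g = tgt G h"
  by (simp add: composable_eq comp.points_C)

lemma smooth_in_mult: "(g, h) \<in> points (composable G) \<Longrightarrow> smooth_in (composable G) \<Sigma> (\<lambda>(g, h). mult G g h) (g, h)"
  using smooth_mult smooth_map_iff[OF comp.manifold_C smooth_manifolds(1)] unfolding composable_eq by blast

lemma mult_points:
  assumes "g \<in> points \<Sigma>" "h \<in> points \<Sigma>" "src G g = tgt G h" shows "mult G g h \<in> points \<Sigma>"
proof -
  have "(g, h) \<in> points (composable G)" using assms by (simp add: composable_iff)
  then show ?thesis using smooth_mult by (force simp: smooth_map_def)
qed

lemma ginv_mult_cancel: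
  assumes "g \<in> points \<Sigma>" "h \<in> points \<Sigma>" "src G g = tgt G h"
  shows "mult G (ginv G g) (mult G g h) = h"
  using assms mult_assoc[of "ginv G g" g h] by (simp add: ginv_points src_tgt_ginv mult_ginv mult_unit)

lemma mult_ginv_cancel:
  assumes "g \<in> points \<Sigma>" "h \<in> points \<Sigma>" "src G g = src G h"
  shows "mult G (mult G g (ginv G h)) h = g"
  using assms mult_assoc[of g "ginv G h" h] by (simp add: ginv_points src_tgt_ginv mult_ginv mult_unit flip: assms(3))

lemma velocity_mult:
  assumes "velocity \<Sigma> \<gamma> v" "velocity \<Sigma> \<delta> w" "\<forall>\<^sub>F r in nhds 0. (\<gamma> r, \<delta> r) \<in> points (composable G)"
  obtains \<xi> where "\<xi> \<in> tangent (composable G) (\<gamma> 0, \<delta> 0)"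
    "differential (composable G) \<Sigma> fst (\<gamma> 0, \<delta> 0) \<xi> = v" "differential (composable G) \<Sigma> snd (\<gamma> 0, \<delta> 0) \<xi> = w"
    "v = 0 \<Longrightarrow> w = 0 \<Longrightarrow> \<xi> = 0"
    "velocity \<Sigma> (\<lambda>r. mult G (\<gamma> r) (\<delta> r)) (differential (composable G) \<Sigma> (\<lambda>(a, b). mult G a b) (\<gamma> 0, \<delta> 0) \<xi>)"
proof -
  have mem: "(\<gamma> 0, \<delta> 0) \<in> points (composable G)" using assms(3) by (rule eventually_nhds_x_imp_x)
  obtain \<xi> where \<xi>: "velocity (composable G) (\<lambda>r. (\<gamma> r, \<delta> r)) \<xi>" "\<xi> \<in> tangent (composable G) (\<gamma> 0, \<delta> 0)"
    "differential (composable G) \<Sigma> fst (\<gamma> 0, \<delta> 0) \<xi> = v" "differential (composable G) \<Sigma> snd (\<gamma> 0, \<delta> 0) \<xi> = w"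
    "v = 0 \<Longrightarrow> w = 0 \<Longrightarrow> \<xi> = 0"
    using comp.velocity_C[OF assms[unfolded composable_eq]] unfolding composable_eq by blast
  have "velocity \<Sigma> (\<lambda>r. (\<lambda>(g, h). mult G g h) (\<gamma> r, \<delta> r)) (differential (composable G) \<Sigma> (\<lambda>(a, b). mult G a b) (\<gamma> 0, \<delta> 0) \<xi>)"
    by (rule velocity_differential[OF comp.manifold_C[folded composable_eq] smooth_manifolds(1) smooth_in_mult[OF mem] \<xi>(1) refl])
  then show thesis using that[OF \<xi>(2-5)] by simp
qed

text \<open>The kernel of the differential of (t, s). At a unit it is the Lie algebra of the
  isotropy group.\<close>

definition anchor_kernel :: "'a \<Rightarrow> 'e set" where
  "anchor_kernel q = {v \<in> tangent \<Sigma> q. differential \<Sigma> (base G) (src G) q v = 0 \<and> differential \<Sigma> (base G) (tgt G) q v = 0}"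

lemma subspace_anchor_kernel:
  assumes q: "q \<in> points \<Sigma>" shows "subspace (anchor_kernel q)"
proof -
  obtain A1 where A1: "linear A1" "\<And>v. v \<in> tangent \<Sigma> q \<Longrightarrow> differential \<Sigma> (base G) (src G) q v = A1 v"
    by (rule smooth_in_differential[OF smooth_manifolds smooth_in_src[OF q]]) blast
  obtain A2 where A2: "linear A2" "\<And>v. v \<in> tangent \<Sigma> q \<Longrightarrow> differential \<Sigma> (base G) (tgt G) q v = A2 v"
    by (rule smooth_in_differential[OF smooth_manifolds smooth_in_tgt[OF q]]) blast
  have "anchor_kernel q = {v \<in> tangent \<Sigma> q. A1 v = 0 \<and> A2 v = 0}" unfolding anchor_kernel_def using A1(2) A2(2) by auto
  then show ?thesis
    using tangent_subspace[of \<Sigma> q] A1(1) A2(1) by (auto simp: subspace_def linear_0 linear_add linear_scale)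
qed

text \<open>Left translation by \<open>g\<close>, which is only defined on a fibre of the target map, acts on \<open>anchor_kernel\<close> through
  the tangent vectors of the composable pairs that are killed by the first projection.\<close>

lemma dim_anchor_kernel_mult:
  assumes gh: "(g, h) \<in> points (composable G)"
  shows "dim (anchor_kernel h) \<le> dim (anchor_kernel (mult G g h))"
proof -
  let ?C = "composable G" and ?X = "base G"
  note C = comp.manifold_C[folded composable_eq] and \<Sigma> = smooth_manifolds(1) and X = smooth_manifolds(2)
  have m: "g \<in> points \<Sigma>" "h \<in> points \<Sigma>" "src G g = tgt G h" using gh by (simp_all add: composable_iff)
  have ghp: "mult G g h \<in> points \<Sigma>" by (rule mult_points[OF m])
  obtain \<alpha> where \<alpha>: "linear \<alpha>" "\<And>v. v \<in> tangent ?C (g, h) \<Longrightarrow> differential ?C \<Sigma> fst (g, h) v = \<alpha> v"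
    by (rule smooth_in_differential[OF C \<Sigma> comp.smooth_fst[folded composable_eq, OF gh]]) blast
  obtain \<beta> where \<beta>: "linear \<beta>" "\<And>v. v \<in> tangent ?C (g, h) \<Longrightarrow> differential ?C \<Sigma> snd (g, h) v = \<beta> v"
    by (rule smooth_in_differential[OF C \<Sigma> comp.smooth_snd[folded composable_eq, OF gh]]) blast
  obtain \<mu> where \<mu>: "linear \<mu>" "\<And>v. v \<in> tangent ?C (g, h) \<Longrightarrow> differential ?C \<Sigma> (\<lambda>(g, h). mult G g h) (g, h) v = \<mu> v"
    by (rule smooth_in_differential[OF C \<Sigma> smooth_in_mult[OF gh]]) blast
  \<comment> \<open>Pairs of the zero vector at g and a vector in the kernel at h. The second
    projection maps \<open>S\<close> onto the kernel at h, and the differential of the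
    multiplication maps it injectively into the kernel at the product.\<close>
  define S where "S = {\<xi> \<in> tangent ?C (g, h). \<alpha> \<xi> = 0 \<and> \<beta> \<xi> \<in> anchor_kernel h}"
  have S: "subspace S"
    unfolding S_def using tangent_subspace[of ?C "(g, h)"] subspace_anchor_kernel[OF m(2)] \<alpha>(1) \<beta>(1)
    by (auto simp: subspace_def linear_0 linear_add linear_scale)
  have curve: "\<exists>\<gamma> \<delta>. \<gamma> 0 = g \<and> \<delta> 0 = h \<and> velocity \<Sigma> \<gamma> (\<alpha> \<xi>) \<and> velocity \<Sigma> \<delta> (\<beta> \<xi>) \<and>
      velocity \<Sigma> (\<lambda>r. mult G (\<gamma> r) (\<delta> r)) (\<mu> \<xi>) \<and> (\<forall>\<^sub>F r in nhds 0. (\<gamma> r, \<delta> r) \<in> points ?C)"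
    if \<xi>: "\<xi> \<in> tangent ?C (g, h)" for \<xi>
  proof -
    obtain c where c: "c 0 = (g, h)" "velocity ?C c \<xi>" by (rule tangent_velocity[OF C gh \<xi>])
    have "velocity \<Sigma> (\<lambda>r. fst (c r)) (\<alpha> \<xi>)" "velocity \<Sigma> (\<lambda>r. snd (c r)) (\<beta> \<xi>)" "\<forall>\<^sub>F r in nhds 0. c r \<in> points ?C"
      using comp.velocity_CD[folded composable_eq, OF c(2)] c(1) gh \<alpha>(2)[OF \<xi>] \<beta>(2)[OF \<xi>] by simp_all
    moreover have "velocity \<Sigma> (\<lambda>r. (\<lambda>(g, h). mult G g h) (c r)) (\<mu> \<xi>)"
      using velocity_differential[OF C \<Sigma> smooth_in_mult[OF gh] c(2,1)] \<mu>(2)[OF \<xi>] by simp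
    ultimately show ?thesis
      using c(1) by (intro exI[of _ "\<lambda>r. fst (c r)"] exI[of _ "\<lambda>r. snd (c r)"]) (simp add: case_prod_beta)
  qed
  have surj: "anchor_kernel h \<subseteq> \<beta> ` S"
  proof
    fix w assume w: "w \<in> anchor_kernel h"
    have "differential \<Sigma> ?X (src G) g 0 = 0"
    proof -
      obtain A where "linear A" "\<And>v. v \<in> tangent \<Sigma> g \<Longrightarrow> differential \<Sigma> ?X (src G) g v = A v"
        by (rule smooth_in_differential[OF \<Sigma> X smooth_in_src[OF m(1)]]) blast
      then show ?thesis using subspace_0[OF tangent_subspace[of \<Sigma> g]] by (simp add: linear_0)
    qed
    then have "differential \<Sigma> ?X (src G) g 0 = differential \<Sigma> ?X (tgt G) h w" using w by (simp add: anchor_kernel_def)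
    moreover have "w \<in> tangent \<Sigma> h" using w by (simp add: anchor_kernel_def)
    ultimately obtain \<gamma> \<delta> where c: "\<gamma> 0 = g" "\<delta> 0 = h" "velocity \<Sigma> \<gamma> 0" "velocity \<Sigma> \<delta> w"
      "\<forall>\<^sub>F r in nhds 0. (\<gamma> r, \<delta> r) \<in> points ?C"
      using comp.tangent_C_exists[folded composable_eq, OF gh subspace_0[OF tangent_subspace]] by blast
    obtain \<xi> where "\<xi> \<in> tangent ?C (g, h)" "\<alpha> \<xi> = 0" "\<beta> \<xi> = w"
      by (rule velocity_mult[OF c(3-5)]) (use \<alpha>(2) \<beta>(2) c(1,2) in auto)
    then show "w \<in> \<beta> ` S" using w by (auto simp: S_def)
  qed
  have inj: "inj_on \<mu> S"
  proof (rule inj_onI)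
    fix \<xi> \<eta> assume "\<xi> \<in> S" "\<eta> \<in> S" "\<mu> \<xi> = \<mu> \<eta>"
    then have d: "\<xi> - \<eta> \<in> S" "\<mu> (\<xi> - \<eta>) = 0" using subspace_diff[OF S] by (simp_all add: linear_diff[OF \<mu>(1)])
    define \<zeta> where "\<zeta> = \<xi> - \<eta>"
    have \<zeta>: "\<zeta> \<in> tangent ?C (g, h)" "\<alpha> \<zeta> = 0" "\<mu> \<zeta> = 0" using d by (simp_all add: \<zeta>_def S_def)
    obtain \<gamma> \<delta> where c: "\<gamma> 0 = g" "\<delta> 0 = h" "velocity \<Sigma> \<gamma> 0" "velocity \<Sigma> \<delta> (\<beta> \<zeta>)"
      "velocity \<Sigma> (\<lambda>r. mult G (\<gamma> r) (\<delta> r)) 0" "\<forall>\<^sub>F r in nhds 0. (\<gamma> r, \<delta> r) \<in> points ?C"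
      using curve[OF \<zeta>(1)] unfolding \<zeta>(2,3) by (elim exE conjE)
    have "differential \<Sigma> \<Sigma> (ginv G) g 0 = 0"
      using velocity_unique[OF velocity_differential[OF \<Sigma> \<Sigma> smooth_in_ginv[OF m(1)] velocity_const[OF \<Sigma> m(1)] refl]
          velocity_const[OF \<Sigma> ginv_points[OF m(1)]]] .
    \<comment> \<open>The first factor has velocity 0 but need not be constant, so the second factor
      is recovered by multiplying with the moving inverse of the first one.\<close>
    then have 1: "velocity \<Sigma> (\<lambda>r. ginv G (\<gamma> r)) 0"
      using velocity_differential[OF \<Sigma> \<Sigma> smooth_in_ginv[OF m(1)] c(3,1)] by simp
    have 2: "\<forall>\<^sub>F r in nhds 0. (ginv G (\<gamma> r), mult G (\<gamma> r) (\<delta> r)) \<in> points ?C"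
      using c(6) by eventually_elim (simp add: composable_iff ginv_points mult_points src_tgt_ginv tgt_mult)
    have 3: "velocity \<Sigma> (\<lambda>r. mult G (ginv G (\<gamma> r)) (mult G (\<gamma> r) (\<delta> r))) 0"
    proof (rule velocity_mult[OF 1 c(5) 2])
      fix \<epsilon> let ?D = "differential (composable G) \<Sigma> (\<lambda>(a, b). mult G a b) (ginv G (\<gamma> 0), mult G (\<gamma> 0) (\<delta> 0))"
      assume \<epsilon>: "(0::'e) = 0 \<Longrightarrow> (0::'e) = 0 \<Longrightarrow> \<epsilon> = 0"
        "velocity \<Sigma> (\<lambda>r. mult G (ginv G (\<gamma> r)) (mult G (\<gamma> r) (\<delta> r))) (?D \<epsilon>)"
      have mem: "(ginv G (\<gamma> 0), mult G (\<gamma> 0) (\<delta> 0)) \<in> points ?C" using 2 by (rule eventually_nhds_x_imp_x)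
      have "?D 0 = 0"
        by (rule differential_eqI[OF C \<Sigma> smooth_in_mult[OF mem] velocity_const[OF C mem] refl])
          (use mem in \<open>simp add: velocity_const[OF \<Sigma>] mult_points composable_iff\<close>)
      then show ?thesis using \<epsilon> by simp
    qed
    have "\<forall>\<^sub>F r in nhds 0. mult G (ginv G (\<gamma> r)) (mult G (\<gamma> r) (\<delta> r)) = \<delta> r"
      using c(6) by eventually_elim (simp add: composable_iff ginv_mult_cancel)
    then have "velocity \<Sigma> \<delta> 0" by (rule velocity_cong[OF 3])
    then have "\<beta> \<zeta> = 0" using velocity_unique[OF c(4)] by simp
    then have "\<zeta> = 0"
      using comp.tangent_C_eq_0[folded composable_eq, OF gh \<zeta>(1)] \<alpha>(2)[OF \<zeta>(1)] \<beta>(2)[OF \<zeta>(1)] \<zeta>(2) by simp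
    then show "\<xi> = \<eta>" by (simp add: \<zeta>_def)
  qed
  have into: "\<mu> ` S \<subseteq> anchor_kernel (mult G g h)"
  proof (rule image_subsetI)
    fix \<xi> assume "\<xi> \<in> S"
    then have \<xi>: "\<xi> \<in> tangent ?C (g, h)" "\<alpha> \<xi> = 0" "\<beta> \<xi> \<in> anchor_kernel h" by (simp_all add: S_def)
    obtain \<gamma> \<delta> where c: "\<gamma> 0 = g" "\<delta> 0 = h" "velocity \<Sigma> \<gamma> 0" "velocity \<Sigma> \<delta> (\<beta> \<xi>)"
      "velocity \<Sigma> (\<lambda>r. mult G (\<gamma> r) (\<delta> r)) (\<mu> \<xi>)" "\<forall>\<^sub>F r in nhds 0. (\<gamma> r, \<delta> r) \<in> points ?C"
      using curve[OF \<xi>(1)] unfolding \<xi>(2) by (elim exE conjE)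
    have 0: "differential \<Sigma> ?X (tgt G) g 0 = 0"
      using velocity_unique[OF velocity_differential[OF \<Sigma> X smooth_in_tgt[OF m(1)] velocity_const[OF \<Sigma> m(1)] refl]
          velocity_const[OF X src_tgt_base(2)[OF m(1)]]] .
    have 1: "velocity ?X (\<lambda>r. src G (\<delta> r)) 0" "velocity ?X (\<lambda>r. tgt G (\<gamma> r)) 0"
      using velocity_differential[OF \<Sigma> X smooth_in_src[OF m(2)] c(4,2)]
        velocity_differential[OF \<Sigma> X smooth_in_tgt[OF m(1)] c(3,1)] \<xi>(3) 0 by (simp_all add: anchor_kernel_def)
    have ev: "\<forall>\<^sub>F r in nhds 0. src G (\<delta> r) = src G (mult G (\<gamma> r) (\<delta> r))"
      "\<forall>\<^sub>F r in nhds 0. tgt G (\<gamma> r) = tgt G (mult G (\<gamma> r) (\<delta> r))"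
      using c(6) by (eventually_elim, simp add: composable_iff src_mult tgt_mult)+
    have 2: "velocity ?X (\<lambda>r. src G (mult G (\<gamma> r) (\<delta> r))) 0" "velocity ?X (\<lambda>r. tgt G (mult G (\<gamma> r) (\<delta> r))) 0"
      by (rule velocity_cong[OF 1(1) ev(1)], rule velocity_cong[OF 1(2) ev(2)])
    have gh0: "mult G (\<gamma> 0) (\<delta> 0) = mult G g h" using c by simp
    have "differential \<Sigma> ?X (src G) (mult G g h) (\<mu> \<xi>) = 0" "differential \<Sigma> ?X (tgt G) (mult G g h) (\<mu> \<xi>) = 0"
      using differential_eqI[OF \<Sigma> X smooth_in_src[OF ghp] c(5) gh0 2(1)]
        differential_eqI[OF \<Sigma> X smooth_in_tgt[OF ghp] c(5) gh0 2(2)] .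
    then show "\<mu> \<xi> \<in> anchor_kernel (mult G g h)" using velocity_tangent[OF c(5)] by (simp add: anchor_kernel_def gh0)
  qed
  have "dim (anchor_kernel h) \<le> dim (\<beta> ` S)" using surj by (rule dim_subset)
  also have "\<dots> \<le> dim S" by (rule dim_image_le[OF \<beta>(1)])
  also have "\<dots> = dim (\<mu> ` S)"
    using dim_image_eq[OF \<mu>(1), of S] inj S by (simp add: span_eq_iff[THEN iffD2])
  also have "\<dots> \<le> dim (anchor_kernel (mult G g h))" using into by (rule dim_subset)
  finally show ?thesis .
qed

text \<open>The estimate required along the source fibre holds because any arrow q with source x is
  the left translate of a by q a^{-1}.\<close>

lemma isotropy_local:
  assumes a: "a \<in> isotropy G x"
  shows "\<exists>c\<in>charts \<Sigma>. a \<in> fst c \<and> (\<exists>W. subspace W \<and> snd c ` (fst c \<inter> isotropy G x) = chart_image c \<inter> W)"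
    and "v \<in> anchor_kernel a \<Longrightarrow> \<exists>\<gamma>. \<gamma> 0 = a \<and> velocity \<Sigma> \<gamma> v \<and> (\<forall>\<^sub>F r in nhds 0. \<gamma> r \<in> isotropy G x)"
proof -
  have a': "a \<in> points \<Sigma>" "src G a = x" "tgt G a = x" using a by (simp_all add: isotropy_def)
  have rank: "dim (anchor_kernel a) \<le> dim (anchor_kernel q)" if q: "q \<in> points \<Sigma>" "src G q = x" for q
  proof -
    let ?g = "mult G q (ginv G a)"
    have "?g \<in> points \<Sigma>" "src G ?g = tgt G a"
      using q a' by (simp_all add: mult_points ginv_points src_tgt_ginv src_mult)
    then have "(?g, a) \<in> points (composable G)" using a' by (simp add: composable_iff)
    from dim_anchor_kernel_mult[OF this] show ?thesis using mult_ginv_cancel[OF q(1) a'(1)] q(2) a'(2) by simp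
  qed
  have t: "smooth_map \<Sigma> (base G) (tgt G)" using submersions(2) by (simp add: surjective_submersion_def)
  note * = fibre_embedded_constant_rank[OF smooth_manifolds(1,2,2) submersions(1) t a', folded anchor_kernel_def isotropy_def]
  show "\<exists>c\<in>charts \<Sigma>. a \<in> fst c \<and> (\<exists>W. subspace W \<and> snd c ` (fst c \<inter> isotropy G x) = chart_image c \<inter> W)"
    by (rule *(1)) (rule rank)
  assume "v \<in> anchor_kernel a"
  show "\<exists>\<gamma>. \<gamma> 0 = a \<and> velocity \<Sigma> \<gamma> v \<and> (\<forall>\<^sub>F r in nhds 0. \<gamma> r \<in> isotropy G x)"
    by (rule *(2)) (fact rank, fact)
qed

lemma embedded_isotropy: "embedded \<Sigma> (isotropy G x)"
  unfolding embedded_def using isotropy_local(1) by (auto simp: isotropy_def)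

section \<open>The manifold structure of isotropy groups\<close>

abbreviation "I \<equiv> isotropy_manifold G"

lemma smooth_manifold_isotropy: "smooth_manifold (I x)"
  unfolding isotropy_manifold_def by (rule smooth_manifold_submanifold[OF smooth_manifolds(1) embedded_isotropy])

lemma points_I [simp]: "points (I x) = isotropy G x"
  by (simp add: isotropy_manifold_def)

lemma isotropyD: "g \<in> isotropy G x \<Longrightarrow> g \<in> points \<Sigma>" "g \<in> isotropy G x \<Longrightarrow> src G g = x" "g \<in> isotropy G x \<Longrightarrow> tgt G g = x"
  by (simp_all add: isotropy_def)

lemma isotropy_mult: "g \<in> isotropy G x \<Longrightarrow> h \<in> isotropy G x \<Longrightarrow> mult G g h \<in> isotropy G x"
  by (simp add: isotropy_def mult_points src_mult tgt_mult)

lemma isotropy_ginv: "g \<in> isotropy G x \<Longrightarrow> ginv G g \<in> isotropy G x"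
  by (simp add: isotropy_def ginv_points src_tgt_ginv)

lemma isotropy_unit: "x \<in> points (base G) \<Longrightarrow> unit_of G x \<in> isotropy G x"
  by (simp add: isotropy_def unit_points src_tgt_unit)

lemma smooth_in_incl: "a \<in> isotropy G x \<Longrightarrow> smooth_in (I x) \<Sigma> (\<lambda>g. g) a"
  unfolding isotropy_manifold_def by (rule smooth_in_inclusion[OF smooth_manifolds(1) embedded_isotropy])

lemma velocity_incl:
  assumes "velocity (I x) \<gamma> w" "\<gamma> 0 \<in> isotropy G x"
  shows "velocity \<Sigma> \<gamma> (isotropy_incl G x (\<gamma> 0) w)" "\<forall>\<^sub>F r in nhds 0. \<gamma> r \<in> isotropy G x"
  unfolding isotropy_incl_def isotropy_manifold_def
  by (rule velocity_submanifoldD[OF smooth_manifolds(1) embedded_isotropy assms[unfolded isotropy_manifold_def]])+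

lemma isotropy_incl_anchor_kernel:
  assumes a: "a \<in> isotropy G x" and w: "w \<in> tangent (I x) a"
  shows "isotropy_incl G x a w \<in> anchor_kernel a"
proof -
  note \<Sigma> = smooth_manifolds(1) and X = smooth_manifolds(2) and ap = isotropyD[OF a]
  have x: "x \<in> points (base G)" using src_tgt_base(1)[OF ap(1)] ap(2) by simp
  obtain \<gamma> where \<gamma>: "\<gamma> 0 = a" "velocity (I x) \<gamma> w" by (rule tangent_velocity[OF smooth_manifold_isotropy _ w]) (simp_all add: a)
  have v: "velocity \<Sigma> \<gamma> (isotropy_incl G x a w)" and ev: "\<forall>\<^sub>F r in nhds 0. \<gamma> r \<in> isotropy G x"
    using velocity_incl[OF \<gamma>(2)] \<gamma>(1) a by simp_all
  have ev': "\<forall>\<^sub>F r in nhds 0. x = src G (\<gamma> r)" "\<forall>\<^sub>F r in nhds 0. x = tgt G (\<gamma> r)"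
    using ev by (eventually_elim, simp add: isotropy_def)+
  have "velocity (base G) (\<lambda>r. src G (\<gamma> r)) 0" "velocity (base G) (\<lambda>r. tgt G (\<gamma> r)) 0"
    by (rule velocity_cong[OF velocity_const[OF X x] ev'(1)], rule velocity_cong[OF velocity_const[OF X x] ev'(2)])
  then have "differential \<Sigma> (base G) (src G) a (isotropy_incl G x a w) = 0"
    "differential \<Sigma> (base G) (tgt G) a (isotropy_incl G x a w) = 0"
    using differential_eqI[OF \<Sigma> X smooth_in_src[OF ap(1)] v \<gamma>(1)]
      differential_eqI[OF \<Sigma> X smooth_in_tgt[OF ap(1)] v \<gamma>(1)] by blast+
  then show ?thesis using velocity_tangent[OF v] \<gamma>(1) by (simp add: anchor_kernel_def)
qed

text \<open>Every vector of the kernel is the velocity of a curve that stays in the isotropy group.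
  The reverse inclusion, \<open>isotropy_incl_anchor_kernel\<close>, only uses that s and t are
  constant on the group.\<close>

lemma anchor_kernel_subset_isotropy_incl:
  assumes a: "a \<in> isotropy G x" shows "anchor_kernel a \<subseteq> isotropy_incl G x a ` tangent (I x) a"
proof
  fix v assume "v \<in> anchor_kernel a"
  then obtain \<gamma> where \<gamma>: "\<gamma> 0 = a" "velocity \<Sigma> \<gamma> v" "\<forall>\<^sub>F r in nhds 0. \<gamma> r \<in> isotropy G x"
    using isotropy_local(2)[OF a] by blast
  obtain w where w: "velocity (I x) \<gamma> w" "isotropy_incl G x (\<gamma> 0) w = v"
    unfolding isotropy_incl_def isotropy_manifold_def
    by (rule velocity_submanifold[OF smooth_manifolds(1) embedded_isotropy \<gamma>(2,3)])
  show "v \<in> isotropy_incl G x a ` tangent (I x) a"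
    using w velocity_tangent[OF w(1)] \<gamma>(1) by (intro image_eqI[of _ _ w]) simp_all
qed

lemma smooth_in_isotropy:
  assumes N: "smooth_manifold N" and f: "smooth_in N \<Sigma> f p" and "\<And>q. q \<in> points N \<Longrightarrow> f q \<in> isotropy G x"
  shows "smooth_in N (I x) f p"
  unfolding isotropy_manifold_def
proof (rule smooth_in_submanifold[OF smooth_manifolds(1) embedded_isotropy N f])
  have p: "p \<in> points N" by (rule smooth_in_mem[OF N smooth_manifolds(1) f])
  show "nbhd N p (points N)"
    unfolding nbhd_def using chart_at(4,2)[OF N p] smooth_manifoldD(5)[OF N chart_at(4)[OF N p]] by blast
qed (rule assms(3))

lemma smooth_right_translation:
  assumes k: "k \<in> isotropy G x" shows "smooth_map (I x) (I x) (\<lambda>g. mult G g k)"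
  unfolding smooth_map_iff[OF smooth_manifold_isotropy smooth_manifold_isotropy]
proof
  fix a assume "a \<in> points (I x)" then have a: "a \<in> isotropy G x" by simp
  have C: "smooth_in (I x) (composable G) (\<lambda>g. (g, k)) a"
    unfolding composable_eq
    by (rule comp.smooth_into[OF smooth_manifold_isotropy smooth_in_incl[OF a] smooth_in_const[OF smooth_manifold_isotropy smooth_manifolds(1)]])
      (use a k in \<open>simp_all add: comp.points_C isotropy_def\<close>)
  have "(a, k) \<in> points (composable G)" using a k by (simp add: composable_iff isotropy_def)
  from smooth_in_compose[OF smooth_manifold_isotropy comp.manifold_C[folded composable_eq] smooth_manifolds(1) C smooth_in_mult[OF this]]
  have "smooth_in (I x) \<Sigma> (\<lambda>g. mult G g k) a" by simp
  then show "smooth_in (I x) (I x) (\<lambda>g. mult G g k) a"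
    by (rule smooth_in_isotropy[OF smooth_manifold_isotropy]) (use k in \<open>simp add: isotropy_mult\<close>)
qed

lemma smooth_left_translation:
  assumes k: "k \<in> isotropy G x" shows "smooth_map (I x) (I x) (\<lambda>g. mult G k g)"
  unfolding smooth_map_iff[OF smooth_manifold_isotropy smooth_manifold_isotropy]
proof
  fix a assume "a \<in> points (I x)" then have a: "a \<in> isotropy G x" by simp
  have C: "smooth_in (I x) (composable G) (\<lambda>g. (k, g)) a"
    unfolding composable_eq
    by (rule comp.smooth_into[OF smooth_manifold_isotropy smooth_in_const[OF smooth_manifold_isotropy smooth_manifolds(1)] smooth_in_incl[OF a]])
      (use a k in \<open>simp_all add: comp.points_C isotropy_def\<close>)
  have "(k, a) \<in> points (composable G)" using a k by (simp add: composable_iff isotropy_def)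
  from smooth_in_compose[OF smooth_manifold_isotropy comp.manifold_C[folded composable_eq] smooth_manifolds(1) C smooth_in_mult[OF this]]
  have "smooth_in (I x) \<Sigma> (\<lambda>g. mult G k g) a" by simp
  then show "smooth_in (I x) (I x) (\<lambda>g. mult G k g) a"
    by (rule smooth_in_isotropy[OF smooth_manifold_isotropy]) (use k in \<open>simp add: isotropy_mult\<close>)
qed

text \<open>The topology of the isotropy group is the one induced by the arrows. Properness is a
  statement about the arrow manifold and has to be carried over to the group.\<close>

lemma nbhd_isotropy:
  assumes a: "a \<in> isotropy G x" and S: "nbhd (I x) a S"
  obtains U where "nbhd \<Sigma> a U" "U \<inter> isotropy G x \<subseteq> S"
proof -
  obtain c where c: "c \<in> charts \<Sigma>" "a \<in> fst c" "(fst c \<inter> isotropy G x, snd c) \<in> charts (I x)"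
    unfolding isotropy_manifold_def by (rule embedded_slice[OF smooth_manifolds(1) embedded_isotropy a])
  obtain T where T: "open T" "snd (fst c \<inter> isotropy G x, snd c) a \<in> T"
    "\<And>q. q \<in> fst (fst c \<inter> isotropy G x, snd c) \<Longrightarrow> snd (fst c \<inter> isotropy G x, snd c) q \<in> T \<Longrightarrow> q \<in> S"
    by (rule nbhd_chart[OF smooth_manifold_isotropy S c(3)]) (use a c(2) in auto)
  show thesis
  proof
    show "nbhd \<Sigma> a {q \<in> fst c. snd c q \<in> T}"
      by (rule nbhd_shrinkI[OF smooth_manifolds(1) c(1,2) T(1)]) (use T(2) in simp_all)
    show "{q \<in> fst c. snd c q \<in> T} \<inter> isotropy G x \<subseteq> S" using T(3) by auto
  qed
qed

end

section \<open>Orbit maps of principal bundles\<close>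

lemma openin_chart_domain:
  assumes M: "smooth_manifold M" and c: "c \<in> charts M"
  shows "openin (manifold_topology M) (fst c)"
  unfolding openin_manifold_topology
proof (intro conjI ballI)
  show "fst c \<subseteq> points M" by (rule smooth_manifoldD(5)[OF M c])
  fix d assume d: "d \<in> atlas M"
  have ic: "is_chart d" by (rule smooth_manifoldD(1)[OF M d])
  have "compatible_charts c d" using c d by (simp add: charts_def)
  then have "openin (top_of_set (chart_image d)) (snd d ` (fst c \<inter> fst d))" by (simp add: compatible_charts_def)
  moreover have "{z \<in> chart_image d. chart_inv d z \<in> fst c} = snd d ` (fst c \<inter> fst d)"
  proof
    show "{z \<in> chart_image d. chart_inv d z \<in> fst c} \<subseteq> snd d ` (fst c \<inter> fst d)"
    proof
      fix z assume "z \<in> {z \<in> chart_image d. chart_inv d z \<in> fst c}"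
      then show "z \<in> snd d ` (fst c \<inter> fst d)"
        using snd_chart_inv[of z d] chart_inv_mem[of z d] by (intro image_eqI[of _ _ "chart_inv d z"]) simp_all
    qed
    show "snd d ` (fst c \<inter> fst d) \<subseteq> {z \<in> chart_image d. chart_inv d z \<in> fst c}"
      using chart_inv_snd[OF ic] chart_image_mem[of _ d] by fastforce
  qed
  ultimately show "openin (top_of_set (chart_image d)) {z \<in> chart_image d. chart_inv d z \<in> fst c}" by simp
qed

lemma topspace_manifold_topology:
  assumes M: "smooth_manifold M" shows "topspace (manifold_topology M) = points M"
proof
  show "topspace (manifold_topology M) \<subseteq> points M"
    using openin_topspace[of "manifold_topology M", unfolded openin_manifold_topology] by blast
  show "points M \<subseteq> topspace (manifold_topology M)"
  proof
    fix p assume p: "p \<in> points M"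
    show "p \<in> topspace (manifold_topology M)"
      using openin_subset[OF openin_chart_domain[OF M chart_at(4)[OF M p]]] chart_at(2)[OF M p] by blast
  qed
qed

text \<open>The image of S - U is closed, and it misses F z0 because the fibre over that point is z0
  alone. Its complement is the required neighbourhood. This is how properness yields continuity of
  the inverse of an orbit map.\<close>

lemma closed_injective_map_nbhd:
  assumes F: "closed_map (subtopology Z S) Y F" and S: "S \<subseteq> topspace Z" and U: "openin Z U" "z0 \<in> U" "z0 \<in> S"
    and inj: "\<And>z. z \<in> S \<Longrightarrow> F z = F z0 \<Longrightarrow> z = z0" and top: "F z0 \<in> topspace Y"
  obtains W where "openin Y W" "F z0 \<in> W" "\<And>z. z \<in> S \<Longrightarrow> F z \<in> W \<Longrightarrow> z \<in> U"
proof -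
  have "closedin (subtopology Z S) (S - U)"
  proof -
    have "openin (subtopology Z S) (S \<inter> U)" by (rule openin_subtopology_Int2[OF U(1)])
    moreover have "topspace (subtopology Z S) - (S - U) = S \<inter> U" using S by auto
    ultimately show ?thesis using S by (auto simp: closedin_def)
  qed
  then have cl: "closedin Y (F ` (S - U))" using F unfolding closed_map_def by blast
  show thesis
  proof
    show "openin Y (topspace Y - F ` (S - U))" by (rule openin_diff[OF openin_topspace cl])
    show "F z0 \<in> topspace Y - F ` (S - U)" using top inj U(2) by force
    show "z \<in> U" if "z \<in> S" "F z \<in> topspace Y - F ` (S - U)" for z using that by blast
  qed
qed

text \<open>The last clause is continuity of the inverse of \<open>j\<close> on its image, in a form
  that does not mention the inverse.\<close>

definition orbit_embedding ::
  "('a, 'e::euclidean_space) manifold \<Rightarrow> ('p, 'q::euclidean_space) manifold \<Rightarrow> ('a \<Rightarrow> 'p) \<Rightarrow> bool" where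
  "orbit_embedding N P j \<longleftrightarrow> smooth_map N P j \<and> (\<forall>a\<in>points N.
     (\<forall>v\<in>tangent N a. differential N P j a v = 0 \<longrightarrow> v = 0) \<and>
     (\<forall>S. nbhd N a S \<longrightarrow> (\<exists>U. nbhd P (j a) U \<and> (\<forall>h\<in>points N. j h \<in> U \<longrightarrow> h \<in> S))))"

text \<open>The two orbit maps of the bibundle are used in both roles: with the right one as
  \<open>j\<close> and the left one as \<open>f\<close> this gives smoothness of the map between the
  isotropy groups, with the roles exchanged that of its inverse. Continuity of \<open>h\<close>
  follows from continuity of \<open>f\<close> and the last clause of
  \<open>orbit_embedding\<close>.\<close>

lemma smooth_map_lift_orbit_embedding:
  assumes N: "smooth_manifold N" and P: "smooth_manifold P" and K: "smooth_manifold K"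
    and j: "orbit_embedding N P j" and f: "smooth_map K P f"
    and h: "\<And>q. q \<in> points K \<Longrightarrow> h q \<in> points N" "\<And>q. q \<in> points K \<Longrightarrow> j (h q) = f q"
  shows "smooth_map K N h"
  unfolding smooth_map_iff[OF K N]
proof
  fix p assume p: "p \<in> points K"
  have fp: "smooth_in K P f p" using f p smooth_map_iff[OF K P] by simp
  show "smooth_in K N h p"
  proof (rule smooth_in_lift_immersion[OF N P K _ _ fp h(2)])
    show "smooth_in N P j (h p)" using j h(1)[OF p] smooth_map_iff[OF N P] by (simp add: orbit_embedding_def)
    show "v = 0" if "v \<in> tangent N (h p)" "differential N P j (h p) v = 0" for v
      using j h(1)[OF p] that by (simp add: orbit_embedding_def)
    fix S assume S: "nbhd N (h p) S"
    have "\<forall>S. nbhd N (h p) S \<longrightarrow> (\<exists>U. nbhd P (j (h p)) U \<and> (\<forall>h\<in>points N. j h \<in> U \<longrightarrow> h \<in> S))"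
      using j h(1)[OF p] unfolding orbit_embedding_def by simp
    then obtain U where U: "nbhd P (j (h p)) U" "\<forall>h\<in>points N. j h \<in> U \<longrightarrow> h \<in> S" using S by blast
    have "nbhd K p {q \<in> points K. f q \<in> U}" by (rule nbhd_vimage[OF K P fp]) (use U(1) h(2)[OF p] in simp)
    then show "nbhd K p {q. h q \<in> S}" by (rule nbhd_mono) (use U(2) h in auto)
  qed
qed

text \<open>The map taking a to q carries the kernel at a injectively into the kernel at q, so the
  rank estimate of \<open>injective_constant_rank_immersion\<close> holds. Equivariance is phrased
  by velocities, since the corresponding translation of \<open>P\<close> is defined on a fibre of
  the moment map and not on an open set.\<close>

lemma homogeneous_injective_immersion:
  assumes N: "smooth_manifold N" and P: "smooth_manifold P" and j: "smooth_map N P j"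
    and inj: "inj_on j (points N)" and a: "a \<in> points N"
    and trans: "\<And>q. q \<in> points N \<Longrightarrow> \<exists>\<tau> \<tau>'. smooth_map N N \<tau> \<and> smooth_map N N \<tau>' \<and> \<tau> a = q \<and>
      (\<forall>n\<in>points N. \<tau>' (\<tau> n) = n) \<and> (\<forall>\<gamma> v. \<gamma> 0 = a \<longrightarrow> velocity N \<gamma> v \<longrightarrow>
        velocity P (\<lambda>r. j (\<gamma> r)) 0 \<longrightarrow> velocity P (\<lambda>r. j (\<tau> (\<gamma> r))) 0)"
    and v: "v \<in> tangent N a" "differential N P j a v = 0"
  shows "v = 0"
proof (rule injective_constant_rank_immersion[OF N P j inj a _ v])
  fix q assume q: "q \<in> points N"
  have jin: "smooth_in N P j n" if "n \<in> points N" for n using j that smooth_map_iff[OF N P] by simp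
  obtain \<tau> \<tau>' where \<tau>: "smooth_map N N \<tau>" "smooth_map N N \<tau>'" "\<tau> a = q" "\<forall>n\<in>points N. \<tau>' (\<tau> n) = n"
    "\<forall>\<gamma> v. \<gamma> 0 = a \<longrightarrow> velocity N \<gamma> v \<longrightarrow> velocity P (\<lambda>r. j (\<gamma> r)) 0 \<longrightarrow> velocity P (\<lambda>r. j (\<tau> (\<gamma> r))) 0"
    using trans[OF q] by (elim exE conjE)
  have \<tau>a: "smooth_in N N \<tau> a" and \<tau>q: "smooth_in N N \<tau>' q"
    using \<tau>(1,2) a q smooth_map_iff[OF N N] by blast+
  obtain D where D: "linear D" "\<And>\<gamma> v. \<gamma> 0 = a \<Longrightarrow> velocity N \<gamma> v \<Longrightarrow> velocity N (\<lambda>r. \<tau> (\<gamma> r)) (D v)"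
    by (rule smooth_in_differential[OF N N \<tau>a]) blast
  obtain D' where D': "linear D'" "\<And>\<gamma> v. \<gamma> 0 = q \<Longrightarrow> velocity N \<gamma> v \<Longrightarrow> velocity N (\<lambda>r. \<tau>' (\<gamma> r)) (D' v)"
    by (rule smooth_in_differential[OF N N \<tau>q]) blast
  let ?k = "ker_differential N P j"
  have inv: "D' (D u) = u" if u: "u \<in> tangent N a" for u
  proof -
    obtain \<gamma> where \<gamma>: "\<gamma> 0 = a" "velocity N \<gamma> u" by (rule tangent_velocity[OF N a u])
    have points: "\<forall>\<^sub>F r in nhds 0. \<gamma> r \<in> points N" using velocity_points[OF N \<gamma>(2)] \<gamma>(1) a by simp
    have "velocity N (\<lambda>r. \<tau>' (\<tau> (\<gamma> r))) (D' (D u))" by (rule D'(2)[OF _ D(2)[OF \<gamma>]]) (simp add: \<gamma> \<tau>)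
    moreover have "\<forall>\<^sub>F r in nhds 0. \<tau>' (\<tau> (\<gamma> r)) = \<gamma> r"
      using points by eventually_elim (simp add: \<tau>(4))
    ultimately have "velocity N \<gamma> (D' (D u))" by (rule velocity_cong)
    then show ?thesis by (rule velocity_unique[OF _ \<gamma>(2)])
  qed
  have into: "D u \<in> ?k q" if u: "u \<in> ?k a" for u
  proof -
    have u': "u \<in> tangent N a" "differential N P j a u = 0" using u by (simp_all add: ker_differential_def)
    obtain \<gamma> where \<gamma>: "\<gamma> 0 = a" "velocity N \<gamma> u" by (rule tangent_velocity[OF N a u'(1)])
    have "velocity P (\<lambda>r. j (\<gamma> r)) 0" using velocity_differential[OF N P jin[OF a] \<gamma>(2,1)] u'(2) by simp
    then have 1: "velocity P (\<lambda>r. j (\<tau> (\<gamma> r))) 0" using \<tau>(5) \<gamma> by blast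
    have 2: "velocity N (\<lambda>r. \<tau> (\<gamma> r)) (D u)" by (rule D(2)[OF \<gamma>])
    have 3: "\<tau> (\<gamma> 0) = q" using \<gamma>(1) \<tau>(3) by simp
    show ?thesis
      using differential_eqI[OF N P jin[OF q] 2 3 1] velocity_tangent[OF 2] 3 by (simp add: ker_differential_def)
  qed
  have sub: "subspace (?k a)"
  proof -
    obtain J where J: "linear J" "\<And>v. v \<in> tangent N a \<Longrightarrow> differential N P j a v = J v"
      by (rule smooth_in_differential[OF N P jin[OF a]]) blast
    have "?k a = {v \<in> tangent N a. J v = 0}" unfolding ker_differential_def using J(2) by auto
    then show ?thesis
      using tangent_subspace[of N a] J(1) by (auto simp: subspace_def linear_0 linear_add linear_scale)
  qed
  have "inj_on D (?k a)" by (rule inj_on_inverseI[of _ D']) (use inv in \<open>simp add: ker_differential_def\<close>)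
  then have "dim (?k a) = dim (D ` ?k a)"
    using dim_image_eq[OF D(1), of "?k a"] sub by (simp add: span_eq_iff[THEN iffD2])
  also have "\<dots> \<le> dim (?k q)" by (rule dim_subset) (use into in blast)
  finally show "dim (?k a) \<le> dim (?k q)" .
qed

context fibred_pair
begin

lemma velocity_image:
  assumes Q: "smooth_manifold Q" and m: "smooth_map C Q m"
    and \<gamma>: "velocity M \<gamma> v" and \<delta>: "velocity N \<delta> w" and ev: "\<forall>\<^sub>F r in nhds 0. (\<gamma> r, \<delta> r) \<in> points C"
  obtains \<xi> where "\<xi> \<in> tangent C (\<gamma> 0, \<delta> 0)" "differential C M fst (\<gamma> 0, \<delta> 0) \<xi> = v"
    "differential C N snd (\<gamma> 0, \<delta> 0) \<xi> = w"
    "velocity Q (\<lambda>r. m (\<gamma> r, \<delta> r)) (differential C Q m (\<gamma> 0, \<delta> 0) \<xi>)"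
    "v = 0 \<Longrightarrow> w = 0 \<Longrightarrow> differential C Q m (\<gamma> 0, \<delta> 0) \<xi> = 0"
proof -
  have mem: "(\<gamma> 0, \<delta> 0) \<in> points C" using ev by (rule eventually_nhds_x_imp_x)
  have m_in: "smooth_in C Q m (\<gamma> 0, \<delta> 0)" using m mem smooth_map_iff[OF manifold_C Q] by blast
  obtain \<xi> where \<xi>: "velocity C (\<lambda>r. (\<gamma> r, \<delta> r)) \<xi>" "\<xi> \<in> tangent C (\<gamma> 0, \<delta> 0)"
    "differential C M fst (\<gamma> 0, \<delta> 0) \<xi> = v" "differential C N snd (\<gamma> 0, \<delta> 0) \<xi> = w"
    "v = 0 \<Longrightarrow> w = 0 \<Longrightarrow> \<xi> = 0" by (rule velocity_C[OF \<gamma> \<delta> ev]) blast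
  have "differential C Q m (\<gamma> 0, \<delta> 0) 0 = 0"
    by (rule differential_eqI[OF manifold_C Q m_in velocity_const[OF manifold_C mem] refl velocity_const[OF Q smooth_in_mem(2)[OF manifold_C Q m_in]]])
  then show thesis
    using that[OF \<xi>(2-4) velocity_differential[OF manifold_C Q m_in \<xi>(1) refl]] \<xi>(5) by simp
qed

end

section \<open>Left principal bundles\<close>

locale left_bundle = lie_gpd G for G :: "('a, 'e::euclidean_space, 'x, 'd::euclidean_space, 'z) lie_groupoid_scheme" +
  fixes P :: "('p, 'q::euclidean_space) manifold" and B :: "('m, 'n::euclidean_space) manifold"
    and act :: "'a \<Rightarrow> 'p \<Rightarrow> 'p" and \<mu> :: "'p \<Rightarrow> 'x" and \<pi> :: "'p \<Rightarrow> 'm"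
  assumes principal: "left_principal_bundle G P B act \<mu> \<pi>"
begin

lemma P: "smooth_manifold P" and moment: "surjective_submersion P (base G) \<mu>"
  and smooth_act: "smooth_map (fibre_product \<Sigma> P (src G) \<mu>) P (\<lambda>(g, p). act g p)"
  and moment_act: "g \<in> points \<Sigma> \<Longrightarrow> p \<in> points P \<Longrightarrow> src G g = \<mu> p \<Longrightarrow> \<mu> (act g p) = tgt G g"
  and act_unit: "p \<in> points P \<Longrightarrow> act (unit_of G (\<mu> p)) p = p"
  and act_mult: "h \<in> points \<Sigma> \<Longrightarrow> p \<in> points P \<Longrightarrow> src G h = \<mu> p \<Longrightarrow> g \<in> points \<Sigma> \<Longrightarrow> src G g = tgt G h \<Longrightarrow>
    act (mult G g h) p = act g (act h p)"
  and proj_act: "g \<in> points \<Sigma> \<Longrightarrow> p \<in> points P \<Longrightarrow> src G g = \<mu> p \<Longrightarrow> \<pi> (act g p) = \<pi> p"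
  and free: "g \<in> points \<Sigma> \<Longrightarrow> p \<in> points P \<Longrightarrow> src G g = \<mu> p \<Longrightarrow> act g p = p \<Longrightarrow> g = unit_of G (\<mu> p)"
  and proper: "proper_map (subtopology (prod_topology (manifold_topology \<Sigma>) (manifold_topology P))
      {(g, p). g \<in> points \<Sigma> \<and> p \<in> points P \<and> src G g = \<mu> p})
    (prod_topology (manifold_topology P) (manifold_topology P)) (\<lambda>(g, p). (act g p, p))"
  and transitive: "p \<in> points P \<Longrightarrow> q \<in> points P \<Longrightarrow> \<pi> p = \<pi> q \<Longrightarrow> \<exists>g\<in>points \<Sigma>. src G g = \<mu> p \<and> act g p = q"
  using principal by (auto simp: left_principal_bundle_def Let_def)

sublocale pair: fibred_pair \<Sigma> P "base G" "src G" \<mu>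
  using smooth_manifolds submersions(1) P moment by unfold_locales (simp_all add: surjective_submersion_def)

lemma pair_iff: "(g, p) \<in> points (fibre_product \<Sigma> P (src G) \<mu>) \<longleftrightarrow> g \<in> points \<Sigma> \<and> p \<in> points P \<and> src G g = \<mu> p"
  by (simp add: pair.points_C)

lemma act_points: "g \<in> points \<Sigma> \<Longrightarrow> p \<in> points P \<Longrightarrow> src G g = \<mu> p \<Longrightarrow> act g p \<in> points P"
  using smooth_act pair_iff[of g p] by (force simp: smooth_map_def)

lemma act_injective:
  assumes "p \<in> points P" "g \<in> points \<Sigma>" "h \<in> points \<Sigma>" "src G g = \<mu> p" "src G h = \<mu> p" "act g p = act h p"
  shows "g = h"
proof -
  have t: "tgt G g = tgt G h" using moment_act[OF assms(2,1,4)] moment_act[OF assms(3,1,5)] assms(6) by simp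
  let ?k = "mult G (ginv G h) g"
  have k: "?k \<in> points \<Sigma>" "src G ?k = \<mu> p" using assms t by (simp_all add: mult_points ginv_points src_tgt_ginv src_mult)
  have "act ?k p = act (ginv G h) (act h p)"
    using act_mult[OF assms(2,1,4) ginv_points[OF assms(3)]] assms t by (simp add: src_tgt_ginv)
  also have "\<dots> = p"
    using act_mult[OF assms(3,1,5) ginv_points[OF assms(3)]] assms by (simp add: src_tgt_ginv mult_ginv act_unit)
  finally have "?k = unit_of G (\<mu> p)" by (rule free[OF k(1) assms(1) k(2)])
  then have "mult G h ?k = h" using mult_unit(2)[OF assms(3)] assms(5) by simp
  moreover have "mult G h ?k = g"
    using mult_assoc[of h "ginv G h" g] mult_unit(1)[OF assms(2)] assms t
    by (simp add: ginv_points src_tgt_ginv mult_ginv)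
  ultimately show ?thesis by simp
qed

lemma velocity_act:
  assumes "velocity \<Sigma> \<gamma> v" "velocity P \<delta> w"
    "\<forall>\<^sub>F r in nhds 0. \<gamma> r \<in> points \<Sigma> \<and> \<delta> r \<in> points P \<and> src G (\<gamma> r) = \<mu> (\<delta> r)"
  obtains \<xi> where "\<xi> \<in> tangent (fibre_product \<Sigma> P (src G) \<mu>) (\<gamma> 0, \<delta> 0)"
    "differential (fibre_product \<Sigma> P (src G) \<mu>) \<Sigma> fst (\<gamma> 0, \<delta> 0) \<xi> = v"
    "differential (fibre_product \<Sigma> P (src G) \<mu>) P snd (\<gamma> 0, \<delta> 0) \<xi> = w"
    "velocity P (\<lambda>r. act (\<gamma> r) (\<delta> r)) (differential (fibre_product \<Sigma> P (src G) \<mu>) P (\<lambda>(a, b). act a b) (\<gamma> 0, \<delta> 0) \<xi>)"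
    "v = 0 \<Longrightarrow> w = 0 \<Longrightarrow> differential (fibre_product \<Sigma> P (src G) \<mu>) P (\<lambda>(a, b). act a b) (\<gamma> 0, \<delta> 0) \<xi> = 0"
proof -
  have "\<forall>\<^sub>F r in nhds 0. (\<gamma> r, \<delta> r) \<in> points (fibre_product \<Sigma> P (src G) \<mu>)" using assms(3) by (simp add: pair_iff)
  then show thesis
    by (rule pair.velocity_image[OF P smooth_act assms(1,2)]) (rule that; simp)
qed

lemma orbit_embedding_act:
  assumes p: "p \<in> points P"
  shows "orbit_embedding (I (\<mu> p)) P (\<lambda>g. act g p)"
proof -
  let ?N = "I (\<mu> p)" and ?j = "\<lambda>g. act g p" and ?S = "{(g, p). g \<in> points \<Sigma> \<and> p \<in> points P \<and> src G g = \<mu> p}"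
  note \<Sigma> = smooth_manifolds(1)
  have j: "smooth_map ?N P ?j"
    unfolding smooth_map_iff[OF smooth_manifold_isotropy P]
  proof
    fix a assume "a \<in> points ?N" then have a: "a \<in> isotropy G (\<mu> p)" by simp
    have 1: "smooth_in ?N (fibre_product \<Sigma> P (src G) \<mu>) (\<lambda>g. (g, p)) a"
      by (rule pair.smooth_into[OF smooth_manifold_isotropy smooth_in_incl[OF a] smooth_in_const[OF smooth_manifold_isotropy P]])
        (use a p in \<open>simp_all add: pair_iff isotropy_def\<close>)
    have "(a, p) \<in> points (fibre_product \<Sigma> P (src G) \<mu>)" using a p by (simp add: pair_iff isotropy_def)
    then have "smooth_in (fibre_product \<Sigma> P (src G) \<mu>) P (\<lambda>(g, p). act g p) (a, p)"
      using smooth_act smooth_map_iff[OF pair.manifold_C P] by blast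
    from smooth_in_compose[OF smooth_manifold_isotropy pair.manifold_C P 1 this] show "smooth_in ?N P ?j a" by simp
  qed
  have inj: "inj_on ?j (points ?N)"
    by (rule inj_onI) (auto intro: act_injective[OF p] simp: isotropy_def)
  have imm: "v = 0" if a: "a \<in> isotropy G (\<mu> p)" and v: "v \<in> tangent ?N a" "differential ?N P ?j a v = 0" for a v
  proof (rule homogeneous_injective_immersion[OF smooth_manifold_isotropy P j inj _ _ v])
    show "a \<in> points ?N" using a by simp
    fix q assume "q \<in> points ?N" then have q: "q \<in> isotropy G (\<mu> p)" by simp
    \<comment> \<open>Left translation by this element takes a to q, and (k g) p = k (g p) relates
      it to the action.\<close>
    define k where "k = mult G q (ginv G a)"
    have k: "k \<in> isotropy G (\<mu> p)" unfolding k_def by (rule isotropy_mult[OF q isotropy_ginv[OF a]])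
    have "mult G k a = q" unfolding k_def using a q by (intro mult_ginv_cancel) (simp_all add: isotropy_def)
    moreover have "mult G (ginv G k) (mult G k n) = n" if "n \<in> points ?N" for n
      using that k by (intro ginv_mult_cancel) (simp_all add: isotropy_def)
    moreover have "velocity P (\<lambda>r. act (mult G k (\<gamma> r)) p) 0"
      if \<gamma>: "\<gamma> 0 = a" "velocity ?N \<gamma> u" "velocity P (\<lambda>r. act (\<gamma> r) p) 0" for \<gamma> u
    proof -
      have ev: "\<forall>\<^sub>F r in nhds 0. \<gamma> r \<in> isotropy G (\<mu> p)" using velocity_incl(2)[OF \<gamma>(2)] \<gamma>(1) a by simp
      have ev2: "\<forall>\<^sub>F r in nhds 0. k \<in> points \<Sigma> \<and> act (\<gamma> r) p \<in> points P \<and> src G k = \<mu> (act (\<gamma> r) p)"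
        using ev by eventually_elim (use k p in \<open>simp add: isotropy_def act_points moment_act\<close>)
      obtain \<xi> where \<xi>: "velocity P (\<lambda>r. act k (act (\<gamma> r) p)) \<xi>" "\<xi> = 0"
        \<comment> \<open>The constant k has velocity 0 and so does the curve in \<open>P\<close>;
          hence the curve obtained by acting with k has velocity 0 as well.\<close>
        by (rule velocity_act[OF velocity_const[OF \<Sigma> isotropyD(1)[OF k]] \<gamma>(3) ev2]) blast
      have eq: "\<forall>\<^sub>F r in nhds 0. act k (act (\<gamma> r) p) = act (mult G k (\<gamma> r)) p"
        using ev by eventually_elim (use k p in \<open>simp add: isotropy_def act_mult\<close>)
      show ?thesis using velocity_cong[OF \<xi>(1) eq] \<xi>(2) by simp
    qed
    ultimately show "\<exists>\<tau> \<tau>'. smooth_map ?N ?N \<tau> \<and> smooth_map ?N ?N \<tau>' \<and> \<tau> a = q \<and> (\<forall>n\<in>points ?N. \<tau>' (\<tau> n) = n) \<and>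
        (\<forall>\<gamma> v. \<gamma> 0 = a \<longrightarrow> velocity ?N \<gamma> v \<longrightarrow> velocity P (\<lambda>r. ?j (\<gamma> r)) 0 \<longrightarrow> velocity P (\<lambda>r. ?j (\<tau> (\<gamma> r))) 0)"
      using smooth_left_translation[OF k] smooth_left_translation[OF isotropy_ginv[OF k]]
      by (intro exI[of _ "\<lambda>g. mult G k g"] exI[of _ "\<lambda>g. mult G (ginv G k) g"]) simp
  qed
  have lift: "\<exists>U. nbhd P (?j a) U \<and> (\<forall>h\<in>points ?N. ?j h \<in> U \<longrightarrow> h \<in> S)"
    if a: "a \<in> isotropy G (\<mu> p)" and S: "nbhd ?N a S" for a S
  proof -
    have a': "a \<in> points \<Sigma>" "src G a = \<mu> p" using isotropyD[OF a] by simp_all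
    have ap: "act a p \<in> points P" by (rule act_points[OF a'(1) p a'(2)])
    obtain V where V: "nbhd \<Sigma> a V" "V \<inter> isotropy G (\<mu> p) \<subseteq> S" by (rule nbhd_isotropy[OF a S])
    obtain c where c: "c \<in> charts \<Sigma>" "a \<in> fst c" "fst c \<subseteq> V" using V(1) unfolding nbhd_def by blast
    let ?Z = "prod_topology (manifold_topology \<Sigma>) (manifold_topology P)"
      and ?Y = "prod_topology (manifold_topology P) (manifold_topology P)"
    have U: "openin ?Z (fst c \<times> points P)"
      using openin_chart_domain[OF \<Sigma> c(1)] openin_topspace[of "manifold_topology P"]
      by (simp add: openin_prod_Times_iff topspace_manifold_topology[OF P])
    \<comment> \<open>The map (g, p) -> (g p, p) is closed by properness and injective by freeness.
      Freezing the second component of W at p afterwards gives a neighbourhood of a p in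
      \<open>P\<close>.\<close>
    obtain W where W: "openin ?Y W" "(\<lambda>(g, p). (act g p, p)) (a, p) \<in> W"
      "\<And>z. z \<in> ?S \<Longrightarrow> (\<lambda>(g, p). (act g p, p)) z \<in> W \<Longrightarrow> z \<in> fst c \<times> points P"
    proof (rule closed_injective_map_nbhd[OF _ _ U])
      show "closed_map (subtopology ?Z ?S) ?Y (\<lambda>(g, p). (act g p, p))" using proper by (simp add: proper_map_def)
      show "?S \<subseteq> topspace ?Z" by (auto simp: topspace_manifold_topology[OF \<Sigma>] topspace_manifold_topology[OF P])
      show "(a, p) \<in> fst c \<times> points P" "(a, p) \<in> ?S" using c(2) p a' by simp_all
      show "(\<lambda>(g, p). (act g p, p)) (a, p) \<in> topspace ?Y"
        using ap p by (simp add: topspace_manifold_topology[OF P])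
      show "z = (a, p)" if "z \<in> ?S" "(\<lambda>(g, p). (act g p, p)) z = (\<lambda>(g, p). (act g p, p)) (a, p)" for z
        using that act_injective[OF p _ a'(1) _ a'(2)] by auto
    qed blast
    have "continuous_map (manifold_topology P) ?Y (\<lambda>q. (q, p))"
      using p by (intro continuous_map_pairedI) (simp_all add: topspace_manifold_topology[OF P])
    then have "openin (manifold_topology P) {q \<in> points P. (q, p) \<in> W}"
      using openin_continuous_map_preimage[OF _ W(1)] topspace_manifold_topology[OF P] by metis
    then have "nbhd P (act a p) {q \<in> points P. (q, p) \<in> W}"
      by (rule openin_nbhd[OF P]) (use W(2) ap in simp)
    moreover have "h \<in> S" if "h \<in> points ?N" "act h p \<in> {q \<in> points P. (q, p) \<in> W}" for h
    proof -
      have "h \<in> isotropy G (\<mu> p)" using that(1) by simp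
      moreover have "(h, p) \<in> fst c \<times> points P"
        by (rule W(3)) (use that p in \<open>simp_all add: isotropy_def\<close>)
      ultimately show ?thesis using c(3) V(2) by blast
    qed
    ultimately show ?thesis by blast
  qed
  show ?thesis unfolding orbit_embedding_def using j imm lift by simp
qed

end

section \<open>Right principal bundles\<close>

locale right_bundle = lie_gpd G for G :: "('a, 'e::euclidean_space, 'x, 'd::euclidean_space, 'z) lie_groupoid_scheme" +
  fixes P :: "('p, 'q::euclidean_space) manifold" and B :: "('m, 'n::euclidean_space) manifold"
    and act :: "'p \<Rightarrow> 'a \<Rightarrow> 'p" and \<mu> :: "'p \<Rightarrow> 'x" and \<pi> :: "'p \<Rightarrow> 'm"
  assumes principal: "right_principal_bundle G P B act \<mu> \<pi>"
begin

lemma P: "smooth_manifold P" and moment: "surjective_submersion P (base G) \<mu>"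
  and smooth_act: "smooth_map (fibre_product P \<Sigma> \<mu> (tgt G)) P (\<lambda>(p, g). act p g)"
  and moment_act: "p \<in> points P \<Longrightarrow> g \<in> points \<Sigma> \<Longrightarrow> \<mu> p = tgt G g \<Longrightarrow> \<mu> (act p g) = src G g"
  and act_unit: "p \<in> points P \<Longrightarrow> act p (unit_of G (\<mu> p)) = p"
  and act_mult: "p \<in> points P \<Longrightarrow> g \<in> points \<Sigma> \<Longrightarrow> \<mu> p = tgt G g \<Longrightarrow> h \<in> points \<Sigma> \<Longrightarrow> src G g = tgt G h \<Longrightarrow>
    act p (mult G g h) = act (act p g) h"
  and proj_act: "p \<in> points P \<Longrightarrow> g \<in> points \<Sigma> \<Longrightarrow> \<mu> p = tgt G g \<Longrightarrow> \<pi> (act p g) = \<pi> p"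
  and free: "p \<in> points P \<Longrightarrow> g \<in> points \<Sigma> \<Longrightarrow> \<mu> p = tgt G g \<Longrightarrow> act p g = p \<Longrightarrow> g = unit_of G (\<mu> p)"
  and proper: "proper_map (subtopology (prod_topology (manifold_topology P) (manifold_topology \<Sigma>))
      {(p, g). p \<in> points P \<and> g \<in> points \<Sigma> \<and> \<mu> p = tgt G g})
    (prod_topology (manifold_topology P) (manifold_topology P)) (\<lambda>(p, g). (p, act p g))"
  and transitive: "p \<in> points P \<Longrightarrow> q \<in> points P \<Longrightarrow> \<pi> p = \<pi> q \<Longrightarrow> \<exists>g\<in>points \<Sigma>. \<mu> p = tgt G g \<and> act p g = q"
  using principal by (auto simp: right_principal_bundle_def Let_def)

sublocale pair: fibred_pair P \<Sigma> "base G" \<mu> "tgt G"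
  using smooth_manifolds submersions(2) P moment by unfold_locales (simp_all add: surjective_submersion_def)

lemma pair_iff: "(p, g) \<in> points (fibre_product P \<Sigma> \<mu> (tgt G)) \<longleftrightarrow> p \<in> points P \<and> g \<in> points \<Sigma> \<and> \<mu> p = tgt G g"
  by (simp add: pair.points_C)

lemma act_points: "p \<in> points P \<Longrightarrow> g \<in> points \<Sigma> \<Longrightarrow> \<mu> p = tgt G g \<Longrightarrow> act p g \<in> points P"
  using smooth_act pair_iff[of p g] by (force simp: smooth_map_def)

lemma act_injective:
  assumes "p \<in> points P" "g \<in> points \<Sigma>" "h \<in> points \<Sigma>" "\<mu> p = tgt G g" "\<mu> p = tgt G h" "act p g = act p h"
  shows "g = h"
proof -
  have t: "src G g = src G h" using moment_act[OF assms(1,2,4)] moment_act[OF assms(1,3,5)] assms(6) by simp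
  let ?k = "mult G g (ginv G h)"
  have k: "?k \<in> points \<Sigma>" "\<mu> p = tgt G ?k" using assms t by (simp_all add: mult_points ginv_points src_tgt_ginv tgt_mult)
  have "act p ?k = act (act p h) (ginv G h)"
    using act_mult[OF assms(1,2,4) ginv_points[OF assms(3)]] assms t by (simp add: src_tgt_ginv)
  also have "\<dots> = p"
    using act_mult[OF assms(1,3,5) ginv_points[OF assms(3)]] assms act_unit[OF assms(1)] by (simp add: src_tgt_ginv mult_ginv)
  finally have "?k = unit_of G (\<mu> p)" by (rule free[OF assms(1) k])
  then have "mult G ?k h = h" using mult_unit(1)[OF assms(3)] assms(5) by simp
  moreover have "mult G ?k h = g" by (rule mult_ginv_cancel[OF assms(2,3) t])
  ultimately show ?thesis by simp
qed

lemma velocity_act: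
  assumes "velocity P \<gamma> v" "velocity \<Sigma> \<delta> w"
    "\<forall>\<^sub>F r in nhds 0. \<gamma> r \<in> points P \<and> \<delta> r \<in> points \<Sigma> \<and> \<mu> (\<gamma> r) = tgt G (\<delta> r)"
  obtains \<xi> where "\<xi> \<in> tangent (fibre_product P \<Sigma> \<mu> (tgt G)) (\<gamma> 0, \<delta> 0)"
    "differential (fibre_product P \<Sigma> \<mu> (tgt G)) P fst (\<gamma> 0, \<delta> 0) \<xi> = v"
    "differential (fibre_product P \<Sigma> \<mu> (tgt G)) \<Sigma> snd (\<gamma> 0, \<delta> 0) \<xi> = w"
    "velocity P (\<lambda>r. act (\<gamma> r) (\<delta> r)) (differential (fibre_product P \<Sigma> \<mu> (tgt G)) P (\<lambda>(a, b). act a b) (\<gamma> 0, \<delta> 0) \<xi>)"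
    "v = 0 \<Longrightarrow> w = 0 \<Longrightarrow> differential (fibre_product P \<Sigma> \<mu> (tgt G)) P (\<lambda>(a, b). act a b) (\<gamma> 0, \<delta> 0) \<xi> = 0"
proof -
  have "\<forall>\<^sub>F r in nhds 0. (\<gamma> r, \<delta> r) \<in> points (fibre_product P \<Sigma> \<mu> (tgt G))" using assms(3) by (simp add: pair_iff)
  then show thesis
    by (rule pair.velocity_image[OF P smooth_act assms(1,2)]) (rule that; simp)
qed

lemma orbit_embedding_act:
  assumes p: "p \<in> points P"
  shows "orbit_embedding (I (\<mu> p)) P (act p)"
proof -
  let ?N = "I (\<mu> p)" and ?j = "\<lambda>g. act p g" and ?S = "{(p, g). p \<in> points P \<and> g \<in> points \<Sigma> \<and> \<mu> p = tgt G g}"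
  note \<Sigma> = smooth_manifolds(1)
  have j: "smooth_map ?N P ?j"
    unfolding smooth_map_iff[OF smooth_manifold_isotropy P]
  proof
    fix a assume "a \<in> points ?N" then have a: "a \<in> isotropy G (\<mu> p)" by simp
    have 1: "smooth_in ?N (fibre_product P \<Sigma> \<mu> (tgt G)) (\<lambda>g. (p, g)) a"
      by (rule pair.smooth_into[OF smooth_manifold_isotropy smooth_in_const[OF smooth_manifold_isotropy P] smooth_in_incl[OF a]])
        (use a p in \<open>simp_all add: pair_iff isotropy_def\<close>)
    have "(p, a) \<in> points (fibre_product P \<Sigma> \<mu> (tgt G))" using a p by (simp add: pair_iff isotropy_def)
    then have "smooth_in (fibre_product P \<Sigma> \<mu> (tgt G)) P (\<lambda>(p, g). act p g) (p, a)"
      using smooth_act smooth_map_iff[OF pair.manifold_C P] by blast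
    from smooth_in_compose[OF smooth_manifold_isotropy pair.manifold_C P 1 this] show "smooth_in ?N P ?j a" by simp
  qed
  have inj: "inj_on ?j (points ?N)"
    by (rule inj_onI) (auto intro: act_injective[OF p] simp: isotropy_def)
  have imm: "v = 0" if a: "a \<in> isotropy G (\<mu> p)" and v: "v \<in> tangent ?N a" "differential ?N P ?j a v = 0" for a v
  proof (rule homogeneous_injective_immersion[OF smooth_manifold_isotropy P j inj _ _ v])
    show "a \<in> points ?N" using a by simp
    fix q assume "q \<in> points ?N" then have q: "q \<in> isotropy G (\<mu> p)" by simp
    \<comment> \<open>For a right action the orbit map is compatible with right translation, so the
      element taking a to q is a^{-1} q.\<close>
    define k where "k = mult G (ginv G a) q"
    have k: "k \<in> isotropy G (\<mu> p)" unfolding k_def by (rule isotropy_mult[OF isotropy_ginv[OF a] q])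
    have "mult G a k = q"
      unfolding k_def using a q mult_assoc[of a "ginv G a" q] mult_unit(1)[of q]
      by (simp add: isotropy_def ginv_points src_tgt_ginv mult_ginv)
    moreover have "mult G (mult G n k) (ginv G k) = n" if "n \<in> points ?N" for n
      using that k mult_assoc[of n k "ginv G k"] mult_unit(2)[of n]
      by (simp add: isotropy_def ginv_points src_tgt_ginv mult_ginv)
    moreover have "velocity P (\<lambda>r. act p (mult G (\<gamma> r) k)) 0"
      if \<gamma>: "\<gamma> 0 = a" "velocity ?N \<gamma> u" "velocity P (\<lambda>r. act p (\<gamma> r)) 0" for \<gamma> u
    proof -
      have ev: "\<forall>\<^sub>F r in nhds 0. \<gamma> r \<in> isotropy G (\<mu> p)" using velocity_incl(2)[OF \<gamma>(2)] \<gamma>(1) a by simp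
      have ev2: "\<forall>\<^sub>F r in nhds 0. act p (\<gamma> r) \<in> points P \<and> k \<in> points \<Sigma> \<and> \<mu> (act p (\<gamma> r)) = tgt G k"
        using ev by eventually_elim (use k p in \<open>simp add: isotropy_def act_points moment_act\<close>)
      obtain \<xi> where \<xi>: "velocity P (\<lambda>r. act (act p (\<gamma> r)) k) \<xi>" "\<xi> = 0"
        by (rule velocity_act[OF \<gamma>(3) velocity_const[OF \<Sigma> isotropyD(1)[OF k]] ev2]) blast
      have eq: "\<forall>\<^sub>F r in nhds 0. act (act p (\<gamma> r)) k = act p (mult G (\<gamma> r) k)"
        using ev by eventually_elim (use k p in \<open>simp add: isotropy_def act_mult\<close>)
      show ?thesis using velocity_cong[OF \<xi>(1) eq] \<xi>(2) by simp
    qed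
    ultimately show "\<exists>\<tau> \<tau>'. smooth_map ?N ?N \<tau> \<and> smooth_map ?N ?N \<tau>' \<and> \<tau> a = q \<and> (\<forall>n\<in>points ?N. \<tau>' (\<tau> n) = n) \<and>
        (\<forall>\<gamma> v. \<gamma> 0 = a \<longrightarrow> velocity ?N \<gamma> v \<longrightarrow> velocity P (\<lambda>r. ?j (\<gamma> r)) 0 \<longrightarrow> velocity P (\<lambda>r. ?j (\<tau> (\<gamma> r))) 0)"
      using smooth_right_translation[OF k] smooth_right_translation[OF isotropy_ginv[OF k]]
      by (intro exI[of _ "\<lambda>g. mult G g k"] exI[of _ "\<lambda>g. mult G g (ginv G k)"]) simp
  qed
  have lift: "\<exists>U. nbhd P (?j a) U \<and> (\<forall>h\<in>points ?N. ?j h \<in> U \<longrightarrow> h \<in> S)"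
    if a: "a \<in> isotropy G (\<mu> p)" and S: "nbhd ?N a S" for a S
  proof -
    have a': "a \<in> points \<Sigma>" "\<mu> p = tgt G a" using isotropyD[OF a] by simp_all
    have ap: "act p a \<in> points P" by (rule act_points[OF p a'])
    obtain V where V: "nbhd \<Sigma> a V" "V \<inter> isotropy G (\<mu> p) \<subseteq> S" by (rule nbhd_isotropy[OF a S])
    obtain c where c: "c \<in> charts \<Sigma>" "a \<in> fst c" "fst c \<subseteq> V" using V(1) unfolding nbhd_def by blast
    let ?Z = "prod_topology (manifold_topology P) (manifold_topology \<Sigma>)"
      and ?Y = "prod_topology (manifold_topology P) (manifold_topology P)"
    have U: "openin ?Z (points P \<times> fst c)"
      using openin_chart_domain[OF \<Sigma> c(1)] openin_topspace[of "manifold_topology P"]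
      by (simp add: openin_prod_Times_iff topspace_manifold_topology[OF P])
    obtain W where W: "openin ?Y W" "(\<lambda>(p, g). (p, act p g)) (p, a) \<in> W"
      "\<And>z. z \<in> ?S \<Longrightarrow> (\<lambda>(p, g). (p, act p g)) z \<in> W \<Longrightarrow> z \<in> points P \<times> fst c"
    proof (rule closed_injective_map_nbhd[OF _ _ U])
      show "closed_map (subtopology ?Z ?S) ?Y (\<lambda>(p, g). (p, act p g))" using proper by (simp add: proper_map_def)
      show "?S \<subseteq> topspace ?Z" by (auto simp: topspace_manifold_topology[OF \<Sigma>] topspace_manifold_topology[OF P])
      show "(p, a) \<in> points P \<times> fst c" "(p, a) \<in> ?S" using c(2) p a' by simp_all
      show "(\<lambda>(p, g). (p, act p g)) (p, a) \<in> topspace ?Y"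
        using ap p by (simp add: topspace_manifold_topology[OF P])
      show "z = (p, a)" if "z \<in> ?S" "(\<lambda>(p, g). (p, act p g)) z = (\<lambda>(p, g). (p, act p g)) (p, a)" for z
        using that act_injective[OF p _ a'(1) _ a'(2)] by auto
    qed blast
    have "continuous_map (manifold_topology P) ?Y (\<lambda>q. (p, q))"
      using p by (intro continuous_map_pairedI) (simp_all add: topspace_manifold_topology[OF P])
    then have "openin (manifold_topology P) {q \<in> points P. (p, q) \<in> W}"
      using openin_continuous_map_preimage[OF _ W(1)] topspace_manifold_topology[OF P] by metis
    then have "nbhd P (act p a) {q \<in> points P. (p, q) \<in> W}"
      by (rule openin_nbhd[OF P]) (use W(2) ap in simp)
    moreover have "h \<in> S" if "h \<in> points ?N" "act p h \<in> {q \<in> points P. (p, q) \<in> W}" for h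
    proof -
      have "h \<in> isotropy G (\<mu> p)" using that(1) by simp
      moreover have "(p, h) \<in> points P \<times> fst c"
        by (rule W(3)) (use that p in \<open>simp_all add: isotropy_def\<close>)
      ultimately show ?thesis using c(3) V(2) by blast
    qed
    ultimately show ?thesis by blast
  qed
  show ?thesis unfolding orbit_embedding_def using j imm lift by simp
qed

end

section \<open>Pfaffian groups of related points\<close>

lemma linear_between_0: "linear_between V W f \<Longrightarrow> 0 \<in> V \<Longrightarrow> f 0 = 0"
  unfolding linear_between_def by (metis scaleR_zero_left)

text \<open>The base of an isotropy group is a one-point submanifold. Its local equation is the
  chart centred at the point, whose linearisation is the identity.\<close>

lemma embedded_singleton:
  assumes M: "smooth_manifold M" and x: "x \<in> points M"
  shows "embedded M {x}"
proof -
  let ?c = "chart_at M x"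
  note c = chart_at(4,2,3)[OF M x]
  have sm: "smooth_open UNIV (\<lambda>z. z + - snd ?c x)"
    by (intro smooth_open_add smooth_open_const smooth_open_linear linear_ident open_UNIV)
  have d: "((\<lambda>z. z + - snd ?c x) has_derivative (\<lambda>v. v)) (at (snd ?c x))"
    by (auto intro!: derivative_eq_intros)
  have "\<exists>c\<in>charts M. x \<in> fst c \<and> (\<exists>W. subspace W \<and> snd c ` (fst c \<inter> {x}) = chart_image c \<inter> W)"
  proof (rule level_set(1)[OF M c(1,2) singletonI sm UNIV_I d])
    fix q assume q: "q \<in> fst ?c"
    have "snd ?c q - snd ?c x \<in> span (chart_image ?c)"
      by (intro span_diff span_base chart_image_mem q c(2))
    then show "snd ?c q + - snd ?c x \<in> (\<lambda>v. v) ` span (chart_image ?c)" by simp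
    show "q \<in> {x} \<longleftrightarrow> snd ?c q + - snd ?c x = 0"
      using chart_injD[OF c(3) q c(2)] by simp
  qed
  then show ?thesis using x by (simp add: embedded_def)
qed

lemma diffeomorphism_singletons:
  assumes M: "smooth_manifold M" "x \<in> points M" and N: "smooth_manifold N" "y \<in> points N"
  shows "diffeomorphism (submanifold M {x}) (submanifold N {y}) (\<lambda>_. y)"
proof -
  let ?M = "submanifold M {x}" and ?N = "submanifold N {y}"
  note sM = smooth_manifold_submanifold[OF M(1) embedded_singleton[OF M]]
  note sN = smooth_manifold_submanifold[OF N(1) embedded_singleton[OF N]]
  have "smooth_map ?M ?N (\<lambda>_. y)"
    unfolding smooth_map_iff[OF sM sN] by (auto intro: smooth_in_const[OF sM sN])
  moreover have "smooth_map ?N ?M (inv_into (points ?M) (\<lambda>_. y))"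
    unfolding smooth_map_iff[OF sN sM]
  proof
    fix b assume b: "b \<in> points ?N"
    have "inv_into {x} (\<lambda>_. y) y \<in> {x}" by (rule inv_into_into) simp
    then have inv: "inv_into {x} (\<lambda>_. y) y = x" by simp
    have nb: "nbhd ?N b (points ?N)"
      unfolding nbhd_def using chart_at(4,2)[OF sN b] smooth_manifoldD(5)[OF sN chart_at(4)[OF sN b]] by blast
    have "smooth_in ?N ?M (\<lambda>_. x) b" by (rule smooth_in_const[OF sN sM b]) simp
    then show "smooth_in ?N ?M (inv_into (points ?M) (\<lambda>_. y)) b"
      by (rule smooth_in_cong[OF sN sM _ nb]) (use inv in simp)
  qed
  ultimately show ?thesis by (simp add: diffeomorphism_def bij_betw_def)
qed

lemma smooth_bundle_iso_singleton:
  assumes M: "smooth_manifold M" "x \<in> points M"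
    and L: "linear_iso (fibre E x) (fibre F y) \<psi>"
  shows "smooth_bundle_iso (submanifold M {x}) (restrict_bundle E {x}) (\<lambda>x. x) (restrict_bundle F {y}) (\<lambda>_. y) (\<lambda>_. \<psi>)"
proof -
  note sM = smooth_manifold_submanifold[OF M(1) embedded_singleton[OF M]]
  have "smooth_fun (submanifold M {x}) S f" for S and f :: "'a \<Rightarrow> 'z::euclidean_space"
    unfolding smooth_fun_def
  proof
    fix c assume "c \<in> charts (submanifold M {x})"
    from smooth_manifoldD(5)[OF sM this] have "snd c ` (fst c \<inter> S) \<subseteq> {snd c x}" by auto
    then show "smooth_on (snd c ` (fst c \<inter> S)) (f \<circ> chart_inv c)" by (rule smooth_on_singleton)
  qed
  moreover have "linear_between (fibre E x) (fibre F y) \<psi>" using L by (simp add: linear_iso_def)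
  ultimately show ?thesis
    using L by (auto simp: smooth_bundle_iso_def smooth_bundle_map_def restrict_bundle_def)
qed

section \<open>Symbol spaces of Pfaffian groupoids\<close>

lemma pfaffian_groupoidD:
  assumes "pfaffian_groupoid G"
  shows "lie_groupoid G" "representation G (coeff G) (rep G)" "one_form (arrows G) (coeff G) (tgt G) (form G)"
    "\<forall>g\<in>points (arrows G). ker_form (arrows G) (form G) g \<inter> ker_differential (arrows G) (base G) (tgt G) g =
      ker_form (arrows G) (form G) g \<inter> ker_differential (arrows G) (base G) (src G) g"
proof -
  note * = assms[unfolded pfaffian_groupoid_def Let_def]
  show "lie_groupoid G" using * by (elim conjE)
  show "representation G (coeff G) (rep G)" using * by (elim conjE)
  show "one_form (arrows G) (coeff G) (tgt G) (form G)" using * by (elim conjE)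
  show "\<forall>g\<in>points (arrows G). ker_form (arrows G) (form G) g \<inter> ker_differential (arrows G) (base G) (tgt G) g =
      ker_form (arrows G) (form G) g \<inter> ker_differential (arrows G) (base G) (src G) g"
    using * by (elim conjE)
qed

locale pfaffian_gpd = lie_gpd G
  for G :: "('a, 'e::euclidean_space, 'x, 'd::euclidean_space, 'v::real_vector, 'f::euclidean_space) pfaffian_groupoid" +
  assumes pfaffian: "pfaffian_groupoid G"
begin

lemma form_linear: "g \<in> points \<Sigma> \<Longrightarrow> linear_between (tangent \<Sigma> g) (fibre (coeff G) (tgt G g)) (form G g)"
  using pfaffian_groupoidD(3)[OF pfaffian] by (simp add: one_form_def)

lemma form_fibre: "g \<in> points \<Sigma> \<Longrightarrow> v \<in> tangent \<Sigma> g \<Longrightarrow> form G g v \<in> fibre (coeff G) (tgt G g)"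
  using form_linear[of g] unfolding linear_between_def by blast

lemma rep_iso: "g \<in> points \<Sigma> \<Longrightarrow> linear_iso (fibre (coeff G) (src G g)) (fibre (coeff G) (tgt G g)) (rep G g)"
  using pfaffian_groupoidD(2)[OF pfaffian] by (simp add: representation_def smooth_bundle_iso_def)

lemma fibre_0: "u \<in> points (base G) \<Longrightarrow> 0 \<in> fibre (coeff G) u"
  using pfaffian_groupoidD(2)[OF pfaffian] by (simp add: representation_def vector_bundle_def subspace_0)

lemma rep_0: "g \<in> points \<Sigma> \<Longrightarrow> rep G g 0 = 0"
  using rep_iso[of g] fibre_0[OF src_tgt_base(1)] by (auto simp: linear_iso_def intro: linear_between_0)

lemma rep_inj:
  "g \<in> points \<Sigma> \<Longrightarrow> a \<in> fibre (coeff G) (src G g) \<Longrightarrow> b \<in> fibre (coeff G) (src G g) \<Longrightarrow> rep G g a = rep G g b \<Longrightarrow> a = b"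
  using rep_iso[of g] by (auto simp: linear_iso_def bij_betw_def dest: inj_onD)

lemma rep_fibre: "g \<in> points \<Sigma> \<Longrightarrow> a \<in> fibre (coeff G) (src G g) \<Longrightarrow> rep G g a \<in> fibre (coeff G) (tgt G g)"
  using rep_iso[of g] by (auto simp: linear_iso_def linear_between_def)

lemma ker_form_src_tgt: "g \<in> points \<Sigma> \<Longrightarrow> ker_form \<Sigma> (form G) g \<inter> ker_differential \<Sigma> (base G) (tgt G) g =
    ker_form \<Sigma> (form G) g \<inter> ker_differential \<Sigma> (base G) (src G) g"
  using pfaffian_groupoidD(4)[OF pfaffian] by blast

text \<open>By the last axiom of a Pfaffian groupoid a vector killed by the form and by ds is also
  killed by dt, so it is tangent to the isotropy group.\<close>

lemma symbol_space_tangent_isotropy: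
  assumes "x \<in> points (base G)"
  shows "symbol_space G x \<subseteq> isotropy_incl G x (unit_of G x) ` tangent (I x) (unit_of G x)"
proof -
  have "symbol_space G x \<subseteq> anchor_kernel (unit_of G x)"
    using ker_form_src_tgt[OF unit_points[OF assms]]
    by (auto simp: symbol_space_def anchor_kernel_def ker_form_def ker_differential_def)
  then show ?thesis using anchor_kernel_subset_isotropy_incl[OF isotropy_unit[OF assms]] by blast
qed

text \<open>Vectors tangent to the isotropy group are killed by ds anyway. The symbol space is
  therefore the kernel of the restricted form at the unit, which reduces its invariance to that of
  the form.\<close>

lemma isotropy_symbol_eq:
  assumes "x \<in> points (base G)"
  shows "isotropy_symbol G x = {w \<in> tangent (I x) (unit_of G x).
    form G (unit_of G x) (isotropy_incl G x (unit_of G x) w) = 0}"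
  using isotropy_incl_anchor_kernel[OF isotropy_unit[OF assms]]
  by (auto simp: isotropy_symbol_def symbol_space_def anchor_kernel_def ker_form_def ker_differential_def)

end

section \<open>The isomorphism induced by a point of a bibundle\<close>

locale pfaffian_bibundle =
  fixes G1 :: "('a, 'e1::euclidean_space, 'x, 'd1::euclidean_space, 'v1::real_vector, 'f1::euclidean_space) pfaffian_groupoid"
    and G2 :: "('b, 'e2::euclidean_space, 'y, 'd2::euclidean_space, 'v2::real_vector, 'f2::euclidean_space) pfaffian_groupoid"
    and P :: "('p, 'q::euclidean_space) manifold"
    and \<mu>1 :: "'p \<Rightarrow> 'x" and \<mu>2 :: "'p \<Rightarrow> 'y"
    and lact :: "'a \<Rightarrow> 'p \<Rightarrow> 'p" and ract :: "'p \<Rightarrow> 'b \<Rightarrow> 'p"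
    and \<theta> :: "'p \<Rightarrow> 'q \<Rightarrow> 'v1" and \<Phi> :: "'p \<Rightarrow> 'v1 \<Rightarrow> 'v2"
    and x :: 'x and y :: 'y and p :: 'p
  assumes pf1: "pfaffian_groupoid G1" and pf2: "pfaffian_groupoid G2"
    and bibundle: "principal_pfaffian_bibundle G1 G2 P \<mu>1 \<mu>2 lact ract \<theta> \<Phi>"
    and p: "p \<in> points P" and x: "\<mu>1 p = x" and y: "\<mu>2 p = y"
begin

sublocale L: pfaffian_gpd G1
  using pf1 pfaffian_groupoidD(1)[OF pf1] by unfold_locales

sublocale R: pfaffian_gpd G2
  using pf2 pfaffian_groupoidD(1)[OF pf2] by unfold_locales

lemma left_pfaffian: "left_principal_pfaffian_bundle G1 P (base G2) lact \<mu>1 \<mu>2 \<theta>"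
  and right_pfaffian: "right_principal_pfaffian_bundle G2 P (base G1) ract \<mu>2 \<mu>1 (\<lambda>p v. \<Phi> p (\<theta> p v))"
  and \<Phi>_iso: "smooth_bundle_iso P (coeff G1) \<mu>1 (coeff G2) \<mu>2 \<Phi>"
  and commute: "g \<in> points (arrows G1) \<Longrightarrow> q \<in> points P \<Longrightarrow> h \<in> points (arrows G2) \<Longrightarrow> src G1 g = \<mu>1 q \<Longrightarrow>
    \<mu>2 q = tgt G2 h \<Longrightarrow> ract (lact g q) h = lact g (ract q h)"
  and \<Phi>_lact: "g \<in> points (arrows G1) \<Longrightarrow> q \<in> points P \<Longrightarrow> src G1 g = \<mu>1 q \<Longrightarrow> \<alpha> \<in> fibre (coeff G1) (\<mu>1 q) \<Longrightarrow>
    \<Phi> (lact g q) (rep G1 g \<alpha>) = \<Phi> q \<alpha>"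
  and \<Phi>_ract: "q \<in> points P \<Longrightarrow> h \<in> points (arrows G2) \<Longrightarrow> \<mu>2 q = tgt G2 h \<Longrightarrow> \<alpha> \<in> fibre (coeff G1) (\<mu>1 q) \<Longrightarrow>
    \<Phi> (ract q h) \<alpha> = rep G2 (ginv G2 h) (\<Phi> q \<alpha>)"
  using bibundle by (simp_all add: principal_pfaffian_bibundle_def)

sublocale LB: left_bundle G1 P "base G2" lact \<mu>1 \<mu>2
  using left_pfaffian by unfold_locales (simp add: left_principal_pfaffian_bundle_def Let_def)

sublocale RB: right_bundle G2 P "base G1" ract \<mu>2 \<mu>1
  using right_pfaffian by unfold_locales (simp add: right_principal_pfaffian_bundle_def Let_def)

lemma base_points: "x \<in> points (base G1)" "y \<in> points (base G2)"
  using LB.moment RB.moment p x y by (auto simp: surjective_submersion_def)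

definition \<phi> :: "'a \<Rightarrow> 'b" where
  "\<phi> = induced_isotropy_map G2 y lact ract p"

lemma ract_isotropy_inj:
  "h \<in> isotropy G2 y \<Longrightarrow> h' \<in> isotropy G2 y \<Longrightarrow> ract p h = ract p h' \<Longrightarrow> h = h'"
  using RB.act_injective[OF p, of h h'] y by (simp add: isotropy_def)

lemma lact_isotropy_inj:
  "g \<in> isotropy G1 x \<Longrightarrow> g' \<in> isotropy G1 x \<Longrightarrow> lact g p = lact g' p \<Longrightarrow> g = g'"
  using LB.act_injective[OF p, of g g'] x by (simp add: isotropy_def)

text \<open>As g fixes x, the points p and g p lie in the same fibre of \<open>\<mu>1\<close>, on
  which the right action is transitive; freeness gives uniqueness. That h has source y follows from
  the invariance of \<open>\<mu>2\<close> under the left action.\<close>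

lemma ex1_induced:
  assumes g: "g \<in> isotropy G1 x" shows "\<exists>!h. h \<in> isotropy G2 y \<and> lact g p = ract p h"
proof -
  have g': "g \<in> points (arrows G1)" "src G1 g = \<mu>1 p" "tgt G1 g = \<mu>1 p" using g x by (simp_all add: isotropy_def)
  have gp: "lact g p \<in> points P" "\<mu>1 (lact g p) = \<mu>1 p" "\<mu>2 (lact g p) = \<mu>2 p"
    using LB.act_points[OF g'(1) p g'(2)] LB.moment_act[OF g'(1) p g'(2)] LB.proj_act[OF g'(1) p g'(2)] g'(3) by simp_all
  obtain h where h: "h \<in> points (arrows G2)" "\<mu>2 p = tgt G2 h" "ract p h = lact g p"
    using RB.transitive[OF p gp(1)] gp(2) by auto
  have "src G2 h = \<mu>2 p" using RB.moment_act[OF p h(1,2)] h(3) gp(3) by simp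
  then have "h \<in> isotropy G2 y" using h y by (simp add: isotropy_def)
  then show ?thesis using h(3) ract_isotropy_inj by metis
qed

lemma ex_induced_inv:
  assumes h: "h \<in> isotropy G2 y" shows "\<exists>g\<in>isotropy G1 x. lact g p = ract p h"
proof -
  have h': "h \<in> points (arrows G2)" "\<mu>2 p = tgt G2 h" "src G2 h = \<mu>2 p" using h y by (simp_all add: isotropy_def)
  have ph: "ract p h \<in> points P" "\<mu>2 (ract p h) = \<mu>2 p" "\<mu>1 (ract p h) = \<mu>1 p"
    using RB.act_points[OF p h'(1,2)] RB.moment_act[OF p h'(1,2)] RB.proj_act[OF p h'(1,2)] h'(3) by simp_all
  obtain g where g: "g \<in> points (arrows G1)" "src G1 g = \<mu>1 p" "lact g p = ract p h"
    using LB.transitive[OF p ph(1)] ph(2) by auto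
  have "tgt G1 g = \<mu>1 p" using LB.moment_act[OF g(1) p g(2)] g(3) ph(3) by simp
  then show ?thesis using g x by (auto simp: isotropy_def)
qed

lemma \<phi>: assumes "g \<in> isotropy G1 x" shows "\<phi> g \<in> isotropy G2 y" "lact g p = ract p (\<phi> g)"
  using theI'[OF ex1_induced[OF assms]] by (simp_all add: \<phi>_def induced_isotropy_map_def)

lemma \<phi>_eqI: "g \<in> isotropy G1 x \<Longrightarrow> h \<in> isotropy G2 y \<Longrightarrow> lact g p = ract p h \<Longrightarrow> \<phi> g = h"
  using \<phi>[of g] ract_isotropy_inj[of "\<phi> g" h] by simp

lemma bij_\<phi>: "bij_betw \<phi> (isotropy G1 x) (isotropy G2 y)"
  unfolding bij_betw_def
proof
  show "inj_on \<phi> (isotropy G1 x)"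
  proof (rule inj_onI)
    fix g g' assume g: "g \<in> isotropy G1 x" "g' \<in> isotropy G1 x" "\<phi> g = \<phi> g'"
    show "g = g'" by (rule lact_isotropy_inj[OF g(1,2)]) (simp add: \<phi>(2)[OF g(1)] \<phi>(2)[OF g(2)] g(3))
  qed
  show "\<phi> ` isotropy G1 x = isotropy G2 y"
  proof
    show "\<phi> ` isotropy G1 x \<subseteq> isotropy G2 y" using \<phi>(1) by blast
    show "isotropy G2 y \<subseteq> \<phi> ` isotropy G1 x"
    proof
      fix h assume h: "h \<in> isotropy G2 y"
      obtain g where "g \<in> isotropy G1 x" "lact g p = ract p h" using ex_induced_inv[OF h] by blast
      then show "h \<in> \<phi> ` isotropy G1 x" using \<phi>_eqI[OF _ h] by blast
    qed
  qed
qed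

lemma orbit_embeddings: "orbit_embedding (L.I x) P (\<lambda>g. lact g p)" "orbit_embedding (R.I y) P (ract p)"
  using LB.orbit_embedding_act[OF p] RB.orbit_embedding_act[OF p] x y by simp_all

lemma smooth_\<phi>: "smooth_map (L.I x) (R.I y) \<phi>"
proof (rule smooth_map_lift_orbit_embedding[OF R.smooth_manifold_isotropy LB.P L.smooth_manifold_isotropy orbit_embeddings(2)])
  show "smooth_map (L.I x) P (\<lambda>g. lact g p)" using orbit_embeddings(1) by (simp add: orbit_embedding_def)
qed (simp_all add: \<phi>(1) flip: \<phi>(2))

lemma inv_\<phi>:
  assumes "h \<in> isotropy G2 y"
  shows "inv_into (isotropy G1 x) \<phi> h \<in> isotropy G1 x" "\<phi> (inv_into (isotropy G1 x) \<phi> h) = h"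
  using assms bij_\<phi> by (auto simp: bij_betw_def intro: inv_into_into f_inv_into_f)

lemma smooth_inv_\<phi>: "smooth_map (R.I y) (L.I x) (inv_into (isotropy G1 x) \<phi>)"
proof (rule smooth_map_lift_orbit_embedding[OF L.smooth_manifold_isotropy LB.P R.smooth_manifold_isotropy orbit_embeddings(1)])
  show "smooth_map (R.I y) P (ract p)" using orbit_embeddings(2) by (simp add: orbit_embedding_def)
  fix h assume "h \<in> points (R.I y)"
  then have h: "h \<in> isotropy G2 y" by simp
  show "inv_into (isotropy G1 x) \<phi> h \<in> points (L.I x)" using inv_\<phi>(1)[OF h] by simp
  show "lact (inv_into (isotropy G1 x) \<phi> h) p = ract p h" using \<phi>(2)[OF inv_\<phi>(1)[OF h]] inv_\<phi>(2)[OF h] by simp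
qed

lemma diffeomorphism_\<phi>: "diffeomorphism (L.I x) (R.I y) \<phi>"
  using bij_\<phi> smooth_\<phi> smooth_inv_\<phi> by (simp add: diffeomorphism_def)

lemma \<phi>_unit: "\<phi> (unit_of G1 x) = unit_of G2 y"
  using LB.act_unit[OF p] RB.act_unit[OF p] x y
  by (intro \<phi>_eqI L.isotropy_unit R.isotropy_unit base_points) simp

text \<open>Commuting actions give (g h) p = g (p \<phi>(h)) = (g p) \<phi>(h) = p \<phi>(g)
  \<phi>(h). The order is preserved because one action is from the left and the other from the
  right.\<close>

lemma \<phi>_mult:
  assumes g: "g \<in> isotropy G1 x" and h: "h \<in> isotropy G1 x"
  shows "\<phi> (mult G1 g h) = mult G2 (\<phi> g) (\<phi> h)"
proof (rule \<phi>_eqI[OF L.isotropy_mult[OF g h] R.isotropy_mult[OF \<phi>(1)[OF g] \<phi>(1)[OF h]]])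
  note g' = L.isotropyD[OF g] and h' = L.isotropyD[OF h] and k = R.isotropyD[OF \<phi>(1)[OF g]] R.isotropyD[OF \<phi>(1)[OF h]]
  have "lact (mult G1 g h) p = lact g (ract p (\<phi> h))"
    using LB.act_mult[OF h'(1) p _ g'(1)] g' h' x \<phi>(2)[OF h] by simp
  also have "\<dots> = ract (ract p (\<phi> g)) (\<phi> h)"
    using commute[OF g'(1) p k(4)] g' k x y \<phi>(2)[OF g] by simp
  also have "\<dots> = ract p (mult G2 (\<phi> g) (\<phi> h))"
    using RB.act_mult[OF p k(1) _ k(4)] k y by simp
  finally show "lact (mult G1 g h) p = ract p (mult G2 (\<phi> g) (\<phi> h))" .
qed

section \<open>Representations, forms and symbol spaces under the isomorphism\<close>

lemma \<Phi>_linear_iso: "q \<in> points P \<Longrightarrow> linear_iso (fibre (coeff G1) (\<mu>1 q)) (fibre (coeff G2) (\<mu>2 q)) (\<Phi> q)"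
  using \<Phi>_iso by (simp add: smooth_bundle_iso_def)

lemma \<Phi>_fibre: "\<alpha> \<in> fibre (coeff G1) x \<Longrightarrow> \<Phi> p \<alpha> \<in> fibre (coeff G2) y"
  using \<Phi>_linear_iso[OF p] x y by (auto simp: linear_iso_def linear_between_def)

lemma \<Phi>_0: "\<Phi> p 0 = 0"
  using \<Phi>_linear_iso[OF p] L.fibre_0[OF base_points(1)] x by (auto simp: linear_iso_def intro: linear_between_0)

lemma \<Phi>_eq_0_iff: "\<alpha> \<in> fibre (coeff G1) x \<Longrightarrow> \<Phi> p \<alpha> = 0 \<longleftrightarrow> \<alpha> = 0"
  using \<Phi>_linear_iso[OF p] L.fibre_0[OF base_points(1)] x \<Phi>_0
  by (auto simp: linear_iso_def bij_betw_def dest: inj_onD[of _ _ \<alpha> 0])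

text \<open>Two elements of the fibre over \<open>y\<close> are compared after applying the inverse of \<open>h\<close>, as the
  right equivariance of \<open>\<Phi>\<close> only gives access to them there.\<close>

lemma cancel_ginv:
  assumes h: "h \<in> isotropy G2 y" and ab: "a \<in> fibre (coeff G2) y" "b \<in> fibre (coeff G2) y"
    and eq: "rep G2 (ginv G2 h) a = rep G2 (ginv G2 h) b"
  shows "a = b"
  by (rule R.rep_inj[OF R.isotropyD(1)[OF R.isotropy_ginv[OF h]] _ _ eq])
    (use ab R.isotropyD(2)[OF R.isotropy_ginv[OF h]] in simp_all)

text \<open>The bundle map is evaluated on g e at the single point g p = p \<phi>(g). The left rule
  gives \<Phi>_p e there, the right rule gives \<phi>(g)^{-1} \<Phi>_p (g e).\<close>

lemma \<Phi>_rep: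
  assumes g: "g \<in> isotropy G1 x" and e: "e \<in> fibre (coeff G1) x"
  shows "\<Phi> p (rep G1 g e) = rep G2 (\<phi> g) (\<Phi> p e)"
proof -
  note g' = L.isotropyD[OF g] and h = \<phi>(1)[OF g] and h' = R.isotropyD[OF \<phi>(1)[OF g]]
  have ge: "rep G1 g e \<in> fibre (coeff G1) x" using L.rep_fibre[OF g'(1)] g'(2,3) e by simp
  have "\<Phi> p e = \<Phi> (lact g p) (rep G1 g e)" using \<Phi>_lact[OF g'(1) p] g'(2) x e by simp
  also have "\<dots> = \<Phi> (ract p (\<phi> g)) (rep G1 g e)" by (simp only: \<phi>(2)[OF g])
  also have "\<dots> = rep G2 (ginv G2 (\<phi> g)) (\<Phi> p (rep G1 g e))" using \<Phi>_ract[OF p h'(1)] h'(3) x y ge by simp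
  finally have "\<Phi> p e = rep G2 (ginv G2 (\<phi> g)) (\<Phi> p (rep G1 g e))" .
  moreover have "rep G2 (mult G2 (\<phi> g) (ginv G2 (\<phi> g))) (\<Phi> p (rep G1 g e)) =
      rep G2 (\<phi> g) (rep G2 (ginv G2 (\<phi> g)) (\<Phi> p (rep G1 g e)))"
    using pfaffian_groupoidD(2)[OF pf2] h' R.isotropyD[OF R.isotropy_ginv[OF h]] \<Phi>_fibre[OF ge]
    by (simp add: representation_def)
  moreover have "rep G2 (mult G2 (\<phi> g) (ginv G2 (\<phi> g))) (\<Phi> p (rep G1 g e)) = \<Phi> p (rep G1 g e)"
    using pfaffian_groupoidD(2)[OF pf2] h' base_points(2) \<Phi>_fibre[OF ge]
    by (simp add: representation_def R.mult_ginv)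
  ultimately show ?thesis by simp
qed

lemma \<theta>_linear: "q \<in> points P \<Longrightarrow> linear_between (tangent P q) (fibre (coeff G1) (\<mu>1 q)) (\<theta> q)"
  using left_pfaffian by (simp add: left_principal_pfaffian_bundle_def Let_def one_form_def)

lemma \<theta>_0: "\<theta> p 0 = 0"
  using \<theta>_linear[OF p] subspace_0[OF tangent_subspace] by (rule linear_between_0)

text \<open>Differentiate \<open>\<gamma> \<cdot> p = p \<cdot> \<phi> \<gamma>\<close> and evaluate \<open>\<theta>\<close> on the velocity with both equivariance rules;
  the contributions of the constant factor \<open>p\<close> vanish.\<close>

lemma form_\<phi>:
  assumes g: "g \<in> isotropy G1 x" and v: "v \<in> tangent (L.I x) g"
  shows "form G2 (\<phi> g) (isotropy_incl G2 y (\<phi> g) (differential (L.I x) (R.I y) \<phi> g v)) =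
    \<Phi> p (form G1 g (isotropy_incl G1 x g v))"
proof -
  note g' = L.isotropyD[OF g] and h = \<phi>(1)[OF g] and h' = R.isotropyD[OF \<phi>(1)[OF g]]
  obtain \<gamma> where \<gamma>: "\<gamma> 0 = g" "velocity (L.I x) \<gamma> v" by (rule tangent_velocity[OF L.smooth_manifold_isotropy _ v]) (simp_all add: g)
  define v1 where "v1 = isotropy_incl G1 x g v"
  define v2 where "v2 = isotropy_incl G2 y (\<phi> g) (differential (L.I x) (R.I y) \<phi> g v)"
  have 1: "velocity (arrows G1) \<gamma> v1" "\<forall>\<^sub>F r in nhds 0. \<gamma> r \<in> isotropy G1 x"
    using L.velocity_incl[OF \<gamma>(2)] \<gamma>(1) g by (simp_all add: v1_def)
  have "smooth_in (L.I x) (R.I y) \<phi> g" using smooth_\<phi> g smooth_map_iff[OF L.smooth_manifold_isotropy R.smooth_manifold_isotropy] by simp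
  then have "velocity (R.I y) (\<lambda>r. \<phi> (\<gamma> r)) (differential (L.I x) (R.I y) \<phi> g v)"
    by (rule velocity_differential[OF L.smooth_manifold_isotropy R.smooth_manifold_isotropy _ \<gamma>(2,1)])
  from R.velocity_incl[OF this] have 2: "velocity (arrows G2) (\<lambda>r. \<phi> (\<gamma> r)) v2"
    using \<gamma>(1) h by (simp add: v2_def)
  have ev1: "\<forall>\<^sub>F r in nhds 0. \<gamma> r \<in> points (arrows G1) \<and> p \<in> points P \<and> src G1 (\<gamma> r) = \<mu>1 p"
    using 1(2) by eventually_elim (use p x in \<open>simp add: isotropy_def\<close>)
  have ev2: "\<forall>\<^sub>F r in nhds 0. p \<in> points P \<and> \<phi> (\<gamma> r) \<in> points (arrows G2) \<and> \<mu>2 p = tgt G2 (\<phi> (\<gamma> r))"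
    using 1(2) by eventually_elim (use p y \<phi>(1) in \<open>simp add: isotropy_def\<close>)
  let ?C1 = "fibre_product (arrows G1) P (src G1) \<mu>1" and ?C2 = "fibre_product P (arrows G2) \<mu>2 (tgt G2)"
  note pconst = velocity_const[OF LB.P p]
  obtain \<xi>1 where \<xi>1: "\<xi>1 \<in> tangent ?C1 (g, p)" "differential ?C1 (arrows G1) fst (g, p) \<xi>1 = v1"
    "differential ?C1 P snd (g, p) \<xi>1 = 0"
    "velocity P (\<lambda>r. lact (\<gamma> r) p) (differential ?C1 P (\<lambda>(a, b). lact a b) (g, p) \<xi>1)"
    by (rule LB.velocity_act[OF 1(1) pconst ev1]) (simp add: \<gamma>(1))
  obtain \<xi>2 where \<xi>2: "\<xi>2 \<in> tangent ?C2 (p, \<phi> g)" "differential ?C2 P fst (p, \<phi> g) \<xi>2 = 0"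
    "differential ?C2 (arrows G2) snd (p, \<phi> g) \<xi>2 = v2"
    "velocity P (\<lambda>r. ract p (\<phi> (\<gamma> r))) (differential ?C2 P (\<lambda>(a, b). ract a b) (p, \<phi> g) \<xi>2)"
    by (rule RB.velocity_act[OF pconst 2 ev2]) (simp add: \<gamma>(1))
  define u where "u = differential ?C1 P (\<lambda>(a, b). lact a b) (g, p) \<xi>1"
  have "\<forall>\<^sub>F r in nhds 0. ract p (\<phi> (\<gamma> r)) = lact (\<gamma> r) p"
    using 1(2) by eventually_elim (simp add: \<phi>(2))
  \<comment> \<open>Both actions trace the same curve in \<open>P\<close>, so the two differentials,
    taken on different fibre products, have the same value.\<close>
  from velocity_unique[OF velocity_cong[OF \<xi>2(4) this] \<xi>1(4)]
  have u2: "differential ?C2 P (\<lambda>(a, b). ract a b) (p, \<phi> g) \<xi>2 = u" by (simp add: u_def)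
  have C1: "(g, p) \<in> points ?C1" using g' p x by (simp add: LB.pair_iff)
  have C2: "(p, \<phi> g) \<in> points ?C2" using h' p y by (simp add: RB.pair_iff)
  have "\<theta> (lact g p) u = form G1 g v1 + rep G1 g (\<theta> p 0)"
    using left_pfaffian C1 \<xi>1(1,2,3) unfolding left_principal_pfaffian_bundle_def Let_def u_def by fastforce
  then have \<theta>u: "\<theta> (lact g p) u = form G1 g v1" by (simp add: \<theta>_0 L.rep_0[OF g'(1)])
  have "\<Phi> (ract p (\<phi> g)) (\<theta> (ract p (\<phi> g)) u) =
      rep G2 (ginv G2 (\<phi> g)) (\<Phi> p (\<theta> p 0)) + rep G2 (ginv G2 (\<phi> g)) (form G2 (\<phi> g) v2)"
    using right_pfaffian C2 \<xi>2(1,2,3) u2 unfolding right_principal_pfaffian_bundle_def Let_def by fastforce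
  then have "\<Phi> (ract p (\<phi> g)) (form G1 g v1) = rep G2 (ginv G2 (\<phi> g)) (form G2 (\<phi> g) v2)"
    using \<theta>u \<phi>(2)[OF g] by (simp add: \<theta>_0 \<Phi>_0 R.rep_0[OF R.ginv_points[OF h'(1)]])
  \<comment> \<open>The form takes values over the target of g. Since g is in the isotropy group
    this is the fibre over x, on which the map \<Phi>_p and the right equivariance rule at p make
    sense.\<close>
  moreover have form1: "form G1 g v1 \<in> fibre (coeff G1) x"
    using L.form_fibre[OF g'(1), of v1] velocity_tangent[OF 1(1)] g'(3) \<gamma>(1) by simp
  then have "\<Phi> (ract p (\<phi> g)) (form G1 g v1) = rep G2 (ginv G2 (\<phi> g)) (\<Phi> p (form G1 g v1))"
    using \<Phi>_ract[OF p h'(1)] h'(3) x y by simp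
  ultimately have "rep G2 (ginv G2 (\<phi> g)) (form G2 (\<phi> g) v2) = rep G2 (ginv G2 (\<phi> g)) (\<Phi> p (form G1 g v1))"
    by simp
  moreover have "form G2 (\<phi> g) v2 \<in> fibre (coeff G2) y"
    using R.form_fibre[OF h'(1), of v2] velocity_tangent[OF 2] h'(3) \<gamma>(1) by simp
  ultimately have "form G2 (\<phi> g) v2 = \<Phi> p (form G1 g v1)"
    using cancel_ginv[OF h _ \<Phi>_fibre[OF form1]] by blast
  then show ?thesis by (simp add: v1_def v2_def)
qed

text \<open>A curve of velocity w is pulled back through the smooth inverse, and its own velocity is
  the preimage.\<close>

lemma differential_\<phi>_surj:
  assumes g: "g \<in> isotropy G1 x" and w: "w \<in> tangent (R.I y) (\<phi> g)"
  obtains v where "v \<in> tangent (L.I x) g" "differential (L.I x) (R.I y) \<phi> g v = w"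
proof -
  let ?\<psi> = "inv_into (isotropy G1 x) \<phi>"
  note h = \<phi>(1)[OF g]
  have inv: "?\<psi> (\<phi> g) = g" using bij_\<phi> g by (simp add: bij_betw_def)
  obtain \<delta> where \<delta>: "\<delta> 0 = \<phi> g" "velocity (R.I y) \<delta> w" by (rule tangent_velocity[OF R.smooth_manifold_isotropy _ w]) (simp_all add: h)
  have "smooth_in (R.I y) (L.I x) ?\<psi> (\<phi> g)" using smooth_inv_\<phi> h smooth_map_iff[OF R.smooth_manifold_isotropy L.smooth_manifold_isotropy] by simp
  then have v: "velocity (L.I x) (\<lambda>r. ?\<psi> (\<delta> r)) (differential (R.I y) (L.I x) ?\<psi> (\<phi> g) w)"
    by (rule velocity_differential[OF R.smooth_manifold_isotropy L.smooth_manifold_isotropy _ \<delta>(2,1)])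
  have ev: "\<forall>\<^sub>F r in nhds 0. \<delta> r \<in> isotropy G2 y" using R.velocity_incl(2)[OF \<delta>(2)] \<delta>(1) h by simp
  then have "\<forall>\<^sub>F r in nhds 0. \<delta> r = \<phi> (?\<psi> (\<delta> r))" by eventually_elim (simp add: inv_\<phi>(2))
  then have w': "velocity (R.I y) (\<lambda>r. \<phi> (?\<psi> (\<delta> r))) w" by (rule velocity_cong[OF \<delta>(2)])
  have sm: "smooth_in (L.I x) (R.I y) \<phi> g" using smooth_\<phi> g smooth_map_iff[OF L.smooth_manifold_isotropy R.smooth_manifold_isotropy] by simp
  have 0: "?\<psi> (\<delta> 0) = g" by (simp add: \<delta>(1) inv)
  show thesis
    by (rule that[OF _ differential_eqI[OF L.smooth_manifold_isotropy R.smooth_manifold_isotropy sm v 0 w']]) (use velocity_tangent[OF v] 0 in simp)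
qed

text \<open>By \<open>form_\<phi>\<close> at the unit and injectivity of \<Phi>_p, one restricted
  form vanishes on a vector exactly if the other vanishes on its image. Surjectivity of the
  differential turns this into an equality of symbol spaces.\<close>

lemma differential_\<phi>_symbol:
  "differential (L.I x) (R.I y) \<phi> (unit_of G1 x) ` isotropy_symbol G1 x = isotropy_symbol G2 y"
proof -
  let ?u = "unit_of G1 x" and ?d = "differential (L.I x) (R.I y) \<phi> (unit_of G1 x)"
  note u = L.isotropy_unit[OF base_points(1)]
  have "smooth_in (L.I x) (R.I y) \<phi> ?u" using smooth_\<phi> u smooth_map_iff[OF L.smooth_manifold_isotropy R.smooth_manifold_isotropy] by simp
  from linear_between_differential[OF L.smooth_manifold_isotropy R.smooth_manifold_isotropy this]
  have into: "?d v \<in> tangent (R.I y) (unit_of G2 y)" if "v \<in> tangent (L.I x) ?u" for v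
    using that by (auto simp: linear_between_def \<phi>_unit)
  have iff: "form G2 (unit_of G2 y) (isotropy_incl G2 y (unit_of G2 y) (?d v)) = 0 \<longleftrightarrow>
      form G1 ?u (isotropy_incl G1 x ?u v) = 0" if v: "v \<in> tangent (L.I x) ?u" for v
  proof -
    have "isotropy_incl G1 x ?u v \<in> tangent (arrows G1) ?u" using L.isotropy_incl_anchor_kernel[OF u v] by (simp add: L.anchor_kernel_def)
    then have "form G1 ?u (isotropy_incl G1 x ?u v) \<in> fibre (coeff G1) x"
      using L.form_fibre[OF L.isotropyD(1)[OF u]] L.isotropyD(3)[OF u] by simp
    then show ?thesis using form_\<phi>[OF u v] by (simp add: \<phi>_unit \<Phi>_eq_0_iff)
  qed
  show ?thesis
    unfolding L.isotropy_symbol_eq[OF base_points(1)] R.isotropy_symbol_eq[OF base_points(2)]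
  proof
    show "?d ` {w \<in> tangent (L.I x) ?u. form G1 ?u (isotropy_incl G1 x ?u w) = 0} \<subseteq>
        {w \<in> tangent (R.I y) (unit_of G2 y). form G2 (unit_of G2 y) (isotropy_incl G2 y (unit_of G2 y) w) = 0}"
      using into iff by auto
    show "{w \<in> tangent (R.I y) (unit_of G2 y). form G2 (unit_of G2 y) (isotropy_incl G2 y (unit_of G2 y) w) = 0} \<subseteq>
        ?d ` {w \<in> tangent (L.I x) ?u. form G1 ?u (isotropy_incl G1 x ?u w) = 0}"
    proof
      fix w assume w: "w \<in> {w \<in> tangent (R.I y) (unit_of G2 y).
        form G2 (unit_of G2 y) (isotropy_incl G2 y (unit_of G2 y) w) = 0}"
      then obtain v where "v \<in> tangent (L.I x) ?u" "?d v = w"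
        using differential_\<phi>_surj[OF u, of w] by (auto simp: \<phi>_unit)
      then show "w \<in> ?d ` {w \<in> tangent (L.I x) ?u. form G1 ?u (isotropy_incl G1 x ?u w) = 0}"
        using w iff by (intro image_eqI[of _ _ v]) auto
    qed
  qed
qed

lemma isotropy_rep_iso_\<Phi>: "isotropy_rep_iso G1 x G2 y \<phi> (\<Phi> p)"
  using \<Phi>_linear_iso[OF p] \<Phi>_rep x y by (simp add: isotropy_rep_iso_def)

lemma pfaffian_iso_\<phi>: "pfaffian_iso (isotropy_pfaffian G1 x) (isotropy_pfaffian G2 y) \<phi> (\<lambda>_. y) (\<lambda>_. \<Phi> p)"
proof -
  have "lie_groupoid_iso (isotropy_pfaffian G1 x) (isotropy_pfaffian G2 y) \<phi> (\<lambda>_. y)"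
    using diffeomorphism_\<phi> diffeomorphism_singletons[OF L.smooth_manifolds(2) base_points(1) R.smooth_manifolds(2) base_points(2)]
      R.isotropyD[OF \<phi>(1)] \<phi>_unit \<phi>_mult
    by (simp add: lie_groupoid_iso_def isotropy_pfaffian_def)
  moreover have "linear_iso (fibre (coeff G1) x) (fibre (coeff G2) y) (\<Phi> p)" using \<Phi>_linear_iso[OF p] x y by simp
  note smooth_bundle_iso_singleton[OF L.smooth_manifolds(2) base_points(1) this]
  ultimately show ?thesis
    using \<Phi>_rep form_\<phi> L.isotropyD
    by (simp add: pfaffian_iso_def isotropy_pfaffian_def restrict_bundle_def)
qed

end

theorem proposition3p14:
  fixes G1 :: "('a, 'e1::euclidean_space, 'x, 'd1::euclidean_space, 'v1::real_vector, 'f1::euclidean_space) pfaffian_groupoid"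
    and G2 :: "('b, 'e2::euclidean_space, 'y, 'd2::euclidean_space, 'v2::real_vector, 'f2::euclidean_space) pfaffian_groupoid"
    and P :: "('p, 'q::euclidean_space) manifold"
    and \<mu>1 :: "'p \<Rightarrow> 'x" and \<mu>2 :: "'p \<Rightarrow> 'y"
    and lact :: "'a \<Rightarrow> 'p \<Rightarrow> 'p" and ract :: "'p \<Rightarrow> 'b \<Rightarrow> 'p"
    and \<theta> :: "'p \<Rightarrow> 'q \<Rightarrow> 'v1" and \<Phi> :: "'p \<Rightarrow> 'v1 \<Rightarrow> 'v2"
    and x :: 'x and y :: 'y and p :: 'p and \<phi> :: "'a \<Rightarrow> 'b"
  assumes "pfaffian_groupoid G1" and "pfaffian_groupoid G2"
    and "principal_pfaffian_bibundle G1 G2 P \<mu>1 \<mu>2 lact ract \<theta> \<Phi>"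
    and "x \<in> points (base G1)" and "y \<in> points (base G2)"
    and "p \<in> points P" and "\<mu>1 p = x" and "\<mu>2 p = y"
  defines "\<phi> \<equiv> induced_isotropy_map G2 y lact ract p"
  shows "(\<forall>g1\<in>isotropy G1 x. \<exists>!g2. g2 \<in> isotropy G2 y \<and> lact g1 p = ract p g2) \<and>
    (symbol_space G1 x \<subseteq> isotropy_incl G1 x (unit_of G1 x) ` tangent (isotropy_manifold G1 x) (unit_of G1 x) \<and>
     symbol_space G2 y \<subseteq> isotropy_incl G2 y (unit_of G2 y) ` tangent (isotropy_manifold G2 y) (unit_of G2 y) \<and>
     differential (isotropy_manifold G1 x) (isotropy_manifold G2 y) \<phi> (unit_of G1 x) ` isotropy_symbol G1 x
       = isotropy_symbol G2 y) \<and>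
    (\<exists>\<psi>. isotropy_rep_iso G1 x G2 y \<phi> \<psi> \<and>
       pfaffian_iso (isotropy_pfaffian G1 x) (isotropy_pfaffian G2 y) \<phi> (\<lambda>_. y) (\<lambda>_. \<psi>))"
proof -
  interpret B: pfaffian_bibundle G1 G2 P \<mu>1 \<mu>2 lact ract \<theta> \<Phi> x y p
    by unfold_locales (fact assms)+
  have \<phi>: "\<phi> = B.\<phi>" by (simp add: \<phi>_def B.\<phi>_def)
  show ?thesis
    unfolding \<phi>
  \<comment> \<open>The witness for the existential is left open by \<open>exI\<close>; the last two
    goals fix it as \<open>\<Phi> p\<close>, which serves as the isomorphism of representations and
    as the coefficient part of the Pfaffian isomorphism at the same time.\<close>
  proof (intro conjI ballI exI)
    fix g1 assume "g1 \<in> isotropy G1 x"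
    then show "\<exists>!g2. g2 \<in> isotropy G2 y \<and> lact g1 p = ract p g2" by (rule B.ex1_induced)
  next
    show "symbol_space G1 x \<subseteq> isotropy_incl G1 x (unit_of G1 x) ` tangent (isotropy_manifold G1 x) (unit_of G1 x)"
      by (rule B.L.symbol_space_tangent_isotropy[OF assms(4)])
    show "symbol_space G2 y \<subseteq> isotropy_incl G2 y (unit_of G2 y) ` tangent (isotropy_manifold G2 y) (unit_of G2 y)"
      by (rule B.R.symbol_space_tangent_isotropy[OF assms(5)])
    show "differential (isotropy_manifold G1 x) (isotropy_manifold G2 y) B.\<phi> (unit_of G1 x) ` isotropy_symbol G1 x
        = isotropy_symbol G2 y" by (rule B.differential_\<phi>_symbol)
    show "isotropy_rep_iso G1 x G2 y B.\<phi> (\<Phi> p)" by (rule B.isotropy_rep_iso_\<Phi>)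
    show "pfaffian_iso (isotropy_pfaffian G1 x) (isotropy_pfaffian G2 y) B.\<phi> (\<lambda>_. y) (\<lambda>_. \<Phi> p)"
      by (rule B.pfaffian_iso_\<phi>)
  qed
qed

end
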